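(* Let $\Omega\subset\mathbb C^m$ be a bounded domain containing the origin and $\mathcal Z\subset\Omega$ the complex submanifold of codimension $d$ defined by $z_1=\cdots=z_d=0$. Let $\mathcal M$ and $\tilde{\mathcal M}$ be Hilbert modules over $\mathcal A(\Omega)$ in $\mathrm B_r(\Omega)$, both containing $\mathbb C[z_1,\dots,z_m]$, let $k\ge 1$, and let $\mathcal M_q$, $\tilde{\mathcal M}_q$ be their quotient modules by the submodules of functions vanishing to order at least $k$ along $\mathcal Z$. Let $E,\tilde E$ be the associated hermitian holomorphic vector bundles over $\Omega^*$, let $\mathbf s,\tilde{\mathbf s}$ be holomorphic frames of $E,\tilde E$ on a neighbourhood $U$ of $0$ normalized at the origin along $\mathcal Z$, with Gramians $H,\tilde H$. Then $\mathcal M_q$ and $\tilde{\mathcal M}_q$ are isomorphic as modules over $\mathcal A(\Omega)$ if and only if the following conditions hold: (i) there exists a holomorphic isometric bundle map $\Phi:E|_{\mathcal Z^*}\to\tilde E|_{\mathcal Z^*}$; (ii) the transverse curvatures $\bar\partial_i((\partial_jH)H^{-1})$ and $\bar\partial_i((\partial_j\tilde H)\tilde H^{-1})$ of $E$ and $\tilde E$, respectively, for $1\le i,j\le d$, as well as their covariant derivatives of order at most $k-2$ along the directions transverse to $\mathcal Z$, are intertwined by $\Phi$ on $\mathcal Z^*$; (iii) $\Phi$ intertwines, on $\mathcal Z^*\cap U$, the bundle maps $\mathcal J_i^\alpha(H):=\bar\partial_i((\partial^\alpha H)H^{-1})$ and $\mathcal J_i^\alpha(\tilde H):=\bar\partial_i((\partial^\alpha\tilde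 H)\tilde H^{-1})$ for $d+1\le i\le m$ and $\alpha\in A=\{\alpha\in(\mathbb N\cup\{0\})^d:|\alpha|<k\}$.
   Context: $1\le d\le m$ and $\mathcal Z$ is connected. For a set $V$, $V^*=\{\bar z:z\in V\}$; so $\mathcal Z^*=\{w\in\Omega^*:w_1=\dots=w_d=0\}$. Points are written $(z',z'')$, $z'=(z_1,\dots,z_d)$, $z''=(z_{d+1},\dots,z_m)$. For $\alpha\in(\mathbb N\cup\{0\})^d$, $\partial^\alpha=\partial_1^{\alpha_1}\cdots\partial_d^{\alpha_d}$ (first $d$ variables only). $\mathcal A(\Omega)$ is the closure, in the supremum norm on $\overline\Omega$, of the functions holomorphic near $\overline\Omega$. The Hilbert modules considered ($\mathcal M$, and likewise $\tilde{\mathcal M}$) are Hilbert spaces of holomorphic functions $\Omega\to\mathbb C^r$ with norm-continuous action of $\mathcal A(\Omega)$ by pointwise multiplication, with all evaluations $ev_z:\mathcal M\to\mathbb C^r$ bounded and surjective, containing all $\mathbb C^r$-valued polynomials, and with the Gleason property ($h(z)=0$ iff $h(w)=\sum_i(w_i-z_i)h^{(i)}(w)$ with $h^{(i)}\in\mathcal M$). Membership in $\mathrm B_r(\Omega)$ means that $(M_{z_1}^*,\dots,M_{z_m}^* )$ is in the Cowen–Douglas class $\mathrm B_r(\Omega^* )$: $\dim\bigcap_i\ker(M_{z_i}^*-w_i)=r$ and the range of $h\mapsto((M_{z_i}^*-w_i)h)_i$ is closed for each $w\in\Omega^*$, and these joint kernels span a dense subspace. $\mathcal M_0=\{h\in\mathcal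 M:\partial^\alpha h_j|_{\mathcal Z}=0,\ \alpha\in A,\ 1\le j\le r\}$; $\mathcal M_q=\mathcal M\ominus\mathcal M_0$ with action $f\cdot P(h)=P(fh)$, $P$ the orthogonal projection onto $\mathcal M_q$. Isomorphic means there is a unitary intertwining the module actions. With $K$ the reproducing kernel of $\mathcal M$, the bundle $E\to\Omega^*$ has fibre $E_w=\bigcap_i\ker(M_{z_i}^*-w_i)=\{K(\cdot,\bar w)\zeta:\zeta\in\mathbb C^r\}\subset\mathcal M$, metric induced from $\mathcal M$ and global holomorphic frame $K(\cdot,\bar w)\sigma_1,\dots,K(\cdot,\bar w)\sigma_r$ ($\sigma_j$ the standard basis of $\mathbb C^r$); sections of $E$ are regarded as $\mathcal M$-valued functions. The Gramian of a frame $\mathbf s=\{s_1,\dots,s_r\}$ is $H=(\langle s_i,s_j\rangle)_{i,j}$. Similarly for $\tilde{\mathcal M}$. A holomorphic frame $\mathbf s$ of $E$ on an open neighbourhood $U\subset\Omega^*$ of $0$ (with $U$ and $U\cap\mathcal Z^*$ connected) is normalized at the origin along $\mathcal Z$ if $\langle s_i(0,z''),s_j(0,0)\rangle=\delta_{ij}$ and $\langle\partial^\alpha s_i(0,z''),s_j(0,0)\rangle=0$ for all $(0,z'')\in U\cap\mathcal Z^*$, all $i,j$, and all nonzero $\alpha\in(\mathbb N\cup\{0\})^d$. Matrices represent bundle maps by the row convention: $\Theta(s_i)=\sum_j\Theta(\mathbf s)_{ij}s_j$. The transverse curvatures in (ii) are the bundle endomorphisms of $E$ with matrix $\bar\partial_i((\partial_jH)H^{-1})$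 in any local holomorphic frame with Gramian $H$ (similarly for $\tilde E$). For a bundle endomorphism $\Theta$, its covariant derivatives $\Theta_{z_l},\Theta_{\bar z_l}$ (components of $[D,\Theta]$, $D$ the Chern connection) have matrices $\Theta_{z_l}(\mathbf s)=\partial_l\Theta(\mathbf s)-[(\partial_lH)H^{-1},\Theta(\mathbf s)]$ and $\Theta_{\bar z_l}(\mathbf s)=\bar\partial_l\Theta(\mathbf s)$; higher covariant derivatives are obtained by iteration, and the transverse directions are those of $z_l,\bar z_l$ with $1\le l\le d$. A bundle map $\Phi$ intertwines endomorphisms $\Theta$ of $E$ and $\tilde\Theta$ of $\tilde E$ if $\Phi\circ\Theta=\tilde\Theta\circ\Phi$. $\mathcal J_i^\alpha(H)$ is regarded as the endomorphism of $E|_{\mathcal Z^*\cap U}$ with the given matrix in the frame $\mathbf s$, and $\mathcal J_i^\alpha(\tilde H)$ as that of $\tilde E|_{\mathcal Z^*\cap U}$ in the frame $\tilde{\mathbf s}$.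
   Formalization: In (ii), "order at most k-2" is counted separately in the holomorphic and antiholomorphic transverse directions, and for k=1 condition (ii) is empty (not even the curvatures are required); with total order the "if" fails for k≥3, and with curvatures the "only if" fails for k=1. *)

theory Defs
  imports "HOL-Analysis.Analysis" "HOL-Library.Function_Algebras"
begin

section \<open>Functions of several complex variables\<close>

text \<open>Unlike \<open>complex^'m\<close>, this notation leaves the sort of \<open>'m\<close> open.\<close>

type_synonym 'm cvec = "(complex, 'm) vec"

text \<open>
  Coordinates of \<open>'m cvec\<close> are numbered by the linear order of \<open>'m\<close>; \<open>transv d\<close>
  is the set of the first \<open>d\<close> of them.
\<close>

definition transv :: "nat \<Rightarrow> 'm::{finite,linorder} set" where
  "transv d = {i. card {j. j < i} < d}"

definition vcnj :: "'m::finite cvec \<Rightarrow> 'm cvec" where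
  "vcnj z = (\<chi> i. cnj (z $ i))"

definition zero_locus :: "nat \<Rightarrow> 'm::{finite,linorder} cvec set \<Rightarrow> 'm cvec set" where
  "zero_locus d \<Omega> = {z \<in> \<Omega>. \<forall>i\<in>transv d. z $ i = 0}"

text \<open>
  The derivative is taken within \<open>S\<close>, so that the definition covers open sets of \<open>'m cvec\<close>
  and also relatively open subsets of a complex linear subspace (such as the zero locus),
  where it is holomorphy in the remaining variables.
\<close>

definition mholomorphic_on :: "'m::finite cvec set \<Rightarrow> ('m cvec \<Rightarrow> complex) \<Rightarrow> bool" where
  "mholomorphic_on S f \<longleftrightarrow>
     (\<forall>z\<in>S. \<exists>c::'m cvec. (f has_derivative (\<lambda>v. \<Sum>i\<in>UNIV. c $ i * v $ i)) (at z within S))"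

text \<open>The operators \<open>\<partial>/\<partial>z\<^sub>i\<close> and \<open>\<partial>/\<partial>z\<^sub>i\<close>-bar.\<close>

definition wirt :: "'m::finite \<Rightarrow> ('m cvec \<Rightarrow> complex) \<Rightarrow> 'm cvec \<Rightarrow> complex" where
  "wirt i f z =
     (vector_derivative (\<lambda>t::real. f (z + axis i (of_real t))) (at 0)
      - \<i> * vector_derivative (\<lambda>t::real. f (z + axis i (\<i> * of_real t))) (at 0)) / 2"

definition wirt_bar :: "'m::finite \<Rightarrow> ('m cvec \<Rightarrow> complex) \<Rightarrow> 'm cvec \<Rightarrow> complex" where
  "wirt_bar i f z =
     (vector_derivative (\<lambda>t::real. f (z + axis i (of_real t))) (at 0)
      + \<i> * vector_derivative (\<lambda>t::real. f (z + axis i (\<i> * of_real t))) (at 0)) / 2"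

definition mat_wirt ::
    "'m::finite \<Rightarrow> ('m cvec \<Rightarrow> complex^'r^'r) \<Rightarrow> 'm cvec \<Rightarrow> complex^'r^'r" where
  "mat_wirt i A z = (\<chi> a b. wirt i (\<lambda>w. A w $ a $ b) z)"

definition mat_wirt_bar ::
    "'m::finite \<Rightarrow> ('m cvec \<Rightarrow> complex^'r^'r) \<Rightarrow> 'm cvec \<Rightarrow> complex^'r^'r" where
  "mat_wirt_bar i A z = (\<chi> a b. wirt_bar i (\<lambda>w. A w $ a $ b) z)"

text \<open>
  \<open>multi_deriv D \<alpha>\<close> is \<open>D\<^sub>1\<^bsup>\<alpha>1\<^esup> \<dots> D\<^sub>m\<^bsup>\<alpha>m\<^esup>\<close>; it is used for scalar, matrix-valued and
  Hilbert-space-valued functions.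
\<close>

definition multi_deriv :: "('m::{finite,linorder} \<Rightarrow> 'f \<Rightarrow> 'f) \<Rightarrow> ('m \<Rightarrow> nat) \<Rightarrow> 'f \<Rightarrow> 'f" where
  "multi_deriv D \<alpha> = foldr (\<lambda>i g. (D i ^^ \<alpha> i) \<circ> g) (sorted_list_of_set UNIV) id"

definition transv_indices :: "nat \<Rightarrow> ('m::{finite,linorder} \<Rightarrow> nat) set" where
  "transv_indices d = {\<alpha>. \<forall>i. i \<notin> transv d \<longrightarrow> \<alpha> i = 0}"

definition index_set :: "nat \<Rightarrow> nat \<Rightarrow> ('m::{finite,linorder} \<Rightarrow> nat) set" where
  "index_set d k = {\<alpha> \<in> transv_indices d. (\<Sum>i\<in>UNIV. \<alpha> i) < k}"

text \<open>
  The algebra \<open>\<A>(\<Omega>)\<close>. Only the values on \<open>closure \<Omega>\<close> matter; members are arbitrary elsewhere.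
\<close>

definition fun_algebra :: "'m::finite cvec set \<Rightarrow> ('m cvec \<Rightarrow> complex) set" where
  "fun_algebra \<Omega> = {f. \<forall>e>0. \<exists>g V. open V \<and> closure \<Omega> \<subseteq> V \<and> mholomorphic_on V g \<and>
                        (\<forall>z\<in>closure \<Omega>. cmod (f z - g z) < e)}"

section \<open>Hilbert spaces of vector-valued functions\<close>

type_synonym ('m, 'r) vfun = "'m cvec \<Rightarrow> complex^'r"

definition fscale :: "complex \<Rightarrow> ('a \<Rightarrow> complex^'r) \<Rightarrow> 'a \<Rightarrow> complex^'r" where
  "fscale c h = (\<lambda>z. c *s h z)"

global_interpretation fun_vs: vector_space "fscale :: complex \<Rightarrow> ('a \<Rightarrow> complex^'r) \<Rightarrow> _"
  by unfold_locales (auto simp: fscale_def fun_eq_iff vec_eq_iff algebra_simps)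

definition pmul :: "('a \<Rightarrow> complex) \<Rightarrow> ('a \<Rightarrow> complex^'r) \<Rightarrow> 'a \<Rightarrow> complex^'r" where
  "pmul f h = (\<lambda>z. f z *s h z)"

record ('m, 'r) fspace =
  car :: "('m, 'r) vfun set"
  ip :: "('m, 'r) vfun \<Rightarrow> ('m, 'r) vfun \<Rightarrow> complex"

definition hnorm :: "('m::finite, 'r::finite) fspace \<Rightarrow> ('m, 'r) vfun \<Rightarrow> real" where
  "hnorm M h = sqrt (Re (ip M h h))"

locale hilbert_fspace =
  fixes M :: "('m::finite, 'r::finite) fspace"
  assumes subspace: "fun_vs.subspace (car M)"
    and ip_add: "\<lbrakk>x \<in> car M; y \<in> car M; z \<in> car M\<rbrakk> \<Longrightarrow> ip M (x + y) z = ip M x z + ip M y z"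
    and ip_scale: "\<lbrakk>x \<in> car M; y \<in> car M\<rbrakk> \<Longrightarrow> ip M (fscale c x) y = c * ip M x y"
    and ip_cnj: "\<lbrakk>x \<in> car M; y \<in> car M\<rbrakk> \<Longrightarrow> ip M y x = cnj (ip M x y)"
    and ip_pos: "\<lbrakk>x \<in> car M; x \<noteq> 0\<rbrakk> \<Longrightarrow> 0 < Re (ip M x x)"
    and complete: "\<lbrakk>\<And>n::nat. X n \<in> car M;
        \<forall>e>0. \<exists>n0. \<forall>n\<ge>n0. \<forall>n'\<ge>n0. hnorm M (X n - X n') < e\<rbrakk>
        \<Longrightarrow> \<exists>x\<in>car M. (\<lambda>n. hnorm M (X n - x)) \<longlonglongrightarrow> 0"

text \<open>
  A function \<open>\<Omega> \<rightarrow> \<complex>\<^sup>r\<close> is represented by its extension by \<open>0\<close> to all of \<open>'m cvec\<close>.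
\<close>

locale hilbert_module = hilbert_fspace M
  for \<Omega> :: "'m::finite cvec set" and M :: "('m, 'r::finite) fspace" +
  assumes zero_outside: "\<lbrakk>h \<in> car M; z \<notin> \<Omega>\<rbrakk> \<Longrightarrow> h z = 0"
    and holomorphic: "h \<in> car M \<Longrightarrow> mholomorphic_on \<Omega> (\<lambda>z. h z $ j)"
    and action_closed: "\<lbrakk>f \<in> fun_algebra \<Omega>; h \<in> car M\<rbrakk> \<Longrightarrow> pmul f h \<in> car M"
    and action_continuous: "\<lbrakk>f \<in> fun_algebra \<Omega>; h \<in> car M; 0 < e\<rbrakk> \<Longrightarrow>
        \<exists>\<delta>>0. \<forall>g\<in>fun_algebra \<Omega>. \<forall>h'\<in>car M.
          (\<forall>z\<in>closure \<Omega>. cmod (f z - g z) < \<delta>) \<longrightarrow> hnorm M (h - h') < \<delta> \<longrightarrow>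
          hnorm M (pmul f h - pmul g h') < e"
    and eval_bounded: "z \<in> \<Omega> \<Longrightarrow> \<exists>C. \<forall>h\<in>car M. norm (h z) \<le> C * hnorm M h"
    and eval_surj: "z \<in> \<Omega> \<Longrightarrow> (\<lambda>h. h z) ` car M = UNIV"
    and polynomials: "finite S \<Longrightarrow>
        (\<lambda>z. if z \<in> \<Omega> then \<Sum>\<alpha>\<in>S. (\<Prod>i\<in>UNIV. z $ i ^ \<alpha> i) *s c (\<alpha> :: 'm \<Rightarrow> nat) else 0) \<in> car M"
    and gleason: "\<lbrakk>h \<in> car M; z \<in> \<Omega>\<rbrakk> \<Longrightarrow>
        h z = 0 \<longleftrightarrow> (\<exists>g. (\<forall>i. g i \<in> car M) \<and>
                        (\<forall>w\<in>\<Omega>. h w = (\<Sum>i\<in>UNIV. (w $ i - z $ i) *s g i w)))"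

definition hadjoint :: "('m::finite, 'r::finite) fspace \<Rightarrow>
    (('m, 'r) vfun \<Rightarrow> ('m, 'r) vfun) \<Rightarrow> ('m, 'r) vfun \<Rightarrow> ('m, 'r) vfun" where
  "hadjoint M T g = (THE k. k \<in> car M \<and> (\<forall>h\<in>car M. ip M (T h) g = ip M h k))"

definition coord_adj :: "('m::finite, 'r::finite) fspace \<Rightarrow> 'm \<Rightarrow> ('m, 'r) vfun \<Rightarrow> ('m, 'r) vfun" where
  "coord_adj M i = hadjoint M (pmul (\<lambda>z. z $ i))"

definition fibre :: "('m::finite, 'r::finite) fspace \<Rightarrow> 'm cvec \<Rightarrow> ('m, 'r) vfun set" where
  "fibre M w = {h \<in> car M. \<forall>i. coord_adj M i h = fscale (w $ i) h}"

text \<open>Membership in \<open>B\<^sub>r(\<Omega>)\<close>, where \<open>r = CARD('r)\<close> is also the dimension of the target space.\<close>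

definition cowen_douglas :: "'m::finite cvec set \<Rightarrow> ('m, 'r::finite) fspace \<Rightarrow> bool" where
  "cowen_douglas \<Omega> M \<longleftrightarrow>
     (\<forall>w\<in>vcnj ` \<Omega>.
        fun_vs.dim (fibre M w) = CARD('r) \<and>
        (\<forall>(X :: nat \<Rightarrow> ('m, 'r) vfun) g.
           (\<forall>n. X n \<in> car M) \<longrightarrow> (\<forall>i. g i \<in> car M) \<longrightarrow>
           (\<forall>i. (\<lambda>n. hnorm M (coord_adj M i (X n) - fscale (w $ i) (X n) - g i)) \<longlonglongrightarrow> 0) \<longrightarrow>
           (\<exists>h\<in>car M. \<forall>i. coord_adj M i h - fscale (w $ i) h = g i))) \<and>
     (\<forall>h\<in>car M. \<forall>e>0. \<exists>g\<in>fun_vs.span (\<Union>w\<in>vcnj ` \<Omega>. fibre M w). hnorm M (h - g) < e)"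

section \<open>Quotient modules\<close>

definition vanishing_submodule :: "'m::{finite,linorder} cvec set \<Rightarrow> nat \<Rightarrow> nat \<Rightarrow>
    ('m, 'r::finite) fspace \<Rightarrow> ('m, 'r) vfun set" where
  "vanishing_submodule \<Omega> d k M =
     {h \<in> car M. \<forall>\<alpha>\<in>index_set d k. \<forall>j. \<forall>z\<in>zero_locus d \<Omega>. multi_deriv wirt \<alpha> (\<lambda>w. h w $ j) z = 0}"

definition quotient_module :: "'m::{finite,linorder} cvec set \<Rightarrow> nat \<Rightarrow> nat \<Rightarrow>
    ('m, 'r::finite) fspace \<Rightarrow> ('m, 'r) vfun set" where
  "quotient_module \<Omega> d k M = {h \<in> car M. \<forall>g\<in>vanishing_submodule \<Omega> d k M. ip M h g = 0}"

definition hproj :: "('m::finite, 'r::finite) fspace \<Rightarrow> ('m, 'r) vfun set \<Rightarrow>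
    ('m, 'r) vfun \<Rightarrow> ('m, 'r) vfun" where
  "hproj M S h = (THE p. p \<in> S \<and> (\<forall>g\<in>S. ip M (h - p) g = 0))"

definition quotients_isomorphic :: "'m::{finite,linorder} cvec set \<Rightarrow> nat \<Rightarrow> nat \<Rightarrow>
    ('m, 'r::finite) fspace \<Rightarrow> ('m, 'r) fspace \<Rightarrow> bool" where
  "quotients_isomorphic \<Omega> d k M N \<longleftrightarrow>
     (let Q = quotient_module \<Omega> d k M; R = quotient_module \<Omega> d k N in
      \<exists>V. bij_betw V Q R \<and>
          (\<forall>x\<in>Q. \<forall>y\<in>Q. V (x + y) = V x + V y) \<and>
          (\<forall>c. \<forall>x\<in>Q. V (fscale c x) = fscale c (V x)) \<and>
          (\<forall>x\<in>Q. \<forall>y\<in>Q. ip N (V x) (V y) = ip M x y) \<and>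
          (\<forall>f\<in>fun_algebra \<Omega>. \<forall>x\<in>Q. V (hproj M Q (pmul f x)) = hproj N R (pmul f (V x))))"

section \<open>The associated bundle\<close>

text \<open>The function \<open>K(\<cdot>, z)\<zeta>\<close>, characterised by the reproducing property.\<close>

definition rkernel :: "('m::finite, 'r::finite) fspace \<Rightarrow> 'm cvec \<Rightarrow> complex^'r \<Rightarrow> ('m, 'r) vfun" where
  "rkernel M z \<zeta> = (THE k. k \<in> car M \<and> (\<forall>h\<in>car M. ip M h k = (\<Sum>j\<in>UNIV. h z $ j * cnj (\<zeta> $ j))))"

definition kframe :: "('m::finite, 'r::finite) fspace \<Rightarrow> 'r \<Rightarrow> 'm cvec \<Rightarrow> ('m, 'r) vfun" where
  "kframe M j w = rkernel M (vcnj w) (axis j 1)"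

definition holomorphic_section :: "('m::finite, 'r::finite) fspace \<Rightarrow> 'm cvec set \<Rightarrow>
    ('m cvec \<Rightarrow> ('m, 'r) vfun) \<Rightarrow> bool" where
  "holomorphic_section M S s \<longleftrightarrow>
     (\<exists>a. (\<forall>j. mholomorphic_on S (a j)) \<and>
          (\<forall>w\<in>S. s w = (\<Sum>j\<in>UNIV. fscale (a j w) (kframe M j w))))"

definition holomorphic_frame :: "('m::finite, 'r::finite) fspace \<Rightarrow> 'm cvec set \<Rightarrow>
    ('r \<Rightarrow> 'm cvec \<Rightarrow> ('m, 'r) vfun) \<Rightarrow> bool" where
  "holomorphic_frame M S s \<longleftrightarrow>
     (\<forall>i. holomorphic_section M S (s i)) \<and>
     (\<forall>w\<in>S. inj (\<lambda>i. s i w) \<and> fun_vs.independent (range (\<lambda>i. s i w)) \<and>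
            fun_vs.span (range (\<lambda>i. s i w)) = fibre M w)"

definition gramian :: "('m::finite, 'r::finite) fspace \<Rightarrow>
    ('r \<Rightarrow> 'm cvec \<Rightarrow> ('m, 'r) vfun) \<Rightarrow> 'm cvec \<Rightarrow> complex^'r^'r" where
  "gramian M s w = (\<chi> i j. ip M (s i w) (s j w))"

text \<open>The complex partial derivative of an \<open>M\<close>-valued function, as a limit in the norm of \<open>M\<close>.\<close>

definition hderiv :: "('m::finite, 'r::finite) fspace \<Rightarrow> 'm \<Rightarrow>
    ('m cvec \<Rightarrow> ('m, 'r) vfun) \<Rightarrow> 'm cvec \<Rightarrow> ('m, 'r) vfun" where
  "hderiv M i s w = (THE g. g \<in> car M \<and>
     ((\<lambda>t. hnorm M (fscale (inverse t) (s (w + axis i t) - s w) - g)) \<longlongrightarrow> 0) (at 0))"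

definition normalized_frame :: "'m::{finite,linorder} cvec set \<Rightarrow> nat \<Rightarrow> ('m, 'r::finite) fspace \<Rightarrow>
    'm cvec set \<Rightarrow> ('r \<Rightarrow> 'm cvec \<Rightarrow> ('m, 'r) vfun) \<Rightarrow> bool" where
  "normalized_frame \<Omega> d M U s \<longleftrightarrow>
     open U \<and> connected U \<and> 0 \<in> U \<and> U \<subseteq> vcnj ` \<Omega> \<and> connected (U \<inter> vcnj ` zero_locus d \<Omega>) \<and>
     holomorphic_frame M U s \<and>
     (\<forall>w\<in>U \<inter> vcnj ` zero_locus d \<Omega>. \<forall>i j.
        ip M (s i w) (s j 0) = (if i = j then 1 else 0) \<and>
        (\<forall>\<alpha>\<in>transv_indices d. \<alpha> \<noteq> (\<lambda>_. 0) \<longrightarrow> ip M (multi_deriv (hderiv M) \<alpha> (s i) w) (s j 0) = 0))"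

definition holomorphic_isometric_map :: "('m::finite, 'r::finite) fspace \<Rightarrow> ('m, 'r) fspace \<Rightarrow>
    'm cvec set \<Rightarrow> ('m cvec \<Rightarrow> ('m, 'r) vfun \<Rightarrow> ('m, 'r) vfun) \<Rightarrow> bool" where
  "holomorphic_isometric_map M N S \<Phi> \<longleftrightarrow>
     (\<forall>w\<in>S. \<Phi> w ` fibre M w \<subseteq> fibre N w \<and>
            (\<forall>x\<in>fibre M w. \<forall>y\<in>fibre M w. \<Phi> w (x + y) = \<Phi> w x + \<Phi> w y) \<and>
            (\<forall>c. \<forall>x\<in>fibre M w. \<Phi> w (fscale c x) = fscale c (\<Phi> w x)) \<and>
            (\<forall>x\<in>fibre M w. \<forall>y\<in>fibre M w. ip N (\<Phi> w x) (\<Phi> w y) = ip M x y)) \<and>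
     (\<forall>j. holomorphic_section N S (\<lambda>w. \<Phi> w (kframe M j w)))"

text \<open>
  The endomorphism with matrix \<open>A\<close> in the frame \<open>s\<close>, in the row convention:
  \<open>s\<^sub>i(w)\<close> is mapped to \<open>\<Sum>j. A\<^sub>i\<^sub>j(w) s\<^sub>j(w)\<close>.
\<close>

definition frame_endo :: "('r::finite \<Rightarrow> 'm::finite cvec \<Rightarrow> ('m, 'r) vfun) \<Rightarrow>
    ('m cvec \<Rightarrow> complex^'r^'r) \<Rightarrow> 'm cvec \<Rightarrow> ('m, 'r) vfun \<Rightarrow> ('m, 'r) vfun" where
  "frame_endo s A w v =
     (\<Sum>i\<in>UNIV. fscale (fun_vs.representation (range (\<lambda>l. s l w)) v (s i w))
                 (\<Sum>j\<in>UNIV. fscale (A w $ i $ j) (s j w)))"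

definition intertwines_on :: "('m::finite, 'r::finite) fspace \<Rightarrow> 'm cvec set \<Rightarrow>
    ('m cvec \<Rightarrow> ('m, 'r) vfun \<Rightarrow> ('m, 'r) vfun) \<Rightarrow>
    ('m cvec \<Rightarrow> ('m, 'r) vfun \<Rightarrow> ('m, 'r) vfun) \<Rightarrow>
    ('m cvec \<Rightarrow> ('m, 'r) vfun \<Rightarrow> ('m, 'r) vfun) \<Rightarrow> bool" where
  "intertwines_on M S \<Phi> \<Theta> \<Theta>' \<longleftrightarrow> (\<forall>w\<in>S. \<forall>v\<in>fibre M w. \<Phi> w (\<Theta> w v) = \<Theta>' w (\<Phi> w v))"

definition curvature :: "'m::finite \<Rightarrow> 'm \<Rightarrow> ('m cvec \<Rightarrow> complex^'r^'r) \<Rightarrow> 'm cvec \<Rightarrow> complex^'r^'r" where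
  "curvature i j H = mat_wirt_bar i (\<lambda>w. mat_wirt j H w ** matrix_inv (H w))"

definition jet_map :: "'m::{finite,linorder} \<Rightarrow> ('m \<Rightarrow> nat) \<Rightarrow> ('m cvec \<Rightarrow> complex^'r^'r) \<Rightarrow>
    'm cvec \<Rightarrow> complex^'r^'r" where
  "jet_map i \<alpha> H = mat_wirt_bar i (\<lambda>w. multi_deriv mat_wirt \<alpha> H w ** matrix_inv (H w))"

datatype 'm direction = Hol 'm | Anti 'm

fun cov_deriv :: "('m::finite cvec \<Rightarrow> complex^'r^'r) \<Rightarrow> 'm direction \<Rightarrow>
    ('m cvec \<Rightarrow> complex^'r^'r) \<Rightarrow> 'm cvec \<Rightarrow> complex^'r^'r" where
  "cov_deriv H (Hol l) A = (\<lambda>w. let \<theta> = mat_wirt l H w ** matrix_inv (H w) in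
                                mat_wirt l A w - (\<theta> ** A w - A w ** \<theta>))"
| "cov_deriv H (Anti l) A = mat_wirt_bar l A"

text \<open>
  The words of transverse directions along which the curvatures are differentiated covariantly.
  Orders are counted separately in the holomorphic and in the antiholomorphic directions: a
  covariant derivative \<open>\<Theta>\<^bsub>z^I zbar^J\<^esub>\<close> is of order at most \<open>k - 2\<close> if \<open>|I| \<le> k - 2\<close> and
  \<open>|J| \<le> k - 2\<close>, in line with the jets \<open>\<partial>\<^sup>\<alpha> \<partial>bar\<^sup>\<beta> H\<close>, \<open>|\<alpha>| < k\<close>, \<open>|\<beta>| < k\<close>, that the
  quotient module sees. The bound on the total order \<open>|I| + |J|\<close> would not suffice: for
  \<open>m = d = r = 1\<close>, \<open>k = 3\<close> and kernels \<open>1 + x + a\<^sub>2 x\<^sup>2 + \<dots>\<close> in \<open>x = z * cnj w\<close>, it misses \<open>a\<^sub>2\<close>.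
  The empty word stands for the curvature itself; for \<open>k = 1\<close> there are no words at all, as
  the quotient then depends only on the restriction of the kernel to the zero locus.
\<close>

definition transv_words :: "nat \<Rightarrow> nat \<Rightarrow> 'm::{finite,linorder} direction list set" where
  "transv_words d k = {ws. set ws \<subseteq> Hol ` transv d \<union> Anti ` transv d \<and>
     length (filter (\<lambda>D. D \<in> range Hol) ws) + 2 \<le> k \<and>
     length (filter (\<lambda>D. D \<in> range Anti) ws) + 2 \<le> k}"

text \<open>
  The endomorphism below does not depend on the holomorphic frame, so it is given by its matrix
  in the global frame \<open>kframe M\<close>.
\<close>

definition curvature_deriv :: "('m::finite, 'r::finite) fspace \<Rightarrow> 'm direction list \<Rightarrow> 'm \<Rightarrow> 'm \<Rightarrow>
    'm cvec \<Rightarrow> ('m, 'r) vfun \<Rightarrow> ('m, 'r) vfun" where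
  "curvature_deriv M ws i j =
     (let H = gramian M (kframe M) in
      frame_endo (kframe M) (fold (cov_deriv H) ws (curvature i j H)))"

end

theory Submission
  imports Defs "HOL-Complex_Analysis.Cauchy_Integral_Formula" "HOL-Library.Sublist"
begin

text \<open>
  Let \<open>Q\<close> be the orthogonal complement of the functions in \<open>M\<close> vanishing to order \<open>k\<close> along the
  zero locus.  If \<open>s\<close> is a holomorphic frame of the bundle of joint eigenvectors, then the
  derivatives \<open>\<partial>\<^sup>\<alpha>s\<^sub>i(w)\<close> with \<open>\<alpha>\<close> transverse, \<open>|\<alpha>| < k\<close> and \<open>w\<close> in the conjugate of the zero locus
  span a dense subspace of \<open>Q\<close>, because pairing with them yields the transverse Taylor coefficients of order
  less than \<open>k\<close>.  The inner products of these vectors at a common point \<open>w\<close> are the derivatives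
  of the Gram matrix \<open>H\<close> of \<open>s\<close> along words with fewer than \<open>k\<close> holomorphic and fewer than \<open>k\<close>
  antiholomorphic transverse directions.  So both directions of the theorem are statements about
  such jets of Gram matrices along the zero locus.

  \<^bold>\<open>From an isomorphism to the conditions.\<close>  Let \<open>V\<close> be an intertwining unitary.  Its adjoint,
  extended by the orthogonal projection, commutes with multiplication operators up to functions
  vanishing to order \<open>k\<close>.  By the Gleason property it therefore acts on jets of order less than
  \<open>k\<close> as multiplication by a holomorphic matrix (\<open>lift_jet\<close>).  Dually, \<open>V\<close> takes the derivatives of
  the kernel frame of \<open>M\<close> to those of a frame \<open>\<tau>\<close>, which is the kernel frame of \<open>N\<close> multiplied by
  a holomorphic matrix (\<open>V_section_deriv\<close>).  In particular \<open>V\<close> itself is the bundle map \<open>\<Phi>\<close>, and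
  the Gram matrices of the two frames have the same jets (\<open>gram_jets\<close>).  Curvature and its
  covariant derivatives are computed from these jets, and passing from \<open>\<tau>\<close> to the kernel frame
  of \<open>N\<close> only conjugates them (\<open>cov_word_gauge\<close>), whence (ii).  For normalized frames \<open>s\<close> and
  \<open>t\<close>, inner products with the values at the origin show that the matrix relating them is a
  constant unitary \<open>E\<close> up to jets of order less than \<open>k\<close>.  So the Gram matrices \<open>H\<^sub>s\<close> and
  \<open>E H\<^sub>t E\<^sup>*\<close> have the same holomorphic jets, whence (iii).

  \<^bold>\<open>From the conditions to an isomorphism.\<close>  In normalized frames the matrix of \<open>\<Phi>\<close> is a constant
  unitary \<open>E\<close>: polarize the isometry relation and put the second variable equal to \<open>0\<close> (\<open>e_const\<close>).
  Let \<open>X = H\<^sub>s - E H\<^sub>t E\<^sup>*\<close>.  Condition (iii) says that \<open>(\<partial>\<^sup>\<alpha>H\<^sub>s) H\<^sub>s\<^sup>-\<^sup>1\<close> and the conjugate of its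
  counterpart differ by a matrix \<open>L\<close> that is holomorphic along the zero locus; polarizing
  \<open>L H\<^sub>s = \<partial>\<^sup>\<alpha>X\<close> and putting the second variable equal to \<open>0\<close> gives \<open>L = 0\<close> by
  normalization, hence \<open>\<partial>\<^sup>\<alpha>X = 0\<close> (\<open>hol_derivs_agree\<close>).  A covariant derivative of the curvature
  has the corresponding mixed derivative of \<open>H\<close> as its leading term (\<open>cov_word_leading_term\<close>), so
  (ii) and induction on the order give the vanishing of all mixed jets of \<open>X\<close>
  (\<open>all_jets_agree\<close>).  Polarizing once more, the vectors \<open>\<partial>\<^sup>\<alpha>s\<^sub>i(w)\<close> and their counterparts have the
  same inner products also for different points \<open>w\<close>; hence a unitary matches them
  (\<open>unitary_of_equal_gramians\<close>), and it intertwines the module actions since their adjoints act on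
  these vectors by Leibniz' rule (\<open>quotients_isomorphic_of_jets\<close>).

  Polarization is available because every scalar function here is the restriction of a holomorphic
  function of twice as many variables to the points \<open>(w, cnj w)\<close>.
\<close>

section \<open>Holomorphic functions of several complex variables\<close>

text \<open>
  The discs of radius \<open>R/3\<close> about the points of \<open>ball 0 (R/3)\<close> lie in \<open>ball 0 R\<close>, so Cauchy's
  inequalities bound the derivatives there, and Taylor's formula applies.
\<close>

lemma cauchy_second_order:
  assumes hol: "g holomorphic_on ball 0 R" and R: "0 < R"
    and B: "\<And>x. x \<in> ball 0 R \<Longrightarrow> cmod (g x) \<le> B"
    and x: "cmod x < R / 3"
  shows "cmod (g x - g 0 - x * deriv g 0) \<le> 18 * B / R\<^sup>2 * (cmod x)\<^sup>2"
    and "cmod (deriv g 0) \<le> 3 * B / R"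
proof -
  let ?b = "ball (0::complex) (R / 3)"
  have sub: "cball y (R/3) \<subseteq> ball 0 R" if "y \<in> ?b" for y
  proof
    fix u assume "u \<in> cball y (R/3)"
    moreover have "dist 0 u \<le> dist 0 y + dist y u" by (rule dist_triangle)
    ultimately show "u \<in> ball 0 R" using that R by auto
  qed
  have cau: "cmod ((deriv ^^ n) g y) \<le> fact n * B / (R/3)^n" if "y \<in> ?b" for y n
  proof (rule Cauchy_inequality)
    show "g holomorphic_on ball y (R/3)"
      using sub[OF that] by (meson ball_subset_cball hol holomorphic_on_subset order_trans)
    show "continuous_on (cball y (R/3)) g"
      using sub[OF that] by (meson hol holomorphic_on_imp_continuous_on holomorphic_on_subset)
    show "0 < R/3" using R by simp
    show "norm (g u) \<le> B" if "norm (y - u) = R/3" for u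
    proof (rule B)
      have "u \<in> cball y (R/3)" using that by (simp add: dist_norm)
      then show "u \<in> ball 0 R" using sub[OF \<open>y \<in> ?b\<close>] by blast
    qed
  qed
  have hol': "(deriv ^^ n) g holomorphic_on ball 0 R" for n
    by (intro holomorphic_higher_deriv hol) auto
  have d: "((deriv ^^ i) g has_field_derivative (deriv ^^ Suc i) g y) (at y within ?b)"
    if "y \<in> ?b" for i y
  proof -
    have "(deriv ^^ i) g field_differentiable at y"
      using hol'[of i] that R by (auto simp: holomorphic_on_open field_differentiable_def)
    then show ?thesis
      by (simp add: field_differentiable_derivI has_field_derivative_at_within)
  qed
  have "cmod ((deriv ^^ 0) g x - (\<Sum>i\<le>1. (deriv ^^ i) g 0 * (x - 0) ^ i / fact i))
      \<le> (fact 2 * B / (R/3)^2) * cmod (x - 0) ^ Suc 1 / fact 1"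
  proof (rule complex_Taylor[of "?b" 1 "\<lambda>i. (deriv ^^ i) g"])
    show "convex ?b" by simp
    show "\<And>i y. y \<in> ?b \<Longrightarrow> i \<le> 1 \<Longrightarrow>
        ((deriv ^^ i) g has_field_derivative (deriv ^^ Suc i) g y) (at y within ?b)"
      using d by blast
    show "\<And>y. y \<in> ?b \<Longrightarrow> cmod ((deriv ^^ Suc 1) g y) \<le> fact 2 * B / (R/3)^2"
      using cau[of _ 2] by (simp add: numeral_2_eq_2)
  qed (use x R in auto)
  then show "cmod (g x - g 0 - x * deriv g 0) \<le> 18 * B / R\<^sup>2 * (cmod x)\<^sup>2"
    by (simp add: power_divide algebra_simps power2_eq_square)
  show "cmod (deriv g 0) \<le> 3 * B / R"
    using cau[of 0 1] R by (simp add: algebra_simps)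
qed

text \<open>
  Holomorphy in each variable together with local boundedness.  By Osgood's lemma this is the same
  as complex Frechet differentiability on open sets, and it is easier to verify.
\<close>

definition sep_holomorphic :: "'m::finite cvec set \<Rightarrow> ('m cvec \<Rightarrow> complex) \<Rightarrow> bool" where
  "sep_holomorphic S f \<longleftrightarrow>
     (\<forall>z\<in>S. (\<forall>i. (\<lambda>\<zeta>. f (z + axis i \<zeta>)) field_differentiable at 0) \<and>
            (\<exists>r>0. \<exists>B. \<forall>w\<in>ball z r. cmod (f w) \<le> B))"

lemma norm_axis [simp]: "norm (axis i x :: 'a::real_normed_vector ^ 'n) = norm x"
proof -
  have "(\<Sum>j\<in>UNIV. (norm (axis i x $ j))\<^sup>2) = (norm x)\<^sup>2"
    by (subst sum.remove[of _ i]) (auto simp: axis_def)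
  then show ?thesis by (simp add: norm_vec_def L2_set_def)
qed

lemma axis_add: "axis i (x + y) = axis i x + (axis i y :: 'a::monoid_add ^ 'n)"
  by (simp add: vec_eq_iff axis_def)

lemma axis_zero_right [simp]: "axis i 0 = (0 :: 'a::zero ^ 'n)"
  by (simp add: vec_eq_iff axis_def)

text \<open>
  The Wirtinger operators are built from the real derivatives along \<open>1\<close> and \<open>\<i>\<close>; for a complex
  differentiable slice these are \<open>D\<close> and \<open>\<i> D\<close>.
\<close>

lemma wirt_of_slice:
  fixes f :: "'m::finite cvec \<Rightarrow> complex"
  assumes "((\<lambda>\<zeta>. f (z + axis i \<zeta>)) has_field_derivative D) (at 0)"
  shows "wirt i f z = D" "wirt_bar i f z = 0"
proof -
  let ?g = "\<lambda>\<zeta>. f (z + axis i \<zeta>)"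
  have r: "((\<lambda>t::real. of_real t :: complex) has_vector_derivative 1) (at 0)"
    using has_vector_derivative_of_real[OF DERIV_ident] by simp
  then have 1: "((\<lambda>t::real. ?g (of_real t)) has_vector_derivative 1 * D) (at 0)"
    using field_vector_diff_chain_at[of of_real 1 0 ?g D] assms by (simp add: o_def)
  have "((\<lambda>t::real. \<i> * of_real t) has_vector_derivative \<i> * 1) (at 0)"
    by (rule has_vector_derivative_mult_right[OF r])
  then have 2: "((\<lambda>t::real. ?g (\<i> * of_real t)) has_vector_derivative \<i> * D) (at 0)"
    using field_vector_diff_chain_at[of "\<lambda>t. \<i> * of_real t" \<i> 0 ?g D] assms
    by (simp add: o_def)
  show "wirt i f z = D" "wirt_bar i f z = 0"
    using vector_derivative_at[OF 1] vector_derivative_at[OF 2]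
    by (simp_all add: wirt_def wirt_bar_def flip: mult.assoc)
qed

lemma wirt_eq_deriv:
  assumes "(\<lambda>\<zeta>. f (z + axis i \<zeta>)) field_differentiable at 0"
  shows "wirt i f z = deriv (\<lambda>\<zeta>. f (z + axis i \<zeta>)) 0"
  using wirt_of_slice(1) assms field_differentiable_derivI by blast

lemma sep_holomorphic_slice:
  assumes "sep_holomorphic S f" "ball z r \<subseteq> S"
  shows "(\<lambda>\<zeta>. f (z + axis i \<zeta>)) holomorphic_on ball 0 r"
    and "\<zeta> \<in> ball 0 r \<Longrightarrow>
      ((\<lambda>\<zeta>. f (z + axis i \<zeta>)) has_field_derivative wirt i f (z + axis i \<zeta>)) (at \<zeta>)"
proof -
  have *: "((\<lambda>\<zeta>. f (z + axis i \<zeta>)) has_field_derivative wirt i f (z + axis i \<zeta>)) (at \<zeta>)"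
    if "\<zeta> \<in> ball 0 r" for \<zeta>
  proof -
    have "z + axis i \<zeta> \<in> S" using that assms(2) by (auto simp: dist_norm)
    then have fd: "(\<lambda>x. f (z + axis i \<zeta> + axis i x)) field_differentiable at 0"
      using assms(1) by (auto simp: sep_holomorphic_def)
    then have "((\<lambda>x. f (z + axis i \<zeta> + axis i x)) has_field_derivative wirt i f (z + axis i \<zeta>)) (at 0)"
      using wirt_eq_deriv field_differentiable_derivI by metis
    then have "((\<lambda>x. f (z + axis i (\<zeta> + x))) has_field_derivative wirt i f (z + axis i \<zeta>)) (at 0)"
      by (simp add: axis_add add.assoc)
    from DERIV_shift[of "\<lambda>x. f (z + axis i x)" "wirt i f (z + axis i \<zeta>)" 0 \<zeta>] this
    show ?thesis by (simp add: add.commute)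
  qed
  then show "(\<lambda>\<zeta>. f (z + axis i \<zeta>)) holomorphic_on ball 0 r"
    unfolding holomorphic_on_open[OF open_ball] by blast
  show "((\<lambda>\<zeta>. f (z + axis i \<zeta>)) has_field_derivative wirt i f (z + axis i \<zeta>)) (at \<zeta>)"
    if "\<zeta> \<in> ball 0 r" using * that by blast
qed

lemma sep_holomorphic_ball:
  assumes "sep_holomorphic S f" "open S" "z \<in> S"
  obtains r B where "0 < r" "0 \<le> B" "\<And>w. w \<in> ball z r \<Longrightarrow> ball w r \<subseteq> S"
    "\<And>w u. w \<in> ball z r \<Longrightarrow> u \<in> ball w r \<Longrightarrow> cmod (f u) \<le> B"
proof -
  obtain e where e: "0 < e" "ball z e \<subseteq> S" using assms openE by blast
  obtain r B where r: "0 < r" "\<forall>w\<in>ball z r. cmod (f w) \<le> B"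
    using assms by (auto simp: sep_holomorphic_def)
  define R where "R = min e r / 2"
  have sub: "ball w R \<subseteq> ball z (min e r)" if "w \<in> ball z R" for w
  proof
    fix u assume "u \<in> ball w R"
    moreover have "dist z u \<le> dist z w + dist w u" by (rule dist_triangle)
    ultimately show "u \<in> ball z (min e r)" using that by (auto simp: R_def)
  qed
  show ?thesis
  proof (rule that)
    show "0 < R" using e r by (simp add: R_def)
    show "0 \<le> max B 0" by simp
    show "ball w R \<subseteq> S" if "w \<in> ball z R" for w
      using sub[OF that] e(2) by (meson min.cobounded1 order_trans subset_ball)
    show "cmod (f u) \<le> max B 0" if "w \<in> ball z R" "u \<in> ball w R" for w u
    proof -
      have "u \<in> ball z (min e r)" using sub[OF that(1)] that(2) by blast
      then have "cmod (f u) \<le> B" using r(2) by simp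
      then show ?thesis by simp
    qed
  qed
qed

lemma sep_holomorphic_taylor:
  assumes "sep_holomorphic S f" "ball w r \<subseteq> S" "0 < r"
    and "\<And>u. u \<in> ball w r \<Longrightarrow> cmod (f u) \<le> B" and "cmod x < r / 3"
  shows "cmod (f (w + axis i x) - f w - x * wirt i f w) \<le> 18 * B / r\<^sup>2 * (cmod x)\<^sup>2"
    and "cmod (wirt i f w) \<le> 3 * B / r"
proof -
  have d: "((\<lambda>\<zeta>. f (w + axis i \<zeta>)) has_field_derivative wirt i f w) (at 0)"
    using sep_holomorphic_slice(2)[OF assms(1,2), of 0 i] assms(3) by simp
  note c = cauchy_second_order[OF sep_holomorphic_slice(1)[OF assms(1,2)] assms(3) _ assms(5), of i B]
  show "cmod (f (w + axis i x) - f w - x * wirt i f w) \<le> 18 * B / r\<^sup>2 * (cmod x)\<^sup>2"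
    using c(1) assms(4) DERIV_imp_deriv[OF d] by (simp add: dist_norm)
  show "cmod (wirt i f w) \<le> 3 * B / r"
    using c(2) assms(4) DERIV_imp_deriv[OF d] by (simp add: dist_norm)
qed

text \<open>
  Partial derivatives of separately holomorphic functions are locally uniform limits of difference
  quotients.  The difference quotients are separately holomorphic, so the limit is as well, and
  since derivatives converge along with the functions, partial derivatives commute.
\<close>

lemma sep_holomorphic_wirt:
  assumes f: "sep_holomorphic S f" and S: "open S"
  shows "sep_holomorphic S (wirt i f)"
    and "z \<in> S \<Longrightarrow> wirt j (wirt i f) z = wirt i (wirt j f) z"
proof -
  have main: "\<exists>q D. (\<forall>n. q n \<noteq> 0) \<and> q \<longlonglongrightarrow> 0 \<and>
     ((\<lambda>\<zeta>. wirt i f (z + axis j \<zeta>)) has_field_derivative D) (at 0) \<and>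
     (\<lambda>n. (wirt j f (z + axis i (q n)) - wirt j f z) / q n) \<longlonglongrightarrow> D"
    if z: "z \<in> S" for z i j
  proof -
    obtain r B where r: "0 < r" "0 \<le> B" "\<And>w. w \<in> ball z r \<Longrightarrow> ball w r \<subseteq> S"
      "\<And>w u. w \<in> ball z r \<Longrightarrow> u \<in> ball w r \<Longrightarrow> cmod (f u) \<le> B"
      using sep_holomorphic_ball[OF f S z] by metis
    define q where "q = (\<lambda>n. of_real (r / 4 / real (Suc n)) :: complex)"
    have q0: "q n \<noteq> 0" for n
      unfolding q_def of_real_eq_0_iff using r(1) by simp
    have qlt: "cmod (q n) < r / 3" for n
    proof -
      have "r / 4 / real (Suc n) \<le> r / 4" using r by (simp add: field_simps)
      also have "\<dots> < r / 3" using r by simp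
      finally show ?thesis unfolding q_def norm_of_real using r(1) by simp
    qed
    have qlim: "q \<longlonglongrightarrow> 0"
    proof -
      have "(\<lambda>n. r / 4 / real (Suc n)) \<longlonglongrightarrow> 0"
        using tendsto_mult_left[OF LIMSEQ_inverse_real_of_nat, of "r / 4"]
        by (simp only: divide_inverse mult_zero_right)
      from tendsto_of_real[OF this] show ?thesis unfolding q_def by (simp only: of_real_0)
    qed
    define Q where "Q n w = (f (w + axis i (q n)) - f w) / q n" for n w
    have Qbd: "cmod (Q n w - wirt i f w) \<le> 18 * B / r\<^sup>2 * cmod (q n)" if "w \<in> ball z r" for n w
    proof -
      have "cmod (f (w + axis i (q n)) - f w - q n * wirt i f w) \<le> 18 * B / r\<^sup>2 * (cmod (q n))\<^sup>2"
        using sep_holomorphic_taylor(1)[OF f r(3)[OF that] r(1) r(4)[OF that] qlt] by simp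
      moreover have "Q n w - wirt i f w = (f (w + axis i (q n)) - f w - q n * wirt i f w) / q n"
        using q0 by (simp add: Q_def field_simps)
      ultimately show ?thesis
        using q0[of n] by (simp add: norm_divide divide_le_eq power2_eq_square)
    qed
    let ?G = "\<lambda>n \<zeta>. Q n (z + axis j \<zeta>)" and ?g = "\<lambda>\<zeta>. wirt i f (z + axis j \<zeta>)"
    have inb: "z + axis j \<zeta> \<in> ball z r" if "\<zeta> \<in> ball 0 r" for \<zeta>
      using that by (simp add: dist_norm)
    have der: "(?G n has_field_derivative
        (wirt j f (z + axis j \<zeta> + axis i (q n)) - wirt j f (z + axis j \<zeta>)) / q n) (at \<zeta>)"
      if "\<zeta> \<in> ball 0 r" for n \<zeta>
    proof -
      have "z + axis j \<zeta> + axis i (q n) \<in> S"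
        using r(3)[OF inb[OF that]] qlt[of n] r(1) by (auto simp: dist_norm)
      then obtain e where e: "0 < e" "ball (z + axis j \<zeta> + axis i (q n)) e \<subseteq> S"
        using S openE by blast
      have "((\<lambda>x. f (z + axis j \<zeta> + axis i (q n) + axis j x)) has_field_derivative
          wirt j f (z + axis j \<zeta> + axis i (q n))) (at 0)"
        using sep_holomorphic_slice(2)[OF f e(2), of 0 j] e(1) by simp
      moreover have "f (z + axis j \<zeta> + axis i (q n) + axis j x) = f (z + axis j (x + \<zeta>) + axis i (q n))" for x
        by (simp add: axis_add algebra_simps)
      ultimately have "((\<lambda>x. f (z + axis j x + axis i (q n))) has_field_derivative
          wirt j f (z + axis j \<zeta> + axis i (q n))) (at \<zeta>)"
        using DERIV_shift[of "\<lambda>x. f (z + axis j x + axis i (q n))" _ 0 \<zeta>] by simp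
      moreover have "((\<lambda>x. f (z + axis j x)) has_field_derivative wirt j f (z + axis j \<zeta>)) (at \<zeta>)"
        using sep_holomorphic_slice(2)[OF f r(3)[of z] that] r(1) by simp
      ultimately show ?thesis
        unfolding Q_def by (intro DERIV_cdivide DERIV_diff)
    qed
    have ul: "uniform_limit (cball x d) ?G ?g sequentially" if "cball x d \<subseteq> ball 0 r" for x d
    proof (rule uniform_limitI)
      fix e :: real assume "e > 0"
      have "(\<lambda>n. 18 * B / r\<^sup>2 * cmod (q n)) \<longlonglongrightarrow> 0"
        using tendsto_mult_right_zero[OF tendsto_norm_zero[OF qlim]] by blast
      then have "\<forall>\<^sub>F n in sequentially. 18 * B / r\<^sup>2 * cmod (q n) < e"
        using \<open>e > 0\<close> by (rule order_tendstoD)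
      then show "\<forall>\<^sub>F n in sequentially. \<forall>x\<in>cball x d. dist (?G n x) (?g x) < e"
      proof eventually_elim
        case (elim n)
          show ?case
          proof
            fix y assume "y \<in> cball x d"
            then have "y \<in> ball 0 r" using that by blast
            from Qbd[OF inb[OF this], of n] elim show "dist (?G n y) (?g y) < e"
              by (simp add: dist_norm)
          qed
      qed
    qed
    obtain g' where g': "\<forall>x\<in>ball 0 r. (?g has_field_derivative g' x) (at x) \<and>
        ((\<lambda>n. (wirt j f (z + axis j x + axis i (q n)) - wirt j f (z + axis j x)) / q n) \<longlongrightarrow> g' x) sequentially"
    proof (atomize_elim, rule has_complex_derivative_uniform_sequence[where f="?G"])
      show "\<exists>d>0. cball x d \<subseteq> ball 0 r \<and> uniform_limit (cball x d) ?G ?g sequentially"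
        if "x \<in> ball 0 r" for x
        using ul that open_contains_cball_eq[of "ball 0 r"] by (metis open_ball)
    qed (use der in auto)
    then have "(?g has_field_derivative g' 0) (at 0) \<and>
        ((\<lambda>n. (wirt j f (z + axis i (q n)) - wirt j f z) / q n) \<longlongrightarrow> g' 0) sequentially"
      using bspec[OF g', of 0] r(1) by simp
    then show ?thesis using q0 qlim by blast
  qed
  have fd: "(\<lambda>\<zeta>. wirt i f (z + axis j \<zeta>)) field_differentiable at 0" if "z \<in> S" for z i j
    using main[OF that, of i j] by (auto simp: field_differentiable_def)
  show "sep_holomorphic S (wirt i f)"
    unfolding sep_holomorphic_def
  proof (intro ballI conjI allI)
    fix z assume z: "z \<in> S"
    obtain r B where r: "0 < r" "0 \<le> B" "\<And>w. w \<in> ball z r \<Longrightarrow> ball w r \<subseteq> S"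
      "\<And>w u. w \<in> ball z r \<Longrightarrow> u \<in> ball w r \<Longrightarrow> cmod (f u) \<le> B"
      using sep_holomorphic_ball[OF f S z] by metis
    have "cmod (wirt i f w) \<le> 3 * B / r" if "w \<in> ball z r" for w
      using sep_holomorphic_taylor(2)[OF f r(3)[OF that] r(1) r(4)[OF that], of 0 i] r(1) by simp
    then show "\<exists>r>0. \<exists>B. \<forall>w\<in>ball z r. cmod (wirt i f w) \<le> B" using r(1) by blast
  qed (use fd in blast)
  show "wirt j (wirt i f) z = wirt i (wirt j f) z" if z: "z \<in> S"
  proof -
    obtain q D where q: "\<And>n. q n \<noteq> 0" "q \<longlonglongrightarrow> 0"
       "((\<lambda>\<zeta>. wirt i f (z + axis j \<zeta>)) has_field_derivative D) (at 0)"
       "(\<lambda>n. (wirt j f (z + axis i (q n)) - wirt j f z) / q n) \<longlonglongrightarrow> D"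
      using main[OF z, of i j] by blast
    have "((\<lambda>\<zeta>. wirt j f (z + axis i \<zeta>)) has_field_derivative wirt i (wirt j f) z) (at 0)"
      using fd[OF z] wirt_eq_deriv field_differentiable_derivI by metis
    then have "((\<lambda>h. (wirt j f (z + axis i h) - wirt j f z) / h) \<longlongrightarrow> wirt i (wirt j f) z) (at 0)"
      by (simp add: DERIV_def)
    then have "(\<lambda>n. (wirt j f (z + axis i (q n)) - wirt j f z) / q n) \<longlonglongrightarrow> wirt i (wirt j f) z"
      by (rule filterlim_compose) (use q in \<open>auto simp: filterlim_at\<close>)
    then show ?thesis
      using LIMSEQ_unique q(4) wirt_of_slice(1)[OF q(3)] by metis
  qed
qed

text \<open>
  Taylor's formula with a quadratic remainder, one coordinate at a time.  Quantifying over all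
  \<open>f\<close> lets the induction use the hypothesis for a partial derivative of \<open>f\<close> too.
\<close>

lemma sep_holomorphic_quadratic_remainder:
  assumes S: "open S" and z: "z \<in> S" and "finite A"
  shows "\<forall>f. sep_holomorphic S f \<longrightarrow> (\<exists>C\<ge>0. \<exists>\<delta>>0. \<forall>v. (\<forall>i. i \<notin> A \<longrightarrow> v $ i = 0) \<longrightarrow> norm v < \<delta> \<longrightarrow>
    cmod (f (z + v) - f z - (\<Sum>i\<in>A. wirt i f z * v $ i)) \<le> C * (norm v)\<^sup>2)"
  using \<open>finite A\<close>
proof induction
  case empty
  show ?case
  proof (intro allI impI exI[of _ "1::real"] conjI)
    fix f :: "'a cvec \<Rightarrow> complex" and v :: "'a cvec"
    assume "\<forall>i. i \<notin> {} \<longrightarrow> v $ i = 0"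
    then have "v = 0" by (simp add: vec_eq_iff)
    then show "cmod (f (z + v) - f z - (\<Sum>i\<in>{}. wirt i f z * v $ i)) \<le> 1 * (norm v)\<^sup>2" by simp
  qed simp_all
next
  case (insert k A)
  show ?case
  proof (intro allI impI)
    fix f assume f: "sep_holomorphic S f"
    obtain C1 \<delta>1 where 1: "C1 \<ge> 0" "\<delta>1 > 0" "\<And>v. (\<forall>i. i \<notin> A \<longrightarrow> v $ i = 0) \<Longrightarrow> norm v < \<delta>1 \<Longrightarrow>
      cmod (f (z + v) - f z - (\<Sum>i\<in>A. wirt i f z * v $ i)) \<le> C1 * (norm v)\<^sup>2"
      using insert.IH f by blast
    obtain C2 \<delta>2 where 2: "C2 \<ge> 0" "\<delta>2 > 0" "\<And>v. (\<forall>i. i \<notin> A \<longrightarrow> v $ i = 0) \<Longrightarrow> norm v < \<delta>2 \<Longrightarrow>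
      cmod (wirt k f (z + v) - wirt k f z - (\<Sum>i\<in>A. wirt i (wirt k f) z * v $ i)) \<le> C2 * (norm v)\<^sup>2"
      using insert.IH sep_holomorphic_wirt(1)[OF f S] by blast
    obtain r B where r: "0 < r" "0 \<le> B" "\<And>w. w \<in> ball z r \<Longrightarrow> ball w r \<subseteq> S"
      "\<And>w u. w \<in> ball z r \<Longrightarrow> u \<in> ball w r \<Longrightarrow> cmod (f u) \<le> B"
      using sep_holomorphic_ball[OF f S z] by metis
    define C3 where "C3 = (\<Sum>i\<in>A. cmod (wirt i (wirt k f) z))"
    define \<delta> where "\<delta> = min (min \<delta>1 \<delta>2) (min (r/3) 1)"
    have C3: "C3 \<ge> 0" by (simp add: C3_def sum_nonneg)
    show "\<exists>C\<ge>0. \<exists>\<delta>>0. \<forall>v. (\<forall>i. i \<notin> insert k A \<longrightarrow> v $ i = 0) \<longrightarrow> norm v < \<delta> \<longrightarrow>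
      cmod (f (z + v) - f z - (\<Sum>i\<in>insert k A. wirt i f z * v $ i)) \<le> C * (norm v)\<^sup>2"
    proof (rule exI[of _ "18 * B / r\<^sup>2 + C1 + (C2 + C3)"], intro conjI exI[of _ \<delta>] allI impI)
      show "18 * B / r\<^sup>2 + C1 + (C2 + C3) \<ge> 0" using r 1 2 C3 by simp
      show "\<delta> > 0" using 1 2 r by (simp add: \<delta>_def)
      fix v :: "'a cvec" assume v: "\<forall>i. i \<notin> insert k A \<longrightarrow> v $ i = 0" "norm v < \<delta>"
      define u where "u = v - axis k (v $ k)"
      have uv: "z + v = z + u + axis k (v $ k)" by (simp add: u_def)
      have uA: "\<forall>i. i \<notin> A \<longrightarrow> u $ i = 0" using v(1) by (auto simp: u_def axis_def)
      have vk: "cmod (v $ k) \<le> norm v" by (rule Finite_Cartesian_Product.norm_nth_le)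
      have nu: "norm u \<le> norm v"
        by (rule norm_le_componentwise_cart) (auto simp: u_def axis_def)
      have ub: "z + u \<in> ball z r" using nu v(2) r(1) by (simp add: dist_norm \<delta>_def)
      have a: "cmod (f (z + v) - f (z + u) - v $ k * wirt k f (z + u)) \<le> 18 * B / r\<^sup>2 * (norm v)\<^sup>2"
      proof -
        have "cmod (f (z + v) - f (z + u) - v $ k * wirt k f (z + u)) \<le> 18 * B / r\<^sup>2 * (cmod (v $ k))\<^sup>2"
          unfolding uv using vk v(2)
          by (intro sep_holomorphic_taylor(1)[OF f r(3)[OF ub] r(1) r(4)[OF ub]]) (auto simp: \<delta>_def)
        also have "\<dots> \<le> 18 * B / r\<^sup>2 * (norm v)\<^sup>2"
          using vk r by (intro mult_left_mono power_mono) auto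
        finally show ?thesis .
      qed
      have b: "cmod (f (z + u) - f z - (\<Sum>i\<in>A. wirt i f z * u $ i)) \<le> C1 * (norm v)\<^sup>2"
      proof -
        have "cmod (f (z + u) - f z - (\<Sum>i\<in>A. wirt i f z * u $ i)) \<le> C1 * (norm u)\<^sup>2"
          using 1(3)[OF uA] nu v(2) by (simp add: \<delta>_def)
        also have "\<dots> \<le> C1 * (norm v)\<^sup>2"
          using nu 1(1) by (intro mult_left_mono power_mono) auto
        finally show ?thesis .
      qed
      have c: "cmod (wirt k f (z + u) - wirt k f z) \<le> (C2 + C3) * norm v"
      proof -
        have "cmod (wirt k f (z + u) - wirt k f z - (\<Sum>i\<in>A. wirt i (wirt k f) z * u $ i)) \<le> C2 * (norm u)\<^sup>2"
          using 2(3)[OF uA] nu v(2) by (simp add: \<delta>_def)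
        also have "\<dots> \<le> C2 * norm v"
        proof (rule mult_left_mono[OF _ 2(1)])
          have "norm u * norm u \<le> norm v * 1"
            using nu v(2) by (intro mult_mono) (auto simp: \<delta>_def)
          then show "(norm u)\<^sup>2 \<le> norm v" by (simp add: power2_eq_square)
        qed
        finally have "cmod (wirt k f (z + u) - wirt k f z - (\<Sum>i\<in>A. wirt i (wirt k f) z * u $ i)) \<le> C2 * norm v" .
        moreover have "cmod (\<Sum>i\<in>A. wirt i (wirt k f) z * u $ i) \<le> C3 * norm v"
          unfolding C3_def sum_distrib_right
        proof (rule sum_norm_le)
          fix i
          have "cmod (u $ i) \<le> norm v"
            using Finite_Cartesian_Product.norm_nth_le[of u i] nu by linarith
          then show "cmod (wirt i (wirt k f) z * u $ i) \<le> cmod (wirt i (wirt k f) z) * norm v"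
            by (simp add: norm_mult mult_left_mono)
        qed
        ultimately show ?thesis
          using norm_triangle_sub[of "wirt k f (z + u) - wirt k f z" "\<Sum>i\<in>A. wirt i (wirt k f) z * u $ i"]
          by (simp add: distrib_right)
      qed
      have d: "cmod (v $ k * (wirt k f (z + u) - wirt k f z)) \<le> (C2 + C3) * (norm v)\<^sup>2"
      proof -
        have "cmod (v $ k) * cmod (wirt k f (z + u) - wirt k f z) \<le> norm v * ((C2 + C3) * norm v)"
          using vk c by (intro mult_mono) auto
        then show ?thesis by (simp add: norm_mult power2_eq_square mult.left_commute)
      qed
      have "f (z + v) - f z - (\<Sum>i\<in>insert k A. wirt i f z * v $ i) =
         (f (z + v) - f (z + u) - v $ k * wirt k f (z + u)) +
         (f (z + u) - f z - (\<Sum>i\<in>A. wirt i f z * u $ i)) +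
         v $ k * (wirt k f (z + u) - wirt k f z)"
      proof -
        have "(\<Sum>i\<in>A. wirt i f z * v $ i) = (\<Sum>i\<in>A. wirt i f z * u $ i)"
          using insert.hyps by (intro sum.cong) (auto simp: u_def axis_def)
        then show ?thesis using insert.hyps by (simp add: algebra_simps)
      qed
      then have "cmod (f (z + v) - f z - (\<Sum>i\<in>insert k A. wirt i f z * v $ i)) \<le>
         cmod (f (z + v) - f (z + u) - v $ k * wirt k f (z + u)) +
         cmod (f (z + u) - f z - (\<Sum>i\<in>A. wirt i f z * u $ i)) +
         cmod (v $ k * (wirt k f (z + u) - wirt k f z))"
        by (simp only:) (rule order_trans[OF norm_triangle_ineq add_right_mono[OF norm_triangle_ineq]])
      then show "cmod (f (z + v) - f z - (\<Sum>i\<in>insert k A. wirt i f z * v $ i))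
          \<le> (18 * B / r\<^sup>2 + C1 + (C2 + C3)) * (norm v)\<^sup>2"
        using a b d unfolding distrib_right by linarith
    qed
  qed
qed

lemma has_derivative_if_quadratic:
  fixes f :: "'a::real_normed_vector \<Rightarrow> 'b::real_normed_vector"
  assumes L: "bounded_linear L" and C: "C \<ge> 0" "\<delta> > 0"
    "\<And>v. norm v < \<delta> \<Longrightarrow> norm (f (z + v) - f z - L v) \<le> C * (norm v)\<^sup>2"
  shows "(f has_derivative L) (at z)"
  unfolding has_derivative_at
proof
  show "bounded_linear L" by fact
  show "(\<lambda>h. norm (f (z + h) - f z - L h) / norm h) \<midarrow>0\<rightarrow> 0"
  proof (rule Lim_null_comparison)
    show "\<forall>\<^sub>F h in at 0. norm (norm (f (z + h) - f z - L h) / norm h) \<le> C * norm h"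
      unfolding eventually_at
    proof (intro exI[of _ \<delta>] conjI ballI impI)
      fix h assume "h \<noteq> 0 \<and> dist h (0::'a) < \<delta>"
      then show "norm (norm (f (z + h) - f z - L h) / norm h) \<le> C * norm h"
        using C(3)[of h] by (simp add: divide_le_eq power2_eq_square algebra_simps)
    qed (rule C)
    show "((\<lambda>h. C * norm h) \<longlongrightarrow> 0) (at 0)"
      by (intro tendsto_mult_right_zero tendsto_norm_zero) simp
  qed
qed

lemma bounded_linear_cvec: "bounded_linear (\<lambda>v::'m::finite cvec. \<Sum>i\<in>UNIV. c i * v $ i)"
  by (intro bounded_linear_sum bounded_linear_const_mult bounded_linear_vec_nth)

text \<open>The quadratic remainder identifies the linear term as the Frechet derivative.\<close>

lemma osgood:
  assumes "open S" "sep_holomorphic S f" "z \<in> S"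
  shows "(f has_derivative (\<lambda>v. \<Sum>i\<in>UNIV. wirt i f z * v $ i)) (at z)"
proof -
  obtain C \<delta> where C: "C \<ge> 0" "\<delta> > 0" "\<And>v. norm v < \<delta> \<Longrightarrow>
      cmod (f (z + v) - f z - (\<Sum>i\<in>UNIV. wirt i f z * v $ i)) \<le> C * (norm v)\<^sup>2"
    using sep_holomorphic_quadratic_remainder[OF assms(1,3) finite[of UNIV]] assms(2) by auto
  show ?thesis
    by (rule has_derivative_if_quadratic[OF bounded_linear_cvec C])
qed

lemma mholomorphic_on_derivative:
  assumes f: "mholomorphic_on S f" and S: "open S" and z: "z \<in> S"
  shows "(f has_derivative (\<lambda>v. \<Sum>i\<in>UNIV. wirt i f z * v $ i)) (at z)"
    and "((\<lambda>\<zeta>. f (z + axis i \<zeta>)) has_field_derivative wirt i f z) (at 0)"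
    and "wirt_bar i f z = 0"
proof -
  obtain c :: "'a cvec" where c: "(f has_derivative (\<lambda>v. \<Sum>i\<in>UNIV. c $ i * v $ i)) (at z)"
    using f z S unfolding mholomorphic_on_def by (metis at_within_open)
  have s: "((\<lambda>\<zeta>. f (z + axis i \<zeta>)) has_field_derivative c $ i) (at 0)" for i
  proof -
    have "((\<lambda>\<zeta>. z + axis i \<zeta>) has_derivative (\<lambda>\<zeta>. axis i \<zeta>)) (at 0)"
    proof -
      have "bounded_linear (\<lambda>\<zeta>::complex. axis i \<zeta> :: 'a cvec)"
        by (rule bounded_linear_intro[where K=1]) (simp_all add: axis_add, simp add: vec_eq_iff axis_def)
      then show ?thesis
        using has_derivative_add_const[OF bounded_linear_imp_has_derivative, of "axis i" z "at 0"]
        by (simp add: add.commute)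
    qed
    moreover have "(f has_derivative (\<lambda>v. \<Sum>i\<in>UNIV. c $ i * v $ i)) (at (z + axis i 0))" using c by simp
    ultimately have "(f \<circ> (\<lambda>\<zeta>. z + axis i \<zeta>) has_derivative (\<lambda>v. \<Sum>i\<in>UNIV. c $ i * v $ i) \<circ> (\<lambda>\<zeta>. axis i \<zeta>)) (at 0)"
      by (rule diff_chain_at)
    moreover have "(\<Sum>j\<in>UNIV. c $ j * axis i x $ j) = c $ i * x" for x
      by (subst sum.remove[of _ i]) (auto simp: axis_def)
    ultimately show ?thesis
      by (simp add: o_def has_field_derivative_def)
  qed
  then show s': "((\<lambda>\<zeta>. f (z + axis i \<zeta>)) has_field_derivative wirt i f z) (at 0)"
    and "wirt_bar i f z = 0" for i
    using wirt_of_slice s by metis+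
  have "wirt i f z = c $ i" for i using wirt_of_slice(1)[OF s] .
  then show "(f has_derivative (\<lambda>v. \<Sum>i\<in>UNIV. wirt i f z * v $ i)) (at z)"
    using c by simp
qed

lemma mholomorphic_on_continuous:
  assumes "mholomorphic_on S f"
  shows "continuous_on S f"
  using assms unfolding mholomorphic_on_def continuous_on_eq_continuous_within
  by (meson has_derivative_continuous)

lemma locally_bounded_of_continuous:
  fixes f :: "'a::metric_space \<Rightarrow> complex"
  assumes "continuous (at z) f"
  shows "\<exists>r>0. \<exists>B. \<forall>w\<in>ball z r. cmod (f w) \<le> B"
proof -
  obtain r where r: "r > 0" "\<And>w. dist w z < r \<Longrightarrow> dist (f w) (f z) < 1"
    using assms[unfolded continuous_at_eps_delta] by (metis zero_less_one)
  have "cmod (f w) \<le> cmod (f z) + 1" if "w \<in> ball z r" for w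
    using r(2)[of w] that by (smt (verit) dist_commute dist_norm mem_ball norm_triangle_sub)
  then show ?thesis using r(1) by blast
qed

lemma mholomorphic_on_iff_sep:
  assumes S: "open S"
  shows "mholomorphic_on S f \<longleftrightarrow> sep_holomorphic S f"
proof
  assume f: "mholomorphic_on S f"
  show "sep_holomorphic S f"
    unfolding sep_holomorphic_def
  proof (intro ballI conjI allI)
    fix z assume z: "z \<in> S"
    show "(\<lambda>\<zeta>. f (z + axis i \<zeta>)) field_differentiable at 0" for i
      using mholomorphic_on_derivative(2)[OF f S z] by (auto simp: field_differentiable_def)
    show "\<exists>r>0. \<exists>B. \<forall>w\<in>ball z r. cmod (f w) \<le> B"
      using mholomorphic_on_continuous[OF f] S z
      by (intro locally_bounded_of_continuous) (simp add: continuous_on_eq_continuous_at)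
  qed
next
  assume f: "sep_holomorphic S f"
  show "mholomorphic_on S f"
    unfolding mholomorphic_on_def
  proof
    fix z assume z: "z \<in> S"
    have "(f has_derivative (\<lambda>v. \<Sum>i\<in>UNIV. (\<chi> i. wirt i f z) $ i * v $ i)) (at z within S)"
      using osgood[OF S f z] has_derivative_at_withinI by simp
    then show "\<exists>c::'a cvec. (f has_derivative (\<lambda>v. \<Sum>i\<in>UNIV. c $ i * v $ i)) (at z within S)"
      by blast
  qed
qed

lemma mholomorphic_on_wirt: "open S \<Longrightarrow> mholomorphic_on S f \<Longrightarrow> mholomorphic_on S (wirt i f)"
  by (simp add: mholomorphic_on_iff_sep sep_holomorphic_wirt(1))

lemma wirt_commute:
  "open S \<Longrightarrow> mholomorphic_on S f \<Longrightarrow> z \<in> S \<Longrightarrow> wirt j (wirt i f) z = wirt i (wirt j f) z"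
  by (simp add: mholomorphic_on_iff_sep sep_holomorphic_wirt(2))

section \<open>Closure properties of holomorphic functions\<close>

lemma mholomorphic_on_subset: "mholomorphic_on S f \<Longrightarrow> T \<subseteq> S \<Longrightarrow> mholomorphic_on T f"
  unfolding mholomorphic_on_def by (meson has_derivative_subset subsetD)

lemma mholomorphic_onI:
  assumes "\<And>z. z \<in> S \<Longrightarrow> (f has_derivative (\<lambda>v. \<Sum>i\<in>UNIV. c z i * v $ i)) (at z within S)"
  shows "mholomorphic_on S f"
  unfolding mholomorphic_on_def
proof
  fix z assume "z \<in> S"
  from assms[OF this] have "(f has_derivative (\<lambda>v. \<Sum>i\<in>UNIV. (\<chi> i. c z i) $ i * v $ i)) (at z within S)"
    by simp
  then show "\<exists>c::'a cvec. (f has_derivative (\<lambda>v. \<Sum>i\<in>UNIV. c $ i * v $ i)) (at z within S)" by blast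
qed

lemma mholomorphic_onD:
  assumes "mholomorphic_on S f"
  obtains c where "\<And>z. z \<in> S \<Longrightarrow> (f has_derivative (\<lambda>v. \<Sum>i\<in>UNIV. c z i * v $ i)) (at z within S)"
proof -
  from assms have "\<forall>z\<in>S. \<exists>c. (f has_derivative (\<lambda>v. \<Sum>i\<in>UNIV. c $ i * v $ i)) (at z within S)"
    unfolding mholomorphic_on_def .
  from bchoice[OF this] obtain c
    where "\<forall>z\<in>S. (f has_derivative (\<lambda>v. \<Sum>i\<in>UNIV. c z $ i * v $ i)) (at z within S)" by blast
  then show ?thesis by (intro that[of "\<lambda>z i. c z $ i"]) auto
qed

lemma mholomorphic_on_cong:
  assumes "mholomorphic_on S f" "\<And>z. z \<in> S \<Longrightarrow> f z = g z"
  shows "mholomorphic_on S g"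
proof -
  obtain c where c: "\<And>z. z \<in> S \<Longrightarrow> (f has_derivative (\<lambda>v. \<Sum>i\<in>UNIV. c z i * v $ i)) (at z within S)"
    using mholomorphic_onD[OF assms(1)] by blast
  show ?thesis
    by (rule mholomorphic_onI[of S g c], rule has_derivative_transform[OF _ _ c])
      (use assms(2) in auto)
qed

lemma mholomorphic_on_const [intro]: "mholomorphic_on S (\<lambda>z. c)"
  by (rule mholomorphic_onI[where c="\<lambda>_ _. 0"]) simp

lemma mholomorphic_on_coord [intro]: "mholomorphic_on S (\<lambda>z. z $ i)"
proof (rule mholomorphic_onI[where c="\<lambda>_ j. if j = i then 1 else 0"])
  have "((\<lambda>z. z $ i) has_derivative (\<lambda>v. v $ i)) (at z within S)" for z :: "'a cvec"
    by (rule bounded_linear_imp_has_derivative[OF bounded_linear_vec_nth])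
  moreover have "(\<lambda>v::'a cvec. \<Sum>j\<in>UNIV. (if j = i then 1 else 0) * v $ j) = (\<lambda>v. v $ i)"
    by (simp add: if_distrib[of "\<lambda>x. x * _"] cong: if_cong)
  ultimately show "((\<lambda>z. z $ i) has_derivative (\<lambda>v. \<Sum>j\<in>UNIV. (if j = i then 1 else 0) * v $ j))
      (at z within S)" for z :: "'a cvec" by simp
qed

lemma mholomorphic_on_add [intro]:
  assumes "mholomorphic_on S f" "mholomorphic_on S g"
  shows "mholomorphic_on S (\<lambda>z. f z + g z)"
proof -
  obtain c where c: "\<And>z. z \<in> S \<Longrightarrow> (f has_derivative (\<lambda>v. \<Sum>i\<in>UNIV. c z i * v $ i)) (at z within S)"
    using mholomorphic_onD[OF assms(1)] by blast
  obtain d where d: "\<And>z. z \<in> S \<Longrightarrow> (g has_derivative (\<lambda>v. \<Sum>i\<in>UNIV. d z i * v $ i)) (at z within S)"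
    using mholomorphic_onD[OF assms(2)] by blast
  show ?thesis
    by (rule mholomorphic_onI[where c="\<lambda>z i. c z i + d z i"])
      (use has_derivative_add[OF c d] in \<open>simp add: sum.distrib distrib_right\<close>)
qed

lemma mholomorphic_on_mult [intro]:
  assumes "mholomorphic_on S f" "mholomorphic_on S g"
  shows "mholomorphic_on S (\<lambda>z. f z * g z)"
proof -
  obtain c where c: "\<And>z. z \<in> S \<Longrightarrow> (f has_derivative (\<lambda>v. \<Sum>i\<in>UNIV. c z i * v $ i)) (at z within S)"
    using mholomorphic_onD[OF assms(1)] by blast
  obtain d where d: "\<And>z. z \<in> S \<Longrightarrow> (g has_derivative (\<lambda>v. \<Sum>i\<in>UNIV. d z i * v $ i)) (at z within S)"
    using mholomorphic_onD[OF assms(2)] by blast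
  show ?thesis
  proof (rule mholomorphic_onI[where c="\<lambda>z i. f z * d z i + c z i * g z"])
    fix z assume "z \<in> S"
    moreover have "(\<lambda>v::'a cvec. \<Sum>i\<in>UNIV. (f z * d z i + c z i * g z) * v $ i) =
        (\<lambda>v. f z * (\<Sum>i\<in>UNIV. d z i * v $ i) + (\<Sum>i\<in>UNIV. c z i * v $ i) * g z)"
      by (simp add: fun_eq_iff sum_distrib_left sum_distrib_right flip: sum.distrib)
        (simp add: algebra_simps)
    ultimately show "((\<lambda>z. f z * g z) has_derivative
        (\<lambda>v. \<Sum>i\<in>UNIV. (f z * d z i + c z i * g z) * v $ i)) (at z within S)"
      using has_derivative_mult[OF c d] by simp
  qed
qed

lemma mholomorphic_on_compose_field:
  assumes f: "mholomorphic_on S f"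
    and p: "\<And>z. z \<in> S \<Longrightarrow> (p has_field_derivative p' z) (at (f z))"
  shows "mholomorphic_on S (\<lambda>z. p (f z))"
proof -
  obtain c where c: "\<And>z. z \<in> S \<Longrightarrow> (f has_derivative (\<lambda>v. \<Sum>i\<in>UNIV. c z i * v $ i)) (at z within S)"
    using mholomorphic_onD[OF f] by blast
  show ?thesis
  proof (rule mholomorphic_onI[where c="\<lambda>z i. p' z * c z i"])
    fix z assume z: "z \<in> S"
    have "(p has_derivative (\<lambda>x. p' z * x)) (at (f z))"
      using p[OF z] by (simp add: has_field_derivative_def)
    from has_derivative_compose[OF c[OF z] this]
    show "((\<lambda>z. p (f z)) has_derivative (\<lambda>v. \<Sum>i\<in>UNIV. p' z * c z i * v $ i)) (at z within S)"
      by (simp add: sum_distrib_left mult.assoc)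
  qed
qed

lemma mholomorphic_on_inverse [intro]:
  assumes "mholomorphic_on S f" "\<And>z. z \<in> S \<Longrightarrow> f z \<noteq> 0"
  shows "mholomorphic_on S (\<lambda>z. inverse (f z))"
  by (rule mholomorphic_on_compose_field[OF assms(1)])
    (use assms(2) in \<open>blast intro: DERIV_inverse\<close>)

lemma mholomorphic_on_uminus [intro]: "mholomorphic_on S f \<Longrightarrow> mholomorphic_on S (\<lambda>z. - f z)"
  using mholomorphic_on_mult[OF mholomorphic_on_const[of S "-1"]] by simp

lemma mholomorphic_on_diff [intro]:
  "mholomorphic_on S f \<Longrightarrow> mholomorphic_on S g \<Longrightarrow> mholomorphic_on S (\<lambda>z. f z - g z)"
  using mholomorphic_on_add[OF _ mholomorphic_on_uminus] by simp

lemma mholomorphic_on_sum [intro]: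
  "(\<And>a. a \<in> A \<Longrightarrow> mholomorphic_on S (f a)) \<Longrightarrow> mholomorphic_on S (\<lambda>z. \<Sum>a\<in>A. f a z)"
  by (induction A rule: infinite_finite_induct) auto

lemma mholomorphic_on_prod [intro]:
  "(\<And>a. a \<in> A \<Longrightarrow> mholomorphic_on S (f a)) \<Longrightarrow> mholomorphic_on S (\<lambda>z. \<Prod>a\<in>A. f a z)"
  by (induction A rule: infinite_finite_induct) auto

lemma mholomorphic_on_compose_linear:
  fixes P :: "'n::finite cvec \<Rightarrow> 'm::finite cvec"
  assumes f: "mholomorphic_on S f" and P: "bounded_linear P"
    and Pi: "\<And>v i. P v $ i = (\<Sum>j\<in>UNIV. A i j * v $ j)"
    and T: "\<And>w. w \<in> T \<Longrightarrow> P w \<in> S"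
  shows "mholomorphic_on T (\<lambda>w. f (P w))"
proof -
  obtain c where c: "\<And>z. z \<in> S \<Longrightarrow> (f has_derivative (\<lambda>v. \<Sum>i\<in>UNIV. c z i * v $ i)) (at z within S)"
    using mholomorphic_onD[OF f] by blast
  show ?thesis
  proof (rule mholomorphic_onI[where c="\<lambda>w j. \<Sum>i\<in>UNIV. c (P w) i * A i j"])
    fix w assume w: "w \<in> T"
    have "(P has_derivative P) (at w within T)" by (rule bounded_linear_imp_has_derivative[OF P])
    from has_derivative_in_compose[OF this has_derivative_subset[OF c[OF T[OF w]], of "P ` T"]] T
    have "((\<lambda>w. f (P w)) has_derivative (\<lambda>v. \<Sum>i\<in>UNIV. c (P w) i * P v $ i)) (at w within T)" by blast
    moreover have "(\<Sum>i\<in>UNIV. c (P w) i * P v $ i) = (\<Sum>j\<in>UNIV. (\<Sum>i\<in>UNIV. c (P w) i * A i j) * v $ j)" for v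
      by (simp only: Pi sum_distrib_left sum_distrib_right mult.assoc) (rule sum.swap)
    ultimately show "((\<lambda>w. f (P w)) has_derivative
        (\<lambda>v. \<Sum>j\<in>UNIV. (\<Sum>i\<in>UNIV. c (P w) i * A i j) * v $ j)) (at w within T)" by simp
  qed
qed

text \<open>
  Uniform limits of holomorphic functions: Weierstrass' theorem applies to every coordinate slice,
  and one approximant bounds the limit locally.
\<close>

lemma fun_algebra_mholomorphic:
  assumes f: "f \<in> fun_algebra \<Omega>" and S: "open \<Omega>"
  shows "mholomorphic_on \<Omega> f"
  unfolding mholomorphic_on_iff_sep[OF S] sep_holomorphic_def
proof (intro ballI conjI allI)
  fix z i assume z: "z \<in> \<Omega>"
  have "\<exists>g. sep_holomorphic \<Omega> g \<and> (\<forall>z\<in>\<Omega>. cmod (f z - g z) < e)" if "e > 0" for e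
  proof -
    obtain g V where "open V" "closure \<Omega> \<subseteq> V" "mholomorphic_on V g"
      "\<forall>z\<in>closure \<Omega>. cmod (f z - g z) < e"
      using f \<open>e > 0\<close> unfolding fun_algebra_def by blast
    then show ?thesis
      using mholomorphic_on_iff_sep[OF S] mholomorphic_on_subset closure_subset
      by (metis order_trans subsetD)
  qed
  then obtain g where g: "\<And>e. e > 0 \<Longrightarrow> sep_holomorphic \<Omega> (g e) \<and> (\<forall>z\<in>\<Omega>. cmod (f z - g e z) < e)"
    by metis
  obtain r where r: "r > 0" "ball z r \<subseteq> \<Omega>" using S z openE by blast
  let ?e = "\<lambda>n. inverse (real (Suc n))"
  have e: "?e n > 0" for n by simp
  have "(\<lambda>\<zeta>. f (z + axis i \<zeta>)) holomorphic_on ball 0 r"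
  proof (rule holomorphic_uniform_sequence)
    show "(\<lambda>\<zeta>. g (?e n) (z + axis i \<zeta>)) holomorphic_on ball 0 r" for n
      using g[OF e] sep_holomorphic_slice(1) r(2) by blast
    show "\<exists>d>0. cball x d \<subseteq> ball 0 r \<and>
        uniform_limit (cball x d) (\<lambda>n \<zeta>. g (?e n) (z + axis i \<zeta>)) (\<lambda>\<zeta>. f (z + axis i \<zeta>)) sequentially"
      if x: "x \<in> ball 0 r" for x
    proof -
      obtain d where d: "d > 0" "cball x d \<subseteq> ball 0 r"
        using open_contains_cball[THEN iffD1, OF open_ball, of "0::complex" r] x by blast
      have "uniform_limit (cball x d) (\<lambda>n \<zeta>. g (?e n) (z + axis i \<zeta>)) (\<lambda>\<zeta>. f (z + axis i \<zeta>)) sequentially"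
      proof (rule uniform_limitI)
        fix e' :: real assume "e' > 0"
        with LIMSEQ_inverse_real_of_nat have "\<forall>\<^sub>F n in sequentially. ?e n < e'"
          by (rule order_tendstoD)
        then show "\<forall>\<^sub>F n in sequentially. \<forall>\<zeta>\<in>cball x d. dist (g (?e n) (z + axis i \<zeta>)) (f (z + axis i \<zeta>)) < e'"
        proof eventually_elim
          case (elim n)
          show ?case
          proof
            fix \<zeta> assume "\<zeta> \<in> cball x d"
            then have "\<zeta> \<in> ball 0 r" using d by blast
            then have "z + axis i \<zeta> \<in> \<Omega>" using r(2) by (auto simp: dist_norm)
            then have "cmod (f (z + axis i \<zeta>) - g (?e n) (z + axis i \<zeta>)) < ?e n" using g[OF e] by blast
            with elim show "dist (g (?e n) (z + axis i \<zeta>)) (f (z + axis i \<zeta>)) < e'"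
              by (simp add: dist_norm norm_minus_commute)
          qed
        qed
      qed
      with d show ?thesis by blast
    qed
  qed simp
  then show "(\<lambda>\<zeta>. f (z + axis i \<zeta>)) field_differentiable at 0"
    using r(1) holomorphic_on_imp_differentiable_at[of _ "ball 0 r" 0] by simp
next
  fix z assume z: "z \<in> \<Omega>"
  obtain g V where g: "open V" "closure \<Omega> \<subseteq> V" "mholomorphic_on V g"
      "\<forall>z\<in>closure \<Omega>. cmod (f z - g z) < 1"
    using f zero_less_one unfolding fun_algebra_def by blast
  have "continuous (at z) g"
    using mholomorphic_on_continuous[OF g(3)] g(1,2) z closure_subset
    by (metis continuous_on_eq_continuous_at subsetD)
  then obtain r B where r: "r > 0" "\<forall>w\<in>ball z r. cmod (g w) \<le> B"
    using locally_bounded_of_continuous by blast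
  obtain r' where r': "r' > 0" "ball z r' \<subseteq> \<Omega>" using S z openE by blast
  have "cmod (f w) \<le> B + 1" if "w \<in> ball z (min r r')" for w
  proof -
    have "w \<in> closure \<Omega>" using that r'(2) closure_subset by fastforce
    then have "cmod (f w - g w) < 1" using g(4) by blast
    moreover have "cmod (g w) \<le> B" using r(2) that by simp
    ultimately show ?thesis using norm_triangle_sub[of "f w" "g w"] by linarith
  qed
  then show "\<exists>r>0. \<exists>B. \<forall>w\<in>ball z r. cmod (f w) \<le> B"
    using r(1) r'(1) by (intro exI[of _ "min r r'"] conjI exI[of _ "B + 1"]) auto
qed

section \<open>The identity theorem\<close>

lemma mholomorphic_on_foldr_wirt:
  "open S \<Longrightarrow> mholomorphic_on S f \<Longrightarrow> mholomorphic_on S (foldr wirt is f)"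
  by (induction "is") (auto intro: mholomorphic_on_wirt)

lemma mholomorphic_line_derivative:
  assumes S: "open S" and f: "mholomorphic_on S f" and z: "z + \<zeta> *s v \<in> S"
  shows "((\<lambda>\<zeta>. f (z + \<zeta> *s v)) has_field_derivative (\<Sum>i\<in>UNIV. v $ i * wirt i f (z + \<zeta> *s v))) (at \<zeta>)"
proof -
  have bl: "bounded_linear (\<lambda>\<zeta>. \<zeta> *s v)"
    by (rule bounded_linear_intro[where K="norm v"])
      (auto simp: vec_eq_iff algebra_simps norm_vec_def L2_set_def norm_mult power_mult_distrib
        real_sqrt_mult simp flip: sum_distrib_left)
  have "((\<lambda>\<zeta>. z + \<zeta> *s v) has_derivative (\<lambda>\<zeta>. \<zeta> *s v)) (at \<zeta>)"
    using has_derivative_add_const[OF bounded_linear_imp_has_derivative[OF bl], of z "at \<zeta>"]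
    by (simp add: add.commute)
  from has_derivative_compose[OF this mholomorphic_on_derivative(1)[OF f S z]]
  have "((\<lambda>\<zeta>. f (z + \<zeta> *s v)) has_derivative (\<lambda>x. \<Sum>i\<in>UNIV. wirt i f (z + \<zeta> *s v) * (x *s v) $ i)) (at \<zeta>)" .
  moreover have "(\<lambda>x. \<Sum>i\<in>UNIV. wirt i f (z + \<zeta> *s v) * (x *s v) $ i) =
      (*) (\<Sum>i\<in>UNIV. v $ i * wirt i f (z + \<zeta> *s v))"
    by (simp add: fun_eq_iff sum_distrib_left sum_distrib_right mult_ac)
  ultimately show ?thesis by (simp add: has_field_derivative_def)
qed

text \<open>
  Only the shape of the derivatives along a complex line matters: as linear combinations of iterated
  partial derivatives they vanish at a point where all the latter vanish.
\<close>

lemma mholomorphic_line_deriv_power: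
  assumes S: "open S" and f: "mholomorphic_on S f"
    and T: "open T" "\<And>\<zeta>. \<zeta> \<in> T \<Longrightarrow> z + \<zeta> *s v \<in> S"
  shows "\<exists>L c. finite L \<and> (\<forall>\<zeta>\<in>T. (deriv ^^ n) (\<lambda>\<zeta>. f (z + \<zeta> *s v)) \<zeta> =
    (\<Sum>is\<in>L. c is * foldr wirt is f (z + \<zeta> *s v)))"
proof (induction n)
  case 0
  show ?case by (rule exI[of _ "{[]}"], rule exI[of _ "\<lambda>_. 1"]) simp
next
  case (Suc n)
  then obtain L c where L: "finite L" "\<forall>\<zeta>\<in>T. (deriv ^^ n) (\<lambda>\<zeta>. f (z + \<zeta> *s v)) \<zeta> =
    (\<Sum>is\<in>L. c is * foldr wirt is f (z + \<zeta> *s v))" by blast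
  have "(deriv ^^ Suc n) (\<lambda>\<zeta>. f (z + \<zeta> *s v)) \<zeta> =
      (\<Sum>is\<in>(\<lambda>(is, i). i # is) ` (L \<times> UNIV). (c (tl is) * v $ hd is) * foldr wirt is f (z + \<zeta> *s v))"
    if "\<zeta> \<in> T" for \<zeta>
  proof -
    have "((\<lambda>\<zeta>. \<Sum>is\<in>L. c is * foldr wirt is f (z + \<zeta> *s v)) has_field_derivative
        (\<Sum>is\<in>L. c is * (\<Sum>i\<in>UNIV. v $ i * wirt i (foldr wirt is f) (z + \<zeta> *s v)))) (at \<zeta>)"
      by (intro DERIV_sum DERIV_cmult mholomorphic_line_derivative[OF S] mholomorphic_on_foldr_wirt S f T(2) that)
    then have "((deriv ^^ n) (\<lambda>\<zeta>. f (z + \<zeta> *s v)) has_field_derivative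
        (\<Sum>is\<in>L. c is * (\<Sum>i\<in>UNIV. v $ i * wirt i (foldr wirt is f) (z + \<zeta> *s v)))) (at \<zeta>)"
      by (rule DERIV_cong_ev[THEN iffD2, rotated -1, OF _ refl _ refl])
        (use eventually_nhds_in_open[OF T(1) that] L(2) in \<open>auto elim!: eventually_mono\<close>)
    then have "(deriv ^^ Suc n) (\<lambda>\<zeta>. f (z + \<zeta> *s v)) \<zeta> =
        (\<Sum>is\<in>L. c is * (\<Sum>i\<in>UNIV. v $ i * wirt i (foldr wirt is f) (z + \<zeta> *s v)))"
      by (simp add: DERIV_imp_deriv)
    also have "\<dots> = (\<Sum>(is, i)\<in>L \<times> UNIV. c is * (v $ i * wirt i (foldr wirt is f) (z + \<zeta> *s v)))"
      by (simp add: sum_distrib_left sum.cartesian_product)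
    also have "\<dots> = (\<Sum>is\<in>(\<lambda>(is, i). i # is) ` (L \<times> UNIV). (c (tl is) * v $ hd is) * foldr wirt is f (z + \<zeta> *s v))"
      by (subst sum.reindex) (auto simp: inj_on_def mult.assoc intro!: sum.cong)
    finally show ?thesis .
  qed
  then show ?case
    by (intro exI[of _ "(\<lambda>(is, i). i # is) ` (L \<times> UNIV)"] exI[of _ "\<lambda>is. c (tl is) * v $ hd is"])
      (use L(1) in auto)
qed

text \<open>
  Where all partial derivatives vanish, the one-variable identity theorem on complex lines makes
  \<open>f\<close> vanish on a whole ball.  So the set of these points is open in \<open>S\<close>, and it is closed in \<open>S\<close> by
  continuity.
\<close>

lemma mholomorphic_identity:
  assumes S: "open S" "connected S" and f: "mholomorphic_on S f"
    and z: "z \<in> S" "\<And>is. foldr wirt is f z = 0" and w: "w \<in> S"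
  shows "f w = 0"
proof -
  define Z where "Z = {x \<in> S. \<forall>is. foldr wirt is f x = 0}"
  have ball: "f y = 0" if "x \<in> Z" "ball x r \<subseteq> S" "y \<in> ball x r" for x y r
  proof -
    define v where "v = y - x"
    have nv: "norm (\<zeta> *s v) = cmod \<zeta> * norm v" for \<zeta>
      by (simp add: norm_vec_def L2_set_def norm_mult power_mult_distrib real_sqrt_mult flip: sum_distrib_left)
    define T where "T = {\<zeta>. cmod \<zeta> * norm v < r}"
    have T: "open T" unfolding T_def by (intro open_Collect_less continuous_intros)
    have cT: "connected T"
    proof (rule convex_connected)
      show "convex T"
      proof (cases "v = 0")
        case True then show ?thesis by (cases "0 < r") (auto simp: T_def)
      next
        case False
        then have "T = ball 0 (r / norm v)" by (auto simp: T_def field_simps)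
        then show ?thesis by simp
      qed
    qed
    have sub: "x + \<zeta> *s v \<in> S" if "\<zeta> \<in> T" for \<zeta>
      using that \<open>ball x r \<subseteq> S\<close> nv by (auto simp: T_def dist_norm)
    have hol: "(\<lambda>\<zeta>. f (x + \<zeta> *s v)) holomorphic_on T"
      using mholomorphic_line_derivative[OF S(1) f sub] T by (auto simp: holomorphic_on_open)
    have "r > 0" using that(3) by (metis ball_eq_empty empty_iff not_le)
    then have T01: "0 \<in> T" "1 \<in> T" using that(3) by (auto simp: T_def v_def dist_norm norm_minus_commute)
    have "(deriv ^^ n) (\<lambda>\<zeta>. f (x + \<zeta> *s v)) 0 = 0" for n
    proof -
      obtain L c where "(deriv ^^ n) (\<lambda>\<zeta>. f (x + \<zeta> *s v)) 0 = (\<Sum>is\<in>L. c is * foldr wirt is f (x + 0 *s v))"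
        using mholomorphic_line_deriv_power[OF S(1) f T sub, of n] T01 by blast
      also have "\<dots> = 0" using \<open>x \<in> Z\<close> by (intro sum.neutral) (auto simp: Z_def)
      finally show ?thesis .
    qed
    from holomorphic_fun_eq_0_on_connected[OF hol T cT this T01]
    show "f y = 0" by (simp add: v_def)
  qed
  have cong: "foldr wirt is f x = 0" if B: "\<And>y. y \<in> B \<Longrightarrow> f y = 0" "open B" "x \<in> B" for "is" B x
    using B(3)
  proof (induction "is" arbitrary: x)
    case (Cons i "is")
    obtain e where e: "e > 0" "ball x e \<subseteq> B" using Cons.prems B(2) openE by blast
    have "\<forall>\<^sub>F \<zeta> in nhds 0. foldr wirt is f (x + axis i \<zeta>) = 0"
      unfolding eventually_nhds_metric
      by (rule exI[of _ e]) (use e Cons.IH in \<open>auto simp: dist_norm subset_iff\<close>)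
    then have "((\<lambda>\<zeta>. foldr wirt is f (x + axis i \<zeta>)) has_field_derivative 0) (at 0)"
      by (subst DERIV_cong_ev[OF refl _ refl, where g="\<lambda>_. 0"]) auto
    then show ?case using wirt_of_slice(1) by simp
  qed (use B in simp)
  have "openin (top_of_set S) Z"
  proof -
    have "\<exists>e>0. ball x e \<subseteq> Z" if x: "x \<in> Z" for x
    proof -
      have "x \<in> S" using x by (simp add: Z_def)
      then obtain e where e: "e > 0" "ball x e \<subseteq> S" using S(1) openE by blast
      have "foldr wirt is f y = 0" if "y \<in> ball x e" for y "is"
        by (rule cong[of "ball x e"]) (use ball[OF x e(2)] that in auto)
      with e show ?thesis unfolding Z_def by blast
    qed
    then have "open Z" by (simp add: open_contains_ball)
    then show ?thesis by (simp add: openin_open_eq S(1)) (auto simp: Z_def)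
  qed
  moreover have "closedin (top_of_set S) Z"
  proof -
    have "closedin (top_of_set S) (S \<inter> foldr wirt is f -` {0})" for "is"
      by (rule continuous_closedin_preimage[OF
            mholomorphic_on_continuous[OF mholomorphic_on_foldr_wirt[OF S(1) f]]]) simp
    then have "closedin (top_of_set S) (\<Inter>is\<in>UNIV. S \<inter> foldr wirt is f -` {0})"
      by (intro closedin_Inter) auto
    moreover have "(\<Inter>is\<in>UNIV. S \<inter> foldr wirt is f -` {0}) = Z" by (auto simp: Z_def)
    ultimately show ?thesis by simp
  qed
  moreover have "z \<in> Z" using z by (auto simp: Z_def)
  ultimately have "Z = S" using S(2) unfolding connected_clopen by blast
  then have "w \<in> Z" using w by simp
  then show ?thesis unfolding Z_def by (auto dest: spec[of _ "[]"])
qed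

section \<open>Doubling the variables\<close>

text \<open>
  A pair of vectors over \<open>'m\<close> is a vector over \<open>'m + 'm\<close>, so functions of twice as many variables
  are covered by the same notion of holomorphy.
\<close>

definition cpair :: "'m::finite cvec \<Rightarrow> 'm cvec \<Rightarrow> ('m + 'm) cvec" where
  "cpair w v = (\<chi> k. case k of Inl i \<Rightarrow> w $ i | Inr i \<Rightarrow> v $ i)"

definition lft :: "('m + 'm) cvec \<Rightarrow> 'm::finite cvec" where "lft p = (\<chi> i. p $ Inl i)"
definition rgt :: "('m + 'm) cvec \<Rightarrow> 'm::finite cvec" where "rgt p = (\<chi> i. p $ Inr i)"

lemma cpair_nth [simp]: "cpair w v $ Inl i = w $ i" "cpair w v $ Inr i = v $ i"
  by (simp_all add: cpair_def)

lemma lft_rgt_cpair [simp]: "lft (cpair w v) = w" "rgt (cpair w v) = v" "cpair (lft p) (rgt p) = p"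
  by (simp_all add: lft_def rgt_def cpair_def vec_eq_iff split: sum.split)

lemma lft_rgt_axis [simp]:
  "lft (axis (Inl i) x) = axis i x" "rgt (axis (Inl i) x) = 0"
  "lft (axis (Inr i) x) = 0" "rgt (axis (Inr i) x) = axis i x"
  by (simp_all add: lft_def rgt_def axis_def vec_eq_iff)

lemma lft_rgt_add [simp]: "lft (p + q) = lft p + lft q" "rgt (p + q) = rgt p + rgt q"
  by (simp_all add: lft_def rgt_def vec_eq_iff)

lemma vcnj_simps [simp]:
  "vcnj (vcnj z) = z" "vcnj (w + z) = vcnj w + vcnj z" "vcnj 0 = 0" "vcnj (axis i x) = axis i (cnj x)"
  "vcnj z $ i = cnj (z $ i)"
  by (simp_all add: vcnj_def vec_eq_iff axis_def)

lemma vcnj_image_iff: "w \<in> vcnj ` S \<longleftrightarrow> vcnj w \<in> S"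
  by (metis image_eqI imageE vcnj_simps(1))

lemma sum_UNIV_sum:
  "(\<Sum>k\<in>(UNIV :: ('a::finite + 'b::finite) set). f k) = (\<Sum>i\<in>UNIV. f (Inl i)) + (\<Sum>i\<in>UNIV. f (Inr i))"
  by (simp add: sum.Plus flip: UNIV_Plus_UNIV)

lemma bounded_linear_componentwise:
  fixes P :: "'a::real_normed_vector \<Rightarrow> 'n::finite cvec"
  assumes "\<And>i. bounded_linear (\<lambda>v. P v $ i)"
  shows "bounded_linear P"
proof -
  have eq: "P = (\<lambda>v. \<Sum>i\<in>UNIV. axis i (P v $ i))"
    by (simp add: fun_eq_iff vec_eq_iff axis_def sum.delta)
  have bl: "bounded_linear (\<lambda>v. axis i (P v $ i) :: 'n cvec)" for i
  proof -
    have "bounded_linear (\<lambda>\<zeta>::complex. axis i \<zeta> :: 'n cvec)"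
      by (rule bounded_linear_intro[where K=1]) (simp_all add: axis_add, simp add: vec_eq_iff axis_def)
    from bounded_linear_compose[OF this assms] show ?thesis .
  qed
  show ?thesis by (subst eq) (rule bounded_linear_sum[OF bl])
qed

lemma bounded_linear_vcnj: "bounded_linear vcnj"
  by (rule bounded_linear_componentwise)
    (simp add: bounded_linear_compose[OF bounded_linear_cnj bounded_linear_vec_nth])

lemma bounded_linear_lft: "bounded_linear lft" and bounded_linear_rgt: "bounded_linear rgt"
  by (rule bounded_linear_componentwise, simp add: lft_def rgt_def bounded_linear_vec_nth)+

lemma bounded_linear_antidiagonal: "bounded_linear (\<lambda>v. cpair v (vcnj v))"
proof (rule bounded_linear_componentwise)
  fix k :: "'a + 'a"
  show "bounded_linear (\<lambda>v. cpair v (vcnj v) $ k)"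
    by (cases k) (simp_all add: bounded_linear_vec_nth bounded_linear_compose[OF bounded_linear_cnj bounded_linear_vec_nth])
qed

lemma open_vcnj: "open S \<Longrightarrow> open (vcnj ` S)"
proof -
  assume "open S"
  have "vcnj ` S = vcnj -` S" by (auto simp: vcnj_image_iff)
  with open_vimage[OF \<open>open S\<close> linear_continuous_on[OF bounded_linear_vcnj]]
  show "open (vcnj ` S)" by simp
qed

section \<open>Derivatives along words of directions\<close>

primrec ddir :: "'m::finite direction \<Rightarrow> ('m cvec \<Rightarrow> complex) \<Rightarrow> 'm cvec \<Rightarrow> complex" where
  "ddir (Hol i) = wirt i"
| "ddir (Anti i) = wirt_bar i"

definition derivs :: "'m::finite direction list \<Rightarrow> ('m cvec \<Rightarrow> complex) \<Rightarrow> 'm cvec \<Rightarrow> complex" where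
  "derivs ws = foldr ddir ws"

lemma derivs_simps [simp]: "derivs [] f = f" "derivs (x # ws) f = ddir x (derivs ws f)"
  "derivs (ws @ vs) f = derivs ws (derivs vs f)"
  by (simp_all add: derivs_def)

lemma wirt_of_has_derivative:
  assumes "(f has_derivative L) (at z)"
  shows "wirt i f z = (L (axis i 1) - \<i> * L (axis i \<i>)) / 2"
    and "wirt_bar i f z = (L (axis i 1) + \<i> * L (axis i \<i>)) / 2"
proof -
  have L: "bounded_linear L" using assms by (rule has_derivative_bounded_linear)
  have "vector_derivative (\<lambda>t::real. f (z + axis i (of_real t * c))) (at 0) = L (axis i c)" for c
  proof (rule vector_derivative_at)
    have "bounded_linear (\<lambda>t::real. axis i (of_real t * c) :: 'a cvec)"
    proof (rule bounded_linear_componentwise)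
      show "bounded_linear (\<lambda>t. axis i (of_real t * c) $ j :: complex)" for j
        by (cases "j = i")
          (simp_all add: axis_def bounded_linear_mult_const[OF bounded_linear_of_real])
    qed
    from has_derivative_add_const[OF bounded_linear_imp_has_derivative[OF this], of z "at 0"]
    have "((\<lambda>t::real. z + axis i (of_real t * c)) has_derivative (\<lambda>t. axis i (of_real t * c))) (at 0)"
      by (simp add: add.commute)
    moreover have "(f has_derivative L) (at (z + axis i (of_real 0 * c)))" using assms by simp
    ultimately have "((\<lambda>t::real. f (z + axis i (of_real t * c))) has_derivative
        (\<lambda>t. L (axis i (of_real t * c)))) (at 0)"
      by (rule has_derivative_compose)
    moreover have "axis i (of_real t * c) = t *\<^sub>R axis i c" for t
      unfolding vec_eq_iff vector_scaleR_component by (simp add: axis_def scaleR_conv_of_real)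
    ultimately show "((\<lambda>t::real. f (z + axis i (of_real t * c))) has_vector_derivative L (axis i c)) (at 0)"
      by (simp add: has_vector_derivative_def linear_simps(5)[OF L])
  qed
  from this[of 1] this[of \<i>]
  show "wirt i f z = (L (axis i 1) - \<i> * L (axis i \<i>)) / 2"
    and "wirt_bar i f z = (L (axis i 1) + \<i> * L (axis i \<i>)) / 2"
    by (simp_all add: wirt_def wirt_bar_def mult.commute)
qed

lemma ddir_cong:
  assumes S: "open S" and fg: "\<And>w. w \<in> S \<Longrightarrow> f w = g w" and z: "z \<in> S"
  shows "ddir x f z = ddir x g z"
proof -
  obtain e where e: "e > 0" "ball z e \<subseteq> S" using S z openE by blast
  have ev: "\<forall>\<^sub>F t in nhds 0. f (z + axis i (of_real t * c)) = g (z + axis i (of_real t * c))"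
    if "cmod c = 1" for c i
    unfolding eventually_nhds_metric
  proof (intro exI[of _ e] conjI allI impI)
    fix t :: real assume "dist t 0 < e"
    then have "z + axis i (of_real t * c) \<in> ball z e" using that by (simp add: dist_norm norm_mult)
    then show "f (z + axis i (of_real t * c)) = g (z + axis i (of_real t * c))" using e fg by blast
  qed (rule e)
  have "vector_derivative (\<lambda>t::real. f (z + axis i (of_real t * c))) (at 0) =
      vector_derivative (\<lambda>t::real. g (z + axis i (of_real t * c))) (at 0)" if "cmod c = 1" for c i
    by (rule vector_derivative_cong_eq) (use ev[OF that, of i] in \<open>auto elim: eventually_mono\<close>)
  from this[of 1] this[of \<i>] show ?thesis
    by (cases x) (simp_all add: wirt_def wirt_bar_def mult.commute)
qed

lemma derivs_cong:
  assumes S: "open S" and fg: "\<And>w. w \<in> S \<Longrightarrow> f w = g w"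
  shows "z \<in> S \<Longrightarrow> derivs ws f z = derivs ws g z"
proof (induction ws arbitrary: z)
  case (Cons x ws)
  then show ?case using ddir_cong[OF S, of "derivs ws f" "derivs ws g"] by simp
qed (simp add: fg)

text \<open>
  Real-analytic functions \<open>f(w) = F(w, cnj w)\<close> with \<open>F\<close> holomorphic.  Their Wirtinger derivatives
  are partial derivatives of \<open>F\<close>, so they are again of this form, and they commute.
\<close>

definition polarizable :: "'m::finite cvec set \<Rightarrow> ('m cvec \<Rightarrow> complex) \<Rightarrow> bool" where
  "polarizable S f \<longleftrightarrow> (\<exists>F W. open W \<and> mholomorphic_on W F \<and>
     (\<forall>w\<in>S. cpair w (vcnj w) \<in> W \<and> f w = F (cpair w (vcnj w))))"

text \<open>The variable of \<open>F\<close> that belongs to a direction of \<open>f(w) = F(w, cnj w)\<close>.\<close>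

primrec slot :: "'m direction \<Rightarrow> 'm + 'm" where
  "slot (Hol i) = Inl i"
| "slot (Anti i) = Inr i"

lemma polarization_has_derivative:
  assumes S: "open S" and W: "open W" and F: "mholomorphic_on W F"
    and f: "\<And>w. w \<in> S \<Longrightarrow> cpair w (vcnj w) \<in> W \<and> f w = F (cpair w (vcnj w))" and w: "w \<in> S"
  shows "(f has_derivative (\<lambda>v. (\<Sum>i\<in>UNIV. wirt (Inl i) F (cpair w (vcnj w)) * v $ i)
           + (\<Sum>i\<in>UNIV. wirt (Inr i) F (cpair w (vcnj w)) * cnj (v $ i)))) (at w)"
    and "ddir x f w = wirt (slot x) F (cpair w (vcnj w))"
proof -
  let ?p = "cpair w (vcnj w)"
  have "(F has_derivative (\<lambda>v. \<Sum>i\<in>UNIV. wirt i F ?p * v $ i)) (at ?p)"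
    using mholomorphic_on_derivative(1)[OF F W] f w by blast
  from has_derivative_compose[OF bounded_linear_imp_has_derivative[OF bounded_linear_antidiagonal] this]
  have "((\<lambda>w. F (cpair w (vcnj w))) has_derivative (\<lambda>v. (\<Sum>i\<in>UNIV. wirt (Inl i) F ?p * v $ i)
           + (\<Sum>i\<in>UNIV. wirt (Inr i) F ?p * cnj (v $ i)))) (at w)"
    by (simp add: sum_UNIV_sum)
  then show *: "(f has_derivative (\<lambda>v. (\<Sum>i\<in>UNIV. wirt (Inl i) F ?p * v $ i)
           + (\<Sum>i\<in>UNIV. wirt (Inr i) F ?p * cnj (v $ i)))) (at w)"
    by (rule has_derivative_transform_within_open[OF _ S w]) (use f in auto)
  have ax: "(\<Sum>j\<in>UNIV. c j * axis i x $ j) = c i * x"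
    "(\<Sum>j\<in>UNIV. c j * cnj (axis i x $ j)) = c i * cnj x" for c :: "'a \<Rightarrow> complex" and i x
    by (subst sum.remove[of _ i]; auto simp: axis_def)+
  show "ddir x f w = wirt (slot x) F ?p"
    by (cases x; simp only: ddir.simps slot.simps wirt_of_has_derivative[OF *] ax; simp add: field_simps)
qed

lemma polarizableE:
  assumes "polarizable S f"
  obtains W F where "open W" "mholomorphic_on W F"
    "\<And>w. w \<in> S \<Longrightarrow> cpair w (vcnj w) \<in> W \<and> f w = F (cpair w (vcnj w))"
  using assms unfolding polarizable_def by (elim exE conjE) (rule that, auto)

lemma polarizable_differentiable:
  assumes "polarizable S f" "open S" "w \<in> S"
  shows "f differentiable (at w)"
proof -
  obtain F W where "open W" "mholomorphic_on W F"
    "\<And>w. w \<in> S \<Longrightarrow> cpair w (vcnj w) \<in> W \<and> f w = F (cpair w (vcnj w))"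
    by (rule polarizableE[OF assms(1)]) blast
  from polarization_has_derivative(1)[OF assms(2) this assms(3)] show ?thesis
    unfolding differentiable_def by blast
qed

lemma polarizable_cong:
  assumes "polarizable S f" "\<And>w. w \<in> S \<Longrightarrow> f w = g w"
  shows "polarizable S g"
proof -
  obtain F W where "open W" "mholomorphic_on W F"
    "\<And>w. w \<in> S \<Longrightarrow> cpair w (vcnj w) \<in> W \<and> f w = F (cpair w (vcnj w))"
    by (rule polarizableE[OF assms(1)]) blast
  then show ?thesis
    unfolding polarizable_def using assms(2) by (intro exI[of _ F] exI[of _ W]) auto
qed

lemma polarizable_ddir:
  assumes "polarizable S f" "open S"
  shows "polarizable S (ddir x f)"
proof -
  obtain F W where *: "open W" "mholomorphic_on W F"
    "\<And>w. w \<in> S \<Longrightarrow> cpair w (vcnj w) \<in> W \<and> f w = F (cpair w (vcnj w))"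
    by (rule polarizableE[OF assms(1)]) blast
  show ?thesis
    unfolding polarizable_def
    using polarization_has_derivative(2)[OF assms(2) *] mholomorphic_on_wirt[OF *(1,2)] *(1,3)
    by (intro exI[of _ "wirt (slot x) F"] exI[of _ W]) auto
qed

lemma polarizable_derivs: "polarizable S f \<Longrightarrow> open S \<Longrightarrow> polarizable S (derivs ws f)"
  by (induction ws) (auto intro: polarizable_ddir)

lemma ddir_commute:
  assumes "polarizable S f" "open S" "w \<in> S"
  shows "ddir x (ddir y f) w = ddir y (ddir x f) w"
proof -
  obtain F W where *: "open W" "mholomorphic_on W F"
    "\<And>w. w \<in> S \<Longrightarrow> cpair w (vcnj w) \<in> W \<and> f w = F (cpair w (vcnj w))"
    by (rule polarizableE[OF assms(1)]) blast
  have "ddir x (ddir y f) w = wirt (slot x) (wirt (slot y) F) (cpair w (vcnj w))" for x y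
    using polarization_has_derivative(2)[OF assms(2) *(1) mholomorphic_on_wirt[OF *(1,2)], of "ddir y f"]
      polarization_has_derivative(2)[OF assms(2) *] *(3) assms(3) by blast
  then show ?thesis using wirt_commute[OF *(1,2)] *(3) assms(3) by metis
qed

lemma polarizable_const [intro]: "polarizable S (\<lambda>_. c)"
  unfolding polarizable_def by (rule exI[of _ "\<lambda>_. c"], rule exI[of _ UNIV]) auto

lemma polarizable_binary:
  fixes S :: "'m::finite cvec set"
  assumes f: "polarizable S f" and g: "polarizable S g"
    and op: "\<And>F G (W :: ('m + 'm) cvec set). mholomorphic_on W F \<Longrightarrow> mholomorphic_on W G \<Longrightarrow> mholomorphic_on W (\<lambda>p. op (F p) (G p))"
  shows "polarizable S (\<lambda>w. op (f w) (g w))"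
proof -
  obtain F W where F: "open W" "mholomorphic_on W F"
    "\<And>w. w \<in> S \<Longrightarrow> cpair w (vcnj w) \<in> W \<and> f w = F (cpair w (vcnj w))"
    by (rule polarizableE[OF f]) blast
  obtain G V where G: "open V" "mholomorphic_on V G"
    "\<And>w. w \<in> S \<Longrightarrow> cpair w (vcnj w) \<in> V \<and> g w = G (cpair w (vcnj w))"
    by (rule polarizableE[OF g]) blast
  have "mholomorphic_on (W \<inter> V) (\<lambda>p. op (F p) (G p))"
    using F(2) G(2) by (intro op) (auto elim: mholomorphic_on_subset)
  then show ?thesis
    unfolding polarizable_def using F(1,3) G(1,3)
    by (intro exI[of _ "\<lambda>p. op (F p) (G p)"] exI[of _ "W \<inter> V"]) auto
qed

lemma polarizable_add [intro]: "polarizable S f \<Longrightarrow> polarizable S g \<Longrightarrow> polarizable S (\<lambda>w. f w + g w)"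
  by (rule polarizable_binary) auto
lemma polarizable_mult [intro]: "polarizable S f \<Longrightarrow> polarizable S g \<Longrightarrow> polarizable S (\<lambda>w. f w * g w)"
  by (rule polarizable_binary) auto
lemma polarizable_diff [intro]: "polarizable S f \<Longrightarrow> polarizable S g \<Longrightarrow> polarizable S (\<lambda>w. f w - g w)"
  by (rule polarizable_binary) auto

lemma polarizable_sum [intro]:
  "(\<And>a. a \<in> A \<Longrightarrow> polarizable S (f a)) \<Longrightarrow> polarizable S (\<lambda>w. \<Sum>a\<in>A. f a w)"
  by (induction A rule: infinite_finite_induct) auto
lemma polarizable_prod [intro]:
  "(\<And>a. a \<in> A \<Longrightarrow> polarizable S (f a)) \<Longrightarrow> polarizable S (\<lambda>w. \<Prod>a\<in>A. f a w)"
  by (induction A rule: infinite_finite_induct) auto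

lemma polarizable_inverse [intro]:
  assumes "polarizable S f" "\<And>w. w \<in> S \<Longrightarrow> f w \<noteq> 0"
  shows "polarizable S (\<lambda>w. inverse (f w))"
proof -
  obtain F W where F: "open W" "mholomorphic_on W F"
    "\<And>w. w \<in> S \<Longrightarrow> cpair w (vcnj w) \<in> W \<and> f w = F (cpair w (vcnj w))"
    by (rule polarizableE[OF assms(1)]) blast
  have "open (W \<inter> F -` (- {0}))"
    by (rule continuous_open_preimage[OF mholomorphic_on_continuous[OF F(2)] F(1)]) auto
  moreover have "mholomorphic_on (W \<inter> F -` (- {0})) (\<lambda>p. inverse (F p))"
    by (rule mholomorphic_on_inverse) (auto intro: mholomorphic_on_subset[OF F(2)])
  ultimately show ?thesis
    unfolding polarizable_def using F(3) assms(2)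
    by (intro exI[of _ "\<lambda>p. inverse (F p)"] exI[of _ "W \<inter> F -` (- {0})"]) auto
qed

lemma mholomorphic_on_lft:
  "mholomorphic_on S f \<Longrightarrow> mholomorphic_on {p. lft p \<in> S} (\<lambda>p. f (lft p))"
  by (rule mholomorphic_on_compose_linear[where A="\<lambda>i j. if j = Inl i then 1 else 0", OF _ bounded_linear_lft])
    (auto simp: lft_def if_distrib[of "\<lambda>x. x * _"] cong: if_cong)

lemma mholomorphic_on_rgt:
  "mholomorphic_on S f \<Longrightarrow> mholomorphic_on {p. rgt p \<in> S} (\<lambda>p. f (rgt p))"
  by (rule mholomorphic_on_compose_linear[where A="\<lambda>i j. if j = Inr i then 1 else 0", OF _ bounded_linear_rgt])
    (auto simp: rgt_def if_distrib[of "\<lambda>x. x * _"] cong: if_cong)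

lemma open_lft: "open S \<Longrightarrow> open {p. lft p \<in> S}" and open_rgt: "open S \<Longrightarrow> open {p. rgt p \<in> S}"
  using open_vimage[OF _ linear_continuous_on[OF bounded_linear_lft], of S]
    open_vimage[OF _ linear_continuous_on[OF bounded_linear_rgt], of S]
  by (simp_all add: vimage_def)

lemma mholomorphic_on_polarizable:
  "mholomorphic_on S f \<Longrightarrow> open S \<Longrightarrow> polarizable S f"
  unfolding polarizable_def
  by (intro exI[of _ "\<lambda>p. f (lft p)"] exI[of _ "{p. lft p \<in> S}"])
    (auto intro: mholomorphic_on_lft open_lft)

section \<open>Conjugation\<close>

text \<open>Conjugating both the argument and the value takes linear maps over \<open>\<complex>\<close> to linear maps over \<open>\<complex>\<close>.\<close>

lemma mholomorphic_on_sharp: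
  assumes "mholomorphic_on S f"
  shows "mholomorphic_on (vcnj ` S) (\<lambda>w. cnj (f (vcnj w)))"
proof -
  obtain c where c: "\<And>z. z \<in> S \<Longrightarrow> (f has_derivative (\<lambda>v. \<Sum>i\<in>UNIV. c z i * v $ i)) (at z within S)"
    using mholomorphic_onD[OF assms] by blast
  show ?thesis
  proof (rule mholomorphic_onI[where c="\<lambda>w i. cnj (c (vcnj w) i)"])
    fix w assume w: "w \<in> vcnj ` S"
    have "vcnj ` vcnj ` S = S" by (auto simp: vcnj_image_iff)
    then have "(f has_derivative (\<lambda>v. \<Sum>i\<in>UNIV. c (vcnj w) i * v $ i)) (at (vcnj w) within vcnj ` vcnj ` S)"
      using c w by (simp add: vcnj_image_iff)
    from has_derivative_in_compose[OF bounded_linear_imp_has_derivative[OF bounded_linear_vcnj] this]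
    have "((\<lambda>w. f (vcnj w)) has_derivative (\<lambda>v. \<Sum>i\<in>UNIV. c (vcnj w) i * vcnj v $ i)) (at w within vcnj ` S)" .
    from bounded_linear.has_derivative[OF bounded_linear_cnj this]
    show "((\<lambda>w. cnj (f (vcnj w))) has_derivative (\<lambda>v. \<Sum>i\<in>UNIV. cnj (c (vcnj w) i) * v $ i)) (at w within vcnj ` S)"
      by simp
  qed
qed

primrec dswap :: "'m direction \<Rightarrow> 'm direction" where
  "dswap (Hol i) = Anti i"
| "dswap (Anti i) = Hol i"

lemma polarizable_cnj [intro]:
  assumes "polarizable S f"
  shows "polarizable S (\<lambda>w. cnj (f w))"
proof -
  obtain F W where F: "open W" "mholomorphic_on W F"
    "\<And>w. w \<in> S \<Longrightarrow> cpair w (vcnj w) \<in> W \<and> f w = F (cpair w (vcnj w))"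
    by (rule polarizableE[OF assms]) blast
  define flip :: "('a + 'a) cvec \<Rightarrow> ('a + 'a) cvec" where "flip p = cpair (rgt p) (lft p)" for p
  have fl: "flip p $ k = (\<Sum>j\<in>UNIV. (if j = (case k of Inl i \<Rightarrow> Inr i | Inr i \<Rightarrow> Inl i) then 1 else 0) * p $ j)" for p k
    by (cases k) (simp_all add: flip_def lft_def rgt_def if_distrib[of "\<lambda>x. x * _"] cong: if_cong)
  have bl: "bounded_linear flip"
  proof (rule bounded_linear_componentwise)
    show "bounded_linear (\<lambda>p. flip p $ k)" for k
      by (cases k) (simp_all add: flip_def lft_def rgt_def bounded_linear_vec_nth)
  qed
  let ?V = "{p. flip p \<in> vcnj ` W}"
  have "mholomorphic_on ?V (\<lambda>p. cnj (F (vcnj (flip p))))"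
    by (rule mholomorphic_on_compose_linear[OF mholomorphic_on_sharp[OF F(2)] bl fl]) simp
  moreover have "open ?V"
    using open_vimage[OF open_vcnj[OF F(1)] linear_continuous_on[OF bl, of UNIV]] by (simp add: vimage_def)
  moreover have "vcnj (flip (cpair w (vcnj w))) = cpair w (vcnj w)" for w
  proof -
    have "vcnj (flip (cpair w (vcnj w))) $ k = cpair w (vcnj w) $ k" for k
      by (cases k) (simp_all add: flip_def)
    then show ?thesis by (simp add: vec_eq_iff)
  qed
  ultimately show ?thesis
    unfolding polarizable_def using F(3)
    by (intro exI[of _ "\<lambda>p. cnj (F (vcnj (flip p)))"] exI[of _ ?V]) (auto simp: vcnj_image_iff)
qed

lemma ddir_cnj:
  assumes "polarizable S f" "open S" "w \<in> S"
  shows "ddir x (\<lambda>w. cnj (f w)) w = cnj (ddir (dswap x) f w)"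
proof -
  obtain L where L: "(f has_derivative L) (at w)"
    using polarizable_differentiable[OF assms] by (auto simp: differentiable_def)
  from bounded_linear.has_derivative[OF bounded_linear_cnj this]
  show ?thesis
    by (cases x) (simp_all add: wirt_of_has_derivative[OF L] wirt_of_has_derivative)
qed

lemma derivs_cnj:
  assumes "polarizable S f" "open S" "w \<in> S"
  shows "derivs ws (\<lambda>w. cnj (f w)) w = cnj (derivs (map dswap ws) f w)"
  using assms(3)
proof (induction ws arbitrary: w)
  case (Cons x ws)
  have "derivs (x # ws) (\<lambda>w. cnj (f w)) w = ddir x (\<lambda>w. cnj (derivs (map dswap ws) f w)) w"
    unfolding derivs_simps by (rule ddir_cong[OF assms(2) Cons.IH Cons.prems])
  also have "\<dots> = cnj (derivs (map dswap (x # ws)) f w)"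
    using ddir_cnj[OF polarizable_derivs[OF assms(1,2)] assms(2) Cons.prems] by simp
  finally show ?case .
qed simp

section \<open>Rules of differentiation\<close>

lemma ddir_linear_rules:
  assumes f: "f differentiable (at w)" and g: "g differentiable (at w)"
  shows ddir_add': "ddir x (\<lambda>w. f w + g w) w = ddir x f w + ddir x g w"
    and ddir_diff': "ddir x (\<lambda>w. f w - g w) w = ddir x f w - ddir x g w"
    and ddir_mult': "ddir x (\<lambda>w. f w * g w) w = ddir x f w * g w + f w * ddir x g w"
proof -
  obtain L where L: "(f has_derivative L) (at w)" using f by (auto simp: differentiable_def)
  obtain K where K: "(g has_derivative K) (at w)" using g by (auto simp: differentiable_def)
  note rules = wirt_of_has_derivative[OF L] wirt_of_has_derivative[OF K]
    wirt_of_has_derivative[OF has_derivative_add[OF L K]]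
    wirt_of_has_derivative[OF has_derivative_diff[OF L K]]
    wirt_of_has_derivative[OF has_derivative_mult[OF L K]]
  show "ddir x (\<lambda>w. f w + g w) w = ddir x f w + ddir x g w"
    "ddir x (\<lambda>w. f w - g w) w = ddir x f w - ddir x g w"
    "ddir x (\<lambda>w. f w * g w) w = ddir x f w * g w + f w * ddir x g w"
    by (cases x; simp add: rules; simp add: field_simps)+
qed

lemma ddir_const [simp]: "ddir x (\<lambda>_. c) = (\<lambda>_. 0)"
  by (rule ext, cases x) (use wirt_of_has_derivative[OF has_derivative_const] in simp_all)

lemma derivs_zero [simp]: "derivs ws (\<lambda>_. 0) = (\<lambda>_. 0)"
  by (induction ws) auto

lemma derivs_const: "ws \<noteq> [] \<Longrightarrow> derivs ws (\<lambda>_. c) = (\<lambda>_. 0)"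
  by (induction ws rule: rev_induct) auto

context
  fixes S :: "'m::finite cvec set"
  assumes S: "open S"
begin

lemma ddir_sum:
  assumes "\<And>a. a \<in> A \<Longrightarrow> polarizable S (f a)" "w \<in> S"
  shows "ddir x (\<lambda>w. \<Sum>a\<in>A. f a w) w = (\<Sum>a\<in>A. ddir x (f a) w)"
  using assms
proof (induction A rule: infinite_finite_induct)
  case (insert a A)
  have "ddir x (\<lambda>w. f a w + (\<Sum>a\<in>A. f a w)) w = ddir x (f a) w + ddir x (\<lambda>w. \<Sum>a\<in>A. f a w) w"
    using insert.prems S
    by (intro ddir_add' polarizable_differentiable[where S=S] polarizable_sum) auto
  then show ?case using insert by simp
qed auto

lemma derivs_add:
  assumes "polarizable S f" "polarizable S g"
  shows "w \<in> S \<Longrightarrow> derivs ws (\<lambda>w. f w + g w) w = derivs ws f w + derivs ws g w"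
proof (induction ws arbitrary: w)
  case (Cons x ws)
  have "ddir x (derivs ws (\<lambda>w. f w + g w)) w = ddir x (\<lambda>w. derivs ws f w + derivs ws g w) w"
    by (rule ddir_cong[OF S Cons.IH Cons.prems])
  also have "\<dots> = ddir x (derivs ws f) w + ddir x (derivs ws g) w"
    using assms S Cons.prems by (intro ddir_add') (auto intro: polarizable_differentiable polarizable_derivs)
  finally show ?case by simp
qed simp

lemma derivs_diff:
  assumes "polarizable S f" "polarizable S g"
  shows "w \<in> S \<Longrightarrow> derivs ws (\<lambda>w. f w - g w) w = derivs ws f w - derivs ws g w"
proof (induction ws arbitrary: w)
  case (Cons x ws)
  have "ddir x (derivs ws (\<lambda>w. f w - g w)) w = ddir x (\<lambda>w. derivs ws f w - derivs ws g w) w"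
    by (rule ddir_cong[OF S Cons.IH Cons.prems])
  also have "\<dots> = ddir x (derivs ws f) w - ddir x (derivs ws g) w"
    using assms S Cons.prems by (intro ddir_diff') (auto intro: polarizable_differentiable polarizable_derivs)
  finally show ?case by simp
qed simp

lemma derivs_sum:
  assumes "\<And>a. a \<in> A \<Longrightarrow> polarizable S (f a)" "w \<in> S"
  shows "derivs ws (\<lambda>w. \<Sum>a\<in>A. f a w) w = (\<Sum>a\<in>A. derivs ws (f a) w)"
  using assms
proof (induction A rule: infinite_finite_induct)
  case (insert a A)
  then show ?case using derivs_add[of "f a" "\<lambda>w. \<Sum>a\<in>A. f a w" w ws] by (simp add: polarizable_sum)
qed auto

lemma ddir_mult:
  assumes "polarizable S f" "polarizable S g" "w \<in> S"
  shows "ddir x (\<lambda>w. f w * g w) w = ddir x f w * g w + f w * ddir x g w"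
  by (intro ddir_mult' polarizable_differentiable[where S=S] assms S)

lemma derivs_mult_snoc:
  assumes "polarizable S f" "polarizable S g" "w \<in> S"
  shows "derivs (ws @ [x]) (\<lambda>w. f w * g w) w =
    derivs ws (\<lambda>w. ddir x f w * g w) w + derivs ws (\<lambda>w. f w * ddir x g w) w"
proof -
  have "derivs (ws @ [x]) (\<lambda>w. f w * g w) w = derivs ws (\<lambda>w. ddir x f w * g w + f w * ddir x g w) w"
    unfolding derivs_simps by (rule derivs_cong[OF S _ assms(3)]) (simp add: ddir_mult assms(1,2))
  also have "\<dots> = derivs ws (\<lambda>w. ddir x f w * g w) w + derivs ws (\<lambda>w. f w * ddir x g w) w"
    using assms S by (intro derivs_add) (auto intro: polarizable_ddir)
  finally show ?thesis .
qed

text \<open>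
  Two words with the same letters can be transformed into each other by moving single letters to the
  end, which \<open>ddir_commute\<close> allows.
\<close>

lemma derivs_perm:
  assumes "polarizable S f" "mset ws = mset vs" "w \<in> S"
  shows "derivs ws f w = derivs vs f w"
proof -
  show ?thesis
    using assms
  proof (induction vs arbitrary: ws f rule: rev_induct)
    case (snoc x vs)
    then have "x \<in> set ws" by (metis in_set_conv_decomp mset_eq_setD)
    then obtain us us' where ws: "ws = us @ x # us'" by (meson split_list)
    have "derivs ws f w = derivs (us @ us') (ddir x f) w"
    proof -
      have "derivs us (ddir x (derivs us' f)) w = derivs (us @ us') (ddir x f) w"
        using \<open>w \<in> S\<close>
      proof (induction us' arbitrary: us)
        case (Cons y vs)
        have "derivs us (ddir x (derivs (y # vs) f)) w = derivs us (ddir y (ddir x (derivs vs f))) w"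
          by (rule derivs_cong[OF S _ Cons.prems])
            (simp, rule ddir_commute[OF polarizable_derivs[OF snoc.prems(1) S] S])
        also have "\<dots> = derivs ((us @ [y]) @ vs) (ddir x f) w"
          using Cons.IH[OF Cons.prems, of "us @ [y]"] by simp
        finally show ?case by simp
      qed simp
      then show ?thesis by (simp add: ws)
    qed
    also have "\<dots> = derivs vs (ddir x f) w"
      by (rule snoc.IH[OF polarizable_ddir[OF snoc.prems(1) S] _ snoc.prems(3)])
        (use snoc.prems(2) in \<open>simp add: ws\<close>)
    finally show ?case by simp
  qed simp
qed

text \<open>By Leibniz' rule each term contains the derivative of \<open>f\<close> along a subword of \<open>ws\<close>.\<close>

lemma derivs_mult_vanish:
  assumes "polarizable S f" "polarizable S g" "w \<in> S"
    and "\<And>us. subseq us ws \<Longrightarrow> derivs us f w = 0"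
  shows "derivs ws (\<lambda>w. f w * g w) w = 0"
  using assms
proof (induction ws arbitrary: f g rule: rev_induct)
  case Nil
  then show ?case using Nil.prems(4)[of "[]"] by simp
next
  case (snoc x ws)
  have "derivs ws (\<lambda>w. ddir x f w * g w) w = 0"
  proof (rule snoc.IH[OF polarizable_ddir[OF snoc.prems(1) S] snoc.prems(2,3)])
    fix us assume "subseq us ws"
    then show "derivs us (ddir x f) w = 0" using snoc.prems(4)[of "us @ [x]"] by simp
  qed
  moreover have "derivs ws (\<lambda>w. f w * ddir x g w) w = 0"
  proof (rule snoc.IH[OF snoc.prems(1) polarizable_ddir[OF snoc.prems(2) S] snoc.prems(3)])
    fix us assume "subseq us ws"
    then show "derivs us f w = 0" using snoc.prems(4)[of us] by (simp add: list_emb_prefix)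
  qed
  ultimately show ?case using derivs_mult_snoc[OF snoc.prems(1-3)] by simp
qed

lemma derivs_holomorphic:
  assumes "mholomorphic_on S f" "w \<in> S"
  shows "derivs (map Hol is) f w = foldr wirt is f w"
    and "Anti i \<in> set ws \<Longrightarrow> derivs ws f w = 0"
proof -
  have *: "derivs (map Hol is) f = foldr wirt is f" for "is" by (induction "is") auto
  then show "derivs (map Hol is) f w = foldr wirt is f w" by simp
  assume "Anti i \<in> set ws"
  have vs: "\<exists>is. vs = map Hol is" if "\<forall>x\<in>set vs. x \<in> range Hol" for vs :: "'m direction list"
    using that by (metis ex_map_conv rangeE)
  obtain us i' vs where ws: "ws = us @ Anti i' # vs" "\<forall>x\<in>set vs. x \<notin> range Anti"
    using split_list_last_prop[of ws "\<lambda>x. x \<in> range Anti"] \<open>Anti i \<in> set ws\<close> by (metis rangeE rangeI)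
  then have "\<forall>x\<in>set vs. x \<in> range Hol" by (metis direction.exhaust rangeI)
  then obtain "is" where "is": "vs = map Hol is" using vs by blast
  have "derivs ws f w = derivs us (wirt_bar i' (foldr wirt is f)) w" by (simp add: ws "is" *)
  also have "\<dots> = derivs us (\<lambda>_. 0) w"
    by (rule derivs_cong[OF S _ assms(2)])
      (rule mholomorphic_on_derivative(3)[OF mholomorphic_on_foldr_wirt[OF S assms(1)] S])
  finally show "derivs ws f w = 0" by simp
qed

end

section \<open>Sesquiholomorphic kernels and polarization\<close>

text \<open>
  Kernels that are holomorphic in the first and antiholomorphic in the second variable, jointly;
  conjugating the second variable makes them holomorphic functions of twice as many variables.
\<close>

definition sesqui :: "'m::finite cvec set \<Rightarrow> ('m cvec \<Rightarrow> 'm cvec \<Rightarrow> complex) \<Rightarrow> bool" where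
  "sesqui C G \<longleftrightarrow> mholomorphic_on {p. lft p \<in> C \<and> vcnj (rgt p) \<in> C} (\<lambda>p. G (lft p) (vcnj (rgt p)))"

lemma open_bidomain:
  assumes "open C" shows "open {p. lft p \<in> C \<and> vcnj (rgt p) \<in> C}"
proof -
  have "{p. lft p \<in> C \<and> vcnj (rgt p) \<in> C} = {p. lft p \<in> C} \<inter> {p. rgt p \<in> vcnj ` C}"
    by (auto simp: vcnj_image_iff)
  then show ?thesis using open_lft[OF assms] open_rgt[OF open_vcnj[OF assms]] by auto
qed

lemma sesqui_polarizable: "sesqui C G \<Longrightarrow> open C \<Longrightarrow> polarizable C (\<lambda>w. G w w)"
  unfolding polarizable_def sesqui_def
  by (intro exI[of _ "\<lambda>p. G (lft p) (vcnj (rgt p))"] exI[of _ "{p. lft p \<in> C \<and> vcnj (rgt p) \<in> C}"])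
    (simp add: open_bidomain)

lemma sesqui_ddir_Hol:
  assumes G: "sesqui C G" and C: "open C" and w: "w \<in> C"
    and d: "((\<lambda>\<zeta>. G (w + axis i \<zeta>) w) has_field_derivative D) (at 0)"
  shows "ddir (Hol i) (\<lambda>w. G w w) w = D"
proof -
  let ?F = "\<lambda>p. G (lft p) (vcnj (rgt p))"
  have "ddir (Hol i) (\<lambda>w. G w w) w = wirt (Inl i) ?F (cpair w (vcnj w))"
    using polarization_has_derivative(2)[OF C open_bidomain[OF C] G[unfolded sesqui_def], of "\<lambda>w. G w w" w "Hol i"] w
    by simp
  also have "\<dots> = D" by (rule wirt_of_slice(1)) (use d in simp)
  finally show ?thesis .
qed

lemma sesqui_ddir_Anti:
  assumes G: "sesqui C G" and C: "open C" and w: "w \<in> C"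
    and d: "((\<lambda>\<zeta>. cnj (G w (w + axis i \<zeta>))) has_field_derivative D) (at 0)"
  shows "ddir (Anti i) (\<lambda>w. G w w) w = cnj D"
proof -
  let ?F = "\<lambda>p. G (lft p) (vcnj (rgt p))"
  have "ddir (Anti i) (\<lambda>w. G w w) w = wirt (Inr i) ?F (cpair w (vcnj w))"
    using polarization_has_derivative(2)[OF C open_bidomain[OF C] G[unfolded sesqui_def], of "\<lambda>w. G w w" w "Anti i"] w
    by simp
  also have "\<dots> = cnj D"
  proof (rule wirt_of_slice(1))
    have "((cnj \<circ> (\<lambda>\<zeta>. cnj (G w (w + axis i \<zeta>))) \<circ> cnj) has_field_derivative cnj D) (at (cnj 0))"
      by (rule has_field_derivative_cnj_cnj) (use d in simp)
    then show "((\<lambda>\<zeta>. ?F (cpair w (vcnj w) + axis (Inr i) \<zeta>)) has_field_derivative cnj D) (at 0)"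
      by (simp add: o_def)
  qed
  finally show ?thesis .
qed

text \<open>
  The partial derivatives of the holomorphic function \<open>(w, v) \<mapsto> G w (cnj v)\<close> at the points
  \<open>(w, cnj w)\<close> are the derivatives of \<open>w \<mapsto> G w w\<close> along words, so they vanish, and the identity theorem
  applies.
\<close>

lemma polarization:
  assumes G: "sesqui C G" and C: "open C" "connected C"
    and diag: "\<And>w. w \<in> C \<Longrightarrow> G w w = 0" and w: "w \<in> C" and v: "v \<in> C"
  shows "G w v = 0"
proof -
  let ?F = "\<lambda>p. G (lft p) (vcnj (rgt p))" and ?W = "{p. lft p \<in> C \<and> vcnj (rgt p) \<in> C}"
  have W: "open ?W" by (rule open_bidomain[OF C(1)])
  have "connected ?W"
  proof -
    have "bounded_linear (\<lambda>x::'a cvec \<times> 'a cvec. cpair (fst x) (vcnj (snd x)))"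
    proof (rule bounded_linear_componentwise)
      fix k :: "'a + 'a"
      show "bounded_linear (\<lambda>x::'a cvec \<times> 'a cvec. cpair (fst x) (vcnj (snd x)) $ k)"
        by (cases k) (simp_all add: bounded_linear_compose[OF bounded_linear_vec_nth bounded_linear_fst]
          bounded_linear_compose[OF bounded_linear_cnj bounded_linear_compose[OF bounded_linear_vec_nth bounded_linear_snd]])
    qed
    then have "connected ((\<lambda>x::'a cvec \<times> 'a cvec. cpair (fst x) (vcnj (snd x))) ` (C \<times> C))"
      by (intro connected_continuous_image linear_continuous_on connected_Times C)
    moreover have "(\<lambda>x::'a cvec \<times> 'a cvec. cpair (fst x) (vcnj (snd x))) ` (C \<times> C) = ?W"
    proof (intro equalityI subsetI)
      fix p :: "('a + 'a) cvec" assume "p \<in> ?W"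
      then show "p \<in> (\<lambda>x. cpair (fst x) (vcnj (snd x))) ` (C \<times> C)"
        by (intro image_eqI[of _ _ "(lft p, vcnj (rgt p))"]) auto
    qed auto
    ultimately show ?thesis by simp
  qed
  moreover have "foldr wirt ks ?F (cpair w (vcnj w)) = 0" if "w \<in> C" for ks w
  proof -
    have sl: "\<exists>xs. ks = map slot xs"
    proof -
      have "\<exists>x. k = slot x" for k :: "'a + 'a" by (cases k) (metis slot.simps)+
      then show ?thesis by (metis ex_map_conv)
    qed
    then obtain xs where xs: "ks = map slot xs" by blast
    have "derivs xs (\<lambda>w. G w w) w = foldr wirt (map slot xs) ?F (cpair w (vcnj w))" if "w \<in> C" for w
      using that
    proof (induction xs arbitrary: w)
      case (Cons x xs)
      have "derivs (x # xs) (\<lambda>w. G w w) w = ddir x (\<lambda>w. foldr wirt (map slot xs) ?F (cpair w (vcnj w))) w"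
        unfolding derivs_simps by (rule ddir_cong[OF C(1) Cons.IH Cons.prems])
      also have "\<dots> = wirt (slot x) (foldr wirt (map slot xs) ?F) (cpair w (vcnj w))"
        by (rule polarization_has_derivative(2)[OF C(1) W mholomorphic_on_foldr_wirt[OF W G[unfolded sesqui_def]]])
          (use Cons.prems in auto)
      finally show ?case by simp
    qed simp
    moreover have "derivs xs (\<lambda>w. G w w) w = derivs xs (\<lambda>w. 0) w"
      by (rule derivs_cong[OF C(1) diag that])
    ultimately show ?thesis using xs that by simp
  qed
  ultimately have "?F (cpair w (vcnj v)) = 0"
    using mholomorphic_identity[OF W _ G[unfolded sesqui_def], of "cpair w (vcnj w)" "cpair w (vcnj v)"] w v
    by simp
  then show ?thesis by simp
qed

lemma sesqui_const [intro]: "sesqui C (\<lambda>_ _. c)"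
  unfolding sesqui_def by auto
lemma sesqui_diff [intro]: "sesqui C F \<Longrightarrow> sesqui C G \<Longrightarrow> sesqui C (\<lambda>w v. F w v - G w v)"
  unfolding sesqui_def by auto
lemma sesqui_mult [intro]: "sesqui C F \<Longrightarrow> sesqui C G \<Longrightarrow> sesqui C (\<lambda>w v. F w v * G w v)"
  unfolding sesqui_def by auto
lemma sesqui_sum [intro]:
  "(\<And>a. a \<in> A \<Longrightarrow> sesqui C (F a)) \<Longrightarrow> sesqui C (\<lambda>w v. \<Sum>a\<in>A. F a w v)"
  unfolding sesqui_def by auto
lemma sesqui_left: "mholomorphic_on C f \<Longrightarrow> sesqui C (\<lambda>w v. f w)"
  unfolding sesqui_def by (rule mholomorphic_on_subset[OF mholomorphic_on_lft]) auto
lemma sesqui_right: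
  assumes "mholomorphic_on C f"
  shows "sesqui C (\<lambda>w v. cnj (f v))"
  unfolding sesqui_def
  by (rule mholomorphic_on_subset[OF mholomorphic_on_rgt[OF mholomorphic_on_sharp[OF assms]]])
    (auto simp: vcnj_image_iff)

section \<open>Functions with vanishing transverse jets\<close>

definition nhol :: "'m direction list \<Rightarrow> nat" where
  "nhol ws = length (filter (\<lambda>D. D \<in> range Hol) ws)"
definition nanti :: "'m direction list \<Rightarrow> nat" where
  "nanti ws = length (filter (\<lambda>D. D \<in> range Anti) ws)"

lemma nhol_nanti_simps [simp]:
  "nhol [] = 0" "nhol (Hol i # ws) = Suc (nhol ws)" "nhol (Anti i # ws) = nhol ws"
  "nanti [] = 0" "nanti (Hol i # ws) = nanti ws" "nanti (Anti i # ws) = Suc (nanti ws)"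
  "nhol (us @ ws) = nhol us + nhol ws" "nanti (us @ ws) = nanti us + nanti ws"
  "nhol (rev ws) = nhol ws" "nanti (rev ws) = nanti ws"
  "nhol (map Hol is) = length is" "nanti (map Hol is) = 0"
  "nhol (map Anti is) = 0" "nanti (map Anti is) = length is"
  by (auto simp: nhol_def nanti_def filter_map filter_empty_conv o_def simp flip: rev_filter)

lemma nhol_nanti_subseq: "subseq us ws \<Longrightarrow> nhol us \<le> nhol ws \<and> nanti us \<le> nanti ws \<and> length us \<le> length ws"
  by (auto simp: nhol_def nanti_def intro!: list_emb_length subseq_filter)

abbreviation dirs :: "'m set \<Rightarrow> 'm direction set" where
  "dirs T \<equiv> Hol ` T \<union> Anti ` T"

text \<open>
  The derivatives along words in the directions \<open>T\<close> vanish on \<open>Z\<close> as long as there are fewer than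
  \<open>p\<close> holomorphic and fewer than \<open>q\<close> antiholomorphic letters, and fewer than \<open>n\<close> letters altogether.
  The module structure bounds the two kinds separately, while the induction on the curvature
  condition runs over the total order.
\<close>

definition jet_zero :: "'m::finite set \<Rightarrow> nat \<Rightarrow> nat \<Rightarrow> nat \<Rightarrow> 'm cvec set \<Rightarrow> ('m cvec \<Rightarrow> complex) \<Rightarrow> bool" where
  "jet_zero T p q n Z f \<longleftrightarrow> (\<forall>ws. set ws \<subseteq> dirs T \<longrightarrow> nhol ws < p \<longrightarrow> nanti ws < q \<longrightarrow> length ws < n \<longrightarrow>
     (\<forall>w\<in>Z. derivs ws f w = 0))"

lemma jet_zero_mono:
  "jet_zero T p q n Z f \<Longrightarrow> p' \<le> p \<Longrightarrow> q' \<le> q \<Longrightarrow> n' \<le> n \<Longrightarrow> jet_zero T p' q' n' Z f"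
  unfolding jet_zero_def by (meson less_le_trans)

lemma jet_zero_derivs:
  assumes "jet_zero T p' q' n' Z f" "set us \<subseteq> dirs T"
    "p + nhol us \<le> p'" "q + nanti us \<le> q'" "n + length us \<le> n'"
  shows "jet_zero T p q n Z (derivs us f)"
  unfolding jet_zero_def
proof (intro allI impI ballI)
  fix ws :: "'a direction list" and w
  assume "set ws \<subseteq> dirs T" "nhol ws < p" "nanti ws < q" "length ws < n" "w \<in> Z"
  then have "derivs (ws @ us) f w = 0"
    using assms(1)[unfolded jet_zero_def, rule_format, of "ws @ us" w] assms(2-) by simp
  then show "derivs ws (derivs us f) w = 0" by simp
qed

lemma jet_zero_ddir:
  assumes "jet_zero T p' q' n' Z f" "x \<in> dirs T"
    "p + nhol [x] \<le> p'" "q + nanti [x] \<le> q'" "n + 1 \<le> n'"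
  shows "jet_zero T p q n Z (ddir x f)"
  using jet_zero_derivs[of T p' q' n' Z f "[x]" p q n] assms by simp

lemma jet_zero_at: "jet_zero T p q n Z f \<Longrightarrow> 0 < p \<Longrightarrow> 0 < q \<Longrightarrow> 0 < n \<Longrightarrow> w \<in> Z \<Longrightarrow> f w = 0"
  unfolding jet_zero_def by (drule spec[of _ "[]"]) simp

context
  fixes S Z :: "'m::finite cvec set" and T :: "'m set"
  assumes S: "open S" and Z: "Z \<subseteq> S"
begin

lemma jet_zero_cong:
  assumes "jet_zero T p q n Z f" "\<And>w. w \<in> S \<Longrightarrow> f w = g w"
  shows "jet_zero T p q n Z g"
  unfolding jet_zero_def
proof (intro allI impI ballI)
  fix ws :: "'m direction list" and w
  assume ws: "set ws \<subseteq> dirs T" "nhol ws < p" "nanti ws < q" "length ws < n" and w: "w \<in> Z"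
  have "derivs ws f w = derivs ws g w"
    by (rule derivs_cong[OF S assms(2)]) (use w Z in auto)
  with ws w assms(1) show "derivs ws g w = 0" unfolding jet_zero_def by simp
qed

text \<open>The bounds on words are inherited by subwords, so \<open>derivs_mult_vanish\<close> applies.\<close>

lemma jet_zero_mult:
  assumes "polarizable S f" "polarizable S g" "jet_zero T p q n Z f"
  shows "jet_zero T p q n Z (\<lambda>w. f w * g w)"
  unfolding jet_zero_def
proof (intro allI impI ballI)
  fix ws :: "'m direction list" and w
  assume ws: "set ws \<subseteq> dirs T" "nhol ws < p" "nanti ws < q" "length ws < n" and w: "w \<in> Z"
  show "derivs ws (\<lambda>w. f w * g w) w = 0"
  proof (rule derivs_mult_vanish[OF S assms(1,2)])
    show "w \<in> S" using w Z by blast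
    fix us assume us: "subseq us ws"
    then have "set us \<subseteq> set ws" by (auto elim: list_emb_set)
    moreover have "nhol us < p" "nanti us < q" "length us < n"
      using nhol_nanti_subseq[OF us] ws by auto
    ultimately show "derivs us f w = 0" using assms(3) ws w unfolding jet_zero_def by blast
  qed
qed

lemma jet_zero_mult_right:
  assumes "polarizable S f" "polarizable S g" "jet_zero T p q n Z g"
  shows "jet_zero T p q n Z (\<lambda>w. f w * g w)"
  using jet_zero_mult[OF assms(2,1,3)] by (simp add: mult.commute)

lemma jet_zero_add:
  assumes "polarizable S f" "polarizable S g" "jet_zero T p q n Z f" "jet_zero T p q n Z g"
  shows "jet_zero T p q n Z (\<lambda>w. f w + g w)"
  using assms(3,4) derivs_add[OF S assms(1,2)] Z unfolding jet_zero_def by (auto simp: subset_iff)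

lemma jet_zero_diff:
  assumes "polarizable S f" "polarizable S g" "jet_zero T p q n Z f" "jet_zero T p q n Z g"
  shows "jet_zero T p q n Z (\<lambda>w. f w - g w)"
  using assms(3,4) derivs_diff[OF S assms(1,2)] Z unfolding jet_zero_def by (auto simp: subset_iff)

lemma jet_zero_sum:
  assumes "\<And>a. a \<in> A \<Longrightarrow> polarizable S (f a)" "\<And>a. a \<in> A \<Longrightarrow> jet_zero T p q n Z (f a)"
  shows "jet_zero T p q n Z (\<lambda>w. \<Sum>a\<in>A. f a w)"
  unfolding jet_zero_def
proof (intro allI impI ballI)
  fix ws :: "'m direction list" and w
  assume ws: "set ws \<subseteq> dirs T" "nhol ws < p" "nanti ws < q" "length ws < n" and w: "w \<in> Z"
  have "derivs ws (\<lambda>w. \<Sum>a\<in>A. f a w) w = (\<Sum>a\<in>A. derivs ws (f a) w)"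
    by (rule derivs_sum[OF S]) (use assms(1) w Z in auto)
  also have "\<dots> = 0" using assms(2) ws w by (intro sum.neutral) (simp add: jet_zero_def)
  finally show "derivs ws (\<lambda>w. \<Sum>a\<in>A. f a w) w = 0" .
qed

end

section \<open>Matrix-valued functions\<close>

definition mpolar :: "'m::finite cvec set \<Rightarrow> ('m cvec \<Rightarrow> complex^'r^'r) \<Rightarrow> bool" where
  "mpolar S A \<longleftrightarrow> (\<forall>a b. polarizable S (\<lambda>w. A w $ a $ b))"

definition mderiv :: "'m::finite direction \<Rightarrow> ('m cvec \<Rightarrow> complex^'r^'r) \<Rightarrow> 'm cvec \<Rightarrow> complex^'r^'r" where
  "mderiv x A w = (\<chi> a b. ddir x (\<lambda>w. A w $ a $ b) w)"

definition mderivs :: "'m::finite direction list \<Rightarrow> ('m cvec \<Rightarrow> complex^'r^'r) \<Rightarrow> 'm cvec \<Rightarrow> complex^'r^'r" where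
  "mderivs ws = foldr mderiv ws"

definition mjet_zero :: "'m::finite set \<Rightarrow> nat \<Rightarrow> nat \<Rightarrow> nat \<Rightarrow> 'm cvec set \<Rightarrow>
    ('m cvec \<Rightarrow> complex^'r^'r) \<Rightarrow> bool" where
  "mjet_zero T p q n Z A \<longleftrightarrow> (\<forall>a b. jet_zero T p q n Z (\<lambda>w. A w $ a $ b))"

lemma mat_wirt_mderiv: "mat_wirt i = mderiv (Hol i)" "mat_wirt_bar i = mderiv (Anti i)"
  by (simp_all add: fun_eq_iff mat_wirt_def mat_wirt_bar_def mderiv_def)

lemma mderivs_simps [simp]: "mderivs [] A = A" "mderivs (x # ws) A = mderiv x (mderivs ws A)"
  "mderivs (ws @ vs) A = mderivs ws (mderivs vs A)"
  by (simp_all add: mderivs_def)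

lemma mderiv_nth [simp]: "mderiv x A w $ a $ b = ddir x (\<lambda>w. A w $ a $ b) w"
  by (simp add: mderiv_def)

lemma mderivs_nth: "mderivs ws A w $ a $ b = derivs ws (\<lambda>w. A w $ a $ b) w"
proof (induction ws arbitrary: w)
  case (Cons x ws)
  then show ?case by (simp add: Cons[abs_def])
qed simp

lemma mjet_zero_mono:
  "mjet_zero T p q n Z f \<Longrightarrow> p' \<le> p \<Longrightarrow> q' \<le> q \<Longrightarrow> n' \<le> n \<Longrightarrow> mjet_zero T p' q' n' Z f"
  unfolding mjet_zero_def using jet_zero_mono by blast

lemma mjet_zero_derivs:
  assumes "mjet_zero T p' q' n' Z A" "set us \<subseteq> dirs T"
    "p + nhol us \<le> p'" "q + nanti us \<le> q'" "n + length us \<le> n'"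
  shows "mjet_zero T p q n Z (mderivs us A)"
  unfolding mjet_zero_def
proof (intro allI)
  fix a b
  have "jet_zero T p q n Z (derivs us (\<lambda>w. A w $ a $ b))"
    by (rule jet_zero_derivs[OF _ assms(2-)]) (use assms(1) in \<open>simp add: mjet_zero_def\<close>)
  then show "jet_zero T p q n Z (\<lambda>w. mderivs us A w $ a $ b)" by (simp add: mderivs_nth)
qed

lemma mjet_zero_deriv:
  assumes "mjet_zero T p' q' n' Z A" "x \<in> dirs T"
    "p + nhol [x] \<le> p'" "q + nanti [x] \<le> q'" "n + 1 \<le> n'"
  shows "mjet_zero T p q n Z (mderiv x A)"
  using mjet_zero_derivs[of T p' q' n' Z A "[x]" p q n] assms by simp

lemma mjet_zero_at:
  "mjet_zero T p q n Z A \<Longrightarrow> 0 < p \<Longrightarrow> 0 < q \<Longrightarrow> 0 < n \<Longrightarrow> w \<in> Z \<Longrightarrow> A w = 0"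
  unfolding mjet_zero_def vec_eq_iff using jet_zero_at[of T p q n Z "\<lambda>w. A w $ _ $ _" w] by simp

lemma mpolar_const [intro]: "mpolar S (\<lambda>_. A)"
  unfolding mpolar_def by auto
lemma mpolar_mult [intro]: "mpolar S A \<Longrightarrow> mpolar S B \<Longrightarrow> mpolar S (\<lambda>w. A w ** B w)"
  unfolding mpolar_def matrix_matrix_mult_def by (auto intro!: polarizable_sum polarizable_mult)
lemma mpolar_add [intro]: "mpolar S A \<Longrightarrow> mpolar S B \<Longrightarrow> mpolar S (\<lambda>w. A w + B w)"
  unfolding mpolar_def by auto
lemma mpolar_diff [intro]: "mpolar S A \<Longrightarrow> mpolar S B \<Longrightarrow> mpolar S (\<lambda>w. A w - B w)"
  unfolding mpolar_def by auto
lemma mpolar_deriv: "mpolar S A \<Longrightarrow> open S \<Longrightarrow> mpolar S (mderiv x A)"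
  unfolding mpolar_def by (simp add: polarizable_ddir)

lemma mpolar_derivs: "mpolar S A \<Longrightarrow> open S \<Longrightarrow> mpolar S (mderivs ws A)"
  by (induction ws) (auto intro: mpolar_deriv)

lemma polarizable_det: "mpolar S A \<Longrightarrow> polarizable S (\<lambda>w. det (A w))"
  unfolding det_def mpolar_def by (intro polarizable_sum polarizable_mult polarizable_prod) auto

text \<open>Cramer's rule shows that inversion preserves polarizable and holomorphic dependence on parameters.\<close>

lemma matrix_inv_cramer:
  fixes A :: "complex^'r^'r"
  assumes "invertible A"
  shows "matrix_inv A $ i $ j = det (\<chi> k l. if l = i then (mat 1 :: complex^'r^'r) $ k $ j else A $ k $ l) * inverse (det A)"
proof -
  have d: "det A \<noteq> 0" using assms invertible_det_nz by blast
  have "A *v (\<chi> k. matrix_inv A $ k $ j) = (\<chi> k. (mat 1 :: complex^'r^'r) $ k $ j)"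
  proof -
    have "A ** matrix_inv A = mat 1"
      using assms someI_ex[of "\<lambda>B. A ** B = mat 1 \<and> B ** A = mat 1"] unfolding invertible_def matrix_inv_def by blast
    then have "(A ** matrix_inv A) $ k $ j = (mat 1 :: complex^'r^'r) $ k $ j" for k by simp
    then show ?thesis by (simp add: vec_eq_iff matrix_vector_mult_def matrix_matrix_mult_def)
  qed
  then have "(\<chi> k. matrix_inv A $ k $ j) = (\<chi> i. det (\<chi> k l. if l = i then (\<chi> k. (mat 1 :: complex^'r^'r) $ k $ j) $ k else A $ k $ l) / det A)"
    using cramer[OF d] by blast
  then have "(\<chi> k. matrix_inv A $ k $ j) $ i = (\<chi> i. det (\<chi> k l. if l = i then (\<chi> k. (mat 1 :: complex^'r^'r) $ k $ j) $ k else A $ k $ l) / det A) $ i"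
    by simp
  then show ?thesis by (simp add: divide_inverse cong: if_cong)
qed

lemma matrix_inv_mult:
  assumes "invertible A"
  shows "A ** matrix_inv A = mat 1" "matrix_inv A ** A = mat 1"
  using assms someI_ex[of "\<lambda>B. A ** B = mat 1 \<and> B ** A = mat 1"] unfolding invertible_def matrix_inv_def by blast+

lemma mpolar_inv:
  fixes A :: "'m::finite cvec \<Rightarrow> complex^'r^'r"
  assumes A: "mpolar S A" and inv: "\<And>w. w \<in> S \<Longrightarrow> invertible (A w)"
  shows "mpolar S (\<lambda>w. matrix_inv (A w))"
  unfolding mpolar_def
proof (intro allI)
  fix i j
  have "polarizable S (\<lambda>w. det (\<chi> k l. if l = i then (mat 1 :: complex^'r^'r) $ k $ j else A w $ k $ l) * inverse (det (A w)))"
  proof (intro polarizable_mult polarizable_inverse polarizable_det A)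
    show "mpolar S (\<lambda>w. \<chi> k l. if l = i then (mat 1 :: complex^'r^'r) $ k $ j else A w $ k $ l)"
      unfolding mpolar_def
    proof (intro allI)
      show "polarizable S (\<lambda>w. (\<chi> k l. if l = i then (mat 1 :: complex^'r^'r) $ k $ j else A w $ k $ l) $ k $ l)" for k l
        using A by (cases "l = i") (auto simp: mpolar_def)
    qed
    show "det (A w) \<noteq> 0" if "w \<in> S" for w using inv[OF that] invertible_det_nz by blast
  qed
  then show "polarizable S (\<lambda>w. matrix_inv (A w) $ i $ j)"
    by (rule polarizable_cong) (simp add: matrix_inv_cramer inv)
qed

lemma matrix_algebra:
  fixes A B C :: "'a::ring_1 ^'n^'n"
  shows "(A + B) ** C = A ** C + B ** C" "C ** (A + B) = C ** A + C ** B"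
    "(A - B) ** C = A ** C - B ** C" "C ** (A - B) = C ** A - C ** B"
    "(A ** B) ** C = A ** (B ** C)" "0 ** A = 0" "A ** 0 = 0" "(- A) ** B = - (A ** B)" "A ** (- B) = - (A ** B)"
  by (simp_all add: matrix_mul_assoc)
    (simp_all add: vec_eq_iff matrix_matrix_mult_def algebra_simps sum.distrib sum_subtractf sum_negf)

context
  fixes S :: "'m::finite cvec set"
  assumes S: "open S"
begin

lemma mderiv_cong: "(\<And>w. w \<in> S \<Longrightarrow> A w = B w) \<Longrightarrow> w \<in> S \<Longrightarrow> mderiv x A w = mderiv x B w"
  unfolding mderiv_def by (intro arg_cong[where f=vec_lambda] ext ddir_cong[OF S]) auto

lemma mderiv_mult:
  assumes "mpolar S A" "mpolar S B" "w \<in> S"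
  shows "mderiv x (\<lambda>w. A w ** B w) w = mderiv x A w ** B w + A w ** mderiv x B w"
proof -
  have "ddir x (\<lambda>w. \<Sum>k\<in>UNIV. A w $ a $ k * B w $ k $ b) w =
      (\<Sum>k\<in>UNIV. ddir x (\<lambda>w. A w $ a $ k) w * B w $ k $ b + A w $ a $ k * ddir x (\<lambda>w. B w $ k $ b) w)" for a b
  proof -
    have "ddir x (\<lambda>w. \<Sum>k\<in>UNIV. A w $ a $ k * B w $ k $ b) w = (\<Sum>k\<in>UNIV. ddir x (\<lambda>w. A w $ a $ k * B w $ k $ b) w)"
      using assms S by (intro ddir_sum) (auto simp: mpolar_def)
    also have "\<dots> = (\<Sum>k\<in>UNIV. ddir x (\<lambda>w. A w $ a $ k) w * B w $ k $ b + A w $ a $ k * ddir x (\<lambda>w. B w $ k $ b) w)"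
      using assms by (intro sum.cong refl ddir_mult[OF S]) (auto simp: mpolar_def)
    finally show ?thesis .
  qed
  then show ?thesis by (simp add: vec_eq_iff matrix_matrix_mult_def sum.distrib)
qed

lemma mderiv_add:
  assumes "mpolar S A" "mpolar S B" "w \<in> S"
  shows "mderiv x (\<lambda>w. A w + B w) w = mderiv x A w + mderiv x B w"
  using assms by (simp add: vec_eq_iff mpolar_def ddir_add' polarizable_differentiable[OF _ S])

lemma mderiv_diff:
  assumes "mpolar S A" "mpolar S B" "w \<in> S"
  shows "mderiv x (\<lambda>w. A w - B w) w = mderiv x A w - mderiv x B w"
  using assms by (simp add: vec_eq_iff mpolar_def ddir_diff' polarizable_differentiable[OF _ S])

lemma mderiv_commute: "mpolar S A \<Longrightarrow> w \<in> S \<Longrightarrow> mderiv x (mderiv y A) w = mderiv y (mderiv x A) w"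
  by (auto simp: vec_eq_iff mpolar_def intro: ddir_commute[OF _ S])

end

lemma mderiv_const [simp]: "mderiv x (\<lambda>_. A) = (\<lambda>_. 0)"
  by (simp add: fun_eq_iff vec_eq_iff)

context
  fixes S Z :: "'m::finite cvec set" and T :: "'m set"
  assumes S: "open S" and Z: "Z \<subseteq> S"
begin

lemma mjet_zero_cong:
  assumes "mjet_zero T p q n Z A" "\<And>w. w \<in> S \<Longrightarrow> A w = B w"
  shows "mjet_zero T p q n Z B"
  unfolding mjet_zero_def
proof (intro allI)
  fix a b
  show "jet_zero T p q n Z (\<lambda>w. B w $ a $ b)"
    by (rule jet_zero_cong[OF S Z, of _ _ _ _ "\<lambda>w. A w $ a $ b"]) (use assms in \<open>auto simp: mjet_zero_def\<close>)
qed

lemma mjet_zero_add: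
  "mpolar S A \<Longrightarrow> mpolar S B \<Longrightarrow> mjet_zero T p q n Z A \<Longrightarrow> mjet_zero T p q n Z B \<Longrightarrow>
    mjet_zero T p q n Z (\<lambda>w. A w + B w)"
  unfolding mjet_zero_def mpolar_def by (simp add: jet_zero_add[OF S Z])

lemma mjet_zero_diff:
  "mpolar S A \<Longrightarrow> mpolar S B \<Longrightarrow> mjet_zero T p q n Z A \<Longrightarrow> mjet_zero T p q n Z B \<Longrightarrow>
    mjet_zero T p q n Z (\<lambda>w. A w - B w)"
  unfolding mjet_zero_def mpolar_def by (simp add: jet_zero_diff[OF S Z])

lemma mjet_zero_mult_left:
  "mpolar S A \<Longrightarrow> mpolar S B \<Longrightarrow> mjet_zero T p q n Z A \<Longrightarrow> mjet_zero T p q n Z (\<lambda>w. A w ** B w)"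
  unfolding mjet_zero_def mpolar_def matrix_matrix_mult_def
  by (auto intro!: jet_zero_sum[OF S Z] jet_zero_mult[OF S Z] polarizable_mult)

lemma mjet_zero_mult_right:
  "mpolar S A \<Longrightarrow> mpolar S B \<Longrightarrow> mjet_zero T p q n Z B \<Longrightarrow> mjet_zero T p q n Z (\<lambda>w. A w ** B w)"
  unfolding mjet_zero_def mpolar_def matrix_matrix_mult_def
  by (auto intro!: jet_zero_sum[OF S Z] jet_zero_mult_right[OF S Z] polarizable_mult)

end

section \<open>Connection, curvature and covariant derivatives\<close>

text \<open>The matrix \<open>(\<partial>\<^sub>l H) H\<^sup>-\<^sup>1\<close> of the Chern connection.\<close>

definition conn :: "'m::finite \<Rightarrow> ('m cvec \<Rightarrow> complex^'r^'r) \<Rightarrow> 'm cvec \<Rightarrow> complex^'r^'r" where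
  "conn l H w = mderiv (Hol l) H w ** matrix_inv (H w)"

text \<open>
  The letters of \<open>ws\<close> are applied from left to right, so the last one is the outermost derivative;
  this explains the reversal of \<open>ws\<close> where words of plain derivatives appear.
\<close>

definition cov_word :: "('m::finite cvec \<Rightarrow> complex^'r^'r) \<Rightarrow> 'm \<Rightarrow> 'm \<Rightarrow> 'm direction list \<Rightarrow>
    'm cvec \<Rightarrow> complex^'r^'r" where
  "cov_word H i j ws = fold (cov_deriv H) ws (curvature i j H)"

lemma cov_word_Nil: "cov_word H i j [] = mderiv (Anti i) (conn j H)"
  by (simp add: cov_word_def curvature_def mat_wirt_mderiv conn_def[abs_def])

lemma cov_word_snoc:
  "cov_word H i j (ws @ [Hol l]) = (\<lambda>w. mderiv (Hol l) (cov_word H i j ws) w -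
     (conn l H w ** cov_word H i j ws w - cov_word H i j ws w ** conn l H w))"
  "cov_word H i j (ws @ [Anti l]) = mderiv (Anti l) (cov_word H i j ws)"
  by (simp_all add: cov_word_def mat_wirt_mderiv conn_def Let_def)

lemma mpolar_conn:
  assumes "open S" "mpolar S H" "\<And>w. w \<in> S \<Longrightarrow> invertible (H w)"
  shows "mpolar S (conn l H)"
  unfolding conn_def[abs_def] using assms by (intro mpolar_mult mpolar_deriv mpolar_inv)

lemma mpolar_cov_word:
  assumes S: "open S" and H: "mpolar S H" and inv: "\<And>w. w \<in> S \<Longrightarrow> invertible (H w)"
  shows "mpolar S (cov_word H i j ws)"
proof (induction ws rule: rev_induct)
  case Nil
  show ?case unfolding cov_word_Nil by (intro mpolar_deriv mpolar_conn S H inv)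
next
  case (snoc x ws)
  show ?case
    by (cases x; simp only: cov_word_snoc; intro mpolar_deriv mpolar_diff mpolar_mult mpolar_conn snoc S H inv)
qed

text \<open>
  If \<open>H' = b H b'\<close> with \<open>b\<close> holomorphic and \<open>b'\<close> antiholomorphic then the connections satisfy
  \<open>\<theta>' b = \<partial>b + b \<theta>\<close>; differentiating this identity transports it to the curvature and to
  all its covariant derivatives.
\<close>

lemma cov_word_gauge:
  assumes S: "open S" and pol: "mpolar S H" "mpolar S b" "mpolar S b'" "mpolar S H'"
    and hol: "\<And>l w. w \<in> S \<Longrightarrow> mderiv (Anti l) b w = 0" "\<And>l w. w \<in> S \<Longrightarrow> mderiv (Hol l) b' w = 0"
    and inv: "\<And>w. w \<in> S \<Longrightarrow> invertible (H w)" "\<And>w. w \<in> S \<Longrightarrow> invertible (H' w)"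
    and H': "\<And>w. w \<in> S \<Longrightarrow> H' w = b w ** (H w ** b' w)" and w: "w \<in> S"
  shows "cov_word H' i j ws w ** b w = b w ** cov_word H i j ws w"
proof -
  have c: "conn l H' w ** b w = mderiv (Hol l) b w + b w ** conn l H w" if w: "w \<in> S" for l w
  proof -
    have "mderiv (Hol l) H' w = mderiv (Hol l) (\<lambda>w. b w ** (H w ** b' w)) w"
      by (rule mderiv_cong[OF S H' w])
    also have "\<dots> = mderiv (Hol l) b w ** (H w ** b' w) + b w ** (mderiv (Hol l) H w ** b' w)"
      using w pol hol(2)[OF w] by (simp add: mderiv_mult[OF S] mpolar_mult matrix_algebra)
    finally have d: "mderiv (Hol l) H' w =
      mderiv (Hol l) b w ** (H w ** b' w) + b w ** (mderiv (Hol l) H w ** b' w)" .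
    define G where "G = matrix_inv (H' w)"
    have "b w ** (H w ** (b' w ** G)) = mat 1"
      using matrix_inv_mult(1)[OF inv(2)[OF w]] H'[OF w] by (simp add: G_def matrix_algebra)
    then have *: "(H w ** (b' w ** G)) ** b w = mat 1"
      using matrix_left_right_inverse by blast
    have "matrix_inv (H w) ** (H w ** (b' w ** (G ** b w))) = matrix_inv (H w)"
      using * by (simp add: matrix_algebra)
    then have **: "b' w ** (G ** b w) = matrix_inv (H w)"
      using matrix_inv_mult(2)[OF inv(1)[OF w]] by (simp add: matrix_mul_assoc)
    show ?thesis
      unfolding conn_def d using * ** by (simp add: matrix_algebra flip: G_def)
  qed
  note mc = mpolar_conn[OF S pol(1) inv(1)] mpolar_conn[OF S pol(4) inv(2)]
  have mw: "mpolar S (cov_word H i j ws)" "mpolar S (cov_word H' i j ws)" for ws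
    using mpolar_cov_word[OF S] pol inv by blast+
  show ?thesis
    using w
  proof (induction ws arbitrary: w rule: rev_induct)
    case Nil
    have "mderiv (Anti i) (\<lambda>w. conn j H' w ** b w) w = mderiv (Anti i) (\<lambda>w. mderiv (Hol j) b w + b w ** conn j H w) w"
      by (rule mderiv_cong[OF S c Nil])
    moreover have "mderiv (Anti i) (\<lambda>w. conn j H' w ** b w) w = mderiv (Anti i) (conn j H') w ** b w"
      using Nil pol mc hol(1)[OF Nil] by (simp add: mderiv_mult[OF S] matrix_algebra)
    moreover have "mderiv (Anti i) (\<lambda>w. mderiv (Hol j) b w + b w ** conn j H w) w = b w ** mderiv (Anti i) (conn j H) w"
    proof -
      have "mderiv (Anti i) (mderiv (Hol j) b) w = mderiv (Hol j) (\<lambda>_. 0) w"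
        unfolding mderiv_commute[OF S pol(2) Nil, of "Anti i"] by (rule mderiv_cong[OF S hol(1) Nil])
      then show ?thesis
        using Nil pol mc hol(1)[OF Nil]
        by (simp add: mderiv_add[OF S] mderiv_mult[OF S] mpolar_mult mpolar_deriv S matrix_algebra)
    qed
    ultimately show ?case by (simp add: cov_word_Nil)
  next
    case (snoc x ws)
    let ?A = "cov_word H i j ws" and ?A' = "cov_word H' i j ws"
    have eq: "mderiv x (\<lambda>w. ?A' w ** b w) w = mderiv x (\<lambda>w. b w ** ?A w) w"
      by (rule mderiv_cong[OF S snoc.IH snoc.prems])
    then have eq': "mderiv x ?A' w ** b w + ?A' w ** mderiv x b w = mderiv x b w ** ?A w + b w ** mderiv x ?A w"
      using snoc.prems pol mw by (simp add: mderiv_mult[OF S])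
    show ?case
    proof (cases x)
      case (Anti l)
      then show ?thesis using eq' hol(1)[OF snoc.prems] by (simp add: cov_word_snoc matrix_algebra)
    next
      case (Hol l)
      have e: "?A' w ** b w = b w ** ?A w" by (rule snoc.IH[OF snoc.prems])
      have "(conn l H' w ** ?A' w - ?A' w ** conn l H' w) ** b w =
          conn l H' w ** (?A' w ** b w) - ?A' w ** (conn l H' w ** b w)"
        by (simp add: matrix_algebra)
      also have "\<dots> = (conn l H' w ** b w) ** ?A w - ?A' w ** (conn l H' w ** b w)"
        by (simp add: e matrix_algebra)
      also have "\<dots> = mderiv x b w ** ?A w + b w ** (conn l H w ** ?A w) - ?A' w ** mderiv x b w - (?A' w ** b w) ** conn l H w"
        unfolding c[OF snoc.prems] by (simp add: matrix_algebra Hol)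
      also have "\<dots> = mderiv x b w ** ?A w + b w ** (conn l H w ** ?A w) - ?A' w ** mderiv x b w - b w ** (?A w ** conn l H w)"
        by (simp add: e matrix_algebra)
      finally show ?thesis
        using eq' by (simp add: Hol cov_word_snoc matrix_algebra) (simp add: algebra_simps)
    qed
  qed
qed

text \<open>
  Let \<open>X = H - H'\<close>.  The connections differ by \<open>(\<partial>\<^sub>l X) H\<^sup>-\<^sup>1 + (\<partial>\<^sub>l H') (H\<^sup>-\<^sup>1 - H'\<^sup>-\<^sup>1)\<close>, and the second
  summand is \<open>X\<close> between two other factors.  So each derivative that is
  taken moves one derivative onto \<open>X\<close>, and every term in which some derivative falls on another
  factor contains a derivative of \<open>X\<close> of lower order, which vanishes on \<open>Z\<close> by hypothesis.
\<close>

lemma cov_word_leading_term: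
  fixes H H' :: "'m::finite cvec \<Rightarrow> complex^'r^'r"
  assumes S: "open S" and Z: "Z \<subseteq> S" and pol: "mpolar S H" "mpolar S H'"
    and inv: "\<And>w. w \<in> S \<Longrightarrow> invertible (H w)" "\<And>w. w \<in> S \<Longrightarrow> invertible (H' w)"
    and X: "mjet_zero T k k n Z (\<lambda>w. H w - H' w)" and ij: "i \<in> T" "j \<in> T"
    and ws: "set ws \<subseteq> dirs T" "p + nhol ws + 1 \<le> k" "q + nanti ws + 1 \<le> k" "m + length ws + 1 \<le> n"
  shows "mjet_zero T p q m Z (\<lambda>w. cov_word H i j ws w - cov_word H' i j ws w -
    mderivs (rev ws @ [Anti i, Hol j]) (\<lambda>w. H w - H' w) w ** matrix_inv (H w))"
proof -
  let ?X = "\<lambda>w. H w - H' w" and ?G = "\<lambda>w. matrix_inv (H w)" and ?G' = "\<lambda>w. matrix_inv (H' w)"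
  let ?E = "\<lambda>l w. mderiv (Hol l) H' w ** (?G w - ?G' w)"
  have pX: "mpolar S ?X" using pol by blast
  note pG = mpolar_inv[OF pol(1) inv(1)] mpolar_inv[OF pol(2) inv(2)]
  note pc = mpolar_conn[OF S pol(1) inv(1)] mpolar_conn[OF S pol(2) inv(2)]
  have pw: "mpolar S (cov_word H i j ws)" "mpolar S (cov_word H' i j ws)" for ws
    using mpolar_cov_word[OF S] pol inv by blast+
  have pE: "mpolar S (?E l)" for l
    by (intro mpolar_mult mpolar_diff mpolar_deriv S pol pG)
  (* the resolvent identity: the difference of the inverses is a multiple of X *)
  have jG: "mjet_zero T k k n Z (\<lambda>w. ?G w - ?G' w)"
  proof (rule mjet_zero_cong[OF S Z])
    show "mjet_zero T k k n Z (\<lambda>w. (0 - ?G w) ** (?X w ** ?G' w))"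
      by (intro mjet_zero_mult_left[OF S Z] mjet_zero_mult_right[OF S Z] X mpolar_mult mpolar_diff mpolar_const pX pG pol)
    fix w assume w: "w \<in> S"
    show "(0 - ?G w) ** (?X w ** ?G' w) = ?G w - ?G' w"
      using matrix_inv_mult[OF inv(1)[OF w]] matrix_inv_mult[OF inv(2)[OF w]]
      by (simp add: matrix_algebra) (simp add: matrix_mul_assoc)
  qed
  have jE: "mjet_zero T k k n Z (?E l)" for l
    by (intro mjet_zero_mult_right[OF S Z] jG mpolar_deriv mpolar_diff S pol pG)
  have conn_diff: "conn l H w - conn l H' w = mderiv (Hol l) ?X w ** ?G w + ?E l w" if "w \<in> S" for l w
    using that pol by (simp add: conn_def mderiv_diff[OF S] matrix_algebra)
  show ?thesis
    using ws
  proof (induction ws arbitrary: p q m rule: rev_induct)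
    case Nil
    have jX: "mjet_zero T p q m Z (mderiv (Hol j) ?X)"
      by (rule mjet_zero_deriv[OF X]) (use ij Nil in auto)
    have "mjet_zero T p q m Z (\<lambda>w. mderiv (Hol j) ?X w ** mderiv (Anti i) ?G w + mderiv (Anti i) (?E j) w)"
      by (intro mjet_zero_add[OF S Z] mjet_zero_mult_left[OF S Z] jX mpolar_mult mpolar_deriv S pX pG pE
          mjet_zero_deriv[OF jE]) (use ij Nil in auto)
    then show ?case
    proof (rule mjet_zero_cong[OF S Z])
      fix w assume w: "w \<in> S"
      have "mderiv (Anti i) (conn j H) w - mderiv (Anti i) (conn j H') w = mderiv (Anti i) (\<lambda>w. conn j H w - conn j H' w) w"
        using mderiv_diff[OF S pc w] by simp
      also have "\<dots> = mderiv (Anti i) (\<lambda>w. mderiv (Hol j) ?X w ** ?G w + ?E j w) w"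
        by (rule mderiv_cong[OF S conn_diff w])
      also have "\<dots> = mderiv (Anti i) (mderiv (Hol j) ?X) w ** ?G w + mderiv (Hol j) ?X w ** mderiv (Anti i) ?G w + mderiv (Anti i) (?E j) w"
        by (simp only: mderiv_add[OF S mpolar_mult[OF mpolar_deriv[OF pX S] pG(1)] pE w]
            mderiv_mult[OF S mpolar_deriv[OF pX S] pG(1) w])
      finally show "mderiv (Hol j) ?X w ** mderiv (Anti i) ?G w + mderiv (Anti i) (?E j) w =
        cov_word H i j [] w - cov_word H' i j [] w - mderivs (rev [] @ [Anti i, Hol j]) ?X w ** ?G w"
        by (simp add: cov_word_Nil)
    qed
  next
    case (snoc x ws)
    let ?A = "cov_word H i j ws" and ?A' = "cov_word H' i j ws" and ?Y = "mderivs (rev ws @ [Anti i, Hol j]) ?X"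
    (* R is the remainder of the shorter word; it is controlled to one more order *)
    let ?R = "\<lambda>w. ?A w - ?A' w - ?Y w ** ?G w"
    have x: "x \<in> dirs T" using snoc.prems(1) by simp
    have pY: "mpolar S ?Y" by (rule mpolar_derivs[OF pX S])
    have pR: "mpolar S ?R" by (intro mpolar_diff mpolar_mult pw pY pG)
    have jR: "mjet_zero T (p + nhol [x]) (q + nanti [x]) (m + 1) Z ?R"
      by (rule snoc.IH) (use snoc.prems in auto)
    have jR': "mjet_zero T p q m Z ?R" by (rule mjet_zero_mono[OF jR]) auto
    have jdR: "mjet_zero T p q m Z (mderiv x ?R)" by (rule mjet_zero_deriv[OF jR x]) auto
    have jY: "mjet_zero T p q m Z ?Y"
      by (rule mjet_zero_derivs[OF X]) (use snoc.prems ij in auto)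
    have dA: "mderiv x ?A w - mderiv x ?A' w - mderiv x ?Y w ** ?G w = ?Y w ** mderiv x ?G w + mderiv x ?R w"
      if w: "w \<in> S" for w
    proof -
      have "mderiv x ?R w = mderiv x ?A w - mderiv x ?A' w - (mderiv x ?Y w ** ?G w + ?Y w ** mderiv x ?G w)"
        by (simp only: mderiv_diff[OF S mpolar_diff[OF pw(1)[of ws] pw(2)[of ws]] mpolar_mult[OF pY pG(1)] w]
            mderiv_diff[OF S pw(1)[of ws] pw(2)[of ws] w] mderiv_mult[OF S pY pG(1) w])
      then show ?thesis by simp
    qed
    have j1: "mjet_zero T p q m Z (\<lambda>w. ?Y w ** mderiv x ?G w + mderiv x ?R w)"
      by (intro mjet_zero_add[OF S Z] mjet_zero_mult_left[OF S Z] jY jdR mpolar_mult mpolar_deriv S pY pG pR)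
    show ?case
    proof (cases x)
      case (Anti l)
      show ?thesis
        by (rule mjet_zero_cong[OF S Z j1]) (use dA in \<open>simp add: Anti cov_word_snoc\<close>)
    next
      case (Hol l)
      (* the commutator with the connection is bilinear, so its change involves D and B only *)
      let ?D = "\<lambda>w. conn l H w - conn l H' w" and ?B = "\<lambda>w. ?A w - ?A' w"
      have pD: "mpolar S ?D" by (rule mpolar_diff[OF pc])
      have pB: "mpolar S ?B" by (rule mpolar_diff[OF pw])
      have jD: "mjet_zero T p q m Z ?D"
      proof (rule mjet_zero_cong[OF S Z])
        show "mjet_zero T p q m Z (\<lambda>w. mderiv (Hol l) ?X w ** ?G w + ?E l w)"
          by (intro mjet_zero_add[OF S Z] mjet_zero_mult_left[OF S Z] mpolar_mult mpolar_deriv S pX pG pE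
             mjet_zero_deriv[OF X] mjet_zero_mono[OF jE]) (use x snoc.prems Hol in auto)
      qed (simp add: conn_diff)
      have jB: "mjet_zero T p q m Z ?B"
      proof (rule mjet_zero_cong[OF S Z])
        show "mjet_zero T p q m Z (\<lambda>w. ?Y w ** ?G w + ?R w)"
          by (intro mjet_zero_add[OF S Z] mjet_zero_mult_left[OF S Z] jY jR' mpolar_mult pY pG pR)
      qed simp
      have "mjet_zero T p q m Z (\<lambda>w. (?Y w ** mderiv x ?G w + mderiv x ?R w) -
          ((?D w ** ?A w + conn l H' w ** ?B w) - (?B w ** conn l H w + ?A' w ** ?D w)))"
        by (intro mjet_zero_diff[OF S Z] mjet_zero_add[OF S Z _ _ _ mjet_zero_mult_right[OF S Z _ _ jB]]
            mjet_zero_add[OF S Z _ _ _ mjet_zero_mult_right[OF S Z _ _ jD]] mjet_zero_mult_left[OF S Z _ _ jD] mjet_zero_mult_left[OF S Z _ _ jB]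
            mjet_zero_mult_right[OF S Z _ _ jD] mjet_zero_mult_right[OF S Z _ _ jB] j1
            mpolar_diff mpolar_add mpolar_mult mpolar_deriv S pY pG pR pD pB pw pc)
      then show ?thesis
      proof (rule mjet_zero_cong[OF S Z])
        fix w assume w: "w \<in> S"
        show "(?Y w ** mderiv x ?G w + mderiv x ?R w) -
          ((?D w ** ?A w + conn l H' w ** ?B w) - (?B w ** conn l H w + ?A' w ** ?D w)) =
          cov_word H i j (ws @ [x]) w - cov_word H' i j (ws @ [x]) w -
          mderivs (rev (ws @ [x]) @ [Anti i, Hol j]) ?X w ** ?G w"
          unfolding dA[OF w, symmetric] by (simp add: Hol cov_word_snoc matrix_algebra)
      qed
    qed
  qed
qed

section \<open>Hilbert spaces of functions\<close>

context hilbert_fspace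
begin

lemma car_zero [simp]: "0 \<in> car M" by (rule fun_vs.subspace_0[OF subspace])
lemma car_add [intro]: "x \<in> car M \<Longrightarrow> y \<in> car M \<Longrightarrow> x + y \<in> car M" by (rule fun_vs.subspace_add[OF subspace])
lemma car_diff [intro]: "x \<in> car M \<Longrightarrow> y \<in> car M \<Longrightarrow> x - y \<in> car M" by (rule fun_vs.subspace_diff[OF subspace])
lemma car_scale [intro]: "x \<in> car M \<Longrightarrow> fscale c x \<in> car M" by (rule fun_vs.subspace_scale[OF subspace])
lemma car_sum [intro]: "(\<And>a. a \<in> A \<Longrightarrow> f a \<in> car M) \<Longrightarrow> sum f A \<in> car M" by (rule fun_vs.subspace_sum[OF subspace])

lemma ip_add_right: "x \<in> car M \<Longrightarrow> y \<in> car M \<Longrightarrow> z \<in> car M \<Longrightarrow> ip M z (x + y) = ip M z x + ip M z y"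
  by (metis car_add complex_cnj_add ip_add ip_cnj)
lemma ip_scale_right: "x \<in> car M \<Longrightarrow> y \<in> car M \<Longrightarrow> ip M y (fscale c x) = cnj c * ip M y x"
  by (metis car_scale complex_cnj_mult ip_scale ip_cnj)
lemma ip_diff_left: "x \<in> car M \<Longrightarrow> y \<in> car M \<Longrightarrow> z \<in> car M \<Longrightarrow> ip M (x - y) z = ip M x z - ip M y z"
  using ip_add[of "x - y" y z] by (simp add: car_diff)
lemma ip_diff_right: "x \<in> car M \<Longrightarrow> y \<in> car M \<Longrightarrow> z \<in> car M \<Longrightarrow> ip M z (x - y) = ip M z x - ip M z y"
  using ip_add_right[of "x - y" y z] by (simp add: car_diff)
lemma ip_zero [simp]: "x \<in> car M \<Longrightarrow> ip M 0 x = 0" "x \<in> car M \<Longrightarrow> ip M x 0 = 0"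
  using ip_diff_left[of x x x] ip_diff_right[of x x x] by simp_all
lemma ip_sum_left: "(\<And>a. a \<in> A \<Longrightarrow> f a \<in> car M) \<Longrightarrow> y \<in> car M \<Longrightarrow> ip M (sum f A) y = (\<Sum>a\<in>A. ip M (f a) y)"
  by (induction A rule: infinite_finite_induct) (simp_all add: ip_add car_sum)
lemma ip_sum_right: "(\<And>a. a \<in> A \<Longrightarrow> f a \<in> car M) \<Longrightarrow> y \<in> car M \<Longrightarrow> ip M y (sum f A) = (\<Sum>a\<in>A. ip M y (f a))"
  by (induction A rule: infinite_finite_induct) (simp_all add: ip_add_right car_sum)


lemma ip_self_Im: "x \<in> car M \<Longrightarrow> Im (ip M x x) = 0"
  using ip_cnj[of x x] by (simp add: complex_eq_iff)
lemma ip_self_nonneg: "x \<in> car M \<Longrightarrow> 0 \<le> Re (ip M x x)"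
  using ip_pos[of x] by (cases "x = 0") auto
lemma hnorm_ge0 [simp]: "x \<in> car M \<Longrightarrow> 0 \<le> hnorm M x"
  unfolding hnorm_def using ip_self_nonneg by simp
lemma hnorm_power2: "x \<in> car M \<Longrightarrow> (hnorm M x)\<^sup>2 = Re (ip M x x)"
  unfolding hnorm_def using ip_self_nonneg by simp
lemma ip_self: "x \<in> car M \<Longrightarrow> ip M x x = of_real ((hnorm M x)\<^sup>2)"
  by (simp add: hnorm_power2 complex_eq_iff ip_self_Im)
lemma hnorm_eq_0: "x \<in> car M \<Longrightarrow> hnorm M x = 0 \<longleftrightarrow> x = 0"
  using ip_pos[of x] hnorm_power2[of x] by (cases "x = 0") (auto simp: hnorm_def)

lemma hnorm_scale: "x \<in> car M \<Longrightarrow> hnorm M (fscale c x) = cmod c * hnorm M x"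
proof -
  assume x: "x \<in> car M"
  have "ip M (fscale c x) (fscale c x) = of_real ((cmod c * hnorm M x)\<^sup>2)"
  proof -
    have "ip M (fscale c x) (fscale c x) = (c * cnj c) * ip M x x"
      using x by (simp add: ip_scale ip_scale_right car_scale)
    also have "\<dots> = of_real ((cmod c)\<^sup>2) * of_real ((hnorm M x)\<^sup>2)"
      by (simp only: complex_norm_square ip_self[OF x])
    also have "\<dots> = of_real ((cmod c * hnorm M x)\<^sup>2)" by (simp add: power_mult_distrib)
    finally show ?thesis .
  qed
  then have "(hnorm M (fscale c x))\<^sup>2 = (cmod c * hnorm M x)\<^sup>2"
    using x by (simp only: hnorm_power2 car_scale Re_complex_of_real)
  then show ?thesis using x by (simp add: power2_eq_iff_nonneg car_scale)
qed

lemma hnorm_uminus_diff: "x \<in> car M \<Longrightarrow> y \<in> car M \<Longrightarrow> hnorm M (x - y) = hnorm M (y - x)"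
proof -
  assume "x \<in> car M" "y \<in> car M"
  then have "hnorm M (fscale (-1) (y - x)) = hnorm M (y - x)" by (subst hnorm_scale) auto
  moreover have "fscale (-1) (y - x) = x - y" by (simp add: fscale_def fun_eq_iff vec_eq_iff)
  ultimately show "hnorm M (x - y) = hnorm M (y - x)" by simp
qed

lemma hnorm_diff_power2:
  assumes "x \<in> car M" "y \<in> car M"
  shows "(hnorm M (x - y))\<^sup>2 = (hnorm M x)\<^sup>2 - 2 * Re (ip M x y) + (hnorm M y)\<^sup>2"
proof -
  have "Re (ip M y x) = Re (ip M x y)" using ip_cnj[OF assms] by simp
  then show ?thesis using assms by (simp add: hnorm_power2 car_diff ip_diff_left ip_diff_right)
qed

lemma cauchy_schwarz:
  assumes x: "x \<in> car M" and y: "y \<in> car M"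
  shows "cmod (ip M x y) \<le> hnorm M x * hnorm M y"
proof (cases "y = 0")
  case False
  then have n: "hnorm M y > 0" using hnorm_eq_0[OF y] hnorm_ge0[OF y] by linarith
  define c where "c = ip M x y / of_real ((hnorm M y)\<^sup>2)"
  have "0 \<le> (hnorm M (x - fscale c y))\<^sup>2" by simp
  also have "\<dots> = (hnorm M x)\<^sup>2 - 2 * Re (cnj c * ip M x y) + (cmod c)\<^sup>2 * (hnorm M y)\<^sup>2"
    using x y by (simp add: hnorm_diff_power2 car_scale ip_scale_right hnorm_scale power_mult_distrib)
  also have "cnj c * ip M x y = of_real ((cmod (ip M x y))\<^sup>2 / (hnorm M y)\<^sup>2)"
    unfolding c_def by (simp add: complex_norm_square[symmetric] mult.commute)
  also have "(cmod c)\<^sup>2 * (hnorm M y)\<^sup>2 = (cmod (ip M x y))\<^sup>2 / (hnorm M y)\<^sup>2"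
  proof -
    have "cmod c = cmod (ip M x y) / (hnorm M y)\<^sup>2"
      unfolding c_def norm_divide norm_of_real by simp
    then show ?thesis using n by (simp add: power_divide) (simp add: field_simps power2_eq_square power4_eq_xxxx)
  qed
  finally have "(cmod (ip M x y))\<^sup>2 / (hnorm M y)\<^sup>2 \<le> (hnorm M x)\<^sup>2" by simp
  then have "(cmod (ip M x y))\<^sup>2 \<le> (hnorm M x * hnorm M y)\<^sup>2"
    using n by (simp add: divide_le_eq power_mult_distrib)
  then show ?thesis using x y by (meson hnorm_ge0 mult_nonneg_nonneg power2_le_imp_le)
qed (simp add: x)

lemma parallelogram:
  assumes "x \<in> car M" "y \<in> car M"
  shows "(hnorm M (y - x))\<^sup>2 + (hnorm M (x + y))\<^sup>2 = 2 * (hnorm M x)\<^sup>2 + 2 * (hnorm M y)\<^sup>2"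
  using assms by (simp add: hnorm_power2 car_add car_diff ip_add ip_add_right ip_diff_left ip_diff_right)

lemma hnorm_triangle:
  assumes "x \<in> car M" "y \<in> car M"
  shows "hnorm M (x + y) \<le> hnorm M x + hnorm M y"
proof -
  have "(hnorm M (x + y))\<^sup>2 = (hnorm M x)\<^sup>2 + 2 * Re (ip M x y) + (hnorm M y)\<^sup>2"
  proof -
    have "Re (ip M y x) = Re (ip M x y)" using ip_cnj[OF assms] by simp
    then show ?thesis using assms by (simp add: hnorm_power2 car_add ip_add ip_add_right)
  qed
  also have "\<dots> \<le> (hnorm M x + hnorm M y)\<^sup>2"
    using cauchy_schwarz[OF assms] complex_Re_le_cmod[of "ip M x y"]
    by (simp add: power2_sum)
  finally show ?thesis using assms by (meson add_nonneg_nonneg hnorm_ge0 power2_le_imp_le)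
qed

lemma hnorm_triangle_diff:
  assumes "x \<in> car M" "y \<in> car M" "z \<in> car M"
  shows "hnorm M (x - z) \<le> hnorm M (x - y) + hnorm M (y - z)"
  using hnorm_triangle[of "x - y" "y - z"] assms by (simp add: car_diff)

lemma hnorm_limit:
  assumes X: "\<And>n. X n \<in> car M" and x: "x \<in> car M" and lim: "(\<lambda>n. hnorm M (X n - x)) \<longlonglongrightarrow> 0"
  shows "(\<lambda>n. hnorm M (X n)) \<longlonglongrightarrow> hnorm M x"
    and "y \<in> car M \<Longrightarrow> (\<lambda>n. ip M (X n) y) \<longlonglongrightarrow> ip M x y"
proof -
  show "(\<lambda>n. hnorm M (X n)) \<longlonglongrightarrow> hnorm M x"
  proof (rule Lim_transform2[OF tendsto_const])
    show "(\<lambda>n. hnorm M x - hnorm M (X n)) \<longlonglongrightarrow> 0"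
    proof (rule Lim_null_comparison[OF _ lim])
      show "\<forall>\<^sub>F n in sequentially. norm (hnorm M x - hnorm M (X n)) \<le> hnorm M (X n - x)"
      proof (intro always_eventually allI)
        fix n
        have "hnorm M x \<le> hnorm M (x - X n) + hnorm M (X n)" "hnorm M (X n) \<le> hnorm M (X n - x) + hnorm M x"
          using hnorm_triangle[of "x - X n" "X n"] hnorm_triangle[of "X n - x" x] x X[of n] by (simp_all add: car_diff)
        then show "norm (hnorm M x - hnorm M (X n)) \<le> hnorm M (X n - x)"
          using hnorm_uminus_diff[OF x X] by (simp add: abs_le_iff)
      qed
    qed
  qed
  assume y: "y \<in> car M"
  show "(\<lambda>n. ip M (X n) y) \<longlonglongrightarrow> ip M x y"
  proof (rule Lim_transform2[OF tendsto_const])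
    show "(\<lambda>n. ip M x y - ip M (X n) y) \<longlonglongrightarrow> 0"
    proof (rule Lim_null_comparison)
      show "\<forall>\<^sub>F n in sequentially. norm (ip M x y - ip M (X n) y) \<le> hnorm M (X n - x) * hnorm M y"
      proof (intro always_eventually allI)
        fix n
        have "ip M x y - ip M (X n) y = ip M (x - X n) y" using x y X by (simp add: ip_diff_left)
        then show "norm (ip M x y - ip M (X n) y) \<le> hnorm M (X n - x) * hnorm M y"
          using cauchy_schwarz[of "x - X n" y] x y X by (simp add: car_diff hnorm_uminus_diff)
      qed
      show "(\<lambda>n. hnorm M (X n - x) * hnorm M y) \<longlonglongrightarrow> 0" using tendsto_mult_left_zero[OF lim] .
    qed
  qed
qed

section \<open>Projections and the Riesz representation theorem\<close>

definition hclosed :: "('m, 'r) vfun set \<Rightarrow> bool" where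
  "hclosed S \<longleftrightarrow> S \<subseteq> car M \<and> fun_vs.subspace S \<and>
     (\<forall>X x. (\<forall>n::nat. X n \<in> S) \<longrightarrow> x \<in> car M \<longrightarrow> (\<lambda>n. hnorm M (X n - x)) \<longlonglongrightarrow> 0 \<longrightarrow> x \<in> S)"

text \<open>
  The projection onto the closure of a subspace that need not be closed: a minimizing sequence in
  the subspace is a Cauchy sequence by the parallelogram law.
\<close>

lemma approximate_projection:
  assumes S: "S \<subseteq> car M" "fun_vs.subspace S" and h: "h \<in> car M"
  obtains p X where "p \<in> car M" "\<And>n::nat. X n \<in> S" "(\<lambda>n. hnorm M (X n - p)) \<longlonglongrightarrow> 0"
    "\<And>g. g \<in> S \<Longrightarrow> ip M (h - p) g = 0"
proof -
  define D where "D = (\<lambda>s. (hnorm M (h - s))\<^sup>2) ` S"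
  have S0: "0 \<in> S" using S(2) by (rule fun_vs.subspace_0)
  have D: "D \<noteq> {}" "bdd_below D" using S0 by (auto simp: D_def intro: bdd_belowI[of _ 0])
  define d where "d = Inf D"
  have dle: "d \<le> (hnorm M (h - s))\<^sup>2" if "s \<in> S" for s
    unfolding d_def by (rule cInf_lower[OF _ D(2)]) (use that in \<open>auto simp: D_def\<close>)
  have "\<exists>s\<in>S. (hnorm M (h - s))\<^sup>2 < d + inverse (real (Suc n))" for n
    using cInf_lessD[OF D(1), of "d + inverse (real (Suc n))"] by (auto simp: d_def D_def)
  then obtain X where X: "\<And>n. X n \<in> S" "\<And>n. (hnorm M (h - X n))\<^sup>2 < d + inverse (real (Suc n))" by metis
  have XM: "X n \<in> car M" for n using X(1) S(1) by blast
  have mid: "(hnorm M (X n - X m))\<^sup>2 \<le> 2 * inverse (real (Suc n)) + 2 * inverse (real (Suc m))" for n m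
  proof -
    let ?s = "fscale (1/2) (X n + X m)"
    have s: "?s \<in> S" by (intro fun_vs.subspace_scale fun_vs.subspace_add S X)
    let ?a = "h - X n" and ?b = "h - X m"
    have ab: "?a \<in> car M" "?b \<in> car M" using h XM by auto
    have "h - ?s = fscale (1/2) (?a + ?b)"
      by (simp add: fscale_def fun_eq_iff vec_eq_iff field_simps)
    then have "hnorm M (h - ?s) = 1/2 * hnorm M (?a + ?b)"
      using hnorm_scale[OF car_add[OF ab], of "1/2"] by (simp only:) (simp add: norm_divide)
    then have 1: "4 * (hnorm M (h - ?s))\<^sup>2 = (hnorm M (?a + ?b))\<^sup>2"
      by (simp only: power_mult_distrib) (simp add: power_divide)
    have 2: "X n - X m = ?b - ?a" by simp
    have "(hnorm M (?b - ?a))\<^sup>2 + (hnorm M (?a + ?b))\<^sup>2 = 2 * (hnorm M ?a)\<^sup>2 + 2 * (hnorm M ?b)\<^sup>2"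
      by (rule parallelogram[OF ab])
    with 1 dle[OF s] X(2)[of n] X(2)[of m] show ?thesis unfolding 2 by linarith
  qed
  have "\<exists>p\<in>car M. (\<lambda>n. hnorm M (X n - p)) \<longlonglongrightarrow> 0"
  proof (rule complete[OF XM], intro allI impI)
    fix e :: real assume e: "e > 0"
    obtain N where N: "inverse (real (Suc N)) < e\<^sup>2 / 4" using reals_Archimedean[of "e\<^sup>2/4"] e by auto
    have "hnorm M (X n - X m) < e" if "n \<ge> N" "m \<ge> N" for n m
    proof -
      have "inverse (real (Suc n)) \<le> inverse (real (Suc N))" "inverse (real (Suc m)) \<le> inverse (real (Suc N))"
        using that by (simp_all add: field_simps)
      then have "(hnorm M (X n - X m))\<^sup>2 < e\<^sup>2" using mid[of n m] N by linarith
      then show ?thesis using e by (simp add: power_less_imp_less_base)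
    qed
    then show "\<exists>n0. \<forall>n\<ge>n0. \<forall>n'\<ge>n0. hnorm M (X n - X n') < e" by blast
  qed
  then obtain p where p: "p \<in> car M" "(\<lambda>n. hnorm M (X n - p)) \<longlonglongrightarrow> 0" by blast
  have "(\<lambda>n. hnorm M ((h - X n) - (h - p))) \<longlonglongrightarrow> 0"
  proof -
    have "hnorm M ((h - X n) - (h - p)) = hnorm M (X n - p)" for n
      using hnorm_uminus_diff[OF XM p(1)] by simp
    then show ?thesis using p(2) by simp
  qed
  then have limh: "(\<lambda>n. (hnorm M (h - X n))\<^sup>2) \<longlonglongrightarrow> (hnorm M (h - p))\<^sup>2"
    using hnorm_limit(1)[of "\<lambda>n. h - X n" "h - p"] XM p(1) h by (intro tendsto_power) auto
  have hp: "(hnorm M (h - p))\<^sup>2 \<le> d"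
  proof (rule LIMSEQ_le[OF limh])
    show "(\<lambda>n. d + inverse (real (Suc n))) \<longlonglongrightarrow> d"
      using tendsto_add[OF tendsto_const LIMSEQ_inverse_real_of_nat, of d] by simp
    show "\<exists>N. \<forall>n\<ge>N. (hnorm M (h - X n))\<^sup>2 \<le> d + inverse (real (Suc n))" using X(2) less_imp_le by blast
  qed
  have low: "d \<le> (hnorm M (h - p - s))\<^sup>2" if s: "s \<in> S" for s
  proof -
    have sM: "s \<in> car M" using s S(1) by blast
    have "(\<lambda>n. hnorm M ((h - (X n + s)) - (h - p - s))) \<longlonglongrightarrow> 0"
    proof -
      have "hnorm M ((h - (X n + s)) - (h - p - s)) = hnorm M (X n - p)" for n
        using hnorm_uminus_diff[OF XM p(1)] by (simp add: algebra_simps)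
      then show ?thesis using p(2) by simp
    qed
    then have "(\<lambda>n. (hnorm M (h - (X n + s)))\<^sup>2) \<longlonglongrightarrow> (hnorm M (h - p - s))\<^sup>2"
      using hnorm_limit(1)[of "\<lambda>n. h - (X n + s)" "h - p - s"] XM p(1) h sM
      by (intro tendsto_power) (auto simp: car_diff car_add)
    then show ?thesis
      by (rule LIMSEQ_le_const) (use dle fun_vs.subspace_add[OF S(2) X(1) s] in auto)
  qed
  have "ip M (h - p) g = 0" if g: "g \<in> S" for g
  proof (cases "g = 0")
    case False
    define u where "u = h - p"
    have gM: "g \<in> car M" and u: "u \<in> car M" using g S(1) h p(1) by (auto simp: u_def)
    note low' = low[folded u_def] and hp' = hp[folded u_def]
    have n: "hnorm M g > 0" using hnorm_eq_0[OF gM] hnorm_ge0[OF gM] False by linarith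
    define c where "c = ip M u g / of_real ((hnorm M g)\<^sup>2)"
    have "d \<le> (hnorm M (u - fscale c g))\<^sup>2"
      using low'[OF fun_vs.subspace_scale[OF S(2) g, of c]] .
    also have "\<dots> = (hnorm M u)\<^sup>2 - 2 * Re (cnj c * ip M u g) + (cmod c)\<^sup>2 * (hnorm M g)\<^sup>2"
      using u gM by (simp add: hnorm_diff_power2 car_scale ip_scale_right hnorm_scale power_mult_distrib)
    also have "cnj c * ip M u g = of_real ((cmod (ip M u g))\<^sup>2 / (hnorm M g)\<^sup>2)"
      unfolding c_def by (simp add: complex_norm_square[symmetric] mult.commute)
    also have "(cmod c)\<^sup>2 * (hnorm M g)\<^sup>2 = (cmod (ip M u g))\<^sup>2 / (hnorm M g)\<^sup>2"
    proof -
      have "cmod c = cmod (ip M u g) / (hnorm M g)\<^sup>2"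
        unfolding c_def norm_divide norm_of_real by simp
      then show ?thesis using n by (simp add: power_divide) (simp add: field_simps power2_eq_square power4_eq_xxxx)
    qed
    finally have "(cmod (ip M u g))\<^sup>2 / (hnorm M g)\<^sup>2 \<le> 0" using hp' by simp
    then show ?thesis using n by (simp add: divide_le_0_iff u_def)
  qed (use h p(1) in \<open>simp add: car_diff\<close>)
  with p X(1) show ?thesis using that by blast
qed

lemma projection:
  assumes "hclosed S" "h \<in> car M"
  obtains p where "p \<in> S" "\<And>g. g \<in> S \<Longrightarrow> ip M (h - p) g = 0"
proof -
  obtain p X where "p \<in> car M" "\<And>n::nat. X n \<in> S" "(\<lambda>n. hnorm M (X n - p)) \<longlonglongrightarrow> 0"
    "\<And>g. g \<in> S \<Longrightarrow> ip M (h - p) g = 0"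
    by (rule approximate_projection[of S h]) (use assms in \<open>auto simp: hclosed_def\<close>)
  with assms(1) that show ?thesis unfolding hclosed_def by blast
qed

text \<open>A vector with nonzero value of \<open>l\<close> and orthogonal to the closed kernel of \<open>l\<close> represents \<open>l\<close> after rescaling.\<close>

lemma riesz:
  assumes add: "\<And>x y. x \<in> car M \<Longrightarrow> y \<in> car M \<Longrightarrow> l (x + y) = l x + l y"
    and scale: "\<And>c x. x \<in> car M \<Longrightarrow> l (fscale c x) = c * l x"
    and bdd: "\<And>x. x \<in> car M \<Longrightarrow> cmod (l x) \<le> C * hnorm M x"
  obtains g where "g \<in> car M" "\<And>h. h \<in> car M \<Longrightarrow> l h = ip M h g"
proof -
  define S where "S = {x \<in> car M. l x = 0}"
  have diff: "l (x - y) = l x - l y" if "x \<in> car M" "y \<in> car M" for x y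
    using add[of "x - y" y] that by (simp add: car_diff)
  have "fscale 0 (0 :: ('m, 'r) vfun) = 0" by (simp add: fscale_def fun_eq_iff)
  then have l0: "l 0 = 0" using scale[OF car_zero, of 0] by simp
  have S: "hclosed S"
    unfolding hclosed_def
  proof (intro conjI allI impI)
    show "fun_vs.subspace S"
      by (rule fun_vs.subspaceI) (auto simp: S_def add scale l0)
    fix X x assume X: "\<forall>n::nat. X n \<in> S" and x: "x \<in> car M" and lim: "(\<lambda>n. hnorm M (X n - x)) \<longlonglongrightarrow> 0"
    have "cmod (l x) \<le> C * hnorm M (X n - x)" for n
    proof -
      have "l x = - l (X n - x)" using diff[of "X n" x] X x by (simp add: S_def)
      then show ?thesis using bdd[of "X n - x"] X x by (simp add: S_def car_diff)
    qed
    moreover have "(\<lambda>n. C * hnorm M (X n - x)) \<longlonglongrightarrow> 0" by (rule tendsto_mult_right_zero[OF lim])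
    ultimately have "cmod (l x) \<le> 0" using LIMSEQ_le_const by blast
    then show "x \<in> S" using x by (simp add: S_def)
  qed (auto simp: S_def)
  show ?thesis
  proof (cases "S = car M")
    case True
    then show ?thesis using that[of 0] by (auto simp: S_def)
  next
    case False
    then obtain h where h: "h \<in> car M" "h \<notin> S" using S unfolding hclosed_def by blast
    obtain p where p: "p \<in> S" "\<And>g. g \<in> S \<Longrightarrow> ip M (h - p) g = 0" using projection[OF S h(1)] by blast
    define u where "u = h - p"
    have u: "u \<in> car M" using h p by (auto simp: u_def S_def)
    have lu: "l u \<noteq> 0" using h p diff[of h p] by (auto simp: u_def S_def)
    have u0: "ip M u u \<noteq> 0" using ip_pos[OF u] lu l0 by force
    show ?thesis
    proof (rule that[of "fscale (cnj (l u / ip M u u)) u"])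
      fix x assume x: "x \<in> car M"
      let ?s = "x - fscale (l x / l u) u"
      have "?s \<in> S" using x u lu by (simp add: S_def car_diff car_scale diff scale)
      then have "ip M u ?s = 0" using p(2) by (simp add: u_def)
      then have "ip M ?s u = 0" using ip_cnj[of u ?s] x u by (simp add: car_diff car_scale)
      then have "ip M x u = l x / l u * ip M u u" using x u by (simp add: ip_diff_left car_scale ip_scale)
      then show "l x = ip M x (fscale (cnj (l u / ip M u u)) u)"
        using x u lu u0 by (simp add: ip_scale_right)
    qed (use u in auto)
  qed
qed

lemma ip_ext: "x \<in> car M \<Longrightarrow> y \<in> car M \<Longrightarrow> (\<And>h. h \<in> car M \<Longrightarrow> ip M h x = ip M h y) \<Longrightarrow> x = y"
proof -
  assume xy: "x \<in> car M" "y \<in> car M" "\<And>h. h \<in> car M \<Longrightarrow> ip M h x = ip M h y"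
  then have "ip M (x - y) (x - y) = 0" by (simp add: ip_diff_right car_diff)
  then show "x = y" using ip_pos[of "x - y"] xy by (auto simp: car_diff)
qed

section \<open>Uniform boundedness\<close>

text \<open>
  A gliding hump.  For unbounded \<open>g\<^sub>n\<close>, one of \<open>x \<plusminus> 3\<^sup>-\<^sup>n g\<^sub>n/|g\<^sub>n|\<close> has an inner product with \<open>g\<^sub>n\<close>
  of modulus at least \<open>3\<^sup>-\<^sup>n|g\<^sub>n|\<close>.  Iterating this choice converges, and all later steps together move
  the point by at most half of \<open>3\<^sup>-\<^sup>n\<close>, so half of the lower bound persists in the limit.
\<close>

lemma uniform_boundedness:
  assumes G: "G \<subseteq> car M" and pw: "\<And>h. h \<in> car M \<Longrightarrow> \<exists>C. \<forall>g\<in>G. cmod (ip M h g) \<le> C"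
  obtains C where "\<And>g. g \<in> G \<Longrightarrow> hnorm M g \<le> C"
proof (rule ccontr)
  assume "\<not> thesis"
  then have "\<exists>g\<in>G. hnorm M g > C" for C using that by (meson not_le)
  (* the factor 2 * 3 ^ n is what the step size and the tail of the series consume *)
  then have "\<exists>g\<in>G. hnorm M g > 2 * real (Suc n) * 3 ^ n" for n by blast
  then obtain g where g: "\<And>n. g n \<in> G" "\<And>n. hnorm M (g n) > 2 * real (Suc n) * 3 ^ n" by metis
  have gM: "g n \<in> car M" for n using g(1) G by blast
  have pos: "hnorm M (g n) > 0" for n
    using g(2)[of n] by (smt (verit) mult_nonneg_nonneg of_nat_0_le_iff zero_le_power)
  define y where "y n = fscale (of_real ((1/3) ^ n / hnorm M (g n))) (g n)" for n
  have y: "y n \<in> car M" "hnorm M (y n) = (1/3) ^ n" for n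
    using gM[of n] pos[of n] by (auto simp: y_def hnorm_scale norm_divide norm_power)
  have ipy: "cmod (ip M (y n) (g n)) = (1/3) ^ n * hnorm M (g n)" for n
    using gM[of n] pos[of n] by (simp add: y_def ip_scale ip_self norm_mult norm_divide norm_power power2_eq_square)
  have step: "\<exists>z. z \<in> car M \<and> hnorm M (z - x) = (1/3) ^ n \<and> cmod (ip M z (g n)) \<ge> (1/3) ^ n * hnorm M (g n)"
    if x: "x \<in> car M" for x n
  proof -
    have "ip M (x + y n) (g n) - ip M (x - y n) (g n) = 2 * ip M (y n) (g n)"
      using x y gM by (simp add: ip_add ip_diff_left)
    then have "2 * cmod (ip M (y n) (g n)) \<le> cmod (ip M (x + y n) (g n)) + cmod (ip M (x - y n) (g n))"
      by (metis norm_mult norm_numeral norm_triangle_ineq4)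
    then consider "cmod (ip M (x + y n) (g n)) \<ge> cmod (ip M (y n) (g n))" | "cmod (ip M (x - y n) (g n)) \<ge> cmod (ip M (y n) (g n))"
      by linarith
    then show ?thesis
    proof cases
      case 1
      then show ?thesis using x y ipy by (intro exI[of _ "x + y n"]) (simp add: car_add)
    next
      case 2
      have "hnorm M (x - y n - x) = hnorm M (y n)"
        using hnorm_uminus_diff[of "x - y n" x] x y by (simp add: car_diff)
      with 2 show ?thesis using x y ipy by (intro exI[of _ "x - y n"]) (simp add: car_diff)
    qed
  qed
  define f where "f n x = (SOME z. z \<in> car M \<and> hnorm M (z - x) = (1/3) ^ n \<and>
      cmod (ip M z (g n)) \<ge> (1/3) ^ n * hnorm M (g n))" for n x
  have f: "f n x \<in> car M \<and> hnorm M (f n x - x) = (1/3) ^ n \<and>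
      cmod (ip M (f n x) (g n)) \<ge> (1/3) ^ n * hnorm M (g n)" if "x \<in> car M" for n x
    unfolding f_def by (rule someI_ex[OF step[OF that]])
  define x where "x = rec_nat 0 f"
  have x0: "x 0 = 0" and xS: "x (Suc n) = f n (x n)" for n by (simp_all add: x_def)
  have xM: "x n \<in> car M" for n
  proof (induction n)
    case 0
    show ?case by (simp only: x0 car_zero)
  next
    case (Suc n)
    with f show ?case by (simp only: xS)
  qed
  have tail: "hnorm M (x (m + n) - x m) \<le> 3/2 * (1/3) ^ m * (1 - (1/3) ^ n)" for m n
  proof (induction n)
    case (Suc n)
    have "hnorm M (x (m + Suc n) - x m) \<le> hnorm M (x (m + Suc n) - x (m + n)) + hnorm M (x (m + n) - x m)"
      by (rule hnorm_triangle_diff) (auto intro: xM)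
    also have "hnorm M (x (m + Suc n) - x (m + n)) = (1/3) ^ (m + n)" using f[OF xM] by (simp add: xS)
    finally show ?case using Suc by (simp add: power_add algebra_simps)
  next
    case 0
    have "hnorm M (x (m + 0) - x m) = 0"
      using hnorm_eq_0[OF car_zero] by (simp only: add_0_right diff_self)
    moreover have "1 - (1/3::real) ^ 0 = 0" by simp
    ultimately show ?case by (simp only: mult_zero_right order_refl)
  qed
  have tail': "hnorm M (x n - x m) \<le> 3/2 * (1/3) ^ m" if "m \<le> n" for m n
  proof -
    have "hnorm M (x n - x m) \<le> 3/2 * (1/3) ^ m * (1 - (1/3) ^ (n - m))" using tail[of m "n - m"] that by simp
    also have "\<dots> \<le> 3/2 * (1/3) ^ m * 1" by (intro mult_left_mono) auto
    finally show ?thesis by simp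
  qed
  have "\<exists>z\<in>car M. (\<lambda>n. hnorm M (x n - z)) \<longlonglongrightarrow> 0"
  proof (rule complete[OF xM], intro allI impI)
    fix e :: real assume e: "e > 0"
    obtain N where N: "(1/3::real) ^ N < e / 3" using real_arch_pow_inv[of "e/3" "1/3"] e by auto
    have le: "hnorm M (x n - x m) < e" if "N \<le> m" "m \<le> n" for n m
    proof -
      have "(1/3::real) ^ m \<le> (1/3) ^ N" using that by (intro power_decreasing) auto
      then show ?thesis using tail'[OF that(2)] N e by linarith
    qed
    have "hnorm M (x n - x m) < e" if "N \<le> m" "N \<le> n" for n m
      using le[of m n] le[of n m] that hnorm_uminus_diff[OF xM xM] by (metis nle_le)
    then show "\<exists>n0. \<forall>n\<ge>n0. \<forall>n'\<ge>n0. hnorm M (x n - x n') < e" by blast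
  qed
  then obtain z where z: "z \<in> car M" "(\<lambda>n. hnorm M (x n - z)) \<longlonglongrightarrow> 0" by blast
  have big: "cmod (ip M z (g n)) \<ge> real (Suc n)" for n
  proof -
    have "hnorm M (z - x (Suc n)) \<le> 1/2 * (1/3) ^ n"
    proof -
      have "(\<lambda>k. hnorm M ((x k - x (Suc n)) - (z - x (Suc n)))) \<longlonglongrightarrow> 0" using z(2) by simp
      then have "(\<lambda>k. hnorm M (x k - x (Suc n))) \<longlonglongrightarrow> hnorm M (z - x (Suc n))"
        using hnorm_limit(1)[of "\<lambda>k. x k - x (Suc n)" "z - x (Suc n)"] xM z(1) by auto
      then show ?thesis
        by (rule LIMSEQ_le_const2) (use tail'[of "Suc n"] in \<open>auto intro!: exI[of _ "Suc n"]\<close>)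
    qed
    then have "cmod (ip M (z - x (Suc n)) (g n)) \<le> 1/2 * (1/3) ^ n * hnorm M (g n)"
      using cauchy_schwarz[of "z - x (Suc n)" "g n"] xM z(1) gM[of n] pos[of n]
      by (smt (verit) car_diff mult_right_mono)
    moreover have "cmod (ip M (x (Suc n)) (g n)) \<ge> (1/3) ^ n * hnorm M (g n)"
      using f[OF xM] by (simp add: xS)
    moreover have "ip M (x (Suc n)) (g n) = ip M z (g n) - ip M (z - x (Suc n)) (g n)"
      using xM z(1) gM by (simp add: ip_diff_left)
    ultimately have "cmod (ip M z (g n)) \<ge> 1/2 * (1/3) ^ n * hnorm M (g n)"
      using norm_triangle_ineq4[of "ip M z (g n)" "ip M (z - x (Suc n)) (g n)"] by simp
    moreover have "1/2 * (1/3) ^ n * hnorm M (g n) \<ge> 1/2 * (1/3) ^ n * (2 * real (Suc n) * 3 ^ n)"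
      using g(2)[of n] by (intro mult_left_mono) auto
    moreover have "1/2 * (1/3) ^ n * (2 * real (Suc n) * 3 ^ n) = real (Suc n)"
      by (simp add: power_one_over field_simps)
    ultimately show ?thesis by linarith
  qed
  obtain C where C: "\<forall>g\<in>G. cmod (ip M z g) \<le> C" using pw[OF z(1)] by blast
  obtain n where "C < real n" using reals_Archimedean2 by blast
  moreover have "real (Suc n) \<le> C" using big[of n] C g(1)[of n] by force
  ultimately show False by simp
qed

end

section \<open>Weakly holomorphic Hilbert-space-valued functions\<close>

definition weakly_holomorphic ::
    "('m::finite, 'r::finite) fspace \<Rightarrow> 'm cvec set \<Rightarrow> ('m cvec \<Rightarrow> ('m, 'r) vfun) \<Rightarrow> bool" where
  "weakly_holomorphic M S F \<longleftrightarrow> (\<forall>w\<in>S. F w \<in> car M) \<and>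
     (\<forall>h\<in>car M. mholomorphic_on S (\<lambda>w. ip M (F w) h))"

lemma weakly_holomorphicD:
  "weakly_holomorphic M S F \<Longrightarrow> w \<in> S \<Longrightarrow> F w \<in> car M"
  "weakly_holomorphic M S F \<Longrightarrow> h \<in> car M \<Longrightarrow> mholomorphic_on S (\<lambda>w. ip M (F w) h)"
  unfolding weakly_holomorphic_def by auto

context hilbert_fspace
begin

text \<open>
  On a compact ball the inner products with any fixed vector are bounded, so uniform boundedness
  applies.
\<close>

lemma weakly_holomorphic_locally_bounded:
  assumes F: "weakly_holomorphic M S F" and S: "open S" and z: "z \<in> S"
  obtains r B where "0 < r" "0 \<le> B" "ball z r \<subseteq> S" "\<And>w. w \<in> ball z r \<Longrightarrow> hnorm M (F w) \<le> B"
proof -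
  obtain r where r: "r > 0" "cball z r \<subseteq> S" using S z open_contains_cball by blast
  have "\<exists>C. \<forall>g\<in>F ` cball z r. cmod (ip M h g) \<le> C" if h: "h \<in> car M" for h
  proof -
    have "continuous_on (cball z r) (\<lambda>w. ip M (F w) h)"
      using mholomorphic_on_continuous[OF weakly_holomorphicD(2)[OF F h]] r(2) continuous_on_subset by blast
    then have "bounded ((\<lambda>w. ip M (F w) h) ` cball z r)"
      by (intro compact_imp_bounded compact_continuous_image) auto
    then obtain C where C: "\<forall>w\<in>cball z r. cmod (ip M (F w) h) \<le> C" by (auto simp: bounded_iff)
    have "cmod (ip M h (F w)) \<le> C" if "w \<in> cball z r" for w
    proof -
      have "F w \<in> car M" using weakly_holomorphicD(1)[OF F] r(2) that by blast
      then have "ip M h (F w) = cnj (ip M (F w) h)" using ip_cnj h by blast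
      then show ?thesis using C that by simp
    qed
    then show ?thesis by blast
  qed
  then obtain B where B: "\<And>g. g \<in> F ` cball z r \<Longrightarrow> hnorm M g \<le> B"
    using uniform_boundedness[of "F ` cball z r"] weakly_holomorphicD(1)[OF F] r(2) by blast
  have "0 \<le> B"
    using B[of "F z"] hnorm_ge0[OF weakly_holomorphicD(1)[OF F z]] r(1) by force
  then show ?thesis using that[of r B] r B ball_subset_cball by (meson image_eqI order_trans subsetD)
qed

text \<open>
  The derivatives of the inner products define a bounded functional, and Riesz' theorem provides a
  candidate.  The Taylor estimate is uniform over the unit ball; applied to the inner product with
  the error vector itself it gives convergence in norm.
\<close>

lemma weakly_holomorphic_hderiv:
  assumes F: "weakly_holomorphic M S F" and S: "open S" and w: "w \<in> S"
  shows "hderiv M i F w \<in> car M"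
    and "h \<in> car M \<Longrightarrow> ip M (hderiv M i F w) h = wirt i (\<lambda>w. ip M (F w) h) w"
proof -
  obtain r B where r: "0 < r" "0 \<le> B" "ball w r \<subseteq> S" "\<And>u. u \<in> ball w r \<Longrightarrow> hnorm M (F u) \<le> B"
    using weakly_holomorphic_locally_bounded[OF F S w] by metis
  have FM: "F u \<in> car M" if "u \<in> ball w r" for u using weakly_holomorphicD(1)[OF F] r(3) that by blast
  let ?f = "\<lambda>h u. ip M (F u) h"
  have taylor: "cmod (?f h (w + axis i x) - ?f h w - x * wirt i (?f h) w) \<le> 18 * (B * hnorm M h) / r\<^sup>2 * (cmod x)\<^sup>2"
    "cmod (wirt i (?f h) w) \<le> 3 * (B * hnorm M h) / r" if h: "h \<in> car M" and x: "cmod x < r / 3" for h x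
  proof -
    have sh: "sep_holomorphic S (?f h)" using weakly_holomorphicD(2)[OF F h] S mholomorphic_on_iff_sep by blast
    have b: "cmod (?f h u) \<le> B * hnorm M h" if "u \<in> ball w r" for u
      using cauchy_schwarz[OF FM[OF that] h] mult_right_mono[OF r(4)[OF that] hnorm_ge0[OF h]] by linarith
    show "cmod (?f h (w + axis i x) - ?f h w - x * wirt i (?f h) w) \<le> 18 * (B * hnorm M h) / r\<^sup>2 * (cmod x)\<^sup>2"
      by (rule sep_holomorphic_taylor(1)[OF sh r(3,1) b x])
    show "cmod (wirt i (?f h) w) \<le> 3 * (B * hnorm M h) / r"
      by (rule sep_holomorphic_taylor(2)[OF sh r(3,1) b x])
  qed
  have slice: "((\<lambda>\<zeta>. ?f h (w + axis i \<zeta>)) has_field_derivative wirt i (?f h) w) (at 0)" if "h \<in> car M" for h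
    by (rule mholomorphic_on_derivative(2)[OF weakly_holomorphicD(2)[OF F that] S w])
  have wF: "w + axis i \<zeta> \<in> ball w r \<longleftrightarrow> cmod \<zeta> < r" for \<zeta> by (simp add: dist_norm)
  obtain G where G: "G \<in> car M" "\<And>h. h \<in> car M \<Longrightarrow> cnj (wirt i (?f h) w) = ip M h G"
  proof (rule riesz[of "\<lambda>h. cnj (wirt i (?f h) w)" "3 * B / r"])
    fix x y assume xy: "x \<in> car M" "y \<in> car M"
    have "((\<lambda>\<zeta>. ?f (x + y) (w + axis i \<zeta>)) has_field_derivative wirt i (?f x) w + wirt i (?f y) w) (at 0)"
      by (rule has_field_derivative_transform_within[OF DERIV_add[OF slice[OF xy(1)] slice[OF xy(2)]] r(1)])
        (use FM wF xy in \<open>auto simp: ip_add_right\<close>)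
    then show "cnj (wirt i (?f (x + y)) w) = cnj (wirt i (?f x) w) + cnj (wirt i (?f y) w)"
      using wirt_of_slice(1)[of "?f (x + y)"] by simp
  next
    fix c x assume x: "x \<in> car M"
    have "((\<lambda>\<zeta>. ?f (fscale c x) (w + axis i \<zeta>)) has_field_derivative cnj c * wirt i (?f x) w) (at 0)"
      by (rule has_field_derivative_transform_within[OF DERIV_cmult[OF slice[OF x]] r(1)])
        (use FM wF x in \<open>auto simp: ip_scale_right\<close>)
    then show "cnj (wirt i (?f (fscale c x)) w) = c * cnj (wirt i (?f x) w)"
      using wirt_of_slice(1)[of "?f (fscale c x)"] by simp
  next
    fix x assume "x \<in> car M"
    then show "cmod (cnj (wirt i (?f x) w)) \<le> 3 * B / r * hnorm M x"
      using taylor(2)[of x 0] r(1) by (simp add: mult.assoc)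
  qed blast
  have G': "ip M G h = wirt i (?f h) w" if "h \<in> car M" for h
    using G that ip_cnj[OF that G(1)] by (metis complex_cnj_cnj)
  let ?D = "\<lambda>t. fscale (inverse t) (F (w + axis i t) - F w)"
  have DM: "?D t \<in> car M" if "cmod t < r" for t
    using FM[of "w + axis i t"] FM[of w] wF that r(1) by (intro car_scale car_diff) auto
  have bound: "hnorm M (?D t - G) \<le> 18 * B / r\<^sup>2 * cmod t" if t: "t \<noteq> 0" "cmod t < r / 3" for t
  proof -
    define e where "e = ?D t - G"
    have tr: "cmod t < r" using t(2) r(1) by simp
    have e: "e \<in> car M" unfolding e_def by (rule car_diff[OF DM[OF tr] G(1)])
    have Fw: "F (w + axis i t) \<in> car M" "F w \<in> car M" using FM wF tr r(1) by auto
    have "ip M e e = inverse t * (?f e (w + axis i t) - ?f e w - t * wirt i (?f e) w)"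
    proof -
      have "ip M (?D t - G) e = inverse t * (ip M (F (w + axis i t)) e - ip M (F w) e) - wirt i (?f e) w"
        using Fw e G(1) G'[OF e] by (simp add: ip_diff_left car_scale car_diff ip_scale)
      then show ?thesis using t(1) by (simp add: e_def field_simps)
    qed
    then have "(hnorm M e)\<^sup>2 = inverse (cmod t) * cmod (?f e (w + axis i t) - ?f e w - t * wirt i (?f e) w)"
      using arg_cong[OF ip_self[OF e], of cmod] unfolding norm_of_real by (simp add: norm_mult norm_inverse)
    also have "\<dots> \<le> inverse (cmod t) * (18 * (B * hnorm M e) / r\<^sup>2 * (cmod t)\<^sup>2)"
      by (rule mult_left_mono[OF taylor(1)[OF e t(2)]]) simp
    also have "\<dots> = (18 * B / r\<^sup>2 * cmod t) * hnorm M e"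
      using t(1) by (simp add: power2_eq_square)
    finally have "hnorm M e * hnorm M e \<le> (18 * B / r\<^sup>2 * cmod t) * hnorm M e" by (simp add: power2_eq_square)
    moreover have "0 \<le> 18 * B / r\<^sup>2 * cmod t" using r(2) by simp
    ultimately show ?thesis
      using mult_right_le_imp_le[of "hnorm M e" "hnorm M e" "18 * B / r\<^sup>2 * cmod t"] hnorm_ge0[OF e]
      unfolding e_def[symmetric] by linarith
  qed
  have lim: "((\<lambda>t. hnorm M (?D t - G)) \<longlongrightarrow> 0) (at 0)"
  proof (rule Lim_null_comparison)
    show "\<forall>\<^sub>F t in at 0. norm (hnorm M (?D t - G)) \<le> 18 * B / r\<^sup>2 * cmod t"
      unfolding eventually_at
      by (rule exI[of _ "r/3"]) (use r(1) bound DM G(1) in \<open>auto simp: hnorm_ge0 car_diff\<close>)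
    show "((\<lambda>t. 18 * B / r\<^sup>2 * cmod t) \<longlongrightarrow> 0) (at 0)"
      by (intro tendsto_mult_right_zero tendsto_norm_zero) simp
  qed
  have "hderiv M i F w = G"
    unfolding hderiv_def
  proof (rule the_equality)
    fix g assume g: "g \<in> car M \<and> ((\<lambda>t. hnorm M (?D t - g)) \<longlongrightarrow> 0) (at 0)"
    have "((\<lambda>t. hnorm M (?D t - g) + hnorm M (?D t - G)) \<longlongrightarrow> 0 + 0) (at 0)"
      using g lim by (intro tendsto_add) auto
    moreover have "\<forall>\<^sub>F t in at 0. hnorm M (g - G) \<le> hnorm M (?D t - g) + hnorm M (?D t - G)"
      unfolding eventually_at
    proof (intro exI[of _ r] conjI ballI impI)
      fix t :: complex assume "t \<noteq> 0 \<and> dist t 0 < r"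
      then have "?D t \<in> car M" using DM by (simp add: dist_norm)
      then show "hnorm M (g - G) \<le> hnorm M (?D t - g) + hnorm M (?D t - G)"
        using hnorm_triangle_diff[of g "?D t" G] hnorm_uminus_diff[of g "?D t"] g G(1) by simp
    qed (rule r)
    ultimately have "hnorm M (g - G) \<le> 0 + 0" by (rule tendsto_lowerbound) simp
    moreover have gG: "g - G \<in> car M" using g G(1) by blast
    ultimately have "hnorm M (g - G) = 0" using hnorm_ge0[OF gG] by linarith
    then have "g - G = 0" using hnorm_eq_0[OF gG] by simp
    then show "g = G" by simp
  qed (use G(1) lim in blast)
  with G(1) G' show "hderiv M i F w \<in> car M"
    and "h \<in> car M \<Longrightarrow> ip M (hderiv M i F w) h = wirt i (\<lambda>w. ip M (F w) h) w" by auto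
qed

lemma weakly_holomorphic_hderiv_fun:
  assumes F: "weakly_holomorphic M S F" and S: "open S"
  shows "weakly_holomorphic M S (hderiv M i F)"
  unfolding weakly_holomorphic_def
proof (intro conjI ballI)
  fix h assume h: "h \<in> car M"
  show "mholomorphic_on S (\<lambda>w. ip M (hderiv M i F w) h)"
    by (rule mholomorphic_on_cong[OF mholomorphic_on_wirt[OF S weakly_holomorphicD(2)[OF F h]]])
      (simp add: weakly_holomorphic_hderiv(2)[OF F S _ h])
qed (rule weakly_holomorphic_hderiv(1)[OF F S])

lemma weakly_holomorphic_hderivs:
  assumes F: "weakly_holomorphic M S F" and S: "open S"
  shows "weakly_holomorphic M S (foldr (hderiv M) is F)"
    and "w \<in> S \<Longrightarrow> h \<in> car M \<Longrightarrow> ip M (foldr (hderiv M) is F w) h = foldr wirt is (\<lambda>w. ip M (F w) h) w"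
proof -
  show *: "weakly_holomorphic M S (foldr (hderiv M) is F)" for "is"
    by (induction "is") (auto intro: weakly_holomorphic_hderiv_fun F S)
  show "w \<in> S \<Longrightarrow> h \<in> car M \<Longrightarrow> ip M (foldr (hderiv M) is F w) h = foldr wirt is (\<lambda>w. ip M (F w) h) w"
  proof (induction "is" arbitrary: w)
    case (Cons i "is")
    have "ip M (foldr (hderiv M) (i # is) F w) h = wirt i (\<lambda>w. ip M (foldr (hderiv M) is F w) h) w"
      using weakly_holomorphic_hderiv(2)[OF * S Cons.prems] by simp
    also have "\<dots> = wirt i (foldr wirt is (\<lambda>w. ip M (F w) h)) w"
      using ddir_cong[OF S Cons.IH Cons.prems(1), where x="Hol i"] Cons.prems(2) by simp
    finally show ?case by simp
  qed simp
qed

text \<open>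
  Each variable separately is covered by weak holomorphy, and the Cauchy-Schwarz inequality bounds
  the kernel locally; so Osgood's lemma applies.
\<close>

lemma gram_sesqui:
  assumes F: "weakly_holomorphic M S F" and G: "weakly_holomorphic M S G" and S: "open S"
  shows "sesqui S (\<lambda>w v. ip M (F w) (G v))"
  unfolding sesqui_def mholomorphic_on_iff_sep[OF open_bidomain[OF S]] sep_holomorphic_def
proof (intro ballI conjI allI)
  fix p assume "p \<in> {p. lft p \<in> S \<and> vcnj (rgt p) \<in> S}"
  then have p: "lft p \<in> S" "vcnj (rgt p) \<in> S" by auto
  note FM = weakly_holomorphicD(1)[OF F] and GM = weakly_holomorphicD(1)[OF G]
  show "(\<lambda>\<zeta>. ip M (F (lft (p + axis k \<zeta>))) (G (vcnj (rgt (p + axis k \<zeta>))))) field_differentiable at 0" for k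
  proof (cases k)
    case (Inl i)
    then show ?thesis
      using mholomorphic_on_derivative(2)[OF weakly_holomorphicD(2)[OF F GM[OF p(2)]] S p(1), of i]
      by (auto simp: field_differentiable_def)
  next
    case (Inr i)
    let ?v = "vcnj (rgt p)"
    obtain e where e: "e > 0" "ball ?v e \<subseteq> S" using S p(2) openE by blast
    obtain D where "((\<lambda>\<zeta>. ip M (G (?v + axis i \<zeta>)) (F (lft p))) has_field_derivative D) (at 0)"
      using mholomorphic_on_derivative(2)[OF weakly_holomorphicD(2)[OF G FM[OF p(1)]] S p(2), of i] by blast
    then have "((cnj \<circ> (\<lambda>\<zeta>. ip M (G (?v + axis i \<zeta>)) (F (lft p))) \<circ> cnj) has_field_derivative cnj D) (at (cnj 0))"
      by (intro has_field_derivative_cnj_cnj) simp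
    then have d: "((\<lambda>\<zeta>. cnj (ip M (G (?v + axis i (cnj \<zeta>))) (F (lft p)))) has_field_derivative cnj D) (at 0)"
      by (simp add: o_def)
    have "((\<lambda>\<zeta>. ip M (F (lft p)) (G (?v + axis i (cnj \<zeta>)))) has_field_derivative cnj D) (at 0)"
    proof (rule has_field_derivative_transform_within[OF d e(1)])
      fix x :: complex assume "dist x 0 < e"
      then have "?v + axis i (cnj x) \<in> S" using e(2) by (auto simp: dist_norm subset_iff)
      then show "cnj (ip M (G (?v + axis i (cnj x))) (F (lft p))) = ip M (F (lft p)) (G (?v + axis i (cnj x)))"
        using ip_cnj[OF GM FM[OF p(1)]] by simp
    qed simp
    then show ?thesis using Inr by (auto simp: field_differentiable_def)
  qed
  obtain r B where r: "0 < r" "0 \<le> B" "ball (lft p) r \<subseteq> S" "\<And>w. w \<in> ball (lft p) r \<Longrightarrow> hnorm M (F w) \<le> B"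
    using weakly_holomorphic_locally_bounded[OF F S p(1)] by metis
  obtain r' B' where r': "0 < r'" "0 \<le> B'" "ball (vcnj (rgt p)) r' \<subseteq> S" "\<And>w. w \<in> ball (vcnj (rgt p)) r' \<Longrightarrow> hnorm M (G w) \<le> B'"
    using weakly_holomorphic_locally_bounded[OF G S p(2)] by metis
  have nl: "norm (lft q) \<le> norm q" "norm (vcnj (rgt q)) \<le> norm q" for q :: "('m + 'm) cvec"
  proof -
    have "norm (vcnj x) = norm x" for x :: "'m cvec" by (simp add: norm_vec_def vcnj_def)
    moreover have "(norm q)\<^sup>2 = (norm (lft q))\<^sup>2 + (norm (rgt q))\<^sup>2"
      by (simp add: norm_vec_def L2_set_def sum_nonneg sum_UNIV_sum lft_def rgt_def)
    ultimately show "norm (lft q) \<le> norm q" "norm (vcnj (rgt q)) \<le> norm q"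
      by (simp_all add: power2_le_imp_le)
  qed
  have "cmod (ip M (F (lft q)) (G (vcnj (rgt q)))) \<le> B * B'" if q: "q \<in> ball p (min r r')" for q
  proof -
    have "lft p - lft q = lft (p - q)" "vcnj (rgt p) - vcnj (rgt q) = vcnj (rgt (p - q))"
      by (simp_all add: lft_def rgt_def vcnj_def vec_eq_iff)
    then have q: "lft q \<in> ball (lft p) r" "vcnj (rgt q) \<in> ball (vcnj (rgt p)) r'"
      using q nl[of "p - q"] by (auto simp: dist_norm)
    then have "F (lft q) \<in> car M" "G (vcnj (rgt q)) \<in> car M" using FM GM r(3) r'(3) by blast+
    then show ?thesis
      using cauchy_schwarz[of "F (lft q)" "G (vcnj (rgt q))"] mult_mono[OF r(4)[OF q(1)] r'(4)[OF q(2)] r(2)] by fastforce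
  qed
  then show "\<exists>r>0. \<exists>B. \<forall>w\<in>ball p r. cmod (ip M (F (lft w)) (G (vcnj (rgt w)))) \<le> B"
    using r(1) r'(1) by (intro exI[of _ "min r r'"] conjI exI[of _ "B * B'"]) auto
qed

end

fun hol_part :: "'m direction list \<Rightarrow> 'm list" where
  "hol_part [] = []"
| "hol_part (Hol i # ws) = i # hol_part ws"
| "hol_part (Anti i # ws) = hol_part ws"

fun anti_part :: "'m direction list \<Rightarrow> 'm list" where
  "anti_part [] = []"
| "anti_part (Hol i # ws) = anti_part ws"
| "anti_part (Anti i # ws) = i # anti_part ws"

text \<open>
  A holomorphic direction differentiates the first factor only; an antiholomorphic one
  differentiates the second factor, which enters through its conjugate.
\<close>

lemma (in hilbert_fspace) derivs_gram:
  assumes F: "weakly_holomorphic M S F" and G: "weakly_holomorphic M S G" and S: "open S"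
  shows "w \<in> S \<Longrightarrow> derivs ws (\<lambda>w. ip M (F w) (G w)) w =
    ip M (foldr (hderiv M) (hol_part ws) F w) (foldr (hderiv M) (anti_part ws) G w)"
proof (induction ws arbitrary: w)
  case (Cons x ws)
  let ?F = "foldr (hderiv M) (hol_part ws) F" and ?G = "foldr (hderiv M) (anti_part ws) G"
  have FG: "weakly_holomorphic M S ?F" "weakly_holomorphic M S ?G"
    using weakly_holomorphic_hderivs(1) F G S by blast+
  note FM = weakly_holomorphicD(1)[OF FG(1)] and GM = weakly_holomorphicD(1)[OF FG(2)]
  note w = Cons.prems
  have "derivs (x # ws) (\<lambda>w. ip M (F w) (G w)) w = ddir x (\<lambda>w. ip M (?F w) (?G w)) w"
    unfolding derivs_simps by (rule ddir_cong[OF S Cons.IH w])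
  also have "\<dots> = ip M (foldr (hderiv M) (hol_part (x # ws)) F w) (foldr (hderiv M) (anti_part (x # ws)) G w)"
  proof (cases x)
    case (Hol i)
    have "ddir (Hol i) (\<lambda>w. ip M (?F w) (?G w)) w = wirt i (\<lambda>u. ip M (?F u) (?G w)) w"
      by (rule sesqui_ddir_Hol[OF gram_sesqui[OF FG S] S w])
        (rule mholomorphic_on_derivative(2)[OF weakly_holomorphicD(2)[OF FG(1) GM[OF w]] S w])
    also have "\<dots> = ip M (hderiv M i ?F w) (?G w)"
      using weakly_holomorphic_hderiv(2)[OF FG(1) S w GM[OF w]] by simp
    finally show ?thesis using Hol by simp
  next
    case (Anti i)
    have "ddir (Anti i) (\<lambda>w. ip M (?F w) (?G w)) w = cnj (wirt i (\<lambda>u. ip M (?G u) (?F w)) w)"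
    proof (rule sesqui_ddir_Anti[OF gram_sesqui[OF FG S] S w])
      obtain e where e: "e > 0" "ball w e \<subseteq> S" using S w openE by blast
      show "((\<lambda>\<zeta>. cnj (ip M (?F w) (?G (w + axis i \<zeta>)))) has_field_derivative wirt i (\<lambda>u. ip M (?G u) (?F w)) w) (at 0)"
      proof (rule has_field_derivative_transform_within[OF
            mholomorphic_on_derivative(2)[OF weakly_holomorphicD(2)[OF FG(2) FM[OF w]] S w] e(1)])
        fix \<zeta> assume "dist \<zeta> (0::complex) < e"
        then have "w + axis i \<zeta> \<in> S" using e(2) by (auto simp: dist_norm subset_iff)
        then show "ip M (?G (w + axis i \<zeta>)) (?F w) = cnj (ip M (?F w) (?G (w + axis i \<zeta>)))"
          using ip_cnj[OF FM[OF w] GM] by simp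
      qed simp
    qed
    also have "\<dots> = cnj (ip M (hderiv M i ?G w) (?F w))"
      using weakly_holomorphic_hderiv(2)[OF FG(2) S w FM[OF w]] by simp
    also have "\<dots> = ip M (?F w) (hderiv M i ?G w)"
      using ip_cnj[OF weakly_holomorphic_hderiv(1)[OF FG(2) S w] FM[OF w]] by simp
    finally show ?thesis using Anti by simp
  qed
  finally show ?case .
qed simp


section \<open>Unitaries from equal Gramians\<close>

definition lincomb :: "('i \<Rightarrow> ('m::finite, 'r::finite) vfun) \<Rightarrow> 'i set \<Rightarrow> ('i \<Rightarrow> complex) \<Rightarrow> ('m, 'r) vfun" where
  "lincomb g A c = (\<Sum>a\<in>A. fscale (c a) (g a))"

definition hunitary :: "('m::finite, 'r::finite) fspace \<Rightarrow> ('m, 'r) fspace \<Rightarrow> ('m, 'r) vfun set \<Rightarrow>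
    ('m, 'r) vfun set \<Rightarrow> (('m, 'r) vfun \<Rightarrow> ('m, 'r) vfun) \<Rightarrow> bool" where
  "hunitary M N Q R V \<longleftrightarrow> bij_betw V Q R \<and>
     (\<forall>x\<in>Q. \<forall>y\<in>Q. V (x + y) = V x + V y) \<and>
     (\<forall>c. \<forall>x\<in>Q. V (fscale c x) = fscale c (V x)) \<and>
     (\<forall>x\<in>Q. \<forall>y\<in>Q. ip N (V x) (V y) = ip M x y)"

context hilbert_fspace
begin

lemma lincomb_mem: "S \<subseteq> car M \<Longrightarrow> fun_vs.subspace S \<Longrightarrow> (\<And>a. a \<in> A \<Longrightarrow> g a \<in> S) \<Longrightarrow> lincomb g A c \<in> S"
  unfolding lincomb_def by (intro fun_vs.subspace_sum fun_vs.subspace_scale) auto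

lemma subspace_lincombs:
  "fun_vs.subspace {lincomb g A c | A c. finite A \<and> A \<subseteq> I}"
proof (rule fun_vs.subspaceI)
  show "0 \<in> {lincomb g A c | A c. finite A \<and> A \<subseteq> I}"
    by (rule CollectI, rule exI[of _ "{}"]) (simp add: lincomb_def)
next
  fix x y assume "x \<in> {lincomb g A c | A c. finite A \<and> A \<subseteq> I}" "y \<in> {lincomb g A c | A c. finite A \<and> A \<subseteq> I}"
  then obtain A c B d where *: "x = lincomb g A c" "y = lincomb g B d" "finite A" "finite B" "A \<subseteq> I" "B \<subseteq> I" by blast
  have ext: "lincomb g A c = lincomb g (A \<union> B) (\<lambda>a. if a \<in> A then c a else 0)" if "finite A" "finite B" for A B c
    unfolding lincomb_def
    by (rule sum.mono_neutral_cong_left) (use that in \<open>auto simp: fscale_def fun_eq_iff\<close>)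
  have "x + y = lincomb g (A \<union> B) (\<lambda>a. (if a \<in> A then c a else 0) + (if a \<in> B then d a else 0))"
    unfolding *(1,2) ext[OF *(3,4), of c] ext[OF *(4,3), of d]
    by (simp only: lincomb_def Un_commute[of B A] fun_vs.scale_left_distrib sum.distrib)
  then show "x + y \<in> {lincomb g A c | A c. finite A \<and> A \<subseteq> I}" using * by blast
next
  fix a x assume "x \<in> {lincomb g A c | A c. finite A \<and> A \<subseteq> I}"
  then obtain A c where *: "x = lincomb g A c" "finite A" "A \<subseteq> I" by blast
  have "fscale a x = lincomb g A (\<lambda>b. a * c b)"
    unfolding *(1) lincomb_def by (simp only: fun_vs.scale_sum_right fun_vs.scale_scale)
  then show "fscale a x \<in> {lincomb g A c | A c. finite A \<and> A \<subseteq> I}" using * by blast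
qed

lemma ip_lincomb:
  assumes "\<And>a. a \<in> A \<union> B \<Longrightarrow> g a \<in> car M"
  shows "ip M (lincomb g A c) (lincomb g B d) = (\<Sum>a\<in>A. \<Sum>b\<in>B. c a * cnj (d b) * ip M (g a) (g b))"
proof -
  have B: "lincomb g B d \<in> car M" unfolding lincomb_def using assms by blast
  have "ip M (lincomb g A c) (lincomb g B d) = (\<Sum>a\<in>A. c a * ip M (g a) (lincomb g B d))"
    unfolding lincomb_def[of g A] using assms B by (subst ip_sum_left) (auto simp: ip_scale intro!: sum.cong)
  also have "\<dots> = (\<Sum>a\<in>A. \<Sum>b\<in>B. c a * cnj (d b) * ip M (g a) (g b))"
  proof (rule sum.cong[OF refl])
    fix a assume "a \<in> A"
    then show "c a * ip M (g a) (lincomb g B d) = (\<Sum>b\<in>B. c a * cnj (d b) * ip M (g a) (g b))"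
      unfolding lincomb_def using assms
      by (subst ip_sum_right) (auto simp: ip_scale_right sum_distrib_left mult.assoc intro!: sum.cong)
  qed
  finally show ?thesis .
qed

end

text \<open>
  One half of the extension of a Gramian-preserving correspondence to the closed spans: images are
  limits of the corresponding linear combinations.
\<close>

lemma gram_image_exists:
  assumes M: "hilbert_fspace M" and N: "hilbert_fspace N"
    and Q: "hilbert_fspace.hclosed M Q" and R: "hilbert_fspace.hclosed N R"
    and g: "\<And>a. a \<in> I \<Longrightarrow> g a \<in> Q" and g': "\<And>a. a \<in> I \<Longrightarrow> g' a \<in> R"
    and gram: "\<And>a b. a \<in> I \<Longrightarrow> b \<in> I \<Longrightarrow> ip M (g a) (g b) = ip N (g' a) (g' b)"
    and total: "\<And>h. h \<in> Q \<Longrightarrow> (\<And>a. a \<in> I \<Longrightarrow> ip M h (g a) = 0) \<Longrightarrow> h = 0"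
    and x: "x \<in> Q"
  shows "\<exists>y\<in>R. hnorm N y = hnorm M x \<and> (\<forall>a\<in>I. ip N y (g' a) = ip M x (g a))"
proof -
  interpret M: hilbert_fspace M by fact
  interpret N: hilbert_fspace N by fact
  have QM: "Q \<subseteq> car M" "fun_vs.subspace Q" and RN: "R \<subseteq> car N" "fun_vs.subspace R"
    using Q R unfolding M.hclosed_def N.hclosed_def by auto
  have gM: "g a \<in> car M" and g'N: "g' a \<in> car N" if "a \<in> I" for a using g g' QM RN that by blast+
  let ?S = "{lincomb g A c | A c. finite A \<and> A \<subseteq> I}"
  have SQ: "?S \<subseteq> Q"
  proof
    fix v assume "v \<in> ?S"
    then obtain A c where "v = lincomb g A c" "A \<subseteq> I" by blast
    then show "v \<in> Q" using M.lincomb_mem[OF QM, of A g c] g by blast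
  qed
  have xM: "x \<in> car M" using x QM by blast
  obtain p X where p: "p \<in> car M" "\<And>n::nat. X n \<in> ?S" "(\<lambda>n. hnorm M (X n - p)) \<longlonglongrightarrow> 0"
    "\<And>v. v \<in> ?S \<Longrightarrow> ip M (x - p) v = 0"
    by (rule M.approximate_projection[of ?S x]) (use SQ QM xM M.subspace_lincombs in auto)
  have "p \<in> Q" using Q p SQ unfolding M.hclosed_def by blast
  have "x - p = 0"
  proof (rule total)
    show "x - p \<in> Q" using fun_vs.subspace_diff[OF QM(2) x \<open>p \<in> Q\<close>] .
    fix a assume a: "a \<in> I"
    have "g a = lincomb g {a} (\<lambda>_. 1)" by (simp add: lincomb_def fscale_def)
    then have "g a \<in> ?S" using a by blast
    then show "ip M (x - p) (g a) = 0" by (rule p(4))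
  qed
  then have px: "p = x" by simp
  have "\<exists>A c. X n = lincomb g A c \<and> finite A \<and> A \<subseteq> I" for n using p(2)[of n] by blast
  then have "\<forall>n. \<exists>Ac. X n = lincomb g (fst Ac) (snd Ac) \<and> finite (fst Ac) \<and> fst Ac \<subseteq> I" by force
  from choice[OF this] obtain Ac where
    "\<And>n. X n = lincomb g (fst (Ac n)) (snd (Ac n)) \<and> finite (fst (Ac n)) \<and> fst (Ac n) \<subseteq> I" by blast
  then obtain A c where X: "\<And>n. X n = lincomb g (A n) (c n)" "\<And>n. finite (A n)" "\<And>n. A n \<subseteq> I"
    using that[of "\<lambda>n. fst (Ac n)" "\<lambda>n. snd (Ac n)"] by blast
  define Y where "Y n = lincomb g' (A n) (c n)" for n
  have XM: "X n \<in> car M" for n using p(2)[of n] SQ QM by blast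
  have YR: "Y n \<in> R" for n unfolding Y_def by (rule N.lincomb_mem[OF RN]) (use g' X(3) in blast)
  then have YN: "Y n \<in> car N" for n using RN by blast
  have ipXY: "ip N (Y n) (Y m) = ip M (X n) (X m)" for n m
  proof -
    have "ip N (Y n) (Y m) = (\<Sum>a\<in>A n. \<Sum>b\<in>A m. c n a * cnj (c m b) * ip N (g' a) (g' b))"
      unfolding Y_def by (rule N.ip_lincomb) (use g'N X(3) in blast)
    also have "\<dots> = (\<Sum>a\<in>A n. \<Sum>b\<in>A m. c n a * cnj (c m b) * ip M (g a) (g b))"
      by (intro sum.cong refl) (use gram X(3) in \<open>simp add: subset_iff\<close>)
    also have "\<dots> = ip M (X n) (X m)"
      unfolding X(1) by (rule M.ip_lincomb[symmetric]) (use gM X(3) in blast)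
    finally show ?thesis .
  qed
  have nXY: "hnorm N (Y n) = hnorm M (X n)" for n unfolding hnorm_def ipXY ..
  have dXY: "hnorm N (Y n - Y m) = hnorm M (X n - X m)" for n m
  proof -
    have "(hnorm N (Y n - Y m))\<^sup>2 = (hnorm M (X n - X m))\<^sup>2"
      by (simp add: N.hnorm_diff_power2 M.hnorm_diff_power2 XM YN nXY ipXY)
    then show ?thesis using XM YN by (simp add: power2_eq_iff_nonneg M.car_diff N.car_diff)
  qed
  have "\<exists>y\<in>car N. (\<lambda>n. hnorm N (Y n - y)) \<longlonglongrightarrow> 0"
  proof (rule N.complete[OF YN], unfold dXY, intro allI impI)
    fix e :: real assume e: "e > 0"
    then have "\<forall>\<^sub>F n in sequentially. hnorm M (X n - p) < e / 2"
      using order_tendstoD(2)[OF p(3), of "e/2"] by simp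
    then obtain n0 where n0: "\<And>n. n \<ge> n0 \<Longrightarrow> hnorm M (X n - p) < e / 2"
      unfolding eventually_sequentially by blast
    have "hnorm M (X n - X m) < e" if "n \<ge> n0" "m \<ge> n0" for n m
      using M.hnorm_triangle_diff[OF XM p(1) XM, of n m] n0[OF that(1)] n0[OF that(2)]
        M.hnorm_uminus_diff[OF XM p(1), of m] by linarith
    then show "\<exists>n0. \<forall>n\<ge>n0. \<forall>n'\<ge>n0. hnorm M (X n - X n') < e" by blast
  qed
  then obtain y where y: "y \<in> car N" "(\<lambda>n. hnorm N (Y n - y)) \<longlonglongrightarrow> 0" by blast
  have "y \<in> R" using R y YR unfolding N.hclosed_def by blast
  moreover have "hnorm N y = hnorm M x"
    using LIMSEQ_unique[OF N.hnorm_limit(1)[OF YN y] M.hnorm_limit(1)[OF XM p(1,3), folded nXY]] px by simp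
  moreover have "ip N y (g' a) = ip M x (g a)" if a: "a \<in> I" for a
  proof -
    have "ip N (Y n) (g' a) = ip M (X n) (g a)" for n
    proof -
      have 1: "g' a = lincomb g' {a} (\<lambda>_. 1)" "g a = lincomb g {a} (\<lambda>_. 1)" by (simp_all add: lincomb_def fscale_def)
      have "ip N (Y n) (g' a) = (\<Sum>b\<in>A n. \<Sum>b'\<in>{a}. c n b * cnj 1 * ip N (g' b) (g' b'))"
        unfolding Y_def by (subst 1(1), rule N.ip_lincomb) (use g'N X(3) a in blast)
      also have "\<dots> = (\<Sum>b\<in>A n. \<Sum>b'\<in>{a}. c n b * cnj 1 * ip M (g b) (g b'))"
        by (intro sum.cong refl) (use gram X(3) a in \<open>simp add: subset_iff\<close>)
      also have "\<dots> = ip M (lincomb g (A n) (c n)) (lincomb g {a} (\<lambda>_. 1))"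
        by (rule M.ip_lincomb[symmetric]) (use gM X(3) a in blast)
      also have "\<dots> = ip M (X n) (g a)" by (simp only: X(1) 1(2)[symmetric])
      finally show ?thesis .
    qed
    then have "(\<lambda>n. ip M (X n) (g a)) \<longlonglongrightarrow> ip N y (g' a)"
      using N.hnorm_limit(2)[OF YN y g'N[OF a]] by simp
    then show ?thesis
      using LIMSEQ_unique M.hnorm_limit(2)[OF XM p(1,3) gM[OF a]] px by blast
  qed
  ultimately show ?thesis by blast
qed

text \<open>
  The image of \<open>x\<close> is determined by its inner products with the \<open>g' a\<close>.  This makes the map
  linear, and exchanging the roles of the two families makes it surjective; inner products are
  recovered from norms.
\<close>

lemma unitary_of_equal_gramians:
  assumes M: "hilbert_fspace M" and N: "hilbert_fspace N"
    and Q: "hilbert_fspace.hclosed M Q" and R: "hilbert_fspace.hclosed N R"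
    and g: "\<And>a. a \<in> I \<Longrightarrow> g a \<in> Q" and g': "\<And>a. a \<in> I \<Longrightarrow> g' a \<in> R"
    and gram: "\<And>a b. a \<in> I \<Longrightarrow> b \<in> I \<Longrightarrow> ip M (g a) (g b) = ip N (g' a) (g' b)"
    and total: "\<And>h. h \<in> Q \<Longrightarrow> (\<And>a. a \<in> I \<Longrightarrow> ip M h (g a) = 0) \<Longrightarrow> h = 0"
    and total': "\<And>h. h \<in> R \<Longrightarrow> (\<And>a. a \<in> I \<Longrightarrow> ip N h (g' a) = 0) \<Longrightarrow> h = 0"
  obtains V where "hunitary M N Q R V" "\<And>a. a \<in> I \<Longrightarrow> V (g a) = g' a"
proof -
  interpret M: hilbert_fspace M by fact
  interpret N: hilbert_fspace N by fact
  have QM: "Q \<subseteq> car M" "fun_vs.subspace Q" and RN: "R \<subseteq> car N" "fun_vs.subspace R"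
    using Q R unfolding M.hclosed_def N.hclosed_def by auto
  have gM: "g a \<in> car M" and g'N: "g' a \<in> car N" if "a \<in> I" for a using g g' QM RN that by blast+
  have uniq: "y = z" if "y \<in> R" "z \<in> R" "\<And>a. a \<in> I \<Longrightarrow> ip N y (g' a) = ip N z (g' a)" for y z
  proof -
    have "y - z = 0"
      by (rule total'[OF fun_vs.subspace_diff[OF RN(2)]]) (use that RN g'N in \<open>auto simp: N.ip_diff_left subset_iff\<close>)
    then show ?thesis by simp
  qed
  have uniq': "y = z" if "y \<in> Q" "z \<in> Q" "\<And>a. a \<in> I \<Longrightarrow> ip M y (g a) = ip M z (g a)" for y z
  proof -
    have "y - z = 0"
      by (rule total[OF fun_vs.subspace_diff[OF QM(2)]]) (use that QM gM in \<open>auto simp: M.ip_diff_left subset_iff\<close>)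
    then show ?thesis by simp
  qed
  have "\<forall>x\<in>Q. \<exists>y. y \<in> R \<and> hnorm N y = hnorm M x \<and> (\<forall>a\<in>I. ip N y (g' a) = ip M x (g a))"
  proof
    fix x assume x: "x \<in> Q"
    have "\<exists>y\<in>R. hnorm N y = hnorm M x \<and> (\<forall>a\<in>I. ip N y (g' a) = ip M x (g a))"
      by (rule gram_image_exists[OF M N Q R]) (fact g g' gram total x)+
    then show "\<exists>y. y \<in> R \<and> hnorm N y = hnorm M x \<and> (\<forall>a\<in>I. ip N y (g' a) = ip M x (g a))" by blast
  qed
  from bchoice[OF this] obtain V where
    V: "\<And>x. x \<in> Q \<Longrightarrow> V x \<in> R \<and> hnorm N (V x) = hnorm M x \<and> (\<forall>a\<in>I. ip N (V x) (g' a) = ip M x (g a))" by blast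
  have add: "V (x + y) = V x + V y" if xy: "x \<in> Q" "y \<in> Q" for x y
  proof (rule uniq)
    have s: "x + y \<in> Q" by (rule fun_vs.subspace_add[OF QM(2) xy])
    show "V (x + y) \<in> R" "V x + V y \<in> R" using V s xy fun_vs.subspace_add[OF RN(2)] by blast+
    fix a assume a: "a \<in> I"
    have "V x \<in> car N" "V y \<in> car N" "x \<in> car M" "y \<in> car M" using V xy QM RN by blast+
    then show "ip N (V (x + y)) (g' a) = ip N (V x + V y) (g' a)"
      using V[OF s] V[OF xy(1)] V[OF xy(2)] a gM[OF a] g'N[OF a] by (simp add: M.ip_add N.ip_add)
  qed
  have scale: "V (fscale c x) = fscale c (V x)" if x: "x \<in> Q" for c x
  proof (rule uniq)
    have s: "fscale c x \<in> Q" by (rule fun_vs.subspace_scale[OF QM(2) x])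
    show "V (fscale c x) \<in> R" "fscale c (V x) \<in> R" using V s x fun_vs.subspace_scale[OF RN(2)] by blast+
    fix a assume a: "a \<in> I"
    have "V x \<in> car N" "x \<in> car M" using V x QM RN by blast+
    then show "ip N (V (fscale c x)) (g' a) = ip N (fscale c (V x)) (g' a)"
      using V[OF s] V[OF x] a gM[OF a] g'N[OF a] by (simp add: M.ip_scale N.ip_scale)
  qed
  have ipV: "ip N (V x) (V y) = ip M x y" if xy: "x \<in> Q" "y \<in> Q" for x y
  proof -
    have re: "Re (ip N (V x) (V y)) = Re (ip M x y)" if xy: "x \<in> Q" "y \<in> Q" for x y
    proof -
      have c: "V x \<in> car N" "V y \<in> car N" "x \<in> car M" "y \<in> car M" using V xy QM RN by blast+
      have d: "x - y \<in> Q" by (rule fun_vs.subspace_diff[OF QM(2) xy])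
      have "V (x - y) = V x - V y"
        using add[OF d xy(2)] by (simp add: algebra_simps)
      then have "hnorm N (V x - V y) = hnorm M (x - y)" using V[OF d] by simp
      then show ?thesis
        using N.hnorm_diff_power2[OF c(1,2)] M.hnorm_diff_power2[OF c(3,4)] V[OF xy(1)] V[OF xy(2)] by simp
    qed
    have c: "V x \<in> car N" "V y \<in> car N" "x \<in> car M" "y \<in> car M" using V xy QM RN by blast+
    have "Re (ip N (V (fscale \<i> x)) (V y)) = Re (ip M (fscale \<i> x) y)"
      by (rule re[OF fun_vs.subspace_scale[OF QM(2) xy(1)] xy(2)])
    then have "Re (\<i> * ip N (V x) (V y)) = Re (\<i> * ip M x y)"
      by (simp only: scale[OF xy(1)] N.ip_scale[OF c(1,2)] M.ip_scale[OF c(3,4)])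
    then have "Im (ip N (V x) (V y)) = Im (ip M x y)" by simp
    with re[OF xy] show ?thesis by (simp add: complex_eq_iff)
  qed
  have "inj_on V Q"
  proof (rule inj_onI)
    fix x y assume xy: "x \<in> Q" "y \<in> Q" "V x = V y"
    show "x = y"
    proof (rule uniq'[OF xy(1,2)])
      fix a assume "a \<in> I"
      then show "ip M x (g a) = ip M y (g a)" using V[OF xy(1)] V[OF xy(2)] xy(3) by simp
    qed
  qed
  moreover have "V ` Q = R"
  proof (intro equalityI subsetI)
    fix y assume y: "y \<in> R"
    have "\<exists>x\<in>Q. hnorm M x = hnorm N y \<and> (\<forall>a\<in>I. ip M x (g a) = ip N y (g' a))"
      by (rule gram_image_exists[OF N M R Q]) (fact g g' gram[symmetric] total' y)+
    then obtain x where x: "x \<in> Q" "\<forall>a\<in>I. ip M x (g a) = ip N y (g' a)" by blast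
    have "V x = y" by (rule uniq) (use V x y in auto)
    then show "y \<in> V ` Q" using x by blast
  qed (use V in blast)
  ultimately have "hunitary M N Q R V"
    unfolding hunitary_def bij_betw_def using add scale ipV by blast
  moreover have "V (g a) = g' a" if a: "a \<in> I" for a
    by (rule uniq) (use V[OF g[OF a]] g'[OF a] gram[OF a] in auto)
  ultimately show ?thesis using that by blast
qed

section \<open>Multi-indices and words\<close>

text \<open>A multi-index as a word, in which derivatives are easier to split and to permute.\<close>

definition expand :: "('m::{finite,linorder} \<Rightarrow> nat) \<Rightarrow> 'm list" where
  "expand \<alpha> = concat (map (\<lambda>i. replicate (\<alpha> i) i) (sorted_list_of_set UNIV))"

lemma multi_deriv_expand: "multi_deriv D \<alpha> f = foldr D (expand \<alpha>) f"
proof -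
  have "foldr D (replicate n i) = D i ^^ n" for i n
    by (induction n) (auto simp: fun_eq_iff)
  then have "foldr (\<lambda>i g. (D i ^^ \<alpha> i) \<circ> g) xs id f = foldr D (concat (map (\<lambda>i. replicate (\<alpha> i) i) xs)) f" for xs
    by (induction xs) auto
  then show ?thesis by (simp add: multi_deriv_def expand_def)
qed

lemma count_expand: "count (mset (expand \<alpha>)) i = \<alpha> i"
proof -
  have "count (mset (concat (map (\<lambda>i. replicate (\<alpha> i) i) xs))) i = (if i \<in> set xs then \<alpha> i else 0)"
    if "distinct xs" for xs
    using that by (induction xs) auto
  then show ?thesis unfolding expand_def by simp
qed

lemma set_expand: "set (expand \<alpha>) = {i. \<alpha> i \<noteq> 0}"
  by (auto simp: expand_def)

lemma length_expand: "length (expand \<alpha>) = (\<Sum>i\<in>UNIV. \<alpha> i)"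
  by (simp add: expand_def length_concat o_def sum_list_distinct_conv_sum_set)

lemma ex_index_of_list:
  fixes xs :: "'m::{finite,linorder} list"
  obtains \<alpha> where "mset (expand \<alpha>) = mset xs"
  using that[of "count (mset xs)"] by (auto simp: multiset_eq_iff count_expand)

lemma expand_mem_index_set: "\<alpha> \<in> index_set d k \<longleftrightarrow> set (expand \<alpha>) \<subseteq> transv d \<and> length (expand \<alpha>) < k"
  by (auto simp: index_set_def transv_indices_def set_expand length_expand)

lemma expand_mem_transv_indices: "\<alpha> \<in> transv_indices d \<longleftrightarrow> set (expand \<alpha>) \<subseteq> transv d"
  by (auto simp: transv_indices_def set_expand)

lemma expand_eq_Nil: "expand \<alpha> = [] \<longleftrightarrow> \<alpha> = (\<lambda>_. 0)"
  using set_expand[of \<alpha>] by (auto simp: fun_eq_iff)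

lemma foldr_wirt_perm:
  assumes "mholomorphic_on S f" "open S" "w \<in> S" "mset xs = mset ys"
  shows "foldr wirt xs f w = foldr wirt ys f w"
proof -
  have "derivs (map Hol xs) f w = derivs (map Hol ys) f w"
    by (rule derivs_perm[OF assms(2) mholomorphic_on_polarizable[OF assms(1,2)] _ assms(3)]) (simp add: assms(4))
  then show ?thesis using derivs_holomorphic(1)[OF assms(2,1,3)] by simp
qed

lemma hol_words:
  assumes "set ws \<subseteq> dirs T" "nanti ws < 1"
  obtains xs where "ws = map Hol xs" "set xs \<subseteq> T"
proof -
  have "\<exists>xs. ws = map Hol xs \<and> set xs \<subseteq> T"
    using assms
  proof (induction ws)
    case (Cons x ws)
    then obtain i where "x = Hol i" "i \<in> T" by auto
    moreover obtain xs where "ws = map Hol xs" "set xs \<subseteq> T" using Cons calculation by auto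
    ultimately have "x # ws = map Hol (i # xs) \<and> set (i # xs) \<subseteq> T" by simp
    then show ?case by (intro exI[of _ "i # xs"])
  qed simp
  then show ?thesis using that by blast
qed

lemma jet_zero_holomorphic:
  assumes f: "mholomorphic_on S f" and S: "open S" and Z: "Z \<subseteq> S"
  shows "jet_zero T k 1 k Z f \<longleftrightarrow> (\<forall>xs. set xs \<subseteq> T \<longrightarrow> length xs < k \<longrightarrow> (\<forall>z\<in>Z. foldr wirt xs f z = 0))"
proof
  assume j: "jet_zero T k 1 k Z f"
  show "\<forall>xs. set xs \<subseteq> T \<longrightarrow> length xs < k \<longrightarrow> (\<forall>z\<in>Z. foldr wirt xs f z = 0)"
  proof (intro allI impI ballI)
    fix xs z assume xs: "set xs \<subseteq> T" "length xs < k" "z \<in> Z"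
    have "set (map Hol xs) \<subseteq> dirs T" using xs by auto
    then have "derivs (map Hol xs) f z = 0" using j xs unfolding jet_zero_def by simp
    then show "foldr wirt xs f z = 0" using derivs_holomorphic(1)[OF S f] Z xs(3) by auto
  qed
next
  assume j: "\<forall>xs. set xs \<subseteq> T \<longrightarrow> length xs < k \<longrightarrow> (\<forall>z\<in>Z. foldr wirt xs f z = 0)"
  show "jet_zero T k 1 k Z f"
    unfolding jet_zero_def
  proof (intro allI impI ballI)
    fix ws z assume ws: "set ws \<subseteq> dirs T" "nhol ws < k" "nanti ws < 1" "length ws < k" "z \<in> Z"
    obtain xs where "ws = map Hol xs" "set xs \<subseteq> T" using hol_words ws(1,3) .
    then show "derivs ws f z = 0" using derivs_holomorphic(1)[OF S f] j ws Z by auto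
  qed
qed

lemma jet_zero_multi_index:
  fixes f :: "'m::{finite,linorder} cvec \<Rightarrow> complex"
  assumes f: "mholomorphic_on S f" and S: "open S" and Z: "Z \<subseteq> S"
  shows "jet_zero (transv d) k 1 k Z f \<longleftrightarrow> (\<forall>\<alpha>\<in>index_set d k. \<forall>z\<in>Z. multi_deriv wirt \<alpha> f z = 0)"
  unfolding jet_zero_holomorphic[OF assms] multi_deriv_expand
proof (intro iffI ballI allI impI)
  fix xs :: "'m list" and z
  assume *: "\<forall>\<alpha>\<in>index_set d k. \<forall>z\<in>Z. foldr wirt (expand (\<alpha> :: 'm \<Rightarrow> nat)) f z = 0"
    and xs: "set xs \<subseteq> transv d" "length xs < k" "z \<in> Z"
  obtain \<alpha> where \<alpha>: "mset (expand \<alpha>) = mset xs" using ex_index_of_list .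
  then have "set (expand \<alpha>) = set xs" "length (expand \<alpha>) = length xs" by (metis set_mset_mset, metis size_mset)
  then have "foldr wirt (expand \<alpha>) f z = 0" using * xs expand_mem_index_set by metis
  then show "foldr wirt xs f z = 0" using foldr_wirt_perm[OF f S _ \<alpha>] xs(3) Z by auto
qed (auto simp: expand_mem_index_set)

lemma foldr_wirt_sharp:
  assumes f: "mholomorphic_on S f" and S: "open S"
  shows "w \<in> vcnj ` S \<Longrightarrow> foldr wirt xs (\<lambda>w. cnj (f (vcnj w))) w = cnj (foldr wirt xs f (vcnj w))"
proof (induction xs arbitrary: w)
  case (Cons i xs)
  let ?g = "foldr wirt xs f"
  have g: "mholomorphic_on S ?g" by (rule mholomorphic_on_foldr_wirt[OF S f])
  have w: "vcnj w \<in> S" using Cons.prems by (simp add: vcnj_image_iff)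
  have "foldr wirt (i # xs) (\<lambda>w. cnj (f (vcnj w))) w = wirt i (\<lambda>w. cnj (?g (vcnj w))) w"
    using ddir_cong[OF open_vcnj[OF S] Cons.IH Cons.prems, where x="Hol i"] by simp
  also have "\<dots> = cnj (wirt i ?g (vcnj w))"
  proof (rule wirt_of_slice(1))
    have "((cnj \<circ> (\<lambda>\<zeta>. ?g (vcnj w + axis i \<zeta>)) \<circ> cnj) has_field_derivative cnj (wirt i ?g (vcnj w))) (at (cnj 0))"
      by (rule has_field_derivative_cnj_cnj) (use mholomorphic_on_derivative(2)[OF g S w] in simp)
    then show "((\<lambda>\<zeta>. cnj (?g (vcnj (w + axis i \<zeta>)))) has_field_derivative cnj (wirt i ?g (vcnj w))) (at 0)"
      by (simp add: o_def)
  qed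
  finally show ?case by simp
qed simp

lemma pmul_apply: "pmul f h z = f z *s h z"
  by (simp add: pmul_def)

lemma sum_fun_apply: "(sum f A) z = (\<Sum>a\<in>A. f a z)"
  by (induction A rule: infinite_finite_induct) auto

section \<open>Kernel functions and fibres\<close>

locale jet_module = hilbert_module \<Omega> M
  for \<Omega> :: "'m::{finite,linorder} cvec set" and M :: "('m, 'r::finite) fspace" +
  assumes open_dom: "open \<Omega>"
begin

abbreviation dual_dom :: "'m cvec set" where "dual_dom \<equiv> vcnj ` \<Omega>"

lemma open_dual: "open dual_dom" by (rule open_vcnj[OF open_dom])

lemma rkernel:
  assumes z: "z \<in> \<Omega>"
  shows "rkernel M z \<zeta> \<in> car M"
    and "h \<in> car M \<Longrightarrow> ip M h (rkernel M z \<zeta>) = (\<Sum>j\<in>UNIV. h z $ j * cnj (\<zeta> $ j))"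
proof -
  obtain C where C: "\<forall>h\<in>car M. norm (h z) \<le> C * hnorm M h" using eval_bounded[OF z] by blast
  obtain g where g: "g \<in> car M" "\<And>h. h \<in> car M \<Longrightarrow> (\<Sum>j\<in>UNIV. h z $ j * cnj (\<zeta> $ j)) = ip M h g"
  proof (rule riesz[of "\<lambda>h. \<Sum>j\<in>UNIV. h z $ j * cnj (\<zeta> $ j)" "C * (\<Sum>j\<in>UNIV. cmod (\<zeta> $ j))"])
    fix h assume h: "h \<in> car M"
    have "cmod (\<Sum>j\<in>UNIV. h z $ j * cnj (\<zeta> $ j)) \<le> (\<Sum>j\<in>UNIV. C * hnorm M h * cmod (\<zeta> $ j))"
    proof (rule sum_norm_le)
      fix j
      have "cmod (h z $ j) \<le> C * hnorm M h"
        using Finite_Cartesian_Product.norm_nth_le[of "h z" j] C h by force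
      then show "cmod (h z $ j * cnj (\<zeta> $ j)) \<le> C * hnorm M h * cmod (\<zeta> $ j)"
        by (simp add: norm_mult mult_right_mono)
    qed
    then show "cmod (\<Sum>j\<in>UNIV. h z $ j * cnj (\<zeta> $ j)) \<le> C * (\<Sum>j\<in>UNIV. cmod (\<zeta> $ j)) * hnorm M h"
      by (simp add: sum_distrib_left sum_distrib_right mult_ac)
  qed (auto simp: fscale_def sum.distrib sum_distrib_left distrib_right mult.assoc)
  have "rkernel M z \<zeta> = g"
    unfolding rkernel_def by (rule the_equality) (use g in \<open>auto intro!: ip_ext\<close>)
  with g show "rkernel M z \<zeta> \<in> car M"
    and "h \<in> car M \<Longrightarrow> ip M h (rkernel M z \<zeta>) = (\<Sum>j\<in>UNIV. h z $ j * cnj (\<zeta> $ j))" by auto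
qed

lemma kframe_mem: "w \<in> dual_dom \<Longrightarrow> kframe M j w \<in> car M"
  unfolding kframe_def by (rule rkernel(1)) (simp add: vcnj_image_iff)

lemma ip_kframe:
  assumes "w \<in> dual_dom" "h \<in> car M"
  shows "ip M h (kframe M j w) = h (vcnj w) $ j" "ip M (kframe M j w) h = cnj (h (vcnj w) $ j)"
proof -
  have "ip M h (kframe M j w) = (\<Sum>i\<in>UNIV. h (vcnj w) $ i * cnj (axis j 1 $ i))"
    unfolding kframe_def by (rule rkernel(2)) (use assms in \<open>simp_all add: vcnj_image_iff\<close>)
  also have "\<dots> = h (vcnj w) $ j" by (subst sum.remove[of _ j]) (auto simp: axis_def)
  finally show "ip M h (kframe M j w) = h (vcnj w) $ j" .
  then show "ip M (kframe M j w) h = cnj (h (vcnj w) $ j)"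
    using ip_cnj[OF assms(2) kframe_mem[OF assms(1)]] by simp
qed

lemma kframe_weakly_holomorphic: "weakly_holomorphic M dual_dom (kframe M j)"
  unfolding weakly_holomorphic_def
proof (intro conjI ballI kframe_mem)
  fix h assume h: "h \<in> car M"
  show "mholomorphic_on dual_dom (\<lambda>w. ip M (kframe M j w) h)"
    by (rule mholomorphic_on_cong[OF mholomorphic_on_sharp[OF holomorphic[OF h]]]) (simp add: ip_kframe(2) h)
qed

text \<open>The constant functions, which serve as a basis dual to the kernel frame at every point.\<close>

definition cst :: "'r \<Rightarrow> ('m, 'r) vfun" where
  "cst l z = (if z \<in> \<Omega> then axis l 1 else 0)"

lemma cst_mem [simp]: "cst l \<in> car M"
proof -
  have "cst l = (\<lambda>z. if z \<in> \<Omega> then \<Sum>\<alpha>\<in>{\<lambda>_. 0}. (\<Prod>i\<in>UNIV. z $ i ^ \<alpha> i) *s axis l 1 else 0)"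
    by (simp add: cst_def fun_eq_iff)
  also have "\<dots> \<in> car M" by (rule polynomials) simp
  finally show ?thesis .
qed

lemma cst_eval: "z \<in> \<Omega> \<Longrightarrow> cst l z $ j = (if j = l then 1 else 0)"
  by (auto simp: cst_def axis_def)

lemma sum_cst_eval: "z \<in> \<Omega> \<Longrightarrow> (\<Sum>l\<in>UNIV. fscale (c l) (cst l)) z $ j = c j"
  by (simp add: sum_fun_apply fscale_def cst_eval if_distrib cong: if_cong)

lemma coord_fun_algebra: "(\<lambda>z. z $ i) \<in> fun_algebra \<Omega>"
  unfolding fun_algebra_def by (auto intro!: exI[of _ "\<lambda>z. z $ i"] exI[of _ UNIV])

lemma coord_mul_mem: "h \<in> car M \<Longrightarrow> pmul (\<lambda>z. z $ i) h \<in> car M"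
  by (rule action_closed[OF coord_fun_algebra])

text \<open>Continuity of the action at \<open>0\<close>, rescaled.\<close>

lemma coord_mul_bounded: "\<exists>C. \<forall>h\<in>car M. hnorm M (pmul (\<lambda>z. z $ i) h) \<le> C * hnorm M h"
proof -
  let ?f = "\<lambda>z :: 'm cvec. z $ i"
  obtain \<delta> where \<delta>: "\<delta> > 0" "\<And>h'. h' \<in> car M \<Longrightarrow> hnorm M (0 - h') < \<delta> \<Longrightarrow> hnorm M (pmul ?f 0 - pmul ?f h') < 1"
    using action_continuous[OF coord_fun_algebra car_zero zero_less_one, of i] coord_fun_algebra
    by (metis diff_self norm_zero)
  have small: "hnorm M (pmul ?f h) < 1" if h: "h \<in> car M" "hnorm M h < \<delta>" for h
  proof -
    have "hnorm M (pmul ?f h - pmul ?f 0) < 1"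
      using \<delta>(2)[OF h(1)] h hnorm_uminus_diff[OF car_zero h(1)]
        hnorm_uminus_diff[OF coord_mul_mem[OF car_zero] coord_mul_mem[OF h(1)], of i i] by simp
    moreover have "pmul ?f 0 = (0 :: ('m, 'r) vfun)" by (simp add: pmul_def fun_eq_iff)
    ultimately show ?thesis by simp
  qed
  have "hnorm M (pmul ?f h) \<le> 2 / \<delta> * hnorm M h" if h: "h \<in> car M" for h
  proof (cases "hnorm M h = 0")
    case True
    then have "h = 0" using hnorm_eq_0[OF h] by simp
    then have "pmul ?f h = 0" by (simp add: pmul_def fun_eq_iff)
    then have "hnorm M (pmul ?f h) = 0" using hnorm_eq_0[OF car_zero] by simp
    then show ?thesis using True by simp
  next
    case False
    then have n: "hnorm M h > 0" using hnorm_ge0[OF h] by linarith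
    define c where "c = \<delta> / (2 * hnorm M h)"
    have c: "c > 0" using n \<delta>(1) by (simp add: c_def)
    have "hnorm M (fscale (of_real c) h) < \<delta>"
    proof -
      have "hnorm M (fscale (of_real c) h) = c * hnorm M h"
        using hnorm_scale[OF h, of "of_real c"] c by simp
      also have "\<dots> < \<delta>" using n \<delta>(1) by (simp add: c_def)
      finally show ?thesis .
    qed
    then have "hnorm M (pmul ?f (fscale (of_real c) h)) < 1" by (rule small[OF car_scale[OF h]])
    moreover have "pmul ?f (fscale (of_real c) h) = fscale (of_real c) (pmul ?f h)"
      by (simp add: pmul_def fscale_def fun_eq_iff vec_eq_iff)
    ultimately have "c * hnorm M (pmul ?f h) < 1" using hnorm_scale[OF coord_mul_mem[OF h], of "of_real c"] c by simp
    then show ?thesis using n \<delta>(1) by (simp add: c_def field_simps)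
  qed
  then show ?thesis by blast
qed

lemma coord_adj:
  assumes g: "g \<in> car M"
  shows "coord_adj M i g \<in> car M"
    and "h \<in> car M \<Longrightarrow> ip M (pmul (\<lambda>z. z $ i) h) g = ip M h (coord_adj M i g)"
proof -
  let ?T = "pmul (\<lambda>z :: 'm cvec. z $ i) :: ('m, 'r) vfun \<Rightarrow> _"
  obtain C where C: "\<forall>h\<in>car M. hnorm M (?T h) \<le> C * hnorm M h" using coord_mul_bounded by blast
  obtain k where k: "k \<in> car M" "\<And>h. h \<in> car M \<Longrightarrow> ip M (?T h) g = ip M h k"
  proof (rule riesz[of "\<lambda>h. ip M (?T h) g" "C * hnorm M g"])
    fix x y assume xy: "x \<in> car M" "y \<in> car M"
    have "?T (x + y) = ?T x + ?T y" by (simp add: pmul_def fun_eq_iff vec_eq_iff algebra_simps)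
    then show "ip M (?T (x + y)) g = ip M (?T x) g + ip M (?T y) g"
      using xy g by (simp add: ip_add coord_mul_mem)
  next
    fix c x assume x: "x \<in> car M"
    have "?T (fscale c x) = fscale c (?T x)" by (simp add: pmul_def fscale_def fun_eq_iff vec_eq_iff)
    then show "ip M (?T (fscale c x)) g = c * ip M (?T x) g"
      using x g by (simp add: ip_scale coord_mul_mem)
  next
    fix x assume x: "x \<in> car M"
    have "cmod (ip M (?T x) g) \<le> hnorm M (?T x) * hnorm M g" by (rule cauchy_schwarz[OF coord_mul_mem[OF x] g])
    also have "\<dots> \<le> C * hnorm M x * hnorm M g" using C x g by (intro mult_right_mono) auto
    finally show "cmod (ip M (?T x) g) \<le> C * hnorm M g * hnorm M x" by (simp add: mult_ac)
  qed blast
  have "coord_adj M i g = k"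
    unfolding coord_adj_def hadjoint_def by (rule the_equality) (use k in \<open>auto intro!: ip_ext\<close>)
  with k show "coord_adj M i g \<in> car M"
    and "h \<in> car M \<Longrightarrow> ip M (pmul (\<lambda>z. z $ i) h) g = ip M h (coord_adj M i g)" by auto
qed

text \<open>The Gleason property, applied to \<open>g\<close> minus the constant function with value \<open>g z\<close>.\<close>

lemma gleason_expansion:
  assumes g: "g \<in> car M" and z: "z \<in> \<Omega>"
  obtains q where "\<And>i. q i \<in> car M"
    "g = (\<Sum>l\<in>UNIV. fscale (g z $ l) (cst l)) + (\<Sum>i\<in>UNIV. pmul (\<lambda>w. w $ i - z $ i) (q i))"
proof -
  let ?c = "\<Sum>l\<in>UNIV. fscale (g z $ l) (cst l)"
  have c: "?c \<in> car M" by (intro car_sum car_scale) simp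
  have "(g - ?c) z = 0" using z by (simp add: vec_eq_iff sum_cst_eval)
  then obtain q where q: "\<And>i. q i \<in> car M" "\<And>w. w \<in> \<Omega> \<Longrightarrow> (g - ?c) w = (\<Sum>i\<in>UNIV. (w $ i - z $ i) *s q i w)"
    using gleason[OF car_diff[OF g c] z] by blast
  have "(g - ?c) w = (\<Sum>i\<in>UNIV. pmul (\<lambda>w. w $ i - z $ i) (q i)) w" for w
  proof (cases "w \<in> \<Omega>")
    case True
    then show ?thesis using q(2)[OF True] by (simp add: sum_fun_apply pmul_def)
  next
    case False
    then show ?thesis
      using zero_outside[OF car_diff[OF g c] False] zero_outside[OF q(1) False]
      by (simp add: sum_fun_apply pmul_def)
  qed
  then have "g - ?c = (\<Sum>i\<in>UNIV. pmul (\<lambda>w. w $ i - z $ i) (q i))" by blast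
  then have "g = ?c + (\<Sum>i\<in>UNIV. pmul (\<lambda>w. w $ i - z $ i) (q i))" by (simp add: algebra_simps)
  with q(1) show ?thesis using that by blast
qed

lemma fibre_subset: "fibre M w \<subseteq> car M" by (auto simp: fibre_def)

text \<open>
  A joint eigenvector is orthogonal to all multiples of \<open>w\<^sub>i - z\<^sub>i\<close>.  By the Gleason expansion its
  inner product with \<open>g\<close> depends on \<open>g z\<close> only, as for a combination of kernel functions.
\<close>

lemma fibre_expansion:
  assumes w: "w \<in> dual_dom" and v: "v \<in> fibre M w"
  shows "v = (\<Sum>j\<in>UNIV. fscale (ip M v (cst j)) (kframe M j w))"
proof (rule ip_ext)
  have vM: "v \<in> car M" using v fibre_subset by blast
  let ?z = "vcnj w"
  have z: "?z \<in> \<Omega>" using w by (simp add: vcnj_image_iff)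
  show "v \<in> car M" by fact
  show "(\<Sum>j\<in>UNIV. fscale (ip M v (cst j)) (kframe M j w)) \<in> car M"
    by (intro car_sum car_scale kframe_mem w)
  fix g assume g: "g \<in> car M"
  obtain q where q: "\<And>i. q i \<in> car M"
    "g = (\<Sum>l\<in>UNIV. fscale (g ?z $ l) (cst l)) + (\<Sum>i\<in>UNIV. pmul (\<lambda>w. w $ i - ?z $ i) (q i))"
    by (rule gleason_expansion[OF g z]) blast
  have pm: "pmul (\<lambda>w. w $ i - ?z $ i) (q i) = pmul (\<lambda>w. w $ i) (q i) - fscale (?z $ i) (q i)" for i
    by (simp add: pmul_def fscale_def fun_eq_iff vec_eq_iff algebra_simps)
  have pmM: "pmul (\<lambda>w. w $ i - ?z $ i) (q i) \<in> car M" for i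
    unfolding pm by (intro car_diff car_scale coord_mul_mem q(1))
  have "ip M (pmul (\<lambda>w. w $ i - ?z $ i) (q i)) v = 0" for i
  proof -
    have "coord_adj M i v = fscale (w $ i) v" using v by (simp add: fibre_def)
    then have "ip M (pmul (\<lambda>w. w $ i) (q i)) v = cnj (w $ i) * ip M (q i) v"
      using coord_adj(2)[OF vM q(1)] by (simp add: ip_scale_right vM q(1))
    then show ?thesis
      unfolding pm by (simp add: ip_diff_left coord_mul_mem q(1) car_scale vM ip_scale)
  qed
  moreover define P where "P i = pmul (\<lambda>w. w $ i - ?z $ i) (q i)" for i
  ultimately have P: "\<And>i. P i \<in> car M" "\<And>i. ip M (P i) v = 0"
    "g = (\<Sum>l\<in>UNIV. fscale (g ?z $ l) (cst l)) + (\<Sum>i\<in>UNIV. P i)"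
    using pmM q(2) by auto
  have "ip M g v = (\<Sum>l\<in>UNIV. g ?z $ l * ip M (cst l) v)"
    by (subst P(3)) (simp add: ip_add car_sum car_scale P(1,2) vM ip_sum_left ip_scale)
  also have "\<dots> = (\<Sum>j\<in>UNIV. cnj (ip M v (cst j)) * g ?z $ j)"
    using ip_cnj[OF vM cst_mem] by (intro sum.cong) (auto simp: mult.commute)
  also have "\<dots> = ip M g (\<Sum>j\<in>UNIV. fscale (ip M v (cst j)) (kframe M j w))"
    by (simp add: ip_sum_right car_scale kframe_mem w g ip_scale_right ip_kframe)
  finally show "ip M g v = ip M g (\<Sum>j\<in>UNIV. fscale (ip M v (cst j)) (kframe M j w))" .
qed

lemma subspace_fibre:
  assumes "w \<in> dual_dom" shows "fun_vs.subspace (fibre M w)"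
proof -
  have char: "v \<in> fibre M w \<longleftrightarrow> v \<in> car M \<and> (\<forall>i. \<forall>h\<in>car M. ip M (pmul (\<lambda>z. z $ i) h) v = cnj (w $ i) * ip M h v)" for v
  proof
    assume v: "v \<in> fibre M w"
    then have "v \<in> car M" "\<And>i. coord_adj M i v = fscale (w $ i) v" by (auto simp: fibre_def)
    then show "v \<in> car M \<and> (\<forall>i. \<forall>h\<in>car M. ip M (pmul (\<lambda>z. z $ i) h) v = cnj (w $ i) * ip M h v)"
      using coord_adj(2)[of v] by (simp add: ip_scale_right)
  next
    assume v: "v \<in> car M \<and> (\<forall>i. \<forall>h\<in>car M. ip M (pmul (\<lambda>z. z $ i) h) v = cnj (w $ i) * ip M h v)"
    then have "coord_adj M i v = fscale (w $ i) v" for i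
      by (intro ip_ext coord_adj(1) car_scale) (simp_all add: ip_scale_right flip: coord_adj(2))
    then show "v \<in> fibre M w" using v by (simp add: fibre_def)
  qed
  show ?thesis
    by (rule fun_vs.subspaceI; unfold char)
      (auto simp: ip_add_right ip_scale_right coord_mul_mem algebra_simps)
qed

lemma kframe_fibre:
  assumes w: "w \<in> dual_dom" shows "kframe M j w \<in> fibre M w"
proof -
  have "coord_adj M i (kframe M j w) = fscale (w $ i) (kframe M j w)" for i
    by (intro ip_ext coord_adj(1) car_scale kframe_mem w)
      (simp add: ip_scale_right kframe_mem w ip_kframe coord_mul_mem pmul_apply flip: coord_adj(2)[OF kframe_mem[OF w]])
  then show ?thesis by (simp add: fibre_def kframe_mem w)
qed

lemma ip_kframe_sum_cst:
  assumes w: "w \<in> dual_dom"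
  shows "ip M (\<Sum>j\<in>UNIV. fscale (c j) (kframe M j w)) (cst l) = c l"
proof -
  have "vcnj w \<in> \<Omega>" using w by (simp add: vcnj_image_iff)
  then show ?thesis
    by (simp add: ip_sum_left car_scale kframe_mem w ip_scale ip_kframe cst_eval if_distrib cong: if_cong)
qed

section \<open>Jets as bounded functionals and the quotient module\<close>

text \<open>Derivatives of kernel functions represent the evaluation of derivatives, see \<open>ip_jetvec\<close>.\<close>

definition jetvec :: "'m list \<Rightarrow> 'r \<Rightarrow> 'm cvec \<Rightarrow> ('m, 'r) vfun" where
  "jetvec xs j w = foldr (hderiv M) xs (kframe M j) w"

lemma jetvec_mem: "w \<in> dual_dom \<Longrightarrow> jetvec xs j w \<in> car M"
  unfolding jetvec_def
  by (rule weakly_holomorphicD(1)[OF weakly_holomorphic_hderivs(1)[OF kframe_weakly_holomorphic open_dual]])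

lemma ip_jetvec:
  assumes w: "w \<in> dual_dom" and h: "h \<in> car M"
  shows "ip M h (jetvec xs j w) = foldr wirt xs (\<lambda>z. h z $ j) (vcnj w)"
proof -
  have "ip M (jetvec xs j w) h = foldr wirt xs (\<lambda>w. ip M (kframe M j w) h) w"
    unfolding jetvec_def by (rule weakly_holomorphic_hderivs(2)[OF kframe_weakly_holomorphic open_dual w h])
  also have "\<dots> = foldr wirt xs (\<lambda>w. cnj (h (vcnj w) $ j)) w"
  proof -
    have "derivs (map Hol xs) (\<lambda>w. ip M (kframe M j w) h) w = derivs (map Hol xs) (\<lambda>w. cnj (h (vcnj w) $ j)) w"
      by (rule derivs_cong[OF open_dual _ w]) (simp add: ip_kframe h)
    then show ?thesis
      using derivs_holomorphic(1)[OF open_dual weakly_holomorphicD(2)[OF kframe_weakly_holomorphic h] w]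
        derivs_holomorphic(1)[OF open_dual mholomorphic_on_sharp[OF holomorphic[OF h]] w] by simp
  qed
  also have "\<dots> = cnj (foldr wirt xs (\<lambda>z. h z $ j) (vcnj w))"
    by (rule foldr_wirt_sharp[OF holomorphic[OF h] open_dom w])
  finally show ?thesis using ip_cnj[OF jetvec_mem[OF w] h] by simp
qed

context
  fixes d k :: nat
begin

abbreviation Z :: "'m cvec set" where "Z \<equiv> zero_locus d \<Omega>"
abbreviation M0 :: "('m, 'r) vfun set" where "M0 \<equiv> vanishing_submodule \<Omega> d k M"
abbreviation Q :: "('m, 'r) vfun set" where "Q \<equiv> quotient_module \<Omega> d k M"

lemma Z_subset: "Z \<subseteq> \<Omega>" by (auto simp: zero_locus_def)

lemma M0_jet_zero: "h \<in> M0 \<longleftrightarrow> h \<in> car M \<and> (\<forall>j. jet_zero (transv d) k 1 k Z (\<lambda>w. h w $ j))"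
  unfolding vanishing_submodule_def mem_Collect_eq
  using jet_zero_multi_index[OF holomorphic open_dom Z_subset, of h] by blast

lemma M0_jetvec:
  "h \<in> M0 \<longleftrightarrow> h \<in> car M \<and> (\<forall>j xs z. set xs \<subseteq> transv d \<longrightarrow> length xs < k \<longrightarrow> z \<in> Z \<longrightarrow> ip M h (jetvec xs j (vcnj z)) = 0)"
proof -
  have "ip M h (jetvec xs j (vcnj z)) = foldr wirt xs (\<lambda>w. h w $ j) z" if "h \<in> car M" "z \<in> Z" for xs j z
    using ip_jetvec[of "vcnj z" h xs j] that Z_subset by auto
  then show ?thesis
    unfolding M0_jet_zero using jet_zero_holomorphic[OF holomorphic open_dom Z_subset, of h] by auto
qed

lemma M0_closed: "hclosed M0"
  unfolding hclosed_def
proof (intro conjI allI impI)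
  show "M0 \<subseteq> car M" by (auto simp: vanishing_submodule_def)
  have J: "jetvec xs j (vcnj z) \<in> car M" if "z \<in> Z" for xs j z
    using jetvec_mem[of "vcnj z"] that Z_subset by auto
  show "fun_vs.subspace M0"
    by (rule fun_vs.subspaceI; unfold M0_jetvec) (auto simp: J ip_add ip_scale)
  fix X x assume X: "\<forall>n. X n \<in> M0" and x: "x \<in> car M" and lim: "(\<lambda>n. hnorm M (X n - x)) \<longlonglongrightarrow> 0"
  show "x \<in> M0"
    unfolding M0_jetvec
  proof (intro conjI x allI impI)
    fix j and xs :: "'m list" and z assume *: "set xs \<subseteq> transv d" "length xs < k" "z \<in> Z"
    have "(\<lambda>n. ip M (X n) (jetvec xs j (vcnj z))) \<longlonglongrightarrow> ip M x (jetvec xs j (vcnj z))"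
      by (rule hnorm_limit(2)[OF _ x lim J[OF *(3)]]) (use X M0_jetvec in blast)
    moreover have "ip M (X n) (jetvec xs j (vcnj z)) = 0" for n using X * M0_jetvec by blast
    ultimately show "ip M x (jetvec xs j (vcnj z)) = 0" by (simp add: LIMSEQ_const_iff)
  qed
qed

lemma Q_subset: "Q \<subseteq> car M" by (auto simp: quotient_module_def)

lemma Q_closed: "hclosed Q"
  unfolding hclosed_def
proof (intro conjI allI impI)
  show "Q \<subseteq> car M" by (rule Q_subset)
  have M0: "g \<in> car M" if "g \<in> M0" for g using that by (simp add: vanishing_submodule_def)
  show "fun_vs.subspace Q"
    by (rule fun_vs.subspaceI) (auto simp: quotient_module_def M0 ip_add ip_scale)
  fix X x assume X: "\<forall>n. X n \<in> Q" and x: "x \<in> car M" and lim: "(\<lambda>n. hnorm M (X n - x)) \<longlonglongrightarrow> 0"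
  have "ip M x g = 0" if g: "g \<in> M0" for g
  proof -
    have "(\<lambda>n. ip M (X n) g) \<longlonglongrightarrow> ip M x g"
      by (rule hnorm_limit(2)[OF _ x lim M0[OF g]]) (use X Q_subset in blast)
    moreover have "ip M (X n) g = 0" for n using X g by (auto simp: quotient_module_def)
    ultimately show ?thesis by (simp add: LIMSEQ_const_iff)
  qed
  then show "x \<in> Q" using x by (simp add: quotient_module_def)
qed

lemma hproj:
  assumes h: "h \<in> car M"
  shows "hproj M Q h \<in> Q" "h - hproj M Q h \<in> M0"
    and "g \<in> Q \<Longrightarrow> ip M (hproj M Q h) g = ip M h g"
    and "g \<in> Q \<Longrightarrow> ip M g (hproj M Q h) = ip M g h"
proof -
  obtain m where m: "m \<in> M0" "\<And>g. g \<in> M0 \<Longrightarrow> ip M (h - m) g = 0" using projection[OF M0_closed h] by blast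
  have mM: "m \<in> car M" using m(1) by (simp add: vanishing_submodule_def)
  let ?p = "h - m"
  have pQ: "?p \<in> Q" using m h mM by (auto simp: quotient_module_def)
  have orth: "ip M m g = 0" if "g \<in> Q" for g
    using that m(1) ip_cnj[of g m] mM by (auto simp: quotient_module_def)
  have eq: "hproj M Q h = ?p"
    unfolding hproj_def
  proof (rule the_equality)
    show "?p \<in> Q \<and> (\<forall>g\<in>Q. ip M (h - ?p) g = 0)" using pQ orth by simp
    fix p assume p: "p \<in> Q \<and> (\<forall>g\<in>Q. ip M (h - p) g = 0)"
    have pM: "p \<in> car M" "?p \<in> car M" using p pQ Q_subset by blast+
    have d: "p - ?p \<in> Q" using Q_closed p pQ fun_vs.subspace_diff unfolding hclosed_def by blast
    have "ip M (h - p) (p - ?p) = 0" "ip M m (p - ?p) = 0" using p orth d by blast+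
    moreover have e: "p - ?p = m - (h - p)" by simp
    ultimately have "ip M (p - ?p) (p - ?p) = 0"
      using ip_diff_left[OF mM car_diff[OF h pM(1)] car_diff[OF pM]] by (simp only: e) simp
    then have "p - ?p = 0" using ip_pos[OF car_diff[OF pM]] by force
    then show "p = ?p" by simp
  qed
  show "hproj M Q h \<in> Q" "h - hproj M Q h \<in> M0" unfolding eq using pQ m(1) by simp_all
  assume g: "g \<in> Q"
  then have gM: "g \<in> car M" using Q_subset by blast
  show "ip M (hproj M Q h) g = ip M h g" unfolding eq using orth[OF g] by (simp add: ip_diff_left h mM gM)
  show "ip M g (hproj M Q h) = ip M g h"
    unfolding eq using g m(1) by (simp add: ip_diff_right h mM gM quotient_module_def)
qed

lemma M0_submodule:
  assumes f: "f \<in> fun_algebra \<Omega>" and h: "h \<in> M0"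
  shows "pmul f h \<in> M0"
proof -
  have hM: "h \<in> car M" using h by (simp add: vanishing_submodule_def)
  have "jet_zero (transv d) k 1 k Z (\<lambda>w. pmul f h w $ j)" for j
    unfolding pmul_def vector_smult_component
    by (rule jet_zero_mult_right[OF open_dom Z_subset
          mholomorphic_on_polarizable[OF fun_algebra_mholomorphic[OF f open_dom] open_dom]
          mholomorphic_on_polarizable[OF holomorphic[OF hM] open_dom]])
      (use h in \<open>simp only: M0_jet_zero\<close>)
  then show ?thesis unfolding M0_jet_zero using action_closed[OF f hM] by blast
qed

end

end

section \<open>Slices and cylinders\<close>

text \<open>
  The projection onto the plane of the zero locus.  Composition with it extends functions on the
  slice of \<open>U\<close> by this plane to the cylinder \<open>tproj d -` U\<close>.  The cylinder is open, and it is connected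
  if the slice is; so polarization and the identity theorem become available for slices.
\<close>

definition tproj :: "nat \<Rightarrow> 'm::{finite,linorder} cvec \<Rightarrow> 'm cvec" where
  "tproj d w = (\<chi> i. if i \<in> transv d then 0 else w $ i)"

lemma tproj_simps [simp]:
  "tproj d (tproj d w) = tproj d w" "tproj d 0 = 0" "tproj d (vcnj w) = vcnj (tproj d w)"
  "tproj d (w + z) = tproj d w + tproj d z"
  by (auto simp: tproj_def vec_eq_iff)

lemma tproj_axis: "tproj d (axis i x) = (if i \<in> transv d then 0 else axis i x)"
  by (auto simp: tproj_def vec_eq_iff axis_def)

lemma bounded_linear_tproj: "bounded_linear (tproj d)"
proof (rule bounded_linear_componentwise)
  show "bounded_linear (\<lambda>v. tproj d v $ i)" for i
    by (cases "i \<in> transv d") (simp_all add: tproj_def bounded_linear_vec_nth)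
qed

lemma open_cylinder: "open U \<Longrightarrow> open (tproj d -` U)"
  by (rule open_vimage[OF _ linear_continuous_on[OF bounded_linear_tproj]])

lemma zero_locus_dual_iff: "w \<in> vcnj ` zero_locus d \<Omega> \<longleftrightarrow> w \<in> vcnj ` \<Omega> \<and> tproj d w = w"
  unfolding vcnj_image_iff zero_locus_def tproj_def by (auto simp: vec_eq_iff vcnj_def)

lemma zero_locus_iff: "w \<in> zero_locus d \<Omega> \<longleftrightarrow> w \<in> \<Omega> \<and> tproj d w = w"
  unfolding zero_locus_def tproj_def by (auto simp: vec_eq_iff)

text \<open>The cylinder is a continuous image of the product of the slice with the whole space.\<close>

lemma connected_cylinder:
  assumes "connected {w \<in> U. tproj d w = w}"
  shows "connected (tproj d -` U)"
proof -
  let ?f = "\<lambda>p. fst p + (snd p - tproj d (snd p))"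
  have "continuous_on ({w \<in> U. tproj d w = w} \<times> UNIV) ?f"
    by (intro continuous_intros linear_continuous_on_compose[OF _ bounded_linear.linear[OF bounded_linear_tproj]])
  then have "connected (?f ` ({w \<in> U. tproj d w = w} \<times> UNIV))"
    by (intro connected_continuous_image connected_Times assms connected_UNIV)
  moreover have "?f ` ({w \<in> U. tproj d w = w} \<times> UNIV) = tproj d -` U"
  proof (intro equalityI subsetI)
    fix w assume "w \<in> tproj d -` U"
    then show "w \<in> ?f ` ({w \<in> U. tproj d w = w} \<times> UNIV)"
      by (intro image_eqI[of _ _ "(tproj d w, w)"]) auto
  next
    fix w assume "w \<in> ?f ` ({w \<in> U. tproj d w = w} \<times> UNIV)"
    then obtain z v where w: "w = z + (v - tproj d v)" "z \<in> U" "tproj d z = z" by auto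
    have "tproj d (v - tproj d v) = 0" by (auto simp: tproj_def vec_eq_iff)
    then show "w \<in> tproj d -` U" using w by simp
  qed
  ultimately show ?thesis by simp
qed

lemma tproj_coeff: "tproj d v $ i = (\<Sum>j\<in>UNIV. (if j = i \<and> i \<notin> transv d then 1 else 0) * v $ j)"
proof -
  have "(\<Sum>j\<in>UNIV. (if j = i \<and> i \<notin> transv d then 1 else 0) * v $ j) = (\<Sum>j\<in>UNIV. if j = i then (if i \<notin> transv d then v $ j else 0) else 0)"
    by (intro sum.cong) auto
  then show ?thesis by (simp add: tproj_def)
qed

lemma mholomorphic_on_tproj:
  assumes "mholomorphic_on {w \<in> U. tproj d w = w} f"
  shows "mholomorphic_on (tproj d -` U) (\<lambda>w. f (tproj d w))"
  by (rule mholomorphic_on_compose_linear[OF assms bounded_linear_tproj tproj_coeff]) auto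

lemma cpair_tproj_coeff:
  "cpair (tproj d (lft p)) (tproj d (rgt p)) $ k = (\<Sum>j\<in>UNIV. (if j = k \<and> (case k of Inl i \<Rightarrow> i | Inr i \<Rightarrow> i) \<notin> transv d then 1 else 0) * p $ j)"
proof -
  have "(\<Sum>j\<in>UNIV. (if j = k \<and> (case k of Inl i \<Rightarrow> i | Inr i \<Rightarrow> i) \<notin> transv d then 1 else 0) * p $ j) =
    (\<Sum>j\<in>UNIV. if j = k then (if (case k of Inl i \<Rightarrow> i | Inr i \<Rightarrow> i) \<notin> transv d then p $ j else 0) else 0)"
    by (intro sum.cong) auto
  then show ?thesis by (cases k) (simp_all add: tproj_def lft_def rgt_def)
qed

lemma bounded_linear_cpair_tproj: "bounded_linear (\<lambda>p. cpair (tproj d (lft p)) (tproj d (rgt p)))"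
proof (rule bounded_linear_componentwise)
  fix k :: "'a + 'a"
  have "(\<lambda>p. cpair (tproj d (lft p)) (tproj d (rgt p)) $ k) =
     (\<lambda>p. if (case k of Inl i \<Rightarrow> i | Inr i \<Rightarrow> i) \<in> transv d then 0 else p $ k)"
    by (cases k) (auto simp: tproj_def lft_def rgt_def)
  then show "bounded_linear (\<lambda>p. cpair (tproj d (lft p)) (tproj d (rgt p)) $ k)"
    by (cases "(case k of Inl i \<Rightarrow> i | Inr i \<Rightarrow> i) \<in> transv d") (simp_all add: bounded_linear_vec_nth)
qed

lemma sesqui_tproj:
  assumes "sesqui U K"
  shows "sesqui (tproj d -` U) (\<lambda>w v. K (tproj d w) (tproj d v))"
proof -
  have "mholomorphic_on {p. lft p \<in> tproj d -` U \<and> vcnj (rgt p) \<in> tproj d -` U}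
    (\<lambda>p. K (lft (cpair (tproj d (lft p)) (tproj d (rgt p)))) (vcnj (rgt (cpair (tproj d (lft p)) (tproj d (rgt p))))))"
    by (rule mholomorphic_on_compose_linear[OF assms[unfolded sesqui_def] bounded_linear_cpair_tproj cpair_tproj_coeff]) auto
  then show ?thesis unfolding sesqui_def by simp
qed

lemma polarizable_tproj:
  assumes "polarizable U f"
  shows "polarizable (tproj d -` U) (\<lambda>w. f (tproj d w))"
proof -
  obtain F W where F: "open W" "mholomorphic_on W F"
    "\<And>w. w \<in> U \<Longrightarrow> cpair w (vcnj w) \<in> W \<and> f w = F (cpair w (vcnj w))"
    by (rule polarizableE[OF assms]) blast
  let ?P = "\<lambda>p. cpair (tproj d (lft p)) (tproj d (rgt p))"
  have "mholomorphic_on (?P -` W) (\<lambda>p. F (?P p))"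
    by (rule mholomorphic_on_compose_linear[OF F(2) bounded_linear_cpair_tproj cpair_tproj_coeff]) auto
  moreover have "open (?P -` W)"
    by (rule open_vimage[OF F(1) linear_continuous_on[OF bounded_linear_cpair_tproj]])
  ultimately show ?thesis
    unfolding polarizable_def using F(3)
    by (intro exI[of _ "\<lambda>p. F (?P p)"] exI[of _ "?P -` W"]) simp
qed

lemma ddir_tproj:
  "ddir (Anti i) (\<lambda>w. f (tproj d w)) w = (if i \<in> transv d then 0 else ddir (Anti i) f (tproj d w))"
  by (simp add: wirt_bar_def tproj_axis)

text \<open>Tangential derivatives see only the values on the slice.\<close>

lemma ddir_tangential_cong:
  assumes U: "open U" and eq: "\<And>w. w \<in> U \<Longrightarrow> tproj d w = w \<Longrightarrow> f w = g w"
    and w: "w \<in> U" "tproj d w = w" and i: "i \<notin> transv d"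
  shows "ddir (Anti i) f w = ddir (Anti i) g w"
proof -
  have "ddir (Anti i) (\<lambda>w. f (tproj d w)) w = ddir (Anti i) (\<lambda>w. g (tproj d w)) w"
    by (rule ddir_cong[OF open_cylinder[OF U, of d]]) (use eq w in auto)
  then show ?thesis using i w by (simp only: ddir_tproj if_False)
qed

text \<open>The Cauchy-Riemann equations in terms of the polarization \<open>F\<close>: its derivatives in the last variables vanish.\<close>

lemma mholomorphic_on_of_antiholomorphic_derivative:
  assumes f: "polarizable S f" and S: "open S" and z: "\<And>i w. w \<in> S \<Longrightarrow> ddir (Anti i) f w = 0"
  shows "mholomorphic_on S f"
proof -
  obtain F W where F: "open W" "mholomorphic_on W F"
    "\<And>w. w \<in> S \<Longrightarrow> cpair w (vcnj w) \<in> W \<and> f w = F (cpair w (vcnj w))"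
    by (rule polarizableE[OF f]) blast
  show ?thesis
  proof (rule mholomorphic_onI[where c="\<lambda>w i. wirt (Inl i) F (cpair w (vcnj w))"])
    fix w assume w: "w \<in> S"
    have "wirt (Inr i) F (cpair w (vcnj w)) = 0" for i
      using polarization_has_derivative(2)[OF S F w, of "Anti i"] z[OF w, of i] by simp
    then show "(f has_derivative (\<lambda>v. \<Sum>i\<in>UNIV. wirt (Inl i) F (cpair w (vcnj w)) * v $ i)) (at w within S)"
      using polarization_has_derivative(1)[OF S F w] has_derivative_at_withinI by simp
  qed
qed

text \<open>Polarization along a slice, obtained from polarization on the cylinder over it.\<close>

lemma polarization_slice:
  assumes U: "open U" and con: "connected {w \<in> U. tproj d w = w}"
    and G: "sesqui (tproj d -` U) (\<lambda>w v. G (tproj d w) (tproj d v))"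
    and diag: "\<And>w. w \<in> U \<Longrightarrow> tproj d w = w \<Longrightarrow> G w w = 0"
    and wv: "w \<in> U" "tproj d w = w" "v \<in> U" "tproj d v = v"
  shows "G w v = 0"
proof -
  have "G (tproj d w) (tproj d v) = 0"
    by (rule polarization[OF G open_cylinder[OF U] connected_cylinder[OF con]]) (use diag wv in auto)
  then show ?thesis using wv by simp
qed

lemma slice_identity:
  assumes U: "open U" and con: "connected {w \<in> U. tproj d w = w}"
    and f: "mholomorphic_on U f"
    and V: "open V" "z \<in> V" "tproj d z = z" "V \<subseteq> U" and zero: "\<And>w. w \<in> V \<Longrightarrow> tproj d w = w \<Longrightarrow> f w = 0"
    and w: "w \<in> U" "tproj d w = w"
  shows "f w = 0"
proof -
  let ?C = "tproj d -` U" and ?g = "\<lambda>w. f (tproj d w)"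
  have g: "mholomorphic_on ?C ?g"
    by (rule mholomorphic_on_tproj[OF mholomorphic_on_subset[OF f]]) auto
  have d0: "derivs ws ?g z = 0" for ws
  proof -
    have "derivs ws ?g z = derivs ws (\<lambda>_. 0) z"
      by (rule derivs_cong[OF open_cylinder[OF V(1), of d]]) (use V zero in auto)
    then show ?thesis by simp
  qed
  have zC: "z \<in> ?C" using V by auto
  have "foldr wirt xs ?g z = 0" for xs
    using d0[of "map Hol xs"] derivs_holomorphic(1)[OF open_cylinder[OF U] g zC, of xs] by simp
  then have "?g w = 0"
    by (rule mholomorphic_identity[OF open_cylinder[OF U] connected_cylinder[OF con] g zC])
      (use w in simp)
  then show ?thesis using w by simp
qed

section \<open>Jets of holomorphic and antiholomorphic functions\<close>

lemma jet_zero_sharp: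
  assumes f: "mholomorphic_on S f" and S: "open S" and Z: "Z \<subseteq> S" and j: "jet_zero T k 1 k Z f"
  shows "jet_zero T k 1 k (vcnj ` Z) (\<lambda>w. cnj (f (vcnj w)))"
proof -
  have "vcnj ` Z \<subseteq> vcnj ` S" using Z by blast
  then show ?thesis
    using j foldr_wirt_sharp[OF f S] Z
    unfolding jet_zero_holomorphic[OF f S Z] jet_zero_holomorphic[OF mholomorphic_on_sharp[OF f] open_vcnj[OF S] \<open>vcnj ` Z \<subseteq> vcnj ` S\<close>]
    by auto
qed

lemma jet_zero_cnj:
  assumes f: "polarizable S f" and S: "open S" and Z: "Z \<subseteq> S" and j: "jet_zero T p q n Z f"
  shows "jet_zero T q p n Z (\<lambda>w. cnj (f w))"
  unfolding jet_zero_def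
proof (intro allI impI ballI)
  fix ws :: "'a direction list" and w
  assume ws: "set ws \<subseteq> dirs T" "nhol ws < q" "nanti ws < p" "length ws < n" "w \<in> Z"
  have sw: "nhol (map dswap ws) = nanti ws \<and> nanti (map dswap ws) = nhol ws \<and> set (map dswap ws) \<subseteq> dirs T"
    using ws(1)
  proof (induction ws)
    case (Cons x ws)
    then show ?case by (cases x) auto
  qed simp
  then have "derivs (map dswap ws) f w = 0" using j ws unfolding jet_zero_def by simp
  then show "derivs ws (\<lambda>w. cnj (f w)) w = 0"
    using derivs_cnj[OF f S, of w ws] ws(5) Z by auto
qed

text \<open>Antiholomorphic derivatives of a holomorphic function vanish identically.\<close>

lemma jet_zero_holomorphic_anti:
  assumes f: "mholomorphic_on S f" and S: "open S" and Z: "Z \<subseteq> S" and j: "jet_zero T p 1 p Z f"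
  shows "jet_zero T p q n Z f"
  unfolding jet_zero_def
proof (intro allI impI ballI)
  fix ws :: "'a direction list" and w
  assume ws: "set ws \<subseteq> dirs T" "nhol ws < p" "nanti ws < q" "length ws < n" "w \<in> Z"
  show "derivs ws f w = 0"
  proof (cases "nanti ws < 1")
    case True
    then obtain xs where xs: "ws = map Hol xs" "set xs \<subseteq> T" using hol_words[OF ws(1)] by blast
    then show ?thesis using j ws(1,2,5) unfolding jet_zero_def by simp
  next
    case False
    then have "\<exists>i. Anti i \<in> set ws" by (auto simp: nanti_def filter_empty_conv)
    then show ?thesis using derivs_holomorphic(2)[OF S f] ws(5) Z by blast
  qed
qed

section \<open>Holomorphic matrices and changes of frame\<close>

definition mhol :: "'m::finite cvec set \<Rightarrow> ('m cvec \<Rightarrow> complex^'r^'r) \<Rightarrow> bool" where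
  "mhol S A \<longleftrightarrow> (\<forall>a b. mholomorphic_on S (\<lambda>w. A w $ a $ b))"

lemma mhol_const [intro]: "mhol S (\<lambda>_. A)" unfolding mhol_def by auto
lemma mhol_mult [intro]: "mhol S A \<Longrightarrow> mhol S B \<Longrightarrow> mhol S (\<lambda>w. A w ** B w)"
  unfolding mhol_def matrix_matrix_mult_def by (auto intro!: mholomorphic_on_sum mholomorphic_on_mult)
lemma mhol_subset: "mhol S A \<Longrightarrow> T \<subseteq> S \<Longrightarrow> mhol T A"
  unfolding mhol_def using mholomorphic_on_subset by blast
lemma mhol_mpolar: "mhol S A \<Longrightarrow> open S \<Longrightarrow> mpolar S A"
  unfolding mhol_def mpolar_def using mholomorphic_on_polarizable by blast
lemma mhol_det: "mhol S A \<Longrightarrow> mholomorphic_on S (\<lambda>w. det (A w))"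
  unfolding det_def mhol_def by (intro mholomorphic_on_sum mholomorphic_on_mult mholomorphic_on_prod) auto

lemma mhol_inv:
  fixes A :: "'m::finite cvec \<Rightarrow> complex^'r^'r"
  assumes A: "mhol S A" and inv: "\<And>w. w \<in> S \<Longrightarrow> invertible (A w)"
  shows "mhol S (\<lambda>w. matrix_inv (A w))"
  unfolding mhol_def
proof (intro allI)
  fix i j
  have "mholomorphic_on S (\<lambda>w. det (\<chi> k l. if l = i then (mat 1 :: complex^'r^'r) $ k $ j else A w $ k $ l) * inverse (det (A w)))"
  proof (intro mholomorphic_on_mult mholomorphic_on_inverse mhol_det A)
    show "mhol S (\<lambda>w. \<chi> k l. if l = i then (mat 1 :: complex^'r^'r) $ k $ j else A w $ k $ l)"
      unfolding mhol_def
    proof (intro allI)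
      show "mholomorphic_on S (\<lambda>w. (\<chi> k l. if l = i then (mat 1 :: complex^'r^'r) $ k $ j else A w $ k $ l) $ k $ l)" for k l
        using A by (cases "l = i") (auto simp: mhol_def)
    qed
    show "det (A w) \<noteq> 0" if "w \<in> S" for w using inv[OF that] invertible_det_nz by blast
  qed
  then show "mholomorphic_on S (\<lambda>w. matrix_inv (A w) $ i $ j)"
    by (rule mholomorphic_on_cong) (simp add: matrix_inv_cramer inv)
qed

definition ctr :: "complex^'r^'r \<Rightarrow> complex^'r^'r" where
  "ctr A = (\<chi> i j. cnj (A $ j $ i))"

lemma ctr_mult: "ctr (A ** B) = ctr B ** ctr A"
  by (simp add: ctr_def matrix_matrix_mult_def vec_eq_iff mult.commute)
lemma ctr_mat [simp]: "ctr (mat 1) = mat 1" "ctr (ctr A) = A"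
  by (simp_all add: ctr_def mat_def vec_eq_iff)
lemma ctr_diff: "ctr (A - B) = ctr A - ctr B"
  by (simp add: ctr_def vec_eq_iff)

lemma mpolar_ctr: "mpolar S A \<Longrightarrow> mpolar S (\<lambda>w. ctr (A w))"
  unfolding mpolar_def ctr_def by auto

lemma mhol_deriv:
  assumes "mhol S b" "open S" "w \<in> S"
  shows "mderiv (Anti l) b w = 0" "mderiv (Hol l) (\<lambda>w. ctr (b w)) w = 0"
proof -
  have z: "wirt_bar l (\<lambda>w. b w $ i $ j) w = 0" for i j
    by (rule mholomorphic_on_derivative(3)[OF _ assms(2,3)]) (use assms(1) in \<open>simp add: mhol_def\<close>)
  then show "mderiv (Anti l) b w = 0" by (simp add: vec_eq_iff)
  have "ddir (Hol l) (\<lambda>w. cnj (b w $ j $ i)) w = 0" for i j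
    using ddir_cnj[OF _ assms(2,3), of "\<lambda>w. b w $ j $ i" "Hol l"] z mhol_mpolar[OF assms(1,2)]
    by (simp add: mpolar_def)
  then show "mderiv (Hol l) (\<lambda>w. ctr (b w)) w = 0" by (simp add: vec_eq_iff ctr_def)
qed

text \<open>The change of frame by the rows of a matrix; Gram matrices then transform into \<open>b H b\<^sup>*\<close>.\<close>

definition mframe :: "('m cvec \<Rightarrow> complex^'r^'r) \<Rightarrow> ('r \<Rightarrow> 'm cvec \<Rightarrow> ('m::finite, 'r::finite) vfun) \<Rightarrow>
    'r \<Rightarrow> 'm cvec \<Rightarrow> ('m, 'r) vfun" where
  "mframe b F i w = (\<Sum>j\<in>UNIV. fscale (b w $ i $ j) (F j w))"

lemma mframe_mframe: "mframe b (mframe a F) i w = mframe (\<lambda>w. b w ** a w) F i w"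
proof -
  have "mframe b (mframe a F) i w = (\<Sum>j\<in>UNIV. \<Sum>l\<in>UNIV. fscale (b w $ i $ j * a w $ j $ l) (F l w))"
    unfolding mframe_def by (simp only: fun_vs.scale_sum_right fun_vs.scale_scale)
  also have "\<dots> = (\<Sum>l\<in>UNIV. \<Sum>j\<in>UNIV. fscale (b w $ i $ j * a w $ j $ l) (F l w))" by (rule sum.swap)
  also have "\<dots> = mframe (\<lambda>w. b w ** a w) F i w"
    unfolding mframe_def by (simp add: matrix_matrix_mult_def fun_vs.scale_sum_left)
  finally show ?thesis .
qed

lemma mframe_cong: "b w = b' w \<Longrightarrow> (\<And>j. F j w = F' j w) \<Longrightarrow> mframe b F i w = mframe b' F' i w"
  unfolding mframe_def by simp

lemma sum_fscale_delta: "(\<Sum>l\<in>(UNIV :: 'i::finite set). fscale (if l = i then 1 else 0) (u l)) = u i"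
proof -
  have "(\<Sum>l\<in>UNIV. fscale (if l = i then 1 else 0) (u l)) = (\<Sum>l\<in>UNIV. if l = i then u l else 0)"
    by (intro sum.cong) (auto simp: fscale_def fun_eq_iff)
  then show ?thesis by simp
qed

lemma mframe_id: "b w = mat 1 \<Longrightarrow> mframe b F i w = F i w"
proof -
  assume "b w = mat 1"
  then have "mframe b F i w = (\<Sum>j\<in>UNIV. if j = i then F j w else 0)"
    unfolding mframe_def by (intro sum.cong) (auto simp: mat_def fscale_def fun_eq_iff)
  then show ?thesis by simp
qed

context hilbert_fspace
begin

lemma mframe_mem: "(\<And>j. F j w \<in> car M) \<Longrightarrow> mframe b F i w \<in> car M"
  unfolding mframe_def by (intro car_sum car_scale)

lemma ip_mframe_left:
  "(\<And>j. F j w \<in> car M) \<Longrightarrow> h \<in> car M \<Longrightarrow> ip M (mframe b F i w) h = (\<Sum>l\<in>UNIV. b w $ i $ l * ip M (F l w) h)"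
  unfolding mframe_def by (simp add: ip_sum_left car_scale ip_scale)

lemma ip_mframe_right:
  "(\<And>j. F j w \<in> car M) \<Longrightarrow> h \<in> car M \<Longrightarrow> ip M h (mframe b F i w) = (\<Sum>l\<in>UNIV. ip M h (F l w) * cnj (b w $ i $ l))"
  unfolding mframe_def by (simp add: ip_sum_right car_scale ip_scale_right mult.commute)

lemma gramian_mframe:
  assumes "\<And>j. F j w \<in> car M"
  shows "gramian M (mframe b F) w = b w ** (gramian M F w ** ctr (b w))"
  unfolding gramian_def ctr_def matrix_matrix_mult_def vec_eq_iff
  by (simp add: ip_mframe_left ip_mframe_right mframe_mem assms)
    (simp add: sum_distrib_left sum_distrib_right mult.assoc, intro allI, rule sum.swap)

lemma weakly_holomorphic_mframe:
  assumes b: "mhol S b" and F: "\<And>j. weakly_holomorphic M S (F j)"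
  shows "weakly_holomorphic M S (mframe b F i)"
  unfolding weakly_holomorphic_def
proof (intro conjI ballI)
  show "mframe b F i w \<in> car M" if "w \<in> S" for w
    by (rule mframe_mem) (use weakly_holomorphicD(1)[OF F] that in blast)
  fix h assume h: "h \<in> car M"
  have "mholomorphic_on S (\<lambda>w. \<Sum>l\<in>UNIV. b w $ i $ l * ip M (F l w) h)"
    using b weakly_holomorphicD(2)[OF F h] by (intro mholomorphic_on_sum mholomorphic_on_mult) (auto simp: mhol_def)
  then show "mholomorphic_on S (\<lambda>w. ip M (mframe b F i w) h)"
    by (rule mholomorphic_on_cong) (use ip_mframe_left[of F _ h] weakly_holomorphicD(1)[OF F] h in simp)
qed

lemma weakly_holomorphic_cong:
  assumes "weakly_holomorphic M S F" "\<And>w. w \<in> S \<Longrightarrow> F w = G w"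
  shows "weakly_holomorphic M S G"
  unfolding weakly_holomorphic_def
proof (intro conjI ballI)
  show "G w \<in> car M" if "w \<in> S" for w using weakly_holomorphicD(1)[OF assms(1) that] assms(2)[OF that] by simp
  show "mholomorphic_on S (\<lambda>w. ip M (G w) h)" if "h \<in> car M" for h
    by (rule mholomorphic_on_cong[OF weakly_holomorphicD(2)[OF assms(1) that]]) (simp add: assms(2))
qed

lemma weakly_holomorphic_subset: "weakly_holomorphic M S F \<Longrightarrow> T \<subseteq> S \<Longrightarrow> weakly_holomorphic M T F"
  unfolding weakly_holomorphic_def using mholomorphic_on_subset by blast

lemma mpolar_gramian:
  assumes "\<And>i. weakly_holomorphic M S (F i)" "open S"
  shows "mpolar S (gramian M F)"
  unfolding mpolar_def gramian_def using sesqui_polarizable[OF gram_sesqui] assms by simp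

lemma gramian_invertible:
  assumes F: "\<And>i. F i w \<in> car M"
    and ind: "\<And>x i. (\<Sum>j\<in>UNIV. fscale (x j) (F j w)) = 0 \<Longrightarrow> x i = 0"
  shows "invertible (gramian M F w)"
proof -
  have "x = 0" if x: "gramian M F w *v x = 0" for x
  proof -
    let ?v = "\<Sum>j\<in>UNIV. fscale (cnj (x $ j)) (F j w)"
    have vM: "?v \<in> car M" by (intro car_sum car_scale F)
    have "ip M (F i w) ?v = 0" for i
    proof -
      have "(gramian M F w *v x) $ i = 0" using x by simp
      then show ?thesis
        by (simp add: gramian_def matrix_vector_mult_def ip_sum_right car_scale F ip_scale_right mult.commute)
    qed
    then have "ip M ?v ?v = 0" using vM by (subst (1) ip_sum_left) (simp_all add: car_scale F ip_scale)
    then have "?v = 0" using ip_pos[OF vM] by force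
    then have "cnj (x $ i) = 0" for i using ind[of "\<lambda>j. cnj (x $ j)" i] by simp
    then show ?thesis by (simp add: vec_eq_iff)
  qed
  then have "\<exists>B. B ** gramian M F w = mat 1" by (simp add: matrix_left_invertible_ker)
  then show ?thesis by (metis invertible_def matrix_left_right_inverse)
qed

end

lemma linear_on_sum:
  assumes sub: "fun_vs.subspace F"
    and add: "\<And>x y. x \<in> F \<Longrightarrow> y \<in> F \<Longrightarrow> \<phi> (x + y) = \<phi> x + \<phi> y"
    and scale: "\<And>c x. x \<in> F \<Longrightarrow> \<phi> (fscale c x) = fscale c (\<phi> x)"
    and u: "\<And>i. u i \<in> F" and I: "finite I"
  shows "\<phi> (\<Sum>i\<in>I. fscale (x i) (u i)) = (\<Sum>i\<in>I. fscale (x i) (\<phi> (u i)))"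
  using I
proof induction
  case empty
  have "\<phi> 0 = fscale 0 (\<phi> 0)"
    using scale[OF fun_vs.subspace_0[OF sub], of 0] by (simp only: fun_vs.scale_zero_right)
  then show ?case by (simp only: sum.empty fun_vs.scale_zero_left)
next
  case (insert a I)
  have "fscale (x a) (u a) \<in> F" "(\<Sum>i\<in>I. fscale (x i) (u i)) \<in> F"
    by (intro fun_vs.subspace_sum[OF sub] fun_vs.subspace_scale[OF sub] u)+
  then show ?case using insert.IH by (simp only: sum.insert[OF insert.hyps] add scale u)
qed

section \<open>Frames at a point\<close>

definition frame_at :: "('m::finite, 'r::finite) fspace \<Rightarrow> ('r \<Rightarrow> 'm cvec \<Rightarrow> ('m, 'r) vfun) \<Rightarrow> 'm cvec \<Rightarrow> bool" where
  "frame_at M s w \<longleftrightarrow> inj (\<lambda>i. s i w) \<and> fun_vs.independent (range (\<lambda>i. s i w)) \<and>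
     fun_vs.span (range (\<lambda>i. s i w)) = fibre M w"

lemma frame_at_unique:
  assumes "frame_at M s w" "(\<Sum>i\<in>UNIV. fscale (x i) (s i w)) = 0"
  shows "x i = 0"
proof -
  let ?B = "range (\<lambda>i. s i w)" and ?g = "inv (\<lambda>i. s i w)"
  have inj: "inj (\<lambda>i. s i w)" and ind: "fun_vs.independent ?B" using assms(1) by (auto simp: frame_at_def)
  have "(\<Sum>v\<in>?B. fscale (x (?g v)) v) = (\<Sum>i\<in>UNIV. fscale (x i) (s i w))"
    by (subst sum.reindex[OF inj]) (simp add: inv_f_f[OF inj])
  then have "(\<Sum>v\<in>?B. fscale (x (?g v)) v) = 0" using assms(2) by simp
  from fun_vs.independentD[OF ind _ subset_refl this, of "s i w"] have "x (?g (s i w)) = 0" by simp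
  then show ?thesis by (simp add: inv_f_f[OF inj])
qed

lemma frame_at_fibre:
  assumes "frame_at M s w"
  shows "v \<in> fibre M w \<longleftrightarrow> (\<exists>x. v = (\<Sum>i\<in>UNIV. fscale (x i) (s i w)))"
proof -
  let ?B = "range (\<lambda>i. s i w)" and ?g = "inv (\<lambda>i. s i w)"
  have inj: "inj (\<lambda>i. s i w)" and sp: "fun_vs.span ?B = fibre M w" using assms(1) by (auto simp: frame_at_def)
  show ?thesis
  proof
    assume "v \<in> fibre M w"
    then obtain u where "v = (\<Sum>b\<in>?B. fscale (u b) b)" unfolding sp[symmetric] by (auto simp: fun_vs.span_finite)
    then have "v = (\<Sum>i\<in>UNIV. fscale (u (s i w)) (s i w))" by (simp add: sum.reindex[OF inj])
    then show "\<exists>x. v = (\<Sum>i\<in>UNIV. fscale (x i) (s i w))" by (intro exI)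
  next
    assume "\<exists>x. v = (\<Sum>i\<in>UNIV. fscale (x i) (s i w))"
    then obtain x where v: "v = (\<Sum>i\<in>UNIV. fscale (x i) (s i w))" by blast
    show "v \<in> fibre M w"
      unfolding sp[symmetric] v by (intro fun_vs.span_sum fun_vs.span_scale fun_vs.span_base rangeI)
  qed
qed

lemma frame_endo_apply:
  assumes "frame_at M s w"
  shows "frame_endo s A w (\<Sum>i\<in>UNIV. fscale (x i) (s i w)) = (\<Sum>i\<in>UNIV. fscale (x i) (mframe A s i w))"
proof -
  let ?B = "range (\<lambda>i. s i w)"
  have inj: "inj (\<lambda>i. s i w)" and ind: "fun_vs.independent ?B" using assms(1) by (auto simp: frame_at_def)
  have "fun_vs.representation ?B (\<Sum>i\<in>UNIV. fscale (x i) (s i w)) (s l w) = x l" for l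
  proof -
    have "fun_vs.representation ?B (\<Sum>i\<in>UNIV. fscale (x i) (s i w)) (s l w) =
        (\<Sum>i\<in>UNIV. fun_vs.representation ?B (fscale (x i) (s i w)) (s l w))"
      by (subst fun_vs.representation_sum[OF ind]) (auto intro: fun_vs.span_scale fun_vs.span_base)
    also have "\<dots> = (\<Sum>i\<in>UNIV. x i * (if i = l then 1 else 0))"
    proof (rule sum.cong[OF refl])
      fix i
      show "fun_vs.representation ?B (fscale (x i) (s i w)) (s l w) = x i * (if i = l then 1 else 0)"
        using fun_vs.representation_scale[OF ind, of "s i w" "x i"] fun_vs.representation_basis[OF ind, of "s i w"]
          inj fun_vs.span_base[of "s i w" ?B]
        by (auto simp: inj_def)
    qed
    finally show ?thesis by (simp add: if_distrib cong: if_cong)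
  qed
  then show ?thesis unfolding frame_endo_def mframe_def by simp
qed

text \<open>
  In the row convention the matrix of a composite is the product of the matrices in reverse order,
  so intertwining reads \<open>A e = e B\<close>.
\<close>

lemma intertwines_iff_matrix:
  fixes M N :: "('m::finite, 'r::finite) fspace"
  assumes s: "frame_at M s w" and t: "frame_at N t w"
    and add: "\<And>x y. x \<in> fibre M w \<Longrightarrow> y \<in> fibre M w \<Longrightarrow> \<phi> (x + y) = \<phi> x + \<phi> y"
    and scale: "\<And>c x. x \<in> fibre M w \<Longrightarrow> \<phi> (fscale c x) = fscale c (\<phi> x)"
    and e: "\<And>i. \<phi> (s i w) = mframe e t i w"
  shows "(\<forall>v\<in>fibre M w. \<phi> (frame_endo s A w v) = frame_endo t B w (\<phi> v)) \<longleftrightarrow> A w ** e w = e w ** B w"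
proof -
  have sub: "fun_vs.subspace (fibre M w)" using s by (metis frame_at_def fun_vs.subspace_span)
  have sf: "s i w \<in> fibre M w" for i
    using s fun_vs.span_base[of "s i w" "range (\<lambda>i. s i w)"] by (auto simp: frame_at_def)
  have \<phi>sum: "\<phi> (\<Sum>i\<in>UNIV. fscale (x i) (s i w)) = (\<Sum>i\<in>UNIV. fscale (x i) (mframe e t i w))" for x
    unfolding e[symmetric] by (rule linear_on_sum[OF sub add scale sf]) auto
  have L: "\<phi> (mframe A s i w) = mframe (\<lambda>w. A w ** e w) t i w" for i
    unfolding mframe_mframe[symmetric] by (subst (1 2) mframe_def) (rule \<phi>sum)
  have R: "frame_endo t B w (mframe e t i w) = mframe (\<lambda>w. e w ** B w) t i w" for e i
    using frame_endo_apply[OF t, of B "\<lambda>j. e w $ i $ j"]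
    unfolding mframe_mframe[symmetric] by (simp only: mframe_def[of e])
  have ft: "frame_endo t B w (\<Sum>i\<in>UNIV. fscale (x i) (mframe e t i w)) =
      (\<Sum>i\<in>UNIV. fscale (x i) (mframe (\<lambda>w. e w ** B w) t i w))" for x
  proof -
    define X where "X = (\<lambda>_::'m cvec. (\<chi> i j. x j) :: complex^'r^'r)"
    have "(\<Sum>i\<in>UNIV. fscale (x i) (mframe e t i w)) = mframe (\<lambda>w. X w ** e w) t undefined w"
      unfolding mframe_mframe[symmetric] mframe_def[of X] by (simp add: X_def)
    moreover have "frame_endo t B w (mframe (\<lambda>w. X w ** e w) t undefined w) = mframe (\<lambda>w. X w ** (e w ** B w)) t undefined w"
      using R[of "\<lambda>w. X w ** e w"] by (simp only: matrix_mul_assoc)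
    moreover have "mframe (\<lambda>w. X w ** (e w ** B w)) t undefined w = (\<Sum>i\<in>UNIV. fscale (x i) (mframe (\<lambda>w. e w ** B w) t i w))"
      unfolding mframe_mframe[symmetric, of X] mframe_def[of X] by (simp add: X_def)
    ultimately show ?thesis by simp
  qed
  have fl: "\<phi> (frame_endo s A w (\<Sum>i\<in>UNIV. fscale (x i) (s i w))) = (\<Sum>i\<in>UNIV. fscale (x i) (mframe (\<lambda>w. A w ** e w) t i w))" for x
  proof -
    have mem: "mframe A s i w \<in> fibre M w" for i
      unfolding mframe_def by (intro fun_vs.subspace_sum[OF sub] fun_vs.subspace_scale[OF sub] sf)
    have "\<phi> (\<Sum>i\<in>UNIV. fscale (x i) (mframe A s i w)) = (\<Sum>i\<in>UNIV. fscale (x i) (mframe (\<lambda>w. A w ** e w) t i w))"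
      unfolding L[symmetric] by (rule linear_on_sum[OF sub add scale mem]) auto
    then show ?thesis by (simp only: frame_endo_apply[OF s])
  qed
  show ?thesis
  proof
    assume *: "\<forall>v\<in>fibre M w. \<phi> (frame_endo s A w v) = frame_endo t B w (\<phi> v)"
    have "(A w ** e w) $ i $ j = (e w ** B w) $ i $ j" for i j
    proof -
      have "s i w = (\<Sum>l\<in>UNIV. fscale (if l = i then 1 else 0) (s l w))"
        by (rule sum_fscale_delta[symmetric])
      then have "\<phi> (frame_endo s A w (s i w)) = (\<Sum>l\<in>UNIV. fscale (if l = i then 1 else 0) (mframe (\<lambda>w. A w ** e w) t l w))"
        using fl[of "\<lambda>l. if l = i then 1 else 0"] by simp
      also have "\<dots> = mframe (\<lambda>w. A w ** e w) t i w"
        by (rule sum_fscale_delta)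
      finally have "mframe (\<lambda>w. A w ** e w) t i w = mframe (\<lambda>w. e w ** B w) t i w"
        using * sf[of i] R e by simp
      then have "(\<Sum>l\<in>UNIV. fscale ((A w ** e w) $ i $ l - (e w ** B w) $ i $ l) (t l w)) = 0"
        by (simp add: mframe_def fun_vs.scale_left_diff_distrib sum_subtractf)
      from frame_at_unique[OF t this, of j] show ?thesis by simp
    qed
    then show "A w ** e w = e w ** B w" by (simp add: vec_eq_iff)
  next
    assume *: "A w ** e w = e w ** B w"
    have same: "mframe (\<lambda>w. A w ** e w) t i w = mframe (\<lambda>w. e w ** B w) t i w" for i
      by (rule mframe_cong) (use * in auto)
    show "\<forall>v\<in>fibre M w. \<phi> (frame_endo s A w v) = frame_endo t B w (\<phi> v)"
    proof
      fix v assume "v \<in> fibre M w"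
      then obtain x where v: "v = (\<Sum>i\<in>UNIV. fscale (x i) (s i w))" using frame_at_fibre[OF s] by blast
      show "\<phi> (frame_endo s A w v) = frame_endo t B w (\<phi> v)"
        unfolding v fl \<phi>sum ft same ..
    qed
  qed
qed

lemma jet_zero_hol_word:
  assumes "jet_zero T k 1 k Z f" "set xs \<subseteq> T" "length xs < k" "w \<in> Z"
  shows "derivs (map Hol xs) f w = 0"
proof -
  have "set (map Hol xs) \<subseteq> dirs T" using assms(2) by auto
  then show ?thesis using assms unfolding jet_zero_def by simp
qed

context jet_module
begin

lemma frame_at_kframe:
  assumes w: "w \<in> dual_dom"
  shows "frame_at M (kframe M) w"
proof -
  let ?B = "range (\<lambda>i. kframe M i w)"
  have inj: "inj (\<lambda>i. kframe M i w)"
  proof (rule injI, rule ccontr)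
    fix i j assume e: "kframe M i w = kframe M j w" and ne: "i \<noteq> j"
    have "ip M (kframe M l w) (cst i) = (if l = i then 1 else 0)" for l
      using w by (simp add: ip_kframe cst_eval vcnj_image_iff)
    from this[of i] this[of j] e ne show False by simp
  qed
  have "\<not> fun_vs.dependent ?B"
  proof
    assume "fun_vs.dependent ?B"
    then obtain u v where u: "v \<in> ?B" "u v \<noteq> 0" "(\<Sum>v\<in>?B. fscale (u v) v) = 0"
      using fun_vs.dependent_finite[of ?B] by auto
    then have s: "(\<Sum>j\<in>UNIV. fscale (u (kframe M j w)) (kframe M j w)) = 0"
      by (simp add: sum.reindex[OF inj])
    obtain l where l: "v = kframe M l w" using u(1) by blast
    have "u (kframe M l w) = ip M 0 (cst l)" using ip_kframe_sum_cst[OF w, of "\<lambda>j. u (kframe M j w)" l] s by simp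
    then show False using u(2) l by simp
  qed
  moreover have "fun_vs.span ?B = fibre M w"
  proof
    show "fun_vs.span ?B \<subseteq> fibre M w"
      by (rule fun_vs.span_minimal[OF _ subspace_fibre[OF w]]) (use kframe_fibre[OF w] in auto)
    show "fibre M w \<subseteq> fun_vs.span ?B"
    proof
      fix v assume "v \<in> fibre M w"
      then have "v = (\<Sum>j\<in>UNIV. fscale (ip M v (cst j)) (kframe M j w))" by (rule fibre_expansion[OF w])
      moreover have "(\<Sum>j\<in>UNIV. fscale (ip M v (cst j)) (kframe M j w)) \<in> fun_vs.span ?B"
        by (intro fun_vs.span_sum fun_vs.span_scale fun_vs.span_base rangeI)
      ultimately show "v \<in> fun_vs.span ?B" by simp
    qed
  qed
  ultimately show ?thesis using inj by (simp add: frame_at_def)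
qed

lemma gramian_frame_invertible:
  assumes "frame_at M s w" shows "invertible (gramian M s w)"
proof (rule gramian_invertible)
  show "s i w \<in> car M" for i
    using assms fun_vs.span_base[of "s i w" "range (\<lambda>i. s i w)"] fibre_subset by (auto simp: frame_at_def)
qed (rule frame_at_unique[OF assms])

text \<open>
  The coefficients with respect to the kernel frame are holomorphic by definition; their matrix is
  invertible because both Gram matrices are.
\<close>

lemma frame_coefficients:
  assumes U: "open U" "U \<subseteq> dual_dom" and s: "holomorphic_frame M U s"
  obtains b where "mhol U b" "\<And>w i. w \<in> U \<Longrightarrow> s i w = mframe b (kframe M) i w"
    "\<And>w. w \<in> U \<Longrightarrow> invertible (b w)" "\<And>w. w \<in> U \<Longrightarrow> frame_at M s w"
proof -
  have "\<forall>i. \<exists>a. (\<forall>j. mholomorphic_on U (a j)) \<and> (\<forall>w\<in>U. s i w = (\<Sum>j\<in>UNIV. fscale (a j w) (kframe M j w)))"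
    using s by (auto simp: holomorphic_frame_def holomorphic_section_def)
  from choice[OF this] obtain a where a: "\<And>i j. mholomorphic_on U (a i j)"
    "\<And>i w. w \<in> U \<Longrightarrow> s i w = (\<Sum>j\<in>UNIV. fscale (a i j w) (kframe M j w))" by blast
  define b where "b w = (\<chi> i j. a i j w)" for w
  have b: "mhol U b" using a(1) by (simp add: mhol_def b_def)
  have sb: "s i w = mframe b (kframe M) i w" if "w \<in> U" for i w
    using a(2)[OF that] by (simp add: mframe_def b_def)
  have fr: "frame_at M s w" if "w \<in> U" for w
    using s that by (simp add: holomorphic_frame_def frame_at_def)
  have inv: "invertible (b w)" if w: "w \<in> U" for w
  proof -
    have K: "kframe M j w \<in> car M" for j using kframe_mem w U by blast
    have "gramian M s w = gramian M (mframe b (kframe M)) w" using sb[OF w] by (simp add: gramian_def)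
    also have "\<dots> = b w ** (gramian M (kframe M) w ** ctr (b w))" by (rule gramian_mframe) (rule K)
    finally have "b w ** ((gramian M (kframe M) w ** ctr (b w)) ** matrix_inv (gramian M s w)) = mat 1"
      using matrix_inv_mult(1)[OF gramian_frame_invertible[OF fr[OF w]]] by (simp add: matrix_mul_assoc)
    then show ?thesis unfolding invertible_def using matrix_left_right_inverse by blast
  qed
  from b sb inv fr show ?thesis by (rule that)
qed

lemma section_weakly_holomorphic:
  "mhol U b \<Longrightarrow> U \<subseteq> dual_dom \<Longrightarrow> weakly_holomorphic M U (mframe b (kframe M) i)"
  by (rule weakly_holomorphic_mframe[OF _ weakly_holomorphic_subset[OF kframe_weakly_holomorphic]])

lemma ip_section:
  assumes "w \<in> dual_dom" "h \<in> car M"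
  shows "ip M (mframe b (kframe M) i w) h = (\<Sum>j\<in>UNIV. b w $ i $ j * cnj (h (vcnj w) $ j))"
  using assms by (simp add: ip_mframe_left kframe_mem ip_kframe)

lemma section_jet_zero:
  assumes U: "open U" "U \<subseteq> dual_dom" and b: "mhol U b"
    and u: "\<And>j. mholomorphic_on \<Omega> (u j)" "\<And>j. jet_zero T k 1 k (zero_locus d \<Omega>) (u j)"
  shows "jet_zero T k 1 k (U \<inter> vcnj ` zero_locus d \<Omega>) (\<lambda>w. \<Sum>j\<in>UNIV. b w $ i $ j * cnj (u j (vcnj w)))"
proof -
  have Z: "zero_locus d \<Omega> \<subseteq> \<Omega>" by (auto simp: zero_locus_def)
  have p: "polarizable U (\<lambda>w. cnj (u j (vcnj w)))" "polarizable U (\<lambda>w. b w $ i $ j)" for j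
    using mholomorphic_on_polarizable[OF mholomorphic_on_subset[OF mholomorphic_on_sharp[OF u(1)] U(2)] U(1)]
      mhol_mpolar[OF b U(1)] by (simp_all add: mpolar_def)
  have j: "jet_zero T k 1 k (U \<inter> vcnj ` zero_locus d \<Omega>) (\<lambda>w. cnj (u j (vcnj w)))" for j
    using jet_zero_sharp[OF u(1) open_dom Z u(2)] unfolding jet_zero_def by blast
  show ?thesis
    by (intro jet_zero_sum[OF U(1)] jet_zero_mult_right[OF U(1)] p j polarizable_mult) auto
qed

lemma section_foldr:
  assumes U: "open U" "U \<subseteq> dual_dom" and b: "mhol U b" and w: "w \<in> U" and h: "h \<in> car M"
  shows "ip M (foldr (hderiv M) xs (mframe b (kframe M) i) w) h =
    derivs (map Hol xs) (\<lambda>w. \<Sum>j\<in>UNIV. b w $ i $ j * cnj (h (vcnj w) $ j)) w"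
proof -
  note wh = section_weakly_holomorphic[OF b U(2), of i]
  have "ip M (foldr (hderiv M) xs (mframe b (kframe M) i) w) h = derivs (map Hol xs) (\<lambda>w. ip M (mframe b (kframe M) i w) h) w"
    using weakly_holomorphic_hderivs(2)[OF wh U(1) w h] derivs_holomorphic(1)[OF U(1) weakly_holomorphicD(2)[OF wh h] w] by simp
  also have "\<dots> = derivs (map Hol xs) (\<lambda>w. \<Sum>j\<in>UNIV. b w $ i $ j * cnj (h (vcnj w) $ j)) w"
    by (rule derivs_cong[OF U(1) _ w]) (use ip_section U h in blast)
  finally show ?thesis .
qed

lemma section_deriv_mem:
  assumes U: "open U" "U \<subseteq> dual_dom" and b: "mhol U b" and w: "w \<in> U"
  shows "foldr (hderiv M) xs (mframe b (kframe M) i) w \<in> car M"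
  by (rule weakly_holomorphicD(1)[OF weakly_holomorphic_hderivs(1)[OF section_weakly_holomorphic[OF b U(2)] U(1)] w])

text \<open>
  Pairing with a derivative of a section evaluates transverse derivatives of order less than \<open>k\<close> on
  the zero locus.
\<close>

lemma section_deriv_Q:
  assumes U: "open U" "U \<subseteq> dual_dom" and b: "mhol U b" and w: "w \<in> U" "w \<in> vcnj ` zero_locus d \<Omega>"
    and xs: "set xs \<subseteq> transv d" "length xs < k"
  shows "foldr (hderiv M) xs (mframe b (kframe M) i) w \<in> quotient_module \<Omega> d k M"
proof -
  note m = section_deriv_mem[OF U b w(1), of xs i]
  have "ip M (foldr (hderiv M) xs (mframe b (kframe M) i) w) g = 0" if g: "g \<in> vanishing_submodule \<Omega> d k M" for g
  proof -
    have gM: "g \<in> car M" and gj: "\<And>j. jet_zero (transv d) k 1 k (zero_locus d \<Omega>) (\<lambda>w. g w $ j)"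
      using g by (auto simp: M0_jet_zero)
    have "jet_zero (transv d) k 1 k (U \<inter> vcnj ` zero_locus d \<Omega>) (\<lambda>w. \<Sum>j\<in>UNIV. b w $ i $ j * cnj (g (vcnj w) $ j))"
      by (rule section_jet_zero[OF U b holomorphic[OF gM] gj])
    then have "derivs (map Hol xs) (\<lambda>w. \<Sum>j\<in>UNIV. b w $ i $ j * cnj (g (vcnj w) $ j)) w = 0"
      by (rule jet_zero_hol_word[OF _ xs]) (use w in blast)
    then show ?thesis by (simp add: section_foldr[OF U b w(1) gM])
  qed
  then show ?thesis using m by (simp add: quotient_module_def)
qed

end

text \<open>Multiplication by a function vanishing at a point raises the order of vanishing there.\<close>

lemma jet_zero_mult_gain:
  assumes S: "open S" and z: "z \<in> S" and f: "polarizable S f" "f z = 0"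
  shows "polarizable S u \<Longrightarrow> jet_zero T n 1 n {z} u \<Longrightarrow> jet_zero T (Suc n) 1 (Suc n) {z} (\<lambda>w. f w * u w)"
proof (induction n arbitrary: u)
  case 0
  show ?case
    unfolding jet_zero_def using f(2) by auto
next
  case (Suc n)
  have zS: "{z} \<subseteq> S" using z by simp
  show ?case
    unfolding jet_zero_def
  proof (intro allI impI ballI)
    fix ws :: "'a direction list" and w
    assume ws: "set ws \<subseteq> dirs T" "nhol ws < Suc (Suc n)" "nanti ws < 1" "length ws < Suc (Suc n)" "w \<in> {z}"
    show "derivs ws (\<lambda>w. f w * u w) w = 0"
    proof (cases ws rule: rev_cases)
      case Nil
      then show ?thesis using f(2) ws(5) by simp
    next
      case (snoc vs x)
      obtain i where x: "x = Hol i" "i \<in> T" using ws(1,3) snoc by auto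
      have vs: "set vs \<subseteq> dirs T" "nhol vs < Suc n" "nanti vs < 1" "length vs < Suc n" using ws snoc x by auto
      have "jet_zero T (Suc n) 1 (Suc n) {z} (\<lambda>w. ddir x f w * u w)"
        by (rule jet_zero_mult_right[OF S zS polarizable_ddir[OF f(1) S] Suc.prems])
      then have 1: "derivs vs (\<lambda>w. ddir x f w * u w) w = 0" using vs ws(5) unfolding jet_zero_def by blast
      have "jet_zero T n 1 n {z} (ddir x u)"
        by (rule jet_zero_ddir[OF Suc.prems(2)]) (use x in auto)
      then have "jet_zero T (Suc n) 1 (Suc n) {z} (\<lambda>w. f w * ddir x u w)"
        by (rule Suc.IH[OF polarizable_ddir[OF Suc.prems(1) S]])
      then have 2: "derivs vs (\<lambda>w. f w * ddir x u w) w = 0" using vs ws(5) unfolding jet_zero_def by blast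
      show ?thesis
        using derivs_mult_snoc[OF S f(1) Suc.prems(1), of w vs x] 1 2 ws(5) z snoc by simp
    qed
  qed
qed

section \<open>Intertwining unitaries act on jets as holomorphic matrices\<close>

locale intertwiner = M: jet_module \<Omega> M + N: jet_module \<Omega> N
  for \<Omega> :: "'m::{finite,linorder} cvec set" and M N :: "('m, 'r::finite) fspace" +
  fixes d k :: nat and V :: "('m, 'r) vfun \<Rightarrow> ('m, 'r) vfun"
  assumes k_pos: "1 \<le> k"
    and unitary: "hunitary M N (quotient_module \<Omega> d k M) (quotient_module \<Omega> d k N) V"
    and intertwine: "\<lbrakk>f \<in> fun_algebra \<Omega>; x \<in> quotient_module \<Omega> d k M\<rbrakk> \<Longrightarrow>
      V (hproj M (quotient_module \<Omega> d k M) (pmul f x)) = hproj N (quotient_module \<Omega> d k N) (pmul f (V x))"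
begin

abbreviation Q where "Q \<equiv> quotient_module \<Omega> d k M"
abbreviation R where "R \<equiv> quotient_module \<Omega> d k N"
abbreviation Z where "Z \<equiv> zero_locus d \<Omega>"
abbreviation T :: "'m set" where "T \<equiv> transv d"

lemma Z_sub: "Z \<subseteq> \<Omega>" by (auto simp: zero_locus_def)

lemma V_mem: "x \<in> Q \<Longrightarrow> V x \<in> R"
  using unitary unfolding hunitary_def bij_betw_def by blast
lemma V_ip: "x \<in> Q \<Longrightarrow> y \<in> Q \<Longrightarrow> ip N (V x) (V y) = ip M x y"
  using unitary unfolding hunitary_def by blast
lemma QM: "x \<in> Q \<Longrightarrow> x \<in> car M" using M.Q_subset by blast
lemma RN: "x \<in> R \<Longrightarrow> x \<in> car N" using N.Q_subset by blast

text \<open>The adjoint of \<open>V\<close>, extended to \<open>N\<close> by the projection onto the quotient module.\<close>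

definition lift :: "('m, 'r) vfun \<Rightarrow> ('m, 'r) vfun" where
  "lift h = inv_into Q V (hproj N R h)"

lemma lift:
  assumes h: "h \<in> car N"
  shows "lift h \<in> Q" "V (lift h) = hproj N R h"
    and "x \<in> Q \<Longrightarrow> ip M (lift h) x = ip N h (V x)"
proof -
  have p: "hproj N R h \<in> V ` Q"
    using N.hproj(1)[OF h, of d k] unitary unfolding hunitary_def bij_betw_def by blast
  show q: "lift h \<in> Q" and e: "V (lift h) = hproj N R h"
    unfolding lift_def by (rule inv_into_into[OF p], rule f_inv_into_f[OF p])
  assume x: "x \<in> Q"
  have "ip M (lift h) x = ip N (V (lift h)) (V x)" using V_ip[OF q x] by simp
  also have "\<dots> = ip N h (V x)" unfolding e by (rule N.hproj(3)[OF h V_mem[OF x]])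
  finally show "ip M (lift h) x = ip N h (V x)" .
qed

lemma lift_mem: "h \<in> car N \<Longrightarrow> lift h \<in> car M" using lift(1) QM by blast

lemma lift_unique:
  assumes h: "h \<in> car N" and y: "y \<in> Q" "\<And>x. x \<in> Q \<Longrightarrow> ip M y x = ip N h (V x)"
  shows "lift h = y"
proof -
  have d: "lift h - y \<in> Q"
    using M.Q_closed fun_vs.subspace_diff lift(1)[OF h] y(1) unfolding M.hclosed_def by blast
  have "ip M (lift h - y) (lift h - y) = 0"
    using M.ip_diff_left[OF lift_mem[OF h] QM[OF y(1)] QM[OF d]] lift(3)[OF h d] y(2)[OF d] by simp
  then have "lift h - y = 0" using M.ip_pos[OF QM[OF d]] by force
  then show ?thesis by simp
qed

lemma subspace_Q: "fun_vs.subspace Q" using M.Q_closed unfolding M.hclosed_def by blast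

lemma lift_add:
  assumes "g \<in> car N" "h \<in> car N" shows "lift (g + h) = lift g + lift h"
proof (rule lift_unique)
  show "lift g + lift h \<in> Q" by (intro fun_vs.subspace_add[OF subspace_Q] lift(1) assms)
  show "ip M (lift g + lift h) x = ip N (g + h) (V x)" if x: "x \<in> Q" for x
    using assms by (simp add: M.ip_add N.ip_add lift_mem QM[OF x] RN[OF V_mem[OF x]] lift(3)[OF _ x])
qed (use assms in blast)

lemma lift_scale:
  assumes "h \<in> car N" shows "lift (fscale c h) = fscale c (lift h)"
proof (rule lift_unique)
  show "fscale c (lift h) \<in> Q" by (intro fun_vs.subspace_scale[OF subspace_Q] lift(1) assms)
  show "ip M (fscale c (lift h)) x = ip N (fscale c h) (V x)" if x: "x \<in> Q" for x
    using assms by (simp add: M.ip_scale N.ip_scale lift_mem QM[OF x] RN[OF V_mem[OF x]] lift(3)[OF _ x])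
qed (use assms in blast)

lemma lift_sum:
  assumes "\<And>i. h i \<in> car N" "finite I" shows "lift (\<Sum>i\<in>I. h i) = (\<Sum>i\<in>I. lift (h i))"
proof -
  have s1: "fscale 1 x = x" for x :: "('m, 'r) vfun" by (rule fun_vs.scale_one)
  show ?thesis
    using linear_on_sum[OF N.subspace lift_add lift_scale assms, of "\<lambda>_. 1"] by (simp only: s1)
qed

text \<open>
  Both quotient actions are compressions of multiplication by \<open>f\<close>, and \<open>f\<close> preserves the
  functions vanishing to order \<open>k\<close>.
\<close>

lemma lift_mult:
  assumes f: "f \<in> fun_algebra \<Omega>" and h: "h \<in> car N"
  shows "pmul f (lift h) - lift (pmul f h) \<in> vanishing_submodule \<Omega> d k M"
proof -
  let ?x = "lift h"
  have fx: "pmul f ?x \<in> car M" by (rule M.action_closed[OF f lift_mem[OF h]])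
  have "lift (pmul f h) = hproj M Q (pmul f ?x)"
  proof (rule lift_unique)
    show "pmul f h \<in> car N" by (rule N.action_closed[OF f h])
    show p: "hproj M Q (pmul f ?x) \<in> Q" by (rule M.hproj(1)[OF fx])
    fix y assume y: "y \<in> Q"
    let ?p = "hproj N R h"
    have pN: "?p \<in> car N" using N.hproj(1)[OF h] RN by blast
    have "ip M (hproj M Q (pmul f ?x)) y = ip N (V (hproj M Q (pmul f ?x))) (V y)" using V_ip[OF p y] by simp
    also have "\<dots> = ip N (hproj N R (pmul f ?p)) (V y)" using intertwine[OF f lift(1)[OF h]] lift(2)[OF h] by simp
    also have "\<dots> = ip N (pmul f ?p) (V y)" by (rule N.hproj(3)[OF N.action_closed[OF f pN] V_mem[OF y]])
    also have "\<dots> = ip N (pmul f h) (V y)"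
    proof -
      have m: "pmul f (h - ?p) \<in> vanishing_submodule \<Omega> d k N"
        by (rule N.M0_submodule[OF f N.hproj(2)[OF h]])
      then have mN: "pmul f (h - ?p) \<in> car N" by (simp add: vanishing_submodule_def)
      have "ip N (V y) (pmul f (h - ?p)) = 0" using V_mem[OF y] m by (simp add: quotient_module_def)
      then have "ip N (pmul f (h - ?p)) (V y) = 0"
        using N.ip_cnj[OF RN[OF V_mem[OF y]] mN] by simp
      moreover have "pmul f (h - ?p) = pmul f h - pmul f ?p"
        by (simp add: pmul_def fun_eq_iff vec_eq_iff algebra_simps)
      ultimately show ?thesis
        by (simp add: N.ip_diff_left N.action_closed f h pN RN V_mem y)
    qed
    finally show "ip M (hproj M Q (pmul f ?x)) y = ip N (pmul f h) (V y)" .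
  qed
  then show ?thesis using M.hproj(2)[OF fx, of d k] by simp
qed

text \<open>The columns of the matrix by which the adjoint of \<open>V\<close> acts on jets.\<close>

definition B :: "'r \<Rightarrow> ('m, 'r) vfun" where "B l = lift (N.cst l)"

lemma B_mem: "B l \<in> car M" unfolding B_def by (rule lift_mem) simp

lemma coord_diff_fun_algebra: "(\<lambda>w. w $ i - c) \<in> fun_algebra \<Omega>"
  unfolding fun_algebra_def by (auto intro!: exI[of _ "\<lambda>w. w $ i - c"] exI[of _ UNIV])

lemma hol_M: "h \<in> car M \<Longrightarrow> polarizable \<Omega> (\<lambda>w. h w $ j)"
  by (rule mholomorphic_on_polarizable[OF M.holomorphic M.open_dom])
lemma hol_N: "h \<in> car N \<Longrightarrow> polarizable \<Omega> (\<lambda>w. h w $ j)"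
  by (rule mholomorphic_on_polarizable[OF N.holomorphic N.open_dom])

text \<open>
  On jets along the zero locus the adjoint of \<open>V\<close> is multiplication by the matrix with columns
  \<open>B l\<close>, the images of the constants.  By the Gleason property a function is a constant plus
  multiples of the coordinate differences \<open>w\<^sub>i - z\<^sub>i\<close>, which commute with the adjoint up to
  functions vanishing to order \<open>k\<close>; so one order is gained in each step.
\<close>

lemma lift_jet:
  assumes z: "z \<in> Z"
  shows "n \<le> k \<Longrightarrow> h \<in> car N \<Longrightarrow> jet_zero T n 1 n {z} (\<lambda>w. lift h w $ j - (\<Sum>l\<in>UNIV. B l w $ j * h w $ l))"
proof (induction n arbitrary: h)
  case 0
  show ?case by (simp add: jet_zero_def)
next
  case (Suc n)
  note hN = Suc.prems(2)
  have z\<Omega>: "z \<in> \<Omega>" using z Z_sub by blast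
  have z1: "{z} \<subseteq> \<Omega>" using z\<Omega> by simp
  obtain q where q: "\<And>i. q i \<in> car N"
    "h = (\<Sum>l\<in>UNIV. fscale (h z $ l) (N.cst l)) + (\<Sum>i\<in>UNIV. pmul (\<lambda>w. w $ i - z $ i) (q i))"
    by (rule N.gleason_expansion[OF hN z\<Omega>]) blast
  let ?c = "\<lambda>i w. w $ i - z $ i"
  define p where "p i = pmul (?c i) (q i)" for i
  have pN: "p i \<in> car N" for i unfolding p_def by (rule N.action_closed[OF coord_diff_fun_algebra q(1)])
  (* u is the error for the Gleason quotients, v the failure of lift to commute with coordinates *)
  define u where "u i w = lift (q i) w $ j - (\<Sum>l\<in>UNIV. B l w $ j * q i w $ l)" for i w
  define v where "v i w = pmul (?c i) (lift (q i)) w $ j - lift (p i) w $ j" for i w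
  have u: "jet_zero T n 1 n {z} (u i)" for i unfolding u_def by (rule Suc.IH) (use Suc.prems q in auto)
  have pu: "polarizable \<Omega> (u i)" for i
    unfolding u_def by (intro polarizable_diff polarizable_sum polarizable_mult hol_M hol_N B_mem lift_mem q(1))
  have pc: "polarizable \<Omega> (?c i)" for i
    using mholomorphic_on_polarizable[OF fun_algebra_mholomorphic[OF coord_diff_fun_algebra M.open_dom] M.open_dom] .
  have pv: "polarizable \<Omega> (v i)" for i
    unfolding v_def by (intro polarizable_diff hol_M M.action_closed coord_diff_fun_algebra lift_mem q(1) pN)
  have cu: "jet_zero T (Suc n) 1 (Suc n) {z} (\<lambda>w. ?c i w * u i w)" for i
    by (rule jet_zero_mult_gain[OF M.open_dom z\<Omega> pc _ pu u]) simp
  have v: "jet_zero T (Suc n) 1 (Suc n) {z} (v i)" for i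
  proof -
    have "jet_zero T k 1 k Z (\<lambda>w. (pmul (?c i) (lift (q i)) - lift (p i)) w $ j)"
      using lift_mult[OF coord_diff_fun_algebra q(1)] unfolding M.M0_jet_zero p_def by blast
    then have "jet_zero T k 1 k {z} (v i)"
      using z unfolding jet_zero_def v_def by (simp add: fun_diff_def)
    then show ?thesis by (rule jet_zero_mono) (use Suc.prems in auto)
  qed
  have "jet_zero T (Suc n) 1 (Suc n) {z} (\<lambda>w. \<Sum>i\<in>UNIV. ?c i w * u i w - v i w)"
    by (intro jet_zero_sum[OF M.open_dom z1] jet_zero_diff[OF M.open_dom z1] cu v polarizable_diff polarizable_mult pc pu pv)
  then show ?case
  proof (rule jet_zero_cong[OF M.open_dom z1])
    fix w assume w: "w \<in> \<Omega>"
    have cN: "(\<Sum>l\<in>UNIV. fscale (h z $ l) (N.cst l)) \<in> car N" by (intro N.car_sum N.car_scale) simp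
    have "lift h = lift (\<Sum>l\<in>UNIV. fscale (h z $ l) (N.cst l)) + lift (\<Sum>i\<in>UNIV. p i)"
      by (subst q(2), subst lift_add[OF cN]) (auto simp: p_def intro!: N.car_sum pN[unfolded p_def])
    also have "lift (\<Sum>i\<in>UNIV. p i) = (\<Sum>i\<in>UNIV. lift (p i))" by (rule lift_sum[OF pN]) simp
    also have "lift (\<Sum>l\<in>UNIV. fscale (h z $ l) (N.cst l)) = (\<Sum>l\<in>UNIV. fscale (h z $ l) (B l))"
      unfolding B_def by (rule linear_on_sum[OF N.subspace lift_add lift_scale]) auto
    finally have 1: "lift h w $ j = (\<Sum>l\<in>UNIV. h z $ l * B l w $ j) + (\<Sum>i\<in>UNIV. lift (p i) w $ j)"
      by (simp add: sum_fun_apply fscale_def)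
    have "h w = ((\<Sum>l\<in>UNIV. fscale (h z $ l) (N.cst l)) + (\<Sum>i\<in>UNIV. p i)) w"
      using q(2) unfolding p_def by simp
    then have 2: "h w $ l = h z $ l + (\<Sum>i\<in>UNIV. ?c i w * q i w $ l)" for l
      using N.sum_cst_eval[OF w, of "\<lambda>l. h z $ l" l] by (simp add: sum_fun_apply p_def pmul_def left_diff_distrib)
    have "(\<Sum>l\<in>UNIV. B l w $ j * h w $ l) = (\<Sum>l\<in>UNIV. h z $ l * B l w $ j) + (\<Sum>i\<in>UNIV. ?c i w * (\<Sum>l\<in>UNIV. B l w $ j * q i w $ l))"
      unfolding 2 distrib_left sum.distrib sum_distrib_left
      by (subst (2) sum.swap) (simp add: mult_ac)
    then show "(\<Sum>i\<in>UNIV. ?c i w * u i w - v i w) = lift h w $ j - (\<Sum>l\<in>UNIV. B l w $ j * h w $ l)"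
      unfolding 1 u_def v_def by (simp add: pmul_def left_diff_distrib right_diff_distrib sum_subtractf sum.distrib)
  qed
qed

lemma lift_jet_zero:
  assumes "h \<in> car N"
  shows "jet_zero T k 1 k Z (\<lambda>w. lift h w $ j - (\<Sum>l\<in>UNIV. B l w $ j * h w $ l))"
  using lift_jet[OF _ order_refl assms, of _ j] unfolding jet_zero_def by blast

text \<open>
  The kernel frame of \<open>N\<close> multiplied by the conjugate transpose of the matrix by which the adjoint of
  \<open>V\<close> acts on jets; it is holomorphic in \<open>w\<close> since both the argument and the values are conjugated.
\<close>

definition amat :: "'m cvec \<Rightarrow> complex^'r^'r" where
  "amat w = (\<chi> j l. cnj (B l (vcnj w) $ j))"

definition \<tau> :: "'r \<Rightarrow> 'm cvec \<Rightarrow> ('m, 'r) vfun" where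
  "\<tau> = mframe amat (kframe N)"

lemma amat_hol: "mhol M.dual_dom amat"
  unfolding mhol_def amat_def using mholomorphic_on_sharp[OF M.holomorphic[OF B_mem]] by simp

text \<open>Pairing with \<open>h\<close> moves \<open>V\<close> to \<open>lift h\<close>, whose jets are known from \<open>lift_jet_zero\<close>.\<close>

lemma V_section_deriv:
  assumes U: "open U" "U \<subseteq> M.dual_dom" and b: "mhol U b" and w: "w \<in> U" "w \<in> vcnj ` Z"
    and xs: "set xs \<subseteq> T" "length xs < k"
  shows "V (foldr (hderiv M) xs (mframe b (kframe M) i) w) = foldr (hderiv N) xs (mframe b \<tau> i) w"
proof (rule N.ip_ext)
  let ?s = "foldr (hderiv M) xs (mframe b (kframe M) i) w"
  have ba: "mhol U (\<lambda>w. b w ** amat w)" by (rule mhol_mult[OF b mhol_subset[OF amat_hol U(2)]])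
  have bt: "mframe b \<tau> i = mframe (\<lambda>w. b w ** amat w) (kframe N) i"
    by (simp add: fun_eq_iff \<tau>_def mframe_mframe)
  have sQ: "?s \<in> Q" by (rule M.section_deriv_Q[OF U b w xs])
  show VN: "V ?s \<in> car N" by (rule RN[OF V_mem[OF sQ]])
  show tN: "foldr (hderiv N) xs (mframe b \<tau> i) w \<in> car N"
    unfolding bt by (rule N.section_deriv_mem[OF U ba w(1)])
  fix h assume h: "h \<in> car N"
  let ?u = "\<lambda>j z. lift h z $ j - (\<Sum>l\<in>UNIV. B l z $ j * h z $ l)"
  have uh: "mholomorphic_on \<Omega> (?u j)" for j
    by (intro mholomorphic_on_diff mholomorphic_on_sum mholomorphic_on_mult M.holomorphic N.holomorphic lift_mem B_mem h)
  have "jet_zero T k 1 k (U \<inter> vcnj ` Z) (\<lambda>w. \<Sum>j\<in>UNIV. b w $ i $ j * cnj (?u j (vcnj w)))"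
    by (rule M.section_jet_zero[OF U b uh lift_jet_zero[OF h]])
  then have z: "derivs (map Hol xs) (\<lambda>w. \<Sum>j\<in>UNIV. b w $ i $ j * cnj (?u j (vcnj w))) w = 0"
    by (rule jet_zero_hol_word[OF _ xs]) (use w in blast)
  let ?F = "\<lambda>w. \<Sum>j\<in>UNIV. b w $ i $ j * cnj (lift h (vcnj w) $ j)"
  let ?G = "\<lambda>w. \<Sum>l\<in>UNIV. (b w ** amat w) $ i $ l * cnj (h (vcnj w) $ l)"
  have pF: "polarizable U ?F" and pG: "polarizable U ?G"
  proof -
    have sh: "polarizable U (\<lambda>w. cnj (f (vcnj w)))" if "mholomorphic_on \<Omega> f" for f
      using mholomorphic_on_polarizable[OF mholomorphic_on_subset[OF mholomorphic_on_sharp[OF that] U(2)] U(1)] .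
    show "polarizable U ?F" "polarizable U ?G"
      using mhol_mpolar[OF b U(1)] mhol_mpolar[OF ba U(1)] sh[OF M.holomorphic[OF lift_mem[OF h]]] sh[OF N.holomorphic[OF h]]
      by (auto simp: mpolar_def intro!: polarizable_sum polarizable_mult)
  qed
  have "derivs (map Hol xs) (\<lambda>w. ?F w - ?G w) w = 0"
  proof -
    have "?F w - ?G w = (\<Sum>j\<in>UNIV. b w $ i $ j * cnj (?u j (vcnj w)))" for w
    proof -
      have "?G w = (\<Sum>l\<in>UNIV. \<Sum>j\<in>UNIV. b w $ i $ j * (cnj (B l (vcnj w) $ j) * cnj (h (vcnj w) $ l)))"
        by (simp add: matrix_matrix_mult_def amat_def sum_distrib_right mult.assoc)
      also have "\<dots> = (\<Sum>j\<in>UNIV. b w $ i $ j * (\<Sum>l\<in>UNIV. cnj (B l (vcnj w) $ j) * cnj (h (vcnj w) $ l)))"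
        by (subst sum.swap) (simp add: sum_distrib_left)
      finally show ?thesis by (simp add: sum_subtractf right_diff_distrib)
    qed
    then show ?thesis using z by simp
  qed
  then have eq: "derivs (map Hol xs) ?F w = derivs (map Hol xs) ?G w"
    using derivs_diff[OF U(1) pF pG w(1)] by simp
  have "ip N h (V ?s) = ip M (lift h) ?s" using lift(3)[OF h sQ] by simp
  also have "\<dots> = cnj (ip M ?s (lift h))" using M.ip_cnj[OF QM[OF sQ] lift_mem[OF h]] by simp
  also have "\<dots> = cnj (derivs (map Hol xs) ?G w)"
    unfolding M.section_foldr[OF U b w(1) lift_mem[OF h]] eq ..
  also have "\<dots> = cnj (ip N (foldr (hderiv N) xs (mframe b \<tau> i) w) h)"
    unfolding bt N.section_foldr[OF U ba w(1) h] ..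
  also have "\<dots> = ip N h (foldr (hderiv N) xs (mframe b \<tau> i) w)" using N.ip_cnj[OF tN h] by simp
  finally show "ip N h (V ?s) = ip N h (foldr (hderiv N) xs (mframe b \<tau> i) w)" .
qed

end

section \<open>Jet maps and normalized frames\<close>

lemma hol_anti_part:
  "set ws \<subseteq> dirs T \<Longrightarrow> set (hol_part ws) \<subseteq> T \<and> set (anti_part ws) \<subseteq> T \<and>
    length (hol_part ws) = nhol ws \<and> length (anti_part ws) = nanti ws"
  by (induction ws rule: hol_part.induct) auto

lemma mderivs_conj_const:
  fixes H :: "'m::finite cvec \<Rightarrow> complex^'r^'r" and E F :: "complex^'r^'r"
  assumes S: "open S" and H: "mpolar S H"
  shows "w \<in> S \<Longrightarrow> mderivs ws (\<lambda>w. E ** (H w ** F)) w = E ** (mderivs ws H w ** F)"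
proof (induction ws arbitrary: w)
  case (Cons x ws)
  have pH: "mpolar S (mderivs ws H)" by (rule mpolar_derivs[OF H S])
  have "mderivs (x # ws) (\<lambda>w. E ** (H w ** F)) w = mderiv x (\<lambda>w. E ** (mderivs ws H w ** F)) w"
    unfolding mderivs_simps by (rule mderiv_cong[OF S Cons.IH Cons.prems])
  also have "\<dots> = E ** (mderiv x (mderivs ws H) w ** F)"
    by (simp add: mderiv_mult[OF S mpolar_const mpolar_mult[OF pH mpolar_const] Cons.prems]
        mderiv_mult[OF S pH mpolar_const Cons.prems] matrix_algebra(6,7))
  finally show ?case by simp
qed simp

lemma mderivs_diff:
  assumes S: "open S" and A: "mpolar S A" and B: "mpolar S B" and w: "w \<in> S"
  shows "mderivs ws (\<lambda>w. A w - B w) w = mderivs ws A w - mderivs ws B w"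
  using A B derivs_diff[OF S _ _ w] by (simp add: vec_eq_iff mderivs_nth mpolar_def)

lemma multi_deriv_mat_wirt: "multi_deriv mat_wirt \<alpha> H = mderivs (map Hol (expand \<alpha>)) H"
proof -
  have "foldr mat_wirt xs H = mderivs (map Hol xs) H" for xs
    by (induction xs) (auto simp: mat_wirt_mderiv)
  then show ?thesis by (simp add: multi_deriv_expand)
qed

lemma matrix_inv_unique:
  fixes A :: "complex^'r^'r"
  assumes "A ** B = mat 1"
  shows "matrix_inv A = B"
proof -
  have BA: "B ** A = mat 1" using assms matrix_left_right_inverse by blast
  have "invertible A" unfolding invertible_def using assms BA by blast
  have "matrix_inv A = (B ** A) ** matrix_inv A" by (simp add: BA)
  also have "\<dots> = B ** (A ** matrix_inv A)" by (simp only: matrix_mul_assoc)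
  also have "\<dots> = B" by (simp add: matrix_inv_mult(1)[OF \<open>invertible A\<close>])
  finally show ?thesis .
qed

lemma mjet_zero_hol_word:
  assumes "mjet_zero T k 1 k Z A" "set xs \<subseteq> T" "length xs < k" "w \<in> Z"
  shows "mderivs (map Hol xs) A w = 0"
proof -
  have "derivs (map Hol xs) (\<lambda>w. A w $ a $ b) w = 0" for a b
    by (rule jet_zero_hol_word[OF _ assms(2-4)]) (use assms(1) in \<open>simp only: mjet_zero_def\<close>)
  then show ?thesis by (simp add: vec_eq_iff mderivs_nth)
qed

text \<open>
  If \<open>H\<close> and \<open>E H\<^sub>t E\<^sup>*\<close> have the same holomorphic jets, then \<open>(\<partial>\<^sup>\<alpha>H)H\<^sup>-\<^sup>1\<close> and the conjugate of its
  counterpart have the same values on the slice, hence also the same tangential derivatives.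
\<close>

lemma jet_map_conj:
  fixes H Ht :: "'m::{finite,linorder} cvec \<Rightarrow> complex^'r^'r"
  assumes U: "open U" and pol: "mpolar U H" "mpolar U Ht"
    and inv: "\<And>w. w \<in> U \<Longrightarrow> invertible (H w)" "\<And>w. w \<in> U \<Longrightarrow> invertible (Ht w)"
    and E: "ctr E ** E = mat 1"
    and jet: "mjet_zero (transv d) k 1 k {w \<in> U. tproj d w = w} (\<lambda>w. H w - E ** (Ht w ** ctr E))"
    and i: "i \<notin> transv d" and \<alpha>: "\<alpha> \<in> index_set d k" and w: "w \<in> U" "tproj d w = w"
  shows "jet_map i \<alpha> H w ** E = E ** jet_map i \<alpha> Ht w"
proof -
  let ?ws = "map Hol (expand \<alpha>)"
  have xs: "set (expand \<alpha>) \<subseteq> transv d" "length (expand \<alpha>) < k" using \<alpha> expand_mem_index_set by auto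
  have E': "E ** ctr E = mat 1" using E matrix_left_right_inverse by blast
  let ?f = "\<lambda>w. mderivs ?ws H w ** matrix_inv (H w)" and ?g = "\<lambda>w. mderivs ?ws Ht w ** matrix_inv (Ht w)"
  have eq: "?f w = E ** (?g w ** ctr E)" if w: "w \<in> U" "tproj d w = w" for w
  proof -
    have wZ: "w \<in> {w \<in> U. tproj d w = w}" using w by simp
    have pH': "mpolar U (\<lambda>w. E ** (Ht w ** ctr E))" by (intro mpolar_mult mpolar_const pol)
    have "mderivs ?ws (\<lambda>w. H w - E ** (Ht w ** ctr E)) w = 0" by (rule mjet_zero_hol_word[OF jet xs wZ])
    then have d: "mderivs ?ws H w = E ** (mderivs ?ws Ht w ** ctr E)"
      using mderivs_diff[OF U pol(1) pH' w(1)] mderivs_conj_const[OF U pol(2) w(1)] by simp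
    have h: "H w = E ** (Ht w ** ctr E)"
      using mjet_zero_at[OF jet _ _ _ wZ] xs(2) by simp
    have c: "ctr E ** (E ** X) = X" for X using E by (simp add: matrix_mul_assoc)
    have "matrix_inv (H w) = E ** (matrix_inv (Ht w) ** ctr E)"
    proof (rule matrix_inv_unique)
      have "H w ** (E ** (matrix_inv (Ht w) ** ctr E)) = E ** ((Ht w ** matrix_inv (Ht w)) ** ctr E)"
        unfolding h by (simp only: matrix_algebra(5) c)
      then show "H w ** (E ** (matrix_inv (Ht w) ** ctr E)) = mat 1"
        using matrix_inv_mult(1)[OF inv(2)[OF w(1)]] E' by simp
    qed
    then show ?thesis unfolding d by (simp only: matrix_algebra(5) c)
  qed
  have pg: "mpolar U ?g" by (intro mpolar_mult mpolar_derivs mpolar_inv pol U inv)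
  have "mderiv (Anti i) ?f w = mderiv (Anti i) (\<lambda>w. E ** (?g w ** ctr E)) w"
    unfolding mderiv_def
    by (intro arg_cong[where f=vec_lambda] ext ddir_tangential_cong[OF U _ w i]) (simp add: eq)
  also have "\<dots> = E ** (mderiv (Anti i) ?g w ** ctr E)"
    using mderivs_conj_const[OF U pg w(1), of "[Anti i]" E "ctr E"] by simp
  finally have "mderiv (Anti i) ?f w ** E = E ** (mderiv (Anti i) ?g w ** (ctr E ** E))"
    by (simp only: matrix_algebra(5))
  then show ?thesis
    by (simp add: jet_map_def mat_wirt_mderiv multi_deriv_mat_wirt E)
qed

context jet_module
begin

lemma normalized_jet:
  assumes nf: "normalized_frame \<Omega> d M U s"
  shows "jet_zero (transv d) p 1 p (U \<inter> vcnj ` zero_locus d \<Omega>) (\<lambda>w. ip M (s i w) (s j 0) - (if i = j then 1 else 0))"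
proof -
  let ?Z = "U \<inter> vcnj ` zero_locus d \<Omega>"
  have U: "open U" "U \<subseteq> dual_dom" "0 \<in> U" and hf: "holomorphic_frame M U s"
    and norm: "\<And>w i j. w \<in> ?Z \<Longrightarrow> ip M (s i w) (s j 0) = (if i = j then 1 else 0)"
    and norm': "\<And>w i j \<alpha>. w \<in> ?Z \<Longrightarrow> \<alpha> \<in> transv_indices d \<Longrightarrow> \<alpha> \<noteq> (\<lambda>_. 0) \<Longrightarrow>
        ip M (multi_deriv (hderiv M) \<alpha> (s i) w) (s j 0) = 0"
    using nf by (auto simp: normalized_frame_def)
  obtain b where b: "mhol U b" "\<And>w i. w \<in> U \<Longrightarrow> s i w = mframe b (kframe M) i w"
    by (rule frame_coefficients[OF U(1,2) hf]) blast
  have wh: "weakly_holomorphic M U (s i)"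
    by (rule weakly_holomorphic_cong[OF section_weakly_holomorphic[OF b(1) U(2), of i]]) (simp add: b(2))
  have s0: "s j 0 \<in> car M"
    using weakly_holomorphicD(1)[OF section_weakly_holomorphic[OF b(1) U(2), of j] U(3)] b(2)[OF U(3)] by simp
  let ?f = "\<lambda>w. ip M (s i w) (s j 0)"
  have hf: "mholomorphic_on U ?f" by (rule weakly_holomorphicD(2)[OF wh s0])
  have d: "foldr wirt xs ?f w = 0" if xs: "set xs \<subseteq> transv d" "xs \<noteq> []" and w: "w \<in> ?Z" for xs w
  proof -
    obtain \<alpha> where \<alpha>: "mset (expand \<alpha>) = mset xs" using ex_index_of_list .
    then have sx: "set (expand \<alpha>) = set xs" by (metis set_mset_mset)
    then have "expand \<alpha> \<noteq> []" using xs(2) by auto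
    then have *: "\<alpha> \<in> transv_indices d" "\<alpha> \<noteq> (\<lambda>_. 0)"
      using xs(1) sx by (simp_all add: expand_mem_transv_indices expand_eq_Nil)
    have wU: "w \<in> U" using w by blast
    have "foldr wirt xs ?f w = foldr wirt (expand \<alpha>) ?f w"
      by (rule foldr_wirt_perm[OF hf U(1) wU]) (simp add: \<alpha>)
    also have "\<dots> = ip M (multi_deriv (hderiv M) \<alpha> (s i) w) (s j 0)"
      unfolding multi_deriv_expand by (rule weakly_holomorphic_hderivs(2)[OF wh U(1) wU s0, symmetric])
    finally show ?thesis using norm'[OF w *] by simp
  qed
  have g: "mholomorphic_on U (\<lambda>w. ?f w - (if i = j then 1 else 0))"
    by (intro mholomorphic_on_diff hf mholomorphic_on_const)
  show ?thesis
    unfolding jet_zero_holomorphic[OF g U(1) Int_lower1]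
  proof (intro allI impI ballI)
    fix xs :: "'m list" and w assume xs: "set xs \<subseteq> transv d" "length xs < p" and w: "w \<in> ?Z"
    show "foldr wirt xs (\<lambda>w. ?f w - (if i = j then 1 else 0)) w = 0"
    proof (cases "xs = []")
      case True
      then show ?thesis using norm[OF w] by simp
    next
      case False
      have wU: "w \<in> U" using w by blast
      have "derivs (map Hol xs) (\<lambda>w. ?f w - (if i = j then 1 else 0)) w =
          derivs (map Hol xs) ?f w - derivs (map Hol xs) (\<lambda>_. if i = j then 1 else 0) w"
        by (rule derivs_diff[OF U(1) mholomorphic_on_polarizable[OF hf U(1)] polarizable_const wU])
      then show ?thesis
        using derivs_holomorphic(1)[OF U(1) g wU, of xs] derivs_holomorphic(1)[OF U(1) hf wU, of xs]
          d[OF xs(1) False w] derivs_const[of "map Hol xs"] False by simp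
    qed
  qed
qed

end

lemma zero_locus_slice: "U \<subseteq> vcnj ` \<Omega> \<Longrightarrow> U \<inter> vcnj ` zero_locus d \<Omega> = {w \<in> U. tproj d w = w}"
  using zero_locus_dual_iff[of _ d \<Omega>] by blast

section \<open>Conditions implied by an isomorphism\<close>

context intertwiner
begin

lemma \<tau>_weakly_holomorphic:
  "mhol U b \<Longrightarrow> U \<subseteq> M.dual_dom \<Longrightarrow> weakly_holomorphic N U (mframe b \<tau> i)"
  unfolding \<tau>_def mframe_mframe[abs_def]
  by (rule N.section_weakly_holomorphic[OF mhol_mult[OF _ mhol_subset[OF amat_hol]]])

lemma V_section:
  assumes "open U" "U \<subseteq> M.dual_dom" "mhol U b" "w \<in> U" "w \<in> vcnj ` Z"
  shows "V (mframe b (kframe M) i w) = mframe b \<tau> i w"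
  using V_section_deriv[OF assms, of "[]" i] k_pos by simp

lemma section_Q:
  assumes "open U" "U \<subseteq> M.dual_dom" "mhol U b" "w \<in> U" "w \<in> vcnj ` Z"
  shows "mframe b (kframe M) i w \<in> Q"
  using M.section_deriv_Q[OF assms, of "[]" k i] k_pos by simp

lemma V_kframe:
  assumes w: "w \<in> vcnj ` Z"
  shows "kframe M i w \<in> Q" "V (kframe M i w) = \<tau> i w"
proof -
  have "w \<in> M.dual_dom" using w Z_sub by blast
  note * = M.open_dual subset_refl mhol_const[of _ "mat 1"] this w
  show "kframe M i w \<in> Q" "V (kframe M i w) = \<tau> i w"
    using section_Q[OF *, of i] V_section[OF *, of i] by (simp_all add: mframe_id)
qed

text \<open>Derivatives of Gram matrices are inner products of derivatives of the frames, which \<open>V\<close> preserves.\<close>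

lemma gram_jets:
  assumes U: "open U" "U \<subseteq> M.dual_dom" and b: "mhol U b"
  shows "mjet_zero T k k n (U \<inter> vcnj ` Z) (\<lambda>w. gramian M (mframe b (kframe M)) w - gramian N (mframe b \<tau>) w)"
  unfolding mjet_zero_def jet_zero_def
proof (intro allI impI ballI)
  fix i j ws w assume ws: "set ws \<subseteq> dirs T" "nhol ws < k" "nanti ws < k" and w: "w \<in> U \<inter> vcnj ` Z"
  let ?s = "mframe b (kframe M)" and ?\<sigma> = "mframe b \<tau>"
  have ws1: "weakly_holomorphic M U (?s l)" for l by (rule M.section_weakly_holomorphic[OF b U(2)])
  have ws2: "weakly_holomorphic N U (?\<sigma> l)" for l by (rule \<tau>_weakly_holomorphic[OF b U(2)])
  have wU: "w \<in> U" "w \<in> vcnj ` Z" using w by auto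
  note hp = hol_anti_part[OF ws(1)]
  let ?h = "hol_part ws" and ?a = "anti_part ws"
  have Q: "foldr (hderiv M) ?h (?s i) w \<in> Q" "foldr (hderiv M) ?a (?s j) w \<in> Q"
    by (rule M.section_deriv_Q[OF U b wU]; use hp ws in simp)+
  have V: "V (foldr (hderiv M) ?h (?s i) w) = foldr (hderiv N) ?h (?\<sigma> i) w"
    "V (foldr (hderiv M) ?a (?s j) w) = foldr (hderiv N) ?a (?\<sigma> j) w"
    by (rule V_section_deriv[OF U b wU]; use hp ws in simp)+
  have "derivs ws (\<lambda>w. ip M (?s i w) (?s j w)) w = ip M (foldr (hderiv M) ?h (?s i) w) (foldr (hderiv M) ?a (?s j) w)"
    by (rule M.derivs_gram[OF ws1 ws1 U(1) wU(1)])
  also have "\<dots> = ip N (foldr (hderiv N) ?h (?\<sigma> i) w) (foldr (hderiv N) ?a (?\<sigma> j) w)"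
    using V_ip[OF Q] unfolding V by simp
  also have "\<dots> = derivs ws (\<lambda>w. ip N (?\<sigma> i w) (?\<sigma> j w)) w"
    by (rule N.derivs_gram[OF ws2 ws2 U(1) wU(1), symmetric])
  finally have "derivs ws (\<lambda>w. ip M (?s i w) (?s j w) - ip N (?\<sigma> i w) (?\<sigma> j w)) w = 0"
    using derivs_diff[OF U(1) sesqui_polarizable[OF M.gram_sesqui[OF ws1 ws1 U(1)] U(1)]
        sesqui_polarizable[OF N.gram_sesqui[OF ws2 ws2 U(1)] U(1)] wU(1)] by simp
  then show "derivs ws (\<lambda>w. (gramian M ?s w - gramian N ?\<sigma> w) $ i $ j) w = 0"
    by (simp add: gramian_def)
qed

lemma fibre_Q: "w \<in> vcnj ` Z \<Longrightarrow> v \<in> fibre M w \<Longrightarrow> v \<in> Q"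
proof -
  assume w: "w \<in> vcnj ` Z" and v: "v \<in> fibre M w"
  have "w \<in> M.dual_dom" using w Z_sub by blast
  from M.frame_at_kframe[OF this] v obtain x where "v = (\<Sum>i\<in>UNIV. fscale (x i) (kframe M i w))"
    using frame_at_fibre by blast
  also have "\<dots> \<in> Q" by (intro fun_vs.subspace_sum[OF subspace_Q] fun_vs.subspace_scale[OF subspace_Q] V_kframe(1)[OF w])
  finally show "v \<in> Q" .
qed

lemma V_linear:
  "x \<in> Q \<Longrightarrow> y \<in> Q \<Longrightarrow> V (x + y) = V x + V y" "x \<in> Q \<Longrightarrow> V (fscale c x) = fscale c (V x)"
  using unitary unfolding hunitary_def by blast+

lemma isometric_map: "holomorphic_isometric_map M N (vcnj ` Z) (\<lambda>_. V)"
  unfolding holomorphic_isometric_map_def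
proof (intro conjI ballI allI)
  fix w assume w: "w \<in> vcnj ` Z"
  have w\<Omega>: "w \<in> M.dual_dom" using w Z_sub by blast
  note F = fibre_Q[OF w]
  show "V ` fibre M w \<subseteq> fibre N w"
  proof (intro image_subsetI)
    fix v assume "v \<in> fibre M w"
    then obtain x where v: "v = (\<Sum>i\<in>UNIV. fscale (x i) (kframe M i w))"
      using frame_at_fibre[OF M.frame_at_kframe[OF w\<Omega>]] by blast
    have "V v = (\<Sum>i\<in>UNIV. fscale (x i) (V (kframe M i w)))"
      unfolding v by (rule linear_on_sum[OF subspace_Q V_linear V_kframe(1)[OF w]]) auto
    also have "\<dots> \<in> fibre N w"
      unfolding V_kframe(2)[OF w] \<tau>_def mframe_def
      by (intro fun_vs.subspace_sum[OF N.subspace_fibre[OF w\<Omega>]] fun_vs.subspace_scale[OF N.subspace_fibre[OF w\<Omega>]]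
          N.kframe_fibre w\<Omega>)
    finally show "V v \<in> fibre N w" .
  qed
  show "V (x + y) = V x + V y" if "x \<in> fibre M w" "y \<in> fibre M w" for x y using V_linear(1) F that by blast
  show "V (fscale c x) = fscale c (V x)" if "x \<in> fibre M w" for c x using V_linear(2) F that by blast
  show "ip N (V x) (V y) = ip M x y" if "x \<in> fibre M w" "y \<in> fibre M w" for x y using V_ip F that by blast
next
  fix j
  have "mholomorphic_on (vcnj ` Z) (\<lambda>w. amat w $ j $ l)" for l
    by (rule mholomorphic_on_subset[of M.dual_dom]) (use amat_hol Z_sub in \<open>auto simp: mhol_def\<close>)
  moreover have "V (kframe M j w) = (\<Sum>l\<in>UNIV. fscale (amat w $ j $ l) (kframe N l w))" if "w \<in> vcnj ` Z" for w
    using V_kframe(2)[OF that] by (simp add: \<tau>_def mframe_def)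
  ultimately show "holomorphic_section N (vcnj ` Z) (\<lambda>w. V (kframe M j w))"
    unfolding holomorphic_section_def by (intro exI[of _ "\<lambda>l w. amat w $ j $ l"]) blast
qed

lemma gramian_\<tau>:
  assumes "w \<in> M.dual_dom"
  shows "gramian N \<tau> w = amat w ** (gramian N (kframe N) w ** ctr (amat w))"
  unfolding \<tau>_def by (rule N.gramian_mframe) (rule N.kframe_mem[OF assms])

lemma mframe_one: "mframe (\<lambda>_. mat 1) F = F"
  by (simp add: fun_eq_iff mframe_id)

lemma kframe_jets: "mjet_zero T k k n (vcnj ` Z) (\<lambda>w. gramian M (kframe M) w - gramian N \<tau> w)"
proof -
  have "M.dual_dom \<inter> vcnj ` Z = vcnj ` Z" using Z_sub by blast
  then show ?thesis
    using gram_jets[OF M.open_dual subset_refl mhol_const[of _ "mat 1"], of n] unfolding mframe_one by simp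
qed

lemma amat_invertible:
  assumes w: "w \<in> vcnj ` Z" shows "invertible (amat w)"
proof -
  have w\<Omega>: "w \<in> M.dual_dom" using w Z_sub by blast
  have "gramian M (kframe M) w - gramian N \<tau> w = 0"
    by (rule mjet_zero_at[OF kframe_jets[of 1]]) (use w k_pos in auto)
  then have "amat w ** ((gramian N (kframe N) w ** ctr (amat w)) ** matrix_inv (gramian M (kframe M) w)) = mat 1"
    using matrix_inv_mult(1)[OF M.gramian_frame_invertible[OF M.frame_at_kframe[OF w\<Omega>]]] gramian_\<tau>[OF w\<Omega>]
    by (simp add: matrix_mul_assoc)
  then show ?thesis unfolding invertible_def using matrix_left_right_inverse by blast
qed

text \<open>
  The kernel frame of \<open>M\<close> and the frame \<open>\<tau>\<close> have the same jets of Gram matrices, hence the same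
  covariant derivatives of curvature; \<open>\<tau>\<close> differs from the kernel frame of \<open>N\<close> by a holomorphic gauge.
\<close>

lemma curvature_intertwines:
  assumes ij: "i \<in> T" "j \<in> T" and ws: "ws \<in> transv_words d k"
  shows "intertwines_on M (vcnj ` Z) (\<lambda>_. V) (curvature_deriv M ws i j) (curvature_deriv N ws i j)"
  unfolding intertwines_on_def
proof
  fix w assume w: "w \<in> vcnj ` Z"
  have w\<Omega>: "w \<in> M.dual_dom" using w Z_sub by blast
  let ?H = "gramian M (kframe M)" and ?H' = "gramian N \<tau>" and ?Ht = "gramian N (kframe N)"
  (* amat is known to be invertible on the zero locus only, hence on a neighbourhood of it *)
  define S where "S = M.dual_dom \<inter> (\<lambda>w. det (amat w)) -` (- {0})"
  have S: "open S"
    unfolding S_def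
    by (rule continuous_open_preimage[OF mholomorphic_on_continuous[OF mhol_det[OF amat_hol]] M.open_dual]) auto
  have SD: "S \<subseteq> M.dual_dom" by (auto simp: S_def)
  have ZS: "vcnj ` Z \<subseteq> S"
    using amat_invertible Z_sub by (auto simp: S_def invertible_det_nz)
  have inva: "invertible (amat v)" if "v \<in> S" for v using that by (simp add: S_def invertible_det_nz)
  have a: "mhol S amat" by (rule mhol_subset[OF amat_hol SD])
  have wM: "weakly_holomorphic M S (kframe M l)" and wN: "weakly_holomorphic N S (kframe N l)" for l
    using M.weakly_holomorphic_subset[OF M.kframe_weakly_holomorphic SD] N.weakly_holomorphic_subset[OF N.kframe_weakly_holomorphic SD] by blast+
  have pH: "mpolar S ?H" and pHt: "mpolar S ?Ht" by (rule M.mpolar_gramian[OF wM S], rule N.mpolar_gramian[OF wN S])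
  have pa: "mpolar S amat" by (rule mhol_mpolar[OF a S])
  have w\<tau>: "weakly_holomorphic N S (\<tau> l)" for l
    unfolding \<tau>_def by (rule N.section_weakly_holomorphic[OF a SD])
  have pH': "mpolar S ?H'" by (rule N.mpolar_gramian[OF w\<tau> S])
  have iH: "invertible (?H v)" "invertible (?Ht v)" if "v \<in> S" for v
    using M.gramian_frame_invertible[OF M.frame_at_kframe] N.gramian_frame_invertible[OF N.frame_at_kframe] SD that by blast+
  have H'eq: "?H' v = amat v ** (?Ht v ** ctr (amat v))" if "v \<in> S" for v using gramian_\<tau> SD that by blast
  have iH': "invertible (?H' v)" if v: "v \<in> S" for v
  proof -
    have "ctr (amat v) ** ctr (matrix_inv (amat v)) = mat 1" "ctr (matrix_inv (amat v)) ** ctr (amat v) = mat 1"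
      using matrix_inv_mult[OF inva[OF v]] by (simp_all flip: ctr_mult)
    then have "invertible (ctr (amat v))" unfolding invertible_def by blast
    then show ?thesis unfolding H'eq[OF v] by (intro invertible_mult inva[OF v] iH(2)[OF v])
  qed
  have words: "set ws \<subseteq> dirs T" "nhol ws + 2 \<le> k" "nanti ws + 2 \<le> k"
    using ws by (auto simp: transv_words_def nhol_def nanti_def)
  have len: "length ws = nhol ws + nanti ws"
    using words(1) by (induction ws) auto
  have X: "mjet_zero T k k (2 * k) (vcnj ` Z) (\<lambda>w. ?H w - ?H' w)" by (rule kframe_jets)
  have "mjet_zero T 1 1 1 (vcnj ` Z) (\<lambda>w. cov_word ?H i j ws w - cov_word ?H' i j ws w -
    mderivs (rev ws @ [Anti i, Hol j]) (\<lambda>w. ?H w - ?H' w) w ** matrix_inv (?H w))"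
    by (rule cov_word_leading_term[OF S ZS pH pH' iH(1) iH' X ij words(1)]) (use words len in auto)
  then have "cov_word ?H i j ws w - cov_word ?H' i j ws w -
    mderivs (rev ws @ [Anti i, Hol j]) (\<lambda>w. ?H w - ?H' w) w ** matrix_inv (?H w) = 0"
    by (rule mjet_zero_at) (use w in auto)
  moreover have "mderivs (rev ws @ [Anti i, Hol j]) (\<lambda>w. ?H w - ?H' w) w = 0"
  proof -
    have "mjet_zero T 1 1 1 (vcnj ` Z) (mderivs (rev ws @ [Anti i, Hol j]) (\<lambda>w. ?H w - ?H' w))"
      by (rule mjet_zero_derivs[OF X]) (use words len ij in auto)
    then show ?thesis by (rule mjet_zero_at) (use w in auto)
  qed
  ultimately have eq: "cov_word ?H i j ws w = cov_word ?H' i j ws w" by (simp add: matrix_algebra)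
  have "cov_word ?H' i j ws w ** amat w = amat w ** cov_word ?Ht i j ws w"
    by (rule cov_word_gauge[OF S pHt pa mpolar_ctr[OF pa] pH' mhol_deriv[OF a S] iH(2) iH' H'eq])
      (use w ZS in auto)
  then have "cov_word ?H i j ws w ** amat w = amat w ** cov_word ?Ht i j ws w" unfolding eq .
  then have "\<forall>v\<in>fibre M w. V (frame_endo (kframe M) (cov_word ?H i j ws) w v) =
      frame_endo (kframe N) (cov_word ?Ht i j ws) w (V v)"
    using intertwines_iff_matrix[OF M.frame_at_kframe[OF w\<Omega>] N.frame_at_kframe[OF w\<Omega>], of V amat]
      V_linear fibre_Q[OF w] V_kframe(2)[OF w] by (simp add: \<tau>_def)
  then show "\<forall>v\<in>fibre M w. V (curvature_deriv M ws i j w v) = curvature_deriv N ws i j w (V v)"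
    unfolding curvature_deriv_def Let_def cov_word_def .
qed

text \<open>
  Let \<open>e\<close> be the holomorphic matrix that relates the image of \<open>s\<close> under \<open>V\<close> to \<open>t\<close>.  The inner
  products with the values at the origin have trivial jets in both normalized frames, so \<open>e E\<^sup>*\<close> has the
  jets of the identity matrix, where \<open>E = e(0)\<close>.  Hence \<open>E\<close> is unitary, \<open>e\<close> may be replaced by \<open>E\<close>
  in all jets, and \<open>jet_map_conj\<close> applies.
\<close>

lemma jet_maps_intertwine:
  assumes ns: "normalized_frame \<Omega> d M U s" and nt: "normalized_frame \<Omega> d N U t"
    and i: "i \<notin> T" and \<alpha>: "\<alpha> \<in> index_set d k"
  shows "intertwines_on M (vcnj ` Z \<inter> U) (\<lambda>_. V)
    (frame_endo s (jet_map i \<alpha> (gramian M s))) (frame_endo t (jet_map i \<alpha> (gramian N t)))"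
proof -
  have U: "open U" "U \<subseteq> M.dual_dom" "0 \<in> U" and fs: "holomorphic_frame M U s" and ft: "holomorphic_frame N U t"
    using ns nt by (auto simp: normalized_frame_def)
  obtain b where b: "mhol U b" "\<And>w i. w \<in> U \<Longrightarrow> s i w = mframe b (kframe M) i w"
    "\<And>w. w \<in> U \<Longrightarrow> frame_at M s w"
    by (rule M.frame_coefficients[OF U(1,2) fs]) blast
  obtain c where c: "mhol U c" "\<And>w i. w \<in> U \<Longrightarrow> t i w = mframe c (kframe N) i w"
    "\<And>w. w \<in> U \<Longrightarrow> invertible (c w)" "\<And>w. w \<in> U \<Longrightarrow> frame_at N t w"
    by (rule N.frame_coefficients[OF U(1,2) ft]) blast
  let ?Zu = "U \<inter> vcnj ` Z"
  have Zu: "?Zu = {w \<in> U. tproj d w = w}" by (rule zero_locus_slice[OF U(2)])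
  have ZU: "?Zu \<subseteq> U" by blast
  have 0: "0 \<in> ?Zu" unfolding Zu using U(3) by simp
  define e where "e w = (b w ** amat w) ** matrix_inv (c w)" for w
  have e: "mhol U e"
    unfolding e_def[abs_def] by (intro mhol_mult b(1) mhol_subset[OF amat_hol U(2)] mhol_inv c(1,3))
  let ?\<sigma> = "mframe b \<tau>"
  have \<sigma>: "?\<sigma> i w = mframe e t i w" if w: "w \<in> U" for i w
  proof -
    have "mframe e t i w = mframe e (mframe c (kframe N)) i w"
      by (rule mframe_cong) (use c(2)[OF w] in \<open>simp_all add: mframe_def\<close>)
    also have "\<dots> = mframe (\<lambda>w. e w ** c w) (kframe N) i w" by (rule mframe_mframe)
    also have "\<dots> = mframe (\<lambda>w. b w ** amat w) (kframe N) i w"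
      by (rule mframe_cong) (use matrix_inv_mult(2)[OF c(3)[OF w]] in \<open>simp_all add: e_def matrix_algebra(5)\<close>)
    finally show ?thesis by (simp add: \<tau>_def mframe_mframe)
  qed
  have whs: "weakly_holomorphic M U (s i)" for i
    by (rule M.weakly_holomorphic_cong[OF M.section_weakly_holomorphic[OF b(1) U(2), of i]]) (simp add: b(2))
  have wht: "weakly_holomorphic N U (t i)" for i
    by (rule N.weakly_holomorphic_cong[OF N.section_weakly_holomorphic[OF c(1) U(2), of i]]) (simp add: c(2))
  have wh\<sigma>: "weakly_holomorphic N U (?\<sigma> i)" for i by (rule \<tau>_weakly_holomorphic[OF b(1) U(2)])
  note tN = weakly_holomorphicD(1)[OF wht]
  define E where "E = e 0"
  let ?f = "\<lambda>i j w. ip N (?\<sigma> i w) (?\<sigma> j 0)" and ?g = "\<lambda>i j w. ip M (s i w) (s j 0)"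
  have hf: "mholomorphic_on U (?f i j)" for i j
    by (rule weakly_holomorphicD(2)[OF wh\<sigma> weakly_holomorphicD(1)[OF wh\<sigma> U(3)]])
  have hg: "mholomorphic_on U (?g i j)" for i j
    by (rule weakly_holomorphicD(2)[OF whs weakly_holomorphicD(1)[OF whs U(3)]])
  have ht: "mholomorphic_on U (\<lambda>w. ip N (t l w) (t m 0))" for l m
    by (rule weakly_holomorphicD(2)[OF wht tN[OF U(3)]])
  note P = mholomorphic_on_polarizable[OF _ U(1)]
  have fg: "jet_zero T k 1 k ?Zu (\<lambda>w. ?f i j w - ?g i j w)" for i j
    unfolding jet_zero_holomorphic[OF mholomorphic_on_diff[OF hf hg] U(1) ZU]
  proof (intro allI impI ballI)
    fix xs w assume xs: "set xs \<subseteq> T" "length xs < k" and w: "w \<in> ?Zu"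
    have wU: "w \<in> U" "w \<in> vcnj ` Z" using w by auto
    let ?s = "mframe b (kframe M)"
    have s': "weakly_holomorphic M U (?s l)" for l by (rule M.section_weakly_holomorphic[OF b(1) U(2)])
    have Q: "foldr (hderiv M) xs (?s i) w \<in> Q" "?s j 0 \<in> Q"
      using M.section_deriv_Q[OF U(1,2) b(1) wU xs] section_Q[OF U(1,2) b(1)] 0 by blast+
    have "foldr wirt xs (?g i j) w = foldr wirt xs (\<lambda>w. ip M (?s i w) (?s j 0)) w"
    proof -
      have "derivs (map Hol xs) (?g i j) w = derivs (map Hol xs) (\<lambda>w. ip M (?s i w) (?s j 0)) w"
        by (rule derivs_cong[OF U(1) _ wU(1)]) (simp add: b(2) U(3))
      then show ?thesis
        using derivs_holomorphic(1)[OF U(1) hg wU(1)]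
          derivs_holomorphic(1)[OF U(1) weakly_holomorphicD(2)[OF s' weakly_holomorphicD(1)[OF s' U(3)]] wU(1)] by simp
    qed
    also have "\<dots> = ip M (foldr (hderiv M) xs (?s i) w) (?s j 0)"
      by (rule M.weakly_holomorphic_hderivs(2)[OF s' U(1) wU(1) weakly_holomorphicD(1)[OF s' U(3)], symmetric])
    also have "\<dots> = ip N (V (foldr (hderiv M) xs (?s i) w)) (V (?s j 0))" by (rule V_ip[OF Q, symmetric])
    also have "\<dots> = ip N (foldr (hderiv N) xs (?\<sigma> i) w) (?\<sigma> j 0)"
      using V_section_deriv[OF U(1,2) b(1) wU xs] V_section[OF U(1,2) b(1) U(3)] 0 by simp
    also have "\<dots> = foldr wirt xs (?f i j) w"
      by (rule N.weakly_holomorphic_hderivs(2)[OF wh\<sigma> U(1) wU(1) weakly_holomorphicD(1)[OF wh\<sigma> U(3)]])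
    finally have eq: "foldr wirt xs (?g i j) w = foldr wirt xs (?f i j) w" .
    show "foldr wirt xs (\<lambda>w. ?f i j w - ?g i j w) w = 0"
      using derivs_diff[OF U(1) P[OF hf[of i j]] P[OF hg[of i j]] wU(1), of "map Hol xs"]
        derivs_holomorphic(1)[OF U(1) hf wU(1)] derivs_holomorphic(1)[OF U(1) hg wU(1)]
        derivs_holomorphic(1)[OF U(1) mholomorphic_on_diff[OF hf hg] wU(1)] eq by simp
  qed
  have pe: "mpolar U e" by (rule mhol_mpolar[OF e U(1)])
  then have pe': "polarizable U (\<lambda>w. e w $ i $ l)" for i l by (simp add: mpolar_def)
  (* r is the deviation from normalization of t; replacing r by 0 below leaves e E* *)
  have D: "mjet_zero T k 1 k ?Zu (\<lambda>w. e w ** ctr E - mat 1)"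
    unfolding mjet_zero_def
  proof (intro allI)
    fix i j
    let ?r = "\<lambda>l m w. ip N (t l w) (t m 0) - (if l = m then 1 else 0)"
    have r: "jet_zero T k 1 k ?Zu (?r l m)" for l m by (rule N.normalized_jet[OF nt])
    have pr: "polarizable U (?r l m)" for l m by (intro polarizable_diff P ht polarizable_const)
    have r1: "polarizable U (\<lambda>w. ?r l m w * cnj (E $ j $ m))" for l m
      by (rule polarizable_mult[OF pr polarizable_const])
    have r2: "jet_zero T k 1 k ?Zu (\<lambda>w. ?r l m w * cnj (E $ j $ m))" for l m
      by (rule jet_zero_mult[OF U(1) ZU pr polarizable_const r])
    have r3: "polarizable U (\<lambda>w. \<Sum>m\<in>UNIV. ?r l m w * cnj (E $ j $ m))" for l
      by (rule polarizable_sum[OF r1])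
    have r4: "jet_zero T k 1 k ?Zu (\<lambda>w. \<Sum>m\<in>UNIV. ?r l m w * cnj (E $ j $ m))" for l
      by (rule jet_zero_sum[OF U(1) ZU r1 r2])
    have r5: "polarizable U (\<lambda>w. e w $ i $ l * (\<Sum>m\<in>UNIV. ?r l m w * cnj (E $ j $ m)))" for l
      by (rule polarizable_mult[OF pe' r3])
    have r6: "jet_zero T k 1 k ?Zu (\<lambda>w. e w $ i $ l * (\<Sum>m\<in>UNIV. ?r l m w * cnj (E $ j $ m)))" for l
      by (rule jet_zero_mult_right[OF U(1) ZU pe' r3 r4])
    have r7: "jet_zero T k 1 k ?Zu (\<lambda>w. ?g i j w - (if i = j then 1 else 0))" by (rule M.normalized_jet[OF ns])
    have r8: "polarizable U (\<lambda>w. ?f i j w - ?g i j w)" "polarizable U (\<lambda>w. ?g i j w - (if i = j then 1 else 0))"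
      by (rule polarizable_diff[OF P[OF hf] P[OF hg]], rule polarizable_diff[OF P[OF hg] polarizable_const])
    have "jet_zero T k 1 k ?Zu (\<lambda>w. ((?f i j w - ?g i j w) + (?g i j w - (if i = j then 1 else 0))) -
        (\<Sum>l\<in>UNIV. e w $ i $ l * (\<Sum>m\<in>UNIV. ?r l m w * cnj (E $ j $ m))))"
      by (rule jet_zero_diff[OF U(1) ZU polarizable_add[OF r8] polarizable_sum[OF r5]
          jet_zero_add[OF U(1) ZU r8 fg r7] jet_zero_sum[OF U(1) ZU r5 r6]])
    then show "jet_zero T k 1 k ?Zu (\<lambda>w. (e w ** ctr E - mat 1) $ i $ j)"
    proof (rule jet_zero_cong[OF U(1) ZU])
      fix w assume w: "w \<in> U"
      have "?f i j w = ip N (mframe e t i w) (mframe e t j 0)" by (simp add: \<sigma>[OF w] \<sigma>[OF U(3)])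
      also have "\<dots> = (\<Sum>l\<in>UNIV. e w $ i $ l * (\<Sum>m\<in>UNIV. ip N (t l w) (t m 0) * cnj (E $ j $ m)))"
        by (subst N.ip_mframe_left) (simp_all add: N.ip_mframe_right N.mframe_mem tN w U(3) E_def)
      finally have f: "?f i j w = (\<Sum>l\<in>UNIV. e w $ i $ l * (\<Sum>m\<in>UNIV. ip N (t l w) (t m 0) * cnj (E $ j $ m)))" .
      have "(\<Sum>m\<in>UNIV. ?r l m w * cnj (E $ j $ m)) = (\<Sum>m\<in>UNIV. ip N (t l w) (t m 0) * cnj (E $ j $ m)) - cnj (E $ j $ l)" for l
        by (simp add: left_diff_distrib sum_subtractf if_distrib[of "\<lambda>x. x * _"] cong: if_cong)
      then have "(\<Sum>l\<in>UNIV. e w $ i $ l * (\<Sum>m\<in>UNIV. ?r l m w * cnj (E $ j $ m))) = ?f i j w - (\<Sum>l\<in>UNIV. e w $ i $ l * cnj (E $ j $ l))"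
        unfolding f by (simp add: right_diff_distrib sum_subtractf)
      then show "((?f i j w - ?g i j w) + (?g i j w - (if i = j then 1 else 0))) -
        (\<Sum>l\<in>UNIV. e w $ i $ l * (\<Sum>m\<in>UNIV. ?r l m w * cnj (E $ j $ m))) = (e w ** ctr E - mat 1) $ i $ j"
        by (simp add: matrix_matrix_mult_def ctr_def mat_def)
    qed
  qed
  have "e 0 ** ctr E - mat 1 = 0" by (rule mjet_zero_at[OF D _ _ _ 0]) (use k_pos in auto)
  then have E1: "E ** ctr E = mat 1" by (simp add: E_def)
  then have E2: "ctr E ** E = mat 1" using matrix_left_right_inverse by blast
  have eE: "mjet_zero T k 1 k ?Zu (\<lambda>w. e w - E)"
  proof (rule mjet_zero_cong[OF U(1) ZU])
    show "mjet_zero T k 1 k ?Zu (\<lambda>w. (e w ** ctr E - mat 1) ** E)"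
      by (intro mjet_zero_mult_left[OF U(1) ZU _ _ D] mpolar_diff mpolar_mult mpolar_const pe)
    show "(e w ** ctr E - mat 1) ** E = e w - E" for w
      using E2 by (simp add: matrix_algebra(3) matrix_algebra(5))
  qed
  have heE: "mholomorphic_on U (\<lambda>w. (e w - E) $ i $ j)" for i j
    using e by (auto simp: mhol_def)
  (* the conjugate transpose is antiholomorphic and vanishes on the slice *)
  have ceE: "mjet_zero T k 1 k ?Zu (\<lambda>w. ctr (e w - E))"
    unfolding mjet_zero_def
  proof (intro allI)
    fix i j
    have "jet_zero T k 1 k ?Zu (\<lambda>w. (e w - E) $ j $ i)" using eE unfolding mjet_zero_def by blast
    then have "jet_zero T 1 1 1 ?Zu (\<lambda>w. (e w - E) $ j $ i)" by (rule jet_zero_mono) (use k_pos in auto)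
    then have "jet_zero T 1 k k ?Zu (\<lambda>w. (e w - E) $ j $ i)"
      by (rule jet_zero_holomorphic_anti[OF heE U(1) ZU])
    from jet_zero_cnj[OF P[OF heE] U(1) ZU this]
    show "jet_zero T k 1 k ?Zu (\<lambda>w. ctr (e w - E) $ i $ j)" by (simp add: ctr_def)
  qed
  have pt: "mpolar U (gramian N t)" by (rule N.mpolar_gramian[OF wht U(1)])
  have ps: "mpolar U (gramian M s)" by (rule M.mpolar_gramian[OF whs U(1)])
  have p\<sigma>: "mpolar U (gramian N ?\<sigma>)" by (rule N.mpolar_gramian[OF wh\<sigma> U(1)])
  have jet: "mjet_zero T k 1 k ?Zu (\<lambda>w. gramian M s w - E ** (gramian N t w ** ctr E))"
  proof (rule mjet_zero_cong[OF U(1) ZU])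
    have g: "mjet_zero T k 1 k ?Zu (\<lambda>w. gramian M s w - gramian N ?\<sigma> w)"
    proof (rule mjet_zero_cong[OF U(1) ZU])
      show "mjet_zero T k 1 k ?Zu (\<lambda>w. gramian M (mframe b (kframe M)) w - gramian N ?\<sigma> w)"
        by (rule mjet_zero_mono[OF gram_jets[OF U(1,2) b(1), of k]]) (use k_pos in auto)
    qed (simp add: gramian_def b(2))
    show "mjet_zero T k 1 k ?Zu (\<lambda>w. (gramian M s w - gramian N ?\<sigma> w) +
        ((e w - E) ** (gramian N t w ** ctr (e w)) + E ** (gramian N t w ** ctr (e w - E))))"
      by (intro mjet_zero_add[OF U(1) ZU] g mjet_zero_mult_left[OF U(1) ZU _ _ eE]
          mjet_zero_mult_right[OF U(1) ZU] ceE mpolar_add mpolar_diff mpolar_mult mpolar_ctr mpolar_const ps p\<sigma> pt pe)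
    fix w assume w: "w \<in> U"
    have "gramian N ?\<sigma> w = gramian N (mframe e t) w" by (simp add: gramian_def \<sigma>[OF w])
    also have "\<dots> = e w ** (gramian N t w ** ctr (e w))" by (rule N.gramian_mframe) (rule tN[OF w])
    finally show "(gramian M s w - gramian N ?\<sigma> w) +
        ((e w - E) ** (gramian N t w ** ctr (e w)) + E ** (gramian N t w ** ctr (e w - E))) =
        gramian M s w - E ** (gramian N t w ** ctr E)"
      by (simp add: ctr_diff matrix_algebra(3,4))
  qed
  show ?thesis
    unfolding intertwines_on_def
  proof
    fix w assume w: "w \<in> vcnj ` Z \<inter> U"
    then have wU: "w \<in> U" "tproj d w = w" "w \<in> ?Zu" using Zu by auto
    have m: "jet_map i \<alpha> (gramian M s) w ** E = E ** jet_map i \<alpha> (gramian N t) w"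
      by (rule jet_map_conj[OF U(1) ps pt _ _ E2 jet[unfolded Zu] i \<alpha> wU(1,2)])
        (use M.gramian_frame_invertible[OF b(3)] N.gramian_frame_invertible[OF c(4)] in auto)
    have "e w - E = 0" by (rule mjet_zero_at[OF eE _ _ _ wU(3)]) (use k_pos in auto)
    then have "V (s l w) = mframe (\<lambda>_. E) t l w" for l
      using V_section[OF U(1,2) b(1) wU(1), of l] w \<sigma>[OF wU(1), of l] b(2)[OF wU(1), of l] by (simp add: mframe_def)
    then show "\<forall>v\<in>fibre M w. V (frame_endo s (jet_map i \<alpha> (gramian M s)) w v) =
        frame_endo t (jet_map i \<alpha> (gramian N t)) w (V v)"
      using intertwines_iff_matrix[OF b(3)[OF wU(1)] c(4)[OF wU(1)], of V "\<lambda>_. E"] V_linear fibre_Q w m by blast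
  qed
qed

end

section \<open>An isomorphism from the conditions\<close>

lemma hol_anti_part_map [simp]:
  "hol_part (map Hol xs @ map Anti ys) = xs" "anti_part (map Hol xs @ map Anti ys) = ys"
  "hol_part (map Hol xs) = xs" "anti_part (map Hol xs) = []"
proof -
  have a: "hol_part (map Anti ys) = []" "anti_part (map Anti ys) = ys" by (induction ys) auto
  show "hol_part (map Hol xs @ map Anti ys) = xs" "anti_part (map Hol xs @ map Anti ys) = ys"
    "hol_part (map Hol xs) = xs" "anti_part (map Hol xs) = []"
    by (induction xs) (auto simp: a)
qed

context jet_module
begin

text \<open>
  A vector orthogonal to the derivatives of a frame on a small piece of the zero locus has vanishing
  jets there, hence on the whole zero locus by the identity theorem, because the latter is connected.
\<close>

lemma section_total:
  assumes U: "open U" "U \<subseteq> dual_dom" "0 \<in> U" and b: "mhol U b" "\<And>w. w \<in> U \<Longrightarrow> invertible (b w)"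
    and con: "connected (zero_locus d \<Omega>)" and h: "h \<in> quotient_module \<Omega> d k M"
    and zero: "\<And>xs i w. set xs \<subseteq> transv d \<Longrightarrow> length xs < k \<Longrightarrow> w \<in> U \<inter> vcnj ` zero_locus d \<Omega> \<Longrightarrow>
      ip M h (foldr (hderiv M) xs (mframe b (kframe M) i) w) = 0"
  shows "h = 0"
proof -
  have hM: "h \<in> car M" using h by (simp add: quotient_module_def)
  let ?S = "mframe b (kframe M)" and ?Zu = "U \<inter> vcnj ` zero_locus d \<Omega>"
  have ZU: "?Zu \<subseteq> U" by blast
  have wh: "weakly_holomorphic M U (?S i)" for i by (rule section_weakly_holomorphic[OF b(1) U(2)])
  note wf = weakly_holomorphicD(2)[OF wh hM]
  have j: "jet_zero (transv d) k 1 k ?Zu (\<lambda>w. ip M (?S i w) h)" for i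
    unfolding jet_zero_holomorphic[OF wf U(1) ZU]
  proof (intro allI impI ballI)
    fix xs :: "'m list" and w assume xs: "set xs \<subseteq> transv d" "length xs < k" and w: "w \<in> ?Zu"
    have wU: "w \<in> U" using w by blast
    have "ip M (foldr (hderiv M) xs (?S i) w) h = 0"
      using zero[OF xs w, of i] ip_cnj[OF hM section_deriv_mem[OF U(1,2) b(1) wU, of xs i]] by simp
    then show "foldr wirt xs (\<lambda>w. ip M (?S i w) h) w = 0"
      using weakly_holomorphic_hderivs(2)[OF wh U(1) wU hM] by simp
  qed
  have pi: "polarizable U (\<lambda>w. matrix_inv (b w) $ j $ i)" for i j
    using mpolar_inv[OF mhol_mpolar[OF b(1) U(1)] b(2)] by (simp add: mpolar_def)
  note pf = mholomorphic_on_polarizable[OF wf U(1)]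
  have hs: "mholomorphic_on U (\<lambda>w. cnj (h (vcnj w) $ j))" for j
    by (rule mholomorphic_on_subset[OF mholomorphic_on_sharp[OF holomorphic[OF hM]] U(2)])
  have js: "jet_zero (transv d) k 1 k ?Zu (\<lambda>w. cnj (h (vcnj w) $ j))" for j
  proof (rule jet_zero_cong[OF U(1) ZU])
    show "jet_zero (transv d) k 1 k ?Zu (\<lambda>w. \<Sum>i\<in>UNIV. matrix_inv (b w) $ j $ i * ip M (?S i w) h)"
      by (rule jet_zero_sum[OF U(1) ZU polarizable_mult[OF pi pf] jet_zero_mult_right[OF U(1) ZU pi pf j]])
    fix w assume w: "w \<in> U"
    let ?v = "\<chi> l. cnj (h (vcnj w) $ l)"
    have "(\<chi> i. ip M (?S i w) h) = b w *v ?v"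
      using ip_section[of w h b] w U(2) hM by (simp add: vec_eq_iff matrix_vector_mult_def subset_iff)
    then have "matrix_inv (b w) *v (\<chi> i. ip M (?S i w) h) = (matrix_inv (b w) ** b w) *v ?v"
      by (simp add: matrix_vector_mul_assoc)
    also have "\<dots> = ?v" by (simp add: matrix_inv_mult(2)[OF b(2)[OF w]])
    finally have "(matrix_inv (b w) *v (\<chi> i. ip M (?S i w) h)) $ j = ?v $ j" by simp
    then show "(\<Sum>i\<in>UNIV. matrix_inv (b w) $ j $ i * ip M (?S i w) h) = cnj (h (vcnj w) $ j)"
      by (simp add: matrix_vector_mult_def)
  qed
  have Z: "zero_locus d \<Omega> = {w \<in> \<Omega>. tproj d w = w}" using zero_locus_iff by blast
  have Z\<Omega>: "zero_locus d \<Omega> \<subseteq> \<Omega>" using Z by blast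
  have "h \<in> vanishing_submodule \<Omega> d k M"
    unfolding M0_jet_zero
  proof (intro conjI hM allI)
    fix j
    show "jet_zero (transv d) k 1 k (zero_locus d \<Omega>) (\<lambda>w. h w $ j)"
      unfolding jet_zero_holomorphic[OF holomorphic[OF hM] open_dom Z\<Omega>]
    proof (intro allI impI ballI)
      fix xs :: "'m list" and z assume xs: "set xs \<subseteq> transv d" "length xs < k" and z: "z \<in> zero_locus d \<Omega>"
      show "foldr wirt xs (\<lambda>w. h w $ j) z = 0"
      proof (rule slice_identity[OF open_dom con[unfolded Z] mholomorphic_on_foldr_wirt[OF open_dom holomorphic[OF hM]]
            open_vcnj[OF U(1)], where z=0])
        show "0 \<in> vcnj ` U" using U(3) by (simp add: vcnj_image_iff)
        show "vcnj ` U \<subseteq> \<Omega>" proof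
          fix w assume "w \<in> vcnj ` U"
          then have "vcnj w \<in> vcnj ` \<Omega>" using U(2) vcnj_image_iff[of w U] by blast
          then show "w \<in> \<Omega>" using vcnj_image_iff[of "vcnj w" \<Omega>] by simp
        qed
        fix w assume w: "w \<in> vcnj ` U" "tproj d w = w"
        have wZ: "vcnj w \<in> ?Zu"
          using w U(2) unfolding zero_locus_slice[OF U(2)] by (simp add: vcnj_image_iff)
        then have "foldr wirt xs (\<lambda>w. cnj (h (vcnj w) $ j)) (vcnj w) = 0"
          using js[of j] xs unfolding jet_zero_holomorphic[OF hs U(1) ZU] by blast
        moreover have "vcnj w \<in> vcnj ` \<Omega>" using wZ U(2) by blast
        ultimately show "foldr wirt xs (\<lambda>w. h w $ j) w = 0"
          using foldr_wirt_sharp[OF holomorphic[OF hM] open_dom, of "vcnj w" xs j] by simp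
      qed (use z Z in auto)
    qed
  qed
  then have "ip M h h = 0" using h by (simp add: quotient_module_def)
  then show ?thesis using ip_pos[OF hM] by force
qed

end

lemma (in hilbert_fspace) gramian_hermitian:
  "(\<And>i. s i w \<in> car M) \<Longrightarrow> gramian M s w $ i $ j = cnj (gramian M s w $ j $ i)"
  using ip_cnj[of "s i w" "s j w"] by (simp add: gramian_def)

text \<open>
  The matrices \<open>b\<close> and \<open>c\<close> express the normalized frames, and \<open>A\<close> expresses \<open>\<Phi>\<close>, through the kernel
  frames.
\<close>

locale bundle_map_setting = M: jet_module \<Omega> M + N: jet_module \<Omega> N
  for \<Omega> :: "'m::{finite,linorder} cvec set" and M N :: "('m, 'r::finite) fspace" +
  fixes d k :: nat and U :: "'m cvec set" and s t :: "'r \<Rightarrow> 'm cvec \<Rightarrow> ('m, 'r) vfun"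
    and \<Phi> :: "'m cvec \<Rightarrow> ('m, 'r) vfun \<Rightarrow> ('m, 'r) vfun"
    and b c A :: "'m cvec \<Rightarrow> complex^'r^'r"
  assumes k_pos: "1 \<le> k"
    and ns: "normalized_frame \<Omega> d M U s" and nt: "normalized_frame \<Omega> d N U t"
    and iso: "holomorphic_isometric_map M N (vcnj ` zero_locus d \<Omega>) \<Phi>"
    and b: "mhol U b" "\<And>w i. w \<in> U \<Longrightarrow> s i w = mframe b (kframe M) i w" "\<And>w. w \<in> U \<Longrightarrow> invertible (b w)"
      "\<And>w. w \<in> U \<Longrightarrow> frame_at M s w"
    and c: "mhol U c" "\<And>w i. w \<in> U \<Longrightarrow> t i w = mframe c (kframe N) i w" "\<And>w. w \<in> U \<Longrightarrow> invertible (c w)"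
      "\<And>w. w \<in> U \<Longrightarrow> frame_at N t w"
    and A: "mhol (vcnj ` zero_locus d \<Omega>) A"
      "\<And>w j. w \<in> vcnj ` zero_locus d \<Omega> \<Longrightarrow> \<Phi> w (kframe M j w) = mframe A (kframe N) j w"
begin

abbreviation T :: "'m set" where "T \<equiv> transv d"
abbreviation Zd :: "'m cvec set" where "Zd \<equiv> vcnj ` zero_locus d \<Omega>"
abbreviation Zu :: "'m cvec set" where "Zu \<equiv> {w \<in> U. tproj d w = w}"
abbreviation Cyl :: "'m cvec set" where "Cyl \<equiv> tproj d -` U"

lemma U: "open U" "U \<subseteq> M.dual_dom" "0 \<in> U" and conZu: "connected Zu"
proof -
  show *: "open U" "U \<subseteq> M.dual_dom" "0 \<in> U" using ns by (auto simp: normalized_frame_def)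
  have "connected (U \<inter> Zd)" using ns by (auto simp: normalized_frame_def)
  then show "connected Zu" by (simp only: zero_locus_slice[OF *(2)])
qed

lemma Zu_eq: "U \<inter> Zd = Zu" by (rule zero_locus_slice[OF U(2)])
lemma Zu_Zd: "w \<in> Zu \<Longrightarrow> w \<in> Zd" using Zu_eq by blast
lemma ZuU: "Zu \<subseteq> U" by blast
lemma zero_Zu: "0 \<in> Zu" using U(3) by simp
lemma Zd_dual: "w \<in> Zd \<Longrightarrow> w \<in> M.dual_dom" by (auto simp: zero_locus_def)

lemma s_hol: "weakly_holomorphic M U (s i)"
  by (rule M.weakly_holomorphic_cong[OF M.section_weakly_holomorphic[OF b(1) U(2), of i]]) (simp add: b(2))
lemma t_hol: "weakly_holomorphic N U (t i)"
  by (rule N.weakly_holomorphic_cong[OF N.section_weakly_holomorphic[OF c(1) U(2), of i]]) (simp add: c(2))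

lemmas sM = weakly_holomorphicD(1)[OF s_hol]
lemmas tN = weakly_holomorphicD(1)[OF t_hol]

lemma \<Phi>_add: "w \<in> Zd \<Longrightarrow> x \<in> fibre M w \<Longrightarrow> y \<in> fibre M w \<Longrightarrow> \<Phi> w (x + y) = \<Phi> w x + \<Phi> w y"
  and \<Phi>_scale: "w \<in> Zd \<Longrightarrow> x \<in> fibre M w \<Longrightarrow> \<Phi> w (fscale a x) = fscale a (\<Phi> w x)"
  and \<Phi>_ip: "w \<in> Zd \<Longrightarrow> x \<in> fibre M w \<Longrightarrow> y \<in> fibre M w \<Longrightarrow> ip N (\<Phi> w x) (\<Phi> w y) = ip M x y"
  using iso unfolding holomorphic_isometric_map_def by blast+

lemma s_fibre: "w \<in> U \<Longrightarrow> s i w \<in> fibre M w"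
  using b(4)[of w] fun_vs.span_base[of "s i w" "range (\<lambda>i. s i w)"] by (auto simp: frame_at_def)

text \<open>The matrix of \<open>\<Phi>\<close> with respect to the normalized frames.\<close>

definition e :: "'m cvec \<Rightarrow> complex^'r^'r" where
  "e w = (b w ** A w) ** matrix_inv (c w)"

definition E :: "complex^'r^'r" where "E = e 0"

lemma e_hol: "mhol Zu e"
  unfolding e_def[abs_def]
  by (intro mhol_mult mhol_subset[OF b(1) ZuU] mhol_subset[OF A(1)] mhol_inv mhol_subset[OF c(1) ZuU])
    (use Zu_Zd c(3) in auto)

lemma \<Phi>_s:
  assumes w: "w \<in> Zu" shows "\<Phi> w (s i w) = mframe e t i w"
proof -
  have wU: "w \<in> U" and wZ: "w \<in> Zd" using w Zu_Zd by auto
  have sf: "fun_vs.subspace (fibre M w)" by (rule M.subspace_fibre[OF Zd_dual[OF wZ]])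
  have "\<Phi> w (s i w) = (\<Sum>j\<in>UNIV. fscale (b w $ i $ j) (\<Phi> w (kframe M j w)))"
    unfolding b(2)[OF wU] mframe_def[of b]
    by (rule linear_on_sum[OF sf \<Phi>_add[OF wZ] \<Phi>_scale[OF wZ] M.kframe_fibre[OF Zd_dual[OF wZ]]]) auto
  also have "\<dots> = mframe b (mframe A (kframe N)) i w" by (simp add: A(2)[OF wZ] mframe_def[of b])
  also have "\<dots> = mframe (\<lambda>w. b w ** A w) (kframe N) i w" by (rule mframe_mframe)
  also have "\<dots> = mframe (\<lambda>w. e w ** c w) (kframe N) i w"
    by (rule mframe_cong) (use matrix_inv_mult(2)[OF c(3)[OF wU]] in \<open>simp_all add: e_def matrix_algebra(5)\<close>)
  also have "\<dots> = mframe e (mframe c (kframe N)) i w" by (rule mframe_mframe[symmetric])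
  also have "\<dots> = mframe e t i w" by (rule mframe_cong) (use c(2)[OF wU] in simp_all)
  finally show ?thesis .
qed

lemma ip_mframe2:
  assumes "w \<in> U" "v \<in> U"
  shows "ip N (mframe a t i w) (mframe a' t j v) =
    (\<Sum>l\<in>UNIV. a w $ i $ l * (\<Sum>m\<in>UNIV. ip N (t l w) (t m v) * cnj (a' v $ j $ m)))"
  by (subst N.ip_mframe_left) (simp_all add: N.ip_mframe_right N.mframe_mem tN assms)

text \<open>
  Polarizing the isometry relation in the normalized frames and evaluating at the origin shows
  that the matrix of \<open>\<Phi>\<close> is a constant unitary.
\<close>

lemma e_const: "w \<in> Zu \<Longrightarrow> e w = E" and E_unitary: "E ** ctr E = mat 1" "ctr E ** E = mat 1"
proof -
  have he: "mholomorphic_on Cyl (\<lambda>w. e (tproj d w) $ i $ l)" for i l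
    by (rule mholomorphic_on_tproj) (use e_hol in \<open>simp add: mhol_def\<close>)
  have eq: "e w ** ctr E = mat 1" if w: "w \<in> Zu" for w
  proof -
    have "(e w ** ctr E) $ i $ j = (mat 1 :: complex^'r^'r) $ i $ j" for i j
    proof -
      define G where "G w v = ip M (s i w) (s j v) -
        (\<Sum>l\<in>UNIV. e w $ i $ l * (\<Sum>m\<in>UNIV. ip N (t l w) (t m v) * cnj (e v $ j $ m)))" for w v
      have "sesqui Cyl (\<lambda>w v. ip M (s i (tproj d w)) (s j (tproj d v)) -
        (\<Sum>l\<in>UNIV. e (tproj d w) $ i $ l * (\<Sum>m\<in>UNIV. ip N (t l (tproj d w)) (t m (tproj d v)) * cnj (e (tproj d v) $ j $ m))))"
        by (rule sesqui_diff[OF sesqui_tproj[OF M.gram_sesqui[OF s_hol s_hol U(1)]]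
            sesqui_sum[OF sesqui_mult[OF sesqui_left[OF he] sesqui_sum[OF sesqui_mult[OF
              sesqui_tproj[OF N.gram_sesqui[OF t_hol t_hol U(1)]] sesqui_right[OF he]]]]]])
      then have sq: "sesqui Cyl (\<lambda>w v. G (tproj d w) (tproj d v))" unfolding G_def .
      have "G w 0 = 0"
      proof (rule polarization_slice[OF U(1) conZu sq])
        fix w assume w: "w \<in> U" "tproj d w = w"
        then have wZ: "w \<in> Zu" by simp
        have "ip N (mframe e t i w) (mframe e t j w) = ip M (s i w) (s j w)"
          using \<Phi>_ip[OF Zu_Zd[OF wZ] s_fibre[OF w(1)] s_fibre[OF w(1)]] by (simp add: \<Phi>_s[OF wZ])
        then show "G w w = 0" unfolding G_def ip_mframe2[OF w(1) w(1)] by simp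
      qed (use w U(3) in auto)
      moreover have "ip M (s i w) (s j 0) = (if i = j then 1 else 0)"
        using ns w Zu_eq unfolding normalized_frame_def by blast
      moreover have "ip N (t l w) (t m 0) = (if l = m then 1 else 0)" for l m
        using nt w Zu_eq unfolding normalized_frame_def by blast
      ultimately have "(\<Sum>l\<in>UNIV. e w $ i $ l * cnj (E $ j $ l)) = (if i = j then 1 else 0)"
        by (simp add: G_def E_def if_distrib[of "\<lambda>x. x * _"] cong: if_cong)
      then show ?thesis by (simp add: matrix_matrix_mult_def ctr_def mat_def)
    qed
    then show ?thesis by (simp add: vec_eq_iff)
  qed
  show E1: "E ** ctr E = mat 1" using eq[OF zero_Zu] by (simp add: E_def)
  then show E2: "ctr E ** E = mat 1" using matrix_left_right_inverse by blast
  assume w: "w \<in> Zu"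
  have "e w = e w ** (ctr E ** E)" by (simp add: E2)
  also have "\<dots> = (e w ** ctr E) ** E" by (simp only: matrix_algebra(5))
  finally show "e w = E" by (simp add: eq[OF w])
qed

lemma \<Phi>_s': "w \<in> Zu \<Longrightarrow> \<Phi> w (s i w) = mframe (\<lambda>_. E) t i w"
  using \<Phi>_s e_const by (simp add: mframe_def)

abbreviation "Hs \<equiv> gramian M s"
abbreviation "Ht \<equiv> gramian N t"
abbreviation "H' \<equiv> \<lambda>w. E ** (Ht w ** ctr E)"

lemma pHs: "mpolar U Hs" and pHt: "mpolar U Ht" and pH': "mpolar U H'"
proof -
  show "mpolar U Hs" by (rule M.mpolar_gramian[OF s_hol U(1)])
  show t: "mpolar U Ht" by (rule N.mpolar_gramian[OF t_hol U(1)])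
  show "mpolar U H'" by (intro mpolar_mult mpolar_const t)
qed

lemma iHs: "w \<in> U \<Longrightarrow> invertible (Hs w)" and iHt: "w \<in> U \<Longrightarrow> invertible (Ht w)"
  using M.gramian_frame_invertible[OF b(4)] N.gramian_frame_invertible[OF c(4)] by blast+

lemma iE: "invertible E" "invertible (ctr E)"
  using E_unitary unfolding invertible_def by blast+

lemma iH': "w \<in> U \<Longrightarrow> invertible (H' w)"
  by (intro invertible_mult iE iHt)

lemma gramian_E: "w \<in> U \<Longrightarrow> gramian N (mframe (\<lambda>_. E) t) w = H' w"
  by (rule N.gramian_mframe) (rule tN)

lemma Hs_eq: "w \<in> Zu \<Longrightarrow> Hs w = H' w"
proof -
  assume w: "w \<in> Zu"
  then have wU: "w \<in> U" by simp
  have "Hs w = gramian N (mframe (\<lambda>_. E) t) w"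
    using \<Phi>_ip[OF Zu_Zd[OF w] s_fibre[OF wU] s_fibre[OF wU]] by (simp add: gramian_def \<Phi>_s'[OF w])
  then show ?thesis using gramian_E[OF wU] by simp
qed

lemma ip_deriv_s:
  assumes "w \<in> U"
  shows "mderivs (map Hol xs) Hs w $ i $ j = ip M (foldr (hderiv M) xs (s i) w) (s j w)"
    and "mderivs (map Hol xs) Ht w $ i $ j = ip N (foldr (hderiv N) xs (t i) w) (t j w)"
  using M.derivs_gram[OF s_hol s_hol U(1) assms, of "map Hol xs" i j]
    N.derivs_gram[OF t_hol t_hol U(1) assms, of "map Hol xs" i j]
  by (simp_all add: mderivs_nth gramian_def)

text \<open>Normalization, restated for words of derivatives; the case of the empty word is the value itself.\<close>

lemma ip_deriv_zero:
  assumes w: "w \<in> Zu" and xs: "set xs \<subseteq> T"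
  shows "ip M (foldr (hderiv M) xs (s i) w) (s j 0) = (if xs = [] \<and> i = j then 1 else 0)"
    and "ip N (foldr (hderiv N) xs (t i) w) (t j 0) = (if xs = [] \<and> i = j then 1 else 0)"
proof -
  have wU: "w \<in> U" using w by simp
  have *: "derivs (map Hol xs) f w = (if xs = [] \<and> i = j then 1 else 0)"
    if f: "mholomorphic_on U f" and j: "jet_zero T (Suc (length xs)) 1 (Suc (length xs)) (U \<inter> Zd) (\<lambda>w. f w - (if i = j then 1 else 0))" for f
  proof -
    have "derivs (map Hol xs) (\<lambda>w. f w - (if i = j then 1 else 0)) w = 0"
      by (rule jet_zero_hol_word[OF j xs]) (use w Zu_eq in auto)
    then have "derivs (map Hol xs) f w = derivs (map Hol xs) (\<lambda>_. if i = j then 1 else 0) w"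
      using derivs_diff[OF U(1) mholomorphic_on_polarizable[OF f U(1)] polarizable_const wU] by simp
    then show ?thesis by (cases "xs = []") (simp_all add: derivs_const)
  qed
  have fs: "mholomorphic_on U (\<lambda>w. ip M (s i w) (s j 0))" by (rule weakly_holomorphicD(2)[OF s_hol sM[OF U(3)]])
  have ft: "mholomorphic_on U (\<lambda>w. ip N (t i w) (t j 0))" by (rule weakly_holomorphicD(2)[OF t_hol tN[OF U(3)]])
  show "ip M (foldr (hderiv M) xs (s i) w) (s j 0) = (if xs = [] \<and> i = j then 1 else 0)"
    using *[OF fs M.normalized_jet[OF ns]] M.weakly_holomorphic_hderivs(2)[OF s_hol U(1) wU sM[OF U(3)]]
      derivs_holomorphic(1)[OF U(1) fs wU] by simp
  show "ip N (foldr (hderiv N) xs (t i) w) (t j 0) = (if xs = [] \<and> i = j then 1 else 0)"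
    using *[OF ft N.normalized_jet[OF nt]] N.weakly_holomorphic_hderivs(2)[OF t_hol U(1) wU tN[OF U(3)]]
      derivs_holomorphic(1)[OF U(1) ft wU] by simp
qed

text \<open>
  Condition (iii) says that \<open>(\<partial>\<^sup>\<alpha>H)H\<^sup>-\<^sup>1\<close> and its counterpart differ by a matrix \<open>L\<close> that is
  holomorphic along the zero locus.  Multiplying by \<open>H\<close>, polarizing and evaluating the second
  variable at the origin, where the frames are normalized, gives \<open>L = 0\<close>.
\<close>

lemma hol_derivs_agree:
  assumes jm: "\<And>i w. i \<notin> T \<Longrightarrow> w \<in> Zu \<Longrightarrow> jet_map i \<alpha> Hs w ** E = E ** jet_map i \<alpha> Ht w"
    and \<alpha>: "\<alpha> \<in> index_set d k" and w: "w \<in> Zu"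
  shows "mderivs (map Hol (expand \<alpha>)) (\<lambda>w. Hs w - H' w) w = 0"
proof -
  let ?xs = "expand \<alpha>"
  let ?ws = "map Hol ?xs"
  have xs: "set ?xs \<subseteq> T" using \<alpha> expand_mem_index_set by blast
  let ?f = "\<lambda>w. mderivs ?ws Hs w ** matrix_inv (Hs w)" and ?g = "\<lambda>w. mderivs ?ws Ht w ** matrix_inv (Ht w)"
  let ?g' = "\<lambda>w. E ** (?g w ** ctr E)"
  define L where "L w = ?f w - ?g' w" for w
  have pf: "mpolar U ?f" by (rule mpolar_mult[OF mpolar_derivs[OF pHs U(1)] mpolar_inv[OF pHs iHs]])
  have pg: "mpolar U ?g" by (rule mpolar_mult[OF mpolar_derivs[OF pHt U(1)] mpolar_inv[OF pHt iHt]])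
  have pg': "mpolar U ?g'" by (intro mpolar_mult[OF mpolar_const] mpolar_mult[OF pg mpolar_const])
  have pL: "mpolar U L" unfolding L_def[abs_def] by (rule mpolar_diff[OF pf pg'])
  have dL: "mderiv (Anti i) L w = 0" if i: "i \<notin> T" and w: "w \<in> Zu" for i w
  proof -
    have wU: "w \<in> U" using w by simp
    have "mderiv (Anti i) L w = mderiv (Anti i) ?f w - mderiv (Anti i) ?g' w"
      unfolding L_def[abs_def] by (rule mderiv_diff[OF U(1) pf pg' wU])
    also have "mderiv (Anti i) ?g' w = E ** (mderiv (Anti i) ?g w ** ctr E)"
      using mderivs_conj_const[OF U(1) pg wU, of "[Anti i]" E "ctr E"] by simp
    also have "\<dots> = (E ** jet_map i \<alpha> Ht w) ** ctr E"
      by (simp add: jet_map_def mat_wirt_mderiv multi_deriv_mat_wirt matrix_algebra(5))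
    also have "\<dots> = jet_map i \<alpha> Hs w ** (E ** ctr E)"
      unfolding jm[OF i w, symmetric] by (simp only: matrix_algebra(5))
    also have "\<dots> = mderiv (Anti i) ?f w"
      by (simp add: E_unitary jet_map_def mat_wirt_mderiv multi_deriv_mat_wirt)
    finally show ?thesis by simp
  qed
  have hL: "mholomorphic_on Cyl (\<lambda>w. L (tproj d w) $ i $ j)" for i j
  proof (rule mholomorphic_on_of_antiholomorphic_derivative[OF _ open_cylinder[OF U(1)]])
    show "polarizable Cyl (\<lambda>w. L (tproj d w) $ i $ j)"
      by (rule polarizable_tproj) (use pL in \<open>simp add: mpolar_def\<close>)
    fix l w assume w: "w \<in> Cyl"
    have "ddir (Anti l) (\<lambda>w. L w $ i $ j) (tproj d w) = 0" if "l \<notin> T"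
    proof -
      have "mderiv (Anti l) L (tproj d w) $ i $ j = 0 $ i $ j" using dL[OF that, of "tproj d w"] w by simp
      then show ?thesis by simp
    qed
    then show "ddir (Anti l) (\<lambda>w. L (tproj d w) $ i $ j) w = 0"
      unfolding ddir_tproj[of l "\<lambda>w. L w $ i $ j" d w] by simp
  qed
  have LH: "L w ** Hs w = mderivs ?ws Hs w - E ** (mderivs ?ws Ht w ** ctr E)" if w: "w \<in> Zu" for w
  proof -
    have wU: "w \<in> U" using w by simp
    have 1: "?f w ** Hs w = mderivs ?ws Hs w"
      using matrix_inv_mult(2)[OF iHs[OF wU]] by (simp add: matrix_algebra(5))
    have "ctr E ** (E ** X) = X" for X :: "complex^'r^'r" using E_unitary(2) by (simp add: matrix_mul_assoc)
    moreover have "matrix_inv (Ht w) ** (Ht w ** X) = X" for X :: "complex^'r^'r"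
      using matrix_inv_mult(2)[OF iHt[OF wU]] by (simp add: matrix_mul_assoc)
    ultimately have 2: "?g' w ** H' w = E ** (mderivs ?ws Ht w ** ctr E)" by (simp add: matrix_algebra(5))
    show ?thesis using 1 2 Hs_eq[OF w] by (simp add: L_def matrix_algebra(3))
  qed
  have L0: "L w = 0" if w: "w \<in> Zu" for w
  proof -
    have "L w $ i $ j = 0" for i j
    proof -
      let ?ds = "\<lambda>i. foldr (hderiv M) ?xs (s i)" and ?dt = "\<lambda>i. foldr (hderiv N) ?xs (t i)"
      have ds: "weakly_holomorphic M U (?ds i)" for i by (rule M.weakly_holomorphic_hderivs(1)[OF s_hol U(1)])
      have dt: "weakly_holomorphic N U (?dt i)" for i by (rule N.weakly_holomorphic_hderivs(1)[OF t_hol U(1)])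
      define G where "G w v = (\<Sum>l\<in>UNIV. L w $ i $ l * ip M (s l w) (s j v)) - (ip M (?ds i w) (s j v) -
        (\<Sum>l\<in>UNIV. E $ i $ l * (\<Sum>m\<in>UNIV. ip N (?dt l w) (t m v) * cnj (E $ j $ m))))" for w v
      have "sesqui Cyl (\<lambda>w v. (\<Sum>l\<in>UNIV. L (tproj d w) $ i $ l * ip M (s l (tproj d w)) (s j (tproj d v))) -
        (ip M (?ds i (tproj d w)) (s j (tproj d v)) -
        (\<Sum>l\<in>UNIV. E $ i $ l * (\<Sum>m\<in>UNIV. ip N (?dt l (tproj d w)) (t m (tproj d v)) * cnj (E $ j $ m)))))"
        by (rule sesqui_diff[OF
            sesqui_sum[OF sesqui_mult[OF sesqui_left[OF hL] sesqui_tproj[OF M.gram_sesqui[OF s_hol s_hol U(1)]]]]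
            sesqui_diff[OF sesqui_tproj[OF M.gram_sesqui[OF ds s_hol U(1)]]
              sesqui_sum[OF sesqui_mult[OF sesqui_const sesqui_sum[OF sesqui_mult[OF
                sesqui_tproj[OF N.gram_sesqui[OF dt t_hol U(1)]] sesqui_const]]]]]])
      then have sq: "sesqui Cyl (\<lambda>w v. G (tproj d w) (tproj d v))" unfolding G_def .
      have "G w 0 = 0"
      proof (rule polarization_slice[OF U(1) conZu sq])
        fix w assume w: "w \<in> U" "tproj d w = w"
        then have wZ: "w \<in> Zu" by simp
        have "(L w ** Hs w) $ i $ j = (mderivs ?ws Hs w - E ** (mderivs ?ws Ht w ** ctr E)) $ i $ j"
          by (simp only: LH[OF wZ])
        then show "G w w = 0"
          unfolding G_def by (simp add: matrix_matrix_mult_def ip_deriv_s[OF w(1)] ctr_def) (simp add: gramian_def)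
      qed (use w U(3) in auto)
      moreover have "ip M (s l w) (s j 0) = (if l = j then 1 else 0)" for l
        using ip_deriv_zero(1)[OF w, of "[]" l j] by simp
      moreover have "ip N (t l w) (t m 0) = (if l = m then 1 else 0)" for l m
        using ip_deriv_zero(2)[OF w, of "[]" l m] by simp
      moreover have "(\<Sum>l\<in>UNIV. E $ i $ l * cnj (E $ j $ l)) = (if i = j then 1 else 0)"
      proof -
        have "(E ** ctr E) $ i $ j = (mat 1 :: complex^'r^'r) $ i $ j" by (simp add: E_unitary)
        then show ?thesis by (simp add: matrix_matrix_mult_def ctr_def mat_def)
      qed
      ultimately show ?thesis
        by (cases "?xs = []") (simp_all add: G_def ip_deriv_zero[OF w xs] if_distrib[of "\<lambda>x. x * _"] if_distrib[of "\<lambda>x. _ * x"] cong: if_cong)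
    qed
    then show ?thesis by (simp add: vec_eq_iff)
  qed
  have wU: "w \<in> U" using w by simp
  have "mderivs ?ws (\<lambda>w. Hs w - H' w) w = mderivs ?ws Hs w - E ** (mderivs ?ws Ht w ** ctr E)"
    by (simp only: mderivs_diff[OF U(1) pHs pH' wU] mderivs_conj_const[OF U(1) pHt wU])
  also have "\<dots> = L w ** Hs w" using LH[OF w] by simp
  finally show ?thesis by (simp add: L0[OF w] matrix_algebra(6))
qed

text \<open>Every holomorphic word is a permutation of the word of a multi-index.\<close>

lemma hol_jets_agree:
  assumes jm: "\<And>i \<alpha> w. i \<notin> T \<Longrightarrow> \<alpha> \<in> index_set d k \<Longrightarrow> w \<in> Zu \<Longrightarrow> jet_map i \<alpha> Hs w ** E = E ** jet_map i \<alpha> Ht w"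
  shows "mjet_zero T k 1 k Zu (\<lambda>w. Hs w - H' w)"
  unfolding mjet_zero_def jet_zero_def
proof (intro allI impI ballI)
  fix a a' ws w assume ws: "set ws \<subseteq> dirs T" "nhol ws < k" "nanti ws < 1" "length ws < k" and w: "w \<in> Zu"
  have wU: "w \<in> U" using w by simp
  obtain xs where xs: "ws = map Hol xs" "set xs \<subseteq> T" using hol_words[OF ws(1,3)] .
  obtain \<alpha> where \<alpha>: "mset (expand \<alpha>) = mset xs" using ex_index_of_list .
  then have "set (expand \<alpha>) = set xs" "length (expand \<alpha>) = length xs" by (metis set_mset_mset, metis size_mset)
  then have \<alpha>I: "\<alpha> \<in> index_set d k" using xs ws(4) by (simp add: expand_mem_index_set)
  have p: "polarizable U (\<lambda>w. (Hs w - H' w) $ a $ a')" using mpolar_diff[OF pHs pH'] by (simp only: mpolar_def)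
  have "derivs ws (\<lambda>w. (Hs w - H' w) $ a $ a') w = derivs (map Hol (expand \<alpha>)) (\<lambda>w. (Hs w - H' w) $ a $ a') w"
    by (rule derivs_perm[OF U(1) p _ wU]) (simp add: xs \<alpha>)
  also have "\<dots> = mderivs (map Hol (expand \<alpha>)) (\<lambda>w. Hs w - H' w) w $ a $ a'" by (simp only: mderivs_nth)
  also have "mderivs (map Hol (expand \<alpha>)) (\<lambda>w. Hs w - H' w) w = 0"
    by (rule hol_derivs_agree[OF _ \<alpha>I w]) (rule jm[OF _ \<alpha>I])
  also have "0 $ a $ a' = (0::complex)" by simp
  finally show "derivs ws (\<lambda>w. (Hs w - H' w) $ a $ a') w = 0" .
qed

text \<open>
  Condition (ii) concerns the kernel frames; holomorphic changes of frame transport it to the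
  normalized frames, and there \<open>\<Phi>\<close> has the matrix \<open>E\<close>.
\<close>

lemma cov_words_agree:
  assumes cw: "cov_word (gramian M (kframe M)) i j ws w ** A w = A w ** cov_word (gramian N (kframe N)) i j ws w"
    and w: "w \<in> Zu"
  shows "cov_word Hs i j ws w = cov_word H' i j ws w"
proof -
  have wU: "w \<in> U" using w by simp
  let ?K = "gramian M (kframe M)" and ?Kt = "gramian N (kframe N)"
  have pK: "mpolar U ?K" by (rule M.mpolar_gramian[OF M.weakly_holomorphic_subset[OF M.kframe_weakly_holomorphic U(2)] U(1)])
  have pKt: "mpolar U ?Kt" by (rule N.mpolar_gramian[OF N.weakly_holomorphic_subset[OF N.kframe_weakly_holomorphic U(2)] U(1)])
  have iK: "invertible (?K w)" and iKt: "invertible (?Kt w)" if "w \<in> U" for w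
    using M.gramian_frame_invertible[OF M.frame_at_kframe] N.gramian_frame_invertible[OF N.frame_at_kframe] that U(2) by blast+
  have pb: "mpolar U b" and pc: "mpolar U c" using mhol_mpolar b(1) c(1) U(1) by blast+
  have gs: "Hs w = b w ** (?K w ** ctr (b w))" if w: "w \<in> U" for w
  proof -
    have "Hs w = gramian M (mframe b (kframe M)) w" by (simp add: gramian_def b(2)[OF w])
    also have "\<dots> = b w ** (?K w ** ctr (b w))" by (rule M.gramian_mframe) (use M.kframe_mem U(2) w in blast)
    finally show ?thesis .
  qed
  have gt: "Ht w = c w ** (?Kt w ** ctr (c w))" if w: "w \<in> U" for w
  proof -
    have "Ht w = gramian N (mframe c (kframe N)) w" by (simp add: gramian_def c(2)[OF w])
    also have "\<dots> = c w ** (?Kt w ** ctr (c w))" by (rule N.gramian_mframe) (use N.kframe_mem U(2) w in blast)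
    finally show ?thesis .
  qed
  have 1: "cov_word Hs i j ws w ** b w = b w ** cov_word ?K i j ws w"
    by (rule cov_word_gauge[OF U(1) pK pb mpolar_ctr[OF pb] pHs mhol_deriv[OF b(1) U(1)] iK iHs gs wU])
  have 2: "cov_word Ht i j ws w ** c w = c w ** cov_word ?Kt i j ws w"
    by (rule cov_word_gauge[OF U(1) pKt pc mpolar_ctr[OF pc] pHt mhol_deriv[OF c(1) U(1)] iKt iHt gt wU])
  have 3: "cov_word H' i j ws w ** E = E ** cov_word Ht i j ws w"
    by (rule cov_word_gauge[OF U(1) pHt mpolar_const mpolar_const pH' _ _ iHt iH' refl wU]) auto
  have ec: "E ** c w = b w ** A w"
    using e_const[OF w] matrix_inv_mult(2)[OF c(3)[OF wU]] unfolding e_def by (metis matrix_mul_assoc matrix_mul_rid)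
  have "cov_word Hs i j ws w ** (E ** c w) = (cov_word Hs i j ws w ** b w) ** A w"
    unfolding ec by (simp only: matrix_mul_assoc)
  also have "\<dots> = b w ** (cov_word ?K i j ws w ** A w)" by (simp only: 1 matrix_algebra(5))
  also have "\<dots> = (E ** c w) ** cov_word ?Kt i j ws w" by (simp only: cw ec matrix_mul_assoc)
  also have "\<dots> = E ** (cov_word Ht i j ws w ** c w)" by (simp only: 2 matrix_algebra(5))
  also have "\<dots> = (E ** cov_word Ht i j ws w) ** c w" by (rule matrix_mul_assoc)
  also have "\<dots> = (cov_word H' i j ws w ** E) ** c w" by (simp only: 3)
  also have "\<dots> = cov_word H' i j ws w ** (E ** c w)" by (rule matrix_mul_assoc[symmetric])
  finally have eq: "cov_word Hs i j ws w ** (E ** c w) = cov_word H' i j ws w ** (E ** c w)" .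
  have "invertible (E ** c w)" by (intro invertible_mult iE c(3)[OF wU])
  then have r: "(E ** c w) ** matrix_inv (E ** c w) = mat 1" by (rule matrix_inv_mult(1))
  have "(cov_word Hs i j ws w ** (E ** c w)) ** matrix_inv (E ** c w) = (cov_word H' i j ws w ** (E ** c w)) ** matrix_inv (E ** c w)"
    by (simp only: eq)
  then show ?thesis by (simp only: matrix_algebra(5)[of _ "E ** c w"] r matrix_mul_rid)
qed

text \<open>
  Induction on the total order of the derivatives.  Pure words are covered by condition (iii) and, as
  Gram matrices are hermitian, by its conjugate.  A mixed word contains a letter of each kind; these
  two become the indices of the curvature and the remaining ones the covariant derivatives, so that the
  mixed derivative of the difference is the leading term of an expression known to vanish.
\<close>

lemma all_jets_agree:
  assumes jm: "\<And>i \<alpha> w. i \<notin> T \<Longrightarrow> \<alpha> \<in> index_set d k \<Longrightarrow> w \<in> Zu \<Longrightarrow> jet_map i \<alpha> Hs w ** E = E ** jet_map i \<alpha> Ht w"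
    and cw: "\<And>i j ws w. i \<in> T \<Longrightarrow> j \<in> T \<Longrightarrow> ws \<in> transv_words d k \<Longrightarrow> w \<in> Zu \<Longrightarrow>
      cov_word (gramian M (kframe M)) i j ws w ** A w = A w ** cov_word (gramian N (kframe N)) i j ws w"
  shows "mjet_zero T k k n Zu (\<lambda>w. Hs w - H' w)"
proof (induction n)
  case 0
  show ?case by (simp add: mjet_zero_def jet_zero_def)
next
  case (Suc n)
  let ?X = "\<lambda>w. Hs w - H' w"
  have pX: "polarizable U (\<lambda>w. ?X w $ a $ a')" for a a' using mpolar_diff[OF pHs pH'] by (simp only: mpolar_def)
  have h: "jet_zero T k 1 k Zu (\<lambda>w. ?X w $ a $ a')" for a a'
    using hol_jets_agree[OF jm] unfolding mjet_zero_def by blast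
  have h': "jet_zero T 1 k k Zu (\<lambda>w. ?X w $ a $ a')" for a a'
  proof (rule jet_zero_cong[OF U(1) ZuU])
    show "jet_zero T 1 k k Zu (\<lambda>w. cnj (?X w $ a' $ a))" by (rule jet_zero_cnj[OF pX U(1) ZuU h])
    fix w assume w: "w \<in> U"
    have "Hs w $ a $ a' = cnj (Hs w $ a' $ a)" by (rule M.gramian_hermitian) (rule sM[OF w])
    moreover have "H' w $ a $ a' = cnj (H' w $ a' $ a)"
      unfolding gramian_E[OF w, symmetric] by (rule N.gramian_hermitian) (intro N.mframe_mem tN[OF w])
    ultimately show "cnj (?X w $ a' $ a) = ?X w $ a $ a'" by simp
  qed
  show ?case
    unfolding mjet_zero_def jet_zero_def
  proof (intro allI impI ballI)
    fix a a' vs w assume vs: "set vs \<subseteq> dirs T" "nhol vs < k" "nanti vs < k" "length vs < Suc n" and w: "w \<in> Zu"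
    have wU: "w \<in> U" using w by simp
    have len: "length vs = nhol vs + nanti vs" using vs(1) by (induction vs) auto
    show "derivs vs (\<lambda>w. ?X w $ a $ a') w = 0"
    proof (cases "length vs < n")
      case True
      then show ?thesis using Suc.IH vs w unfolding mjet_zero_def jet_zero_def by blast
    next
      case False
      then have ln: "length vs = n" using vs(4) by simp
      show ?thesis
      proof (cases "nanti vs = 0 \<or> nhol vs = 0")
        case True
        then show ?thesis using h[of a a'] h'[of a a'] vs w len unfolding jet_zero_def by auto
      next
        case False
        then have "\<exists>i. Anti i \<in> set vs" "\<exists>j. Hol j \<in> set vs" by (auto simp: nhol_def nanti_def filter_empty_conv)
        then obtain i j where ij: "Anti i \<in> set vs" "Hol j \<in> set vs" by blast
        then have ijT: "i \<in> T" "j \<in> T" using vs(1) by auto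
        define ws where "ws = remove1 (Hol j) (remove1 (Anti i) vs)"
        have ms: "mset vs = mset (rev ws @ [Anti i, Hol j])"
        proof -
          have "Hol j \<in># mset vs - {#Anti i#}" using ij(2) by (simp add: in_diff_count)
          have "mset vs = add_mset (Anti i) (mset vs - {#Anti i#})" using ij(1) by simp
          also have "mset vs - {#Anti i#} = add_mset (Hol j) (mset vs - {#Anti i#} - {#Hol j#})"
            by (rule insert_DiffM[symmetric]) fact
          finally show ?thesis by (simp add: ws_def)
        qed
        have cnt: "nhol us = nhol us' \<and> nanti us = nanti us' \<and> length us = length us'" if "mset us = mset us'"
          for us us' :: "'m direction list"
          unfolding nhol_def nanti_def using that by (metis mset_filter size_mset)
        have wd: "set ws \<subseteq> dirs T" using vs(1) by (auto simp: ws_def dest!: notin_set_remove1[rotated] set_remove1_subset[THEN subsetD])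
        have n1: "nhol vs = nhol ws + 1" "nanti vs = nanti ws + 1" "length vs = length ws + 2" using cnt[OF ms] by auto
        have wT: "ws \<in> transv_words d k" using wd vs(2,3) n1 by (simp add: transv_words_def nhol_def nanti_def)
        have "mjet_zero T 1 1 1 Zu (\<lambda>w. cov_word Hs i j ws w - cov_word H' i j ws w -
            mderivs (rev ws @ [Anti i, Hol j]) ?X w ** matrix_inv (Hs w))"
          by (rule cov_word_leading_term[OF U(1) ZuU pHs pH' iHs iH' Suc.IH ijT wd]) (use n1 vs ln in auto)
        then have "cov_word Hs i j ws w - cov_word H' i j ws w -
            mderivs (rev ws @ [Anti i, Hol j]) ?X w ** matrix_inv (Hs w) = 0"
          by (rule mjet_zero_at) (use w in auto)
        then have "mderivs (rev ws @ [Anti i, Hol j]) ?X w ** matrix_inv (Hs w) = 0"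
          using cov_words_agree[OF cw[OF ijT wT w] w] by simp
        then have "mderivs (rev ws @ [Anti i, Hol j]) ?X w ** (matrix_inv (Hs w) ** Hs w) = 0"
          unfolding matrix_mul_assoc by (simp only: matrix_algebra(6))
        then have z: "mderivs (rev ws @ [Anti i, Hol j]) ?X w = 0"
          by (simp only: matrix_inv_mult(2)[OF iHs[OF wU]] matrix_mul_rid)
        have "derivs vs (\<lambda>w. ?X w $ a $ a') w = derivs (rev ws @ [Anti i, Hol j]) (\<lambda>w. ?X w $ a $ a') w"
          by (rule derivs_perm[OF U(1) pX ms wU])
        also have "\<dots> = mderivs (rev ws @ [Anti i, Hol j]) ?X w $ a $ a'" by (simp only: mderivs_nth)
        also have "\<dots> = 0" by (simp only: z zero_index)
        finally show ?thesis .
      qed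
    qed
  qed
qed

text \<open>
  Polarization extends the equality of inner products of derivatives from one point to pairs of
  points, which yields a unitary matching these derivatives.  Pairing \<open>f x\<close> with them involves only
  jets of the pairings with \<open>x\<close>, by Leibniz' rule, and these are preserved; so the unitary intertwines
  the actions.
\<close>

lemma quotients_isomorphic_of_jets:
  assumes con: "connected (zero_locus d \<Omega>)" and jets: "\<And>n. mjet_zero T k k n Zu (\<lambda>w. Hs w - H' w)"
  shows "quotients_isomorphic \<Omega> d k M N"
proof -
  let ?S = "mframe b (kframe M)" and ?c = "\<lambda>w. E ** c w"
  let ?T = "mframe ?c (kframe N)"
  let ?Q = "quotient_module \<Omega> d k M" and ?R = "quotient_module \<Omega> d k N"
  have c': "mhol U ?c" by (intro mhol_mult mhol_const c(1))
  have ic': "invertible (?c w)" if "w \<in> U" for w by (intro invertible_mult iE c(3) that)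
  have Te: "?T i w = mframe (\<lambda>_. E) t i w" if "w \<in> U" for i w
    unfolding mframe_mframe[of "\<lambda>_. E" c, symmetric] by (rule mframe_cong) (use c(2)[OF that] in simp_all)
  have Sh: "weakly_holomorphic M U (?S i)" for i by (rule M.section_weakly_holomorphic[OF b(1) U(2)])
  have Th: "weakly_holomorphic N U (?T i)" for i by (rule N.section_weakly_holomorphic[OF c' U(2)])
  let ?dS = "\<lambda>xs i. foldr (hderiv M) xs (?S i)" and ?dT = "\<lambda>xs i. foldr (hderiv N) xs (?T i)"
  have dSh: "weakly_holomorphic M U (?dS xs i)" for xs i by (rule M.weakly_holomorphic_hderivs(1)[OF Sh U(1)])
  have dTh: "weakly_holomorphic N U (?dT xs i)" for xs i by (rule N.weakly_holomorphic_hderivs(1)[OF Th U(1)])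
  have gram: "ip M (?dS xs i w) (?dS ys j v) = ip N (?dT xs i w) (?dT ys j v)"
    if xs: "set xs \<subseteq> T" "length xs < k" and ys: "set ys \<subseteq> T" "length ys < k" and wv: "w \<in> Zu" "v \<in> Zu" for xs ys i j w v
  proof -
    let ?G = "\<lambda>w v. ip M (?dS xs i w) (?dS ys j v) - ip N (?dT xs i w) (?dT ys j v)"
    have sq: "sesqui Cyl (\<lambda>w v. ?G (tproj d w) (tproj d v))"
      by (rule sesqui_diff[OF sesqui_tproj[OF M.gram_sesqui[OF dSh dSh U(1)]] sesqui_tproj[OF N.gram_sesqui[OF dTh dTh U(1)]]])
    have "?G w v = 0"
    proof (rule polarization_slice[OF U(1) conZu sq])
      fix w assume w: "w \<in> U" "tproj d w = w"
      let ?ws = "map Hol xs @ map Anti ys"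
      have "derivs ?ws (\<lambda>w. (Hs w - H' w) $ i $ j) w = 0"
      proof -
        have ws: "set ?ws \<subseteq> dirs T" using xs ys by auto
        have n: "nhol ?ws < k" "nanti ?ws < k" "length ?ws < Suc (length ?ws)" using xs ys by simp_all
        have "w \<in> Zu" using w by simp
        then show ?thesis
          using jets[of "Suc (length ?ws)"] ws n unfolding mjet_zero_def jet_zero_def by blast
      qed
      moreover have "derivs ?ws (\<lambda>w. (Hs w - H' w) $ i $ j) w = derivs ?ws (\<lambda>w. ip M (?S i w) (?S j w) - ip N (?T i w) (?T j w)) w"
      proof (rule derivs_cong[OF U(1) _ w(1)])
        fix w assume w: "w \<in> U"
        have "H' w $ i $ j = ip N (?T i w) (?T j w)" unfolding gramian_E[OF w, symmetric] by (simp add: gramian_def Te[OF w])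
        then show "(Hs w - H' w) $ i $ j = ip M (?S i w) (?S j w) - ip N (?T i w) (?T j w)"
          by (simp add: gramian_def b(2)[OF w])
      qed
      moreover have "derivs ?ws (\<lambda>w. ip M (?S i w) (?S j w) - ip N (?T i w) (?T j w)) w = ?G w w"
        using derivs_diff[OF U(1) sesqui_polarizable[OF M.gram_sesqui[OF Sh Sh U(1)] U(1)]
            sesqui_polarizable[OF N.gram_sesqui[OF Th Th U(1)] U(1)] w(1), of ?ws]
          M.derivs_gram[OF Sh Sh U(1) w(1), of ?ws] N.derivs_gram[OF Th Th U(1) w(1), of ?ws] by simp
      ultimately show "?G w w = 0" by simp
    qed (use wv in auto)
    then show ?thesis by simp
  qed
  define I where "I = {(xs, i, w). set xs \<subseteq> T \<and> length xs < k \<and> w \<in> Zu \<and> i \<in> (UNIV :: 'r set)}"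
  define g where "g = (\<lambda>(xs, i, w). ?dS xs i w)"
  define g' where "g' = (\<lambda>(xs, i, w). ?dT xs i w)"
  have gQ: "g a \<in> ?Q" if "a \<in> I" for a
    using that M.section_deriv_Q[OF U(1,2) b(1)] Zu_Zd by (auto simp: I_def g_def)
  have gR: "g' a \<in> ?R" if "a \<in> I" for a
    using that N.section_deriv_Q[OF U(1,2) c'] Zu_Zd by (auto simp: I_def g'_def)
  have gg: "ip M (g a) (g a') = ip N (g' a) (g' a')" if "a \<in> I" "a' \<in> I" for a a'
    using that gram by (auto simp: I_def g_def g'_def)
  have tot: "h = 0" if h: "h \<in> ?Q" "\<And>a. a \<in> I \<Longrightarrow> ip M h (g a) = 0" for h
  proof (rule M.section_total[OF U b(1,3) con h(1)])
    fix xs i w assume "set xs \<subseteq> T" "length xs < k" "w \<in> U \<inter> Zd"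
    then have "(xs, i, w) \<in> I" using Zu_eq by (auto simp: I_def)
    from h(2)[OF this] show "ip M h (?dS xs i w) = 0" by (simp add: g_def)
  qed
  have tot': "h = 0" if h: "h \<in> ?R" "\<And>a. a \<in> I \<Longrightarrow> ip N h (g' a) = 0" for h
  proof (rule N.section_total[OF U c' ic' con h(1)])
    fix xs i w assume "set xs \<subseteq> T" "length xs < k" "w \<in> U \<inter> Zd"
    then have "(xs, i, w) \<in> I" using Zu_eq by (auto simp: I_def)
    from h(2)[OF this] show "ip N h (?dT xs i w) = 0" by (simp add: g'_def)
  qed
  obtain V where V: "hunitary M N ?Q ?R V" "\<And>a. a \<in> I \<Longrightarrow> V (g a) = g' a"
  proof (rule unitary_of_equal_gramians[OF M.hilbert_fspace_axioms N.hilbert_fspace_axioms M.Q_closed N.Q_closed gQ gR gg tot tot'])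
    fix V assume "hunitary M N ?Q ?R V" "\<And>a. a \<in> I \<Longrightarrow> V (g a) = g' a"
    then show thesis by (rule that)
  qed
  have Vip: "ip N (V x) (V y) = ip M x y" if "x \<in> ?Q" "y \<in> ?Q" for x y using V(1) that unfolding hunitary_def by blast
  have VR: "V x \<in> ?R" if "x \<in> ?Q" for x using V(1) that unfolding hunitary_def bij_betw_def by blast
  have QM: "x \<in> car M" if "x \<in> ?Q" for x using that M.Q_subset by blast
  have RN: "x \<in> car N" if "x \<in> ?R" for x using that N.Q_subset by blast
  have inter: "V (hproj M ?Q (pmul f x)) = hproj N ?R (pmul f (V x))" if f: "f \<in> fun_algebra \<Omega>" and x: "x \<in> ?Q" for f x
  proof -
    have fx: "pmul f x \<in> car M" by (rule M.action_closed[OF f QM[OF x]])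
    have fVx: "pmul f (V x) \<in> car N" by (rule N.action_closed[OF f RN[OF VR[OF x]]])
    note p = M.hproj(1)[OF fx, of d k] and p' = N.hproj(1)[OF fVx, of d k]
    let ?D = "V (hproj M ?Q (pmul f x)) - hproj N ?R (pmul f (V x))"
    have DR: "?D \<in> ?R" using N.Q_closed fun_vs.subspace_diff VR[OF p] p' unfolding N.hclosed_def by blast
    have "?D = 0"
    proof (rule tot'[OF DR])
      fix a assume a: "a \<in> I"
      then obtain xs i w where aw: "a = (xs, i, w)" "set xs \<subseteq> T" "length xs < k" "w \<in> Zu" by (auto simp: I_def)
      have wU: "w \<in> U" using aw by simp
      let ?f = "\<lambda>w. cnj (f (vcnj w))"
      let ?u = "\<lambda>w. ip M (?S i w) x" and ?u' = "\<lambda>w. ip N (?T i w) (V x)"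
      have hu: "mholomorphic_on U ?u" by (rule weakly_holomorphicD(2)[OF Sh QM[OF x]])
      have hu': "mholomorphic_on U ?u'" by (rule weakly_holomorphicD(2)[OF Th RN[OF VR[OF x]]])
      have hf: "mholomorphic_on U ?f"
        by (rule mholomorphic_on_subset[OF mholomorphic_on_sharp[OF fun_algebra_mholomorphic[OF f M.open_dom]] U(2)])
      note P = mholomorphic_on_polarizable[OF _ U(1)]
      have ju: "jet_zero T k 1 k Zu (\<lambda>w. ?u w - ?u' w)"
        unfolding jet_zero_holomorphic[OF mholomorphic_on_diff[OF hu hu'] U(1) ZuU]
      proof (intro allI impI ballI)
        fix ys w assume ys: "set ys \<subseteq> T" "length ys < k" and w: "w \<in> Zu"
        have wU: "w \<in> U" using w by simp
        have yI: "(ys, i, w) \<in> I" using ys w by (simp add: I_def)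
        have "foldr wirt ys ?u w = ip M (g (ys, i, w)) x"
          using M.weakly_holomorphic_hderivs(2)[OF Sh U(1) wU QM[OF x]] by (simp add: g_def)
        also have "\<dots> = ip N (g' (ys, i, w)) (V x)" using Vip[OF gQ[OF yI] x] V(2)[OF yI] by simp
        also have "\<dots> = foldr wirt ys ?u' w"
          using N.weakly_holomorphic_hderivs(2)[OF Th U(1) wU RN[OF VR[OF x]]] by (simp add: g'_def)
        finally show "foldr wirt ys (\<lambda>w. ?u w - ?u' w) w = 0"
          using derivs_diff[OF U(1) P[OF hu] P[OF hu'] wU, of "map Hol ys"] derivs_holomorphic(1)[OF U(1) hu wU]
            derivs_holomorphic(1)[OF U(1) hu' wU] derivs_holomorphic(1)[OF U(1) mholomorphic_on_diff[OF hu hu'] wU] by simp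
      qed
      have "jet_zero T k 1 k Zu (\<lambda>w. ?f w * (?u w - ?u' w))"
        by (rule jet_zero_mult_right[OF U(1) ZuU P[OF hf] polarizable_diff[OF P[OF hu] P[OF hu']] ju])
      then have "derivs (map Hol xs) (\<lambda>w. ?f w * (?u w - ?u' w)) w = 0"
        by (rule jet_zero_hol_word) (use aw in auto)
      moreover have "derivs (map Hol xs) (\<lambda>w. ?f w * (?u w - ?u' w)) w =
          derivs (map Hol xs) (\<lambda>w. ip M (?S i w) (pmul f x) - ip N (?T i w) (pmul f (V x))) w"
      proof (rule derivs_cong[OF U(1) _ wU])
        fix w assume w: "w \<in> U"
        have wd: "w \<in> M.dual_dom" using w U(2) by blast
        have 1: "ip M (?S i w) (pmul f x) = ?f w * ?u w"
          by (simp add: M.ip_section[OF wd fx] M.ip_section[OF wd QM[OF x]] pmul_apply sum_distrib_left mult.left_commute)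
        have 2: "ip N (?T i w) (pmul f (V x)) = ?f w * ?u' w"
          by (simp add: N.ip_section[OF wd fVx] N.ip_section[OF wd RN[OF VR[OF x]]] pmul_apply sum_distrib_left mult.left_commute)
        show "?f w * (?u w - ?u' w) = ip M (?S i w) (pmul f x) - ip N (?T i w) (pmul f (V x))"
          unfolding 1 2 by (simp add: right_diff_distrib)
      qed
      moreover have "derivs (map Hol xs) (\<lambda>w. ip M (?S i w) (pmul f x) - ip N (?T i w) (pmul f (V x))) w =
          ip M (g a) (pmul f x) - ip N (g' a) (pmul f (V x))"
      proof -
        have h1: "mholomorphic_on U (\<lambda>w. ip M (?S i w) (pmul f x))" by (rule weakly_holomorphicD(2)[OF Sh fx])
        have h2: "mholomorphic_on U (\<lambda>w. ip N (?T i w) (pmul f (V x)))" by (rule weakly_holomorphicD(2)[OF Th fVx])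
        show ?thesis
          using derivs_diff[OF U(1) P[OF h1] P[OF h2] wU, of "map Hol xs"] derivs_holomorphic(1)[OF U(1) h1 wU]
            derivs_holomorphic(1)[OF U(1) h2 wU] M.weakly_holomorphic_hderivs(2)[OF Sh U(1) wU fx]
            N.weakly_holomorphic_hderivs(2)[OF Th U(1) wU fVx] by (simp add: aw(1) g_def g'_def)
      qed
      ultimately have eq: "ip M (g a) (pmul f x) = ip N (g' a) (pmul f (V x))" by simp
      have "ip N (g' a) (V (hproj M ?Q (pmul f x))) = ip M (g a) (hproj M ?Q (pmul f x))"
        using Vip[OF gQ[OF a] p] V(2)[OF a] by simp
      also have "\<dots> = ip M (g a) (pmul f x)" by (rule M.hproj(4)[OF fx gQ[OF a]])
      also have "\<dots> = ip N (g' a) (hproj N ?R (pmul f (V x)))"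
        unfolding eq by (rule N.hproj(4)[OF fVx gR[OF a], symmetric])
      finally have "ip N (g' a) ?D = 0"
        using N.ip_diff_right[OF RN[OF VR[OF p]] RN[OF p'] RN[OF gR[OF a]]] by simp
      then show "ip N ?D (g' a) = 0" using N.ip_cnj[OF RN[OF gR[OF a]] RN[OF DR]] by simp
    qed
    then show ?thesis by simp
  qed
  show ?thesis
    unfolding quotients_isomorphic_def Let_def
    using V(1) inter unfolding hunitary_def by blast
qed

end

theorem theorem5p13:
  fixes \<Omega> U :: "'m::{finite,linorder} cvec set"
    and M N :: "('m, 'r::finite) fspace"
    and s t :: "'r \<Rightarrow> 'm cvec \<Rightarrow> ('m, 'r) vfun"
    and d k :: nat
  assumes "open \<Omega>" "connected \<Omega>" "bounded \<Omega>" "0 \<in> \<Omega>"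
    and "1 \<le> d" "d \<le> CARD('m)"
    and "connected (zero_locus d \<Omega>)"
    and "hilbert_module \<Omega> M" "cowen_douglas \<Omega> M"
    and "hilbert_module \<Omega> N" "cowen_douglas \<Omega> N"
    and "1 \<le> k"
    and "normalized_frame \<Omega> d M U s" "normalized_frame \<Omega> d N U t"
  shows "quotients_isomorphic \<Omega> d k M N \<longleftrightarrow>
    (\<exists>\<Phi>. holomorphic_isometric_map M N (vcnj ` zero_locus d \<Omega>) \<Phi> \<and>
         (\<forall>i\<in>transv d. \<forall>j\<in>transv d. \<forall>ws\<in>transv_words d k.
            intertwines_on M (vcnj ` zero_locus d \<Omega>) \<Phi>
              (curvature_deriv M ws i j) (curvature_deriv N ws i j)) \<and>
         (\<forall>i. i \<notin> transv d \<longrightarrow> (\<forall>\<alpha>\<in>index_set d k.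
            intertwines_on M (vcnj ` zero_locus d \<Omega> \<inter> U) \<Phi>
              (frame_endo s (jet_map i \<alpha> (gramian M s)))
              (frame_endo t (jet_map i \<alpha> (gramian N t))))))"
proof -
  interpret M: jet_module \<Omega> M
    using assms(8,1) by (simp add: jet_module_def jet_module_axioms_def)
  interpret N: jet_module \<Omega> N
    using assms(10,1) by (simp add: jet_module_def jet_module_axioms_def)
  show ?thesis
  proof
    assume "quotients_isomorphic \<Omega> d k M N"
    then obtain V where "hunitary M N (quotient_module \<Omega> d k M) (quotient_module \<Omega> d k N) V"
      "\<forall>f\<in>fun_algebra \<Omega>. \<forall>x\<in>quotient_module \<Omega> d k M.
        V (hproj M (quotient_module \<Omega> d k M) (pmul f x)) = hproj N (quotient_module \<Omega> d k N) (pmul f (V x))"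
      unfolding quotients_isomorphic_def Let_def hunitary_def by blast
    then interpret intertwiner \<Omega> M N d k V
      using assms(12) by unfold_locales auto
    show "\<exists>\<Phi>. holomorphic_isometric_map M N (vcnj ` zero_locus d \<Omega>) \<Phi> \<and>
         (\<forall>i\<in>transv d. \<forall>j\<in>transv d. \<forall>ws\<in>transv_words d k.
            intertwines_on M (vcnj ` zero_locus d \<Omega>) \<Phi>
              (curvature_deriv M ws i j) (curvature_deriv N ws i j)) \<and>
         (\<forall>i. i \<notin> transv d \<longrightarrow> (\<forall>\<alpha>\<in>index_set d k.
            intertwines_on M (vcnj ` zero_locus d \<Omega> \<inter> U) \<Phi>
              (frame_endo s (jet_map i \<alpha> (gramian M s)))
              (frame_endo t (jet_map i \<alpha> (gramian N t)))))"
      by (intro exI[of _ "\<lambda>_. V"] conjI ballI allI impI isometric_map curvature_intertwines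
          jet_maps_intertwine[OF assms(13,14)])
  next
    assume "\<exists>\<Phi>. holomorphic_isometric_map M N (vcnj ` zero_locus d \<Omega>) \<Phi> \<and>
         (\<forall>i\<in>transv d. \<forall>j\<in>transv d. \<forall>ws\<in>transv_words d k.
            intertwines_on M (vcnj ` zero_locus d \<Omega>) \<Phi>
              (curvature_deriv M ws i j) (curvature_deriv N ws i j)) \<and>
         (\<forall>i. i \<notin> transv d \<longrightarrow> (\<forall>\<alpha>\<in>index_set d k.
            intertwines_on M (vcnj ` zero_locus d \<Omega> \<inter> U) \<Phi>
              (frame_endo s (jet_map i \<alpha> (gramian M s)))
              (frame_endo t (jet_map i \<alpha> (gramian N t)))))"
    then obtain \<Phi> where iso: "holomorphic_isometric_map M N (vcnj ` zero_locus d \<Omega>) \<Phi>"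
      and curv: "\<And>i j ws. i \<in> transv d \<Longrightarrow> j \<in> transv d \<Longrightarrow> ws \<in> transv_words d k \<Longrightarrow>
            intertwines_on M (vcnj ` zero_locus d \<Omega>) \<Phi> (curvature_deriv M ws i j) (curvature_deriv N ws i j)"
      and jet: "\<And>i \<alpha>. i \<notin> transv d \<Longrightarrow> \<alpha> \<in> index_set d k \<Longrightarrow>
            intertwines_on M (vcnj ` zero_locus d \<Omega> \<inter> U) \<Phi>
              (frame_endo s (jet_map i \<alpha> (gramian M s))) (frame_endo t (jet_map i \<alpha> (gramian N t)))"
      by blast
    have U: "open U" "U \<subseteq> vcnj ` \<Omega>" and fs: "holomorphic_frame M U s" and ft: "holomorphic_frame N U t"
      using assms(13,14) by (auto simp: normalized_frame_def)
    obtain b where b: "mhol U b" "\<And>w i. w \<in> U \<Longrightarrow> s i w = mframe b (kframe M) i w"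
      "\<And>w. w \<in> U \<Longrightarrow> invertible (b w)" "\<And>w. w \<in> U \<Longrightarrow> frame_at M s w"
      by (rule M.frame_coefficients[OF U fs]) blast
    obtain c where c: "mhol U c" "\<And>w i. w \<in> U \<Longrightarrow> t i w = mframe c (kframe N) i w"
      "\<And>w. w \<in> U \<Longrightarrow> invertible (c w)" "\<And>w. w \<in> U \<Longrightarrow> frame_at N t w"
      by (rule N.frame_coefficients[OF U ft]) blast
    have "\<forall>j. \<exists>a. (\<forall>l. mholomorphic_on (vcnj ` zero_locus d \<Omega>) (a l)) \<and>
        (\<forall>w\<in>vcnj ` zero_locus d \<Omega>. \<Phi> w (kframe M j w) = (\<Sum>l\<in>UNIV. fscale (a l w) (kframe N l w)))"
      using iso unfolding holomorphic_isometric_map_def holomorphic_section_def by blast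
    from choice[OF this] obtain a where a: "\<And>j l. mholomorphic_on (vcnj ` zero_locus d \<Omega>) (a j l)"
      "\<And>j w. w \<in> vcnj ` zero_locus d \<Omega> \<Longrightarrow> \<Phi> w (kframe M j w) = (\<Sum>l\<in>UNIV. fscale (a j l w) (kframe N l w))"
      by blast
    define A where "A w = (\<chi> j l. a j l w)" for w
    interpret bundle_map_setting \<Omega> M N d k U s t \<Phi> b c A
    proof
      show "mhol (vcnj ` zero_locus d \<Omega>) A" using a(1) by (simp add: mhol_def A_def)
      show "\<And>w j. w \<in> vcnj ` zero_locus d \<Omega> \<Longrightarrow> \<Phi> w (kframe M j w) = mframe A (kframe N) j w"
        using a(2) by (simp add: mframe_def A_def)
    qed (fact assms(12) assms(13) assms(14) iso b c)+
    show "quotients_isomorphic \<Omega> d k M N"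
    proof (rule quotients_isomorphic_of_jets[OF assms(7) all_jets_agree])
      fix i w and \<alpha> :: "'m \<Rightarrow> nat" assume i: "i \<notin> T" "\<alpha> \<in> index_set d k" and w: "w \<in> Zu"
      have wZ: "w \<in> Zd \<inter> U" "w \<in> Zd" "w \<in> U" using w Zu_eq by auto
      show "jet_map i \<alpha> Hs w ** E = E ** jet_map i \<alpha> Ht w"
        using intertwines_iff_matrix[OF b(4)[OF wZ(3)] c(4)[OF wZ(3)], of "\<Phi> w" "\<lambda>_. E"]
          \<Phi>_add[OF wZ(2)] \<Phi>_scale[OF wZ(2)] \<Phi>_s'[OF w] jet[OF i] wZ(1) unfolding intertwines_on_def by blast
    next
      fix i j w and ws :: "'m direction list" assume ij: "i \<in> T" "j \<in> T" "ws \<in> transv_words d k" and w: "w \<in> Zu"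
      have wZ: "w \<in> Zd" "w \<in> M.dual_dom" using Zu_Zd[OF w] Zd_dual by auto
      have "\<forall>v\<in>fibre M w. \<Phi> w (frame_endo (kframe M) (cov_word (gramian M (kframe M)) i j ws) w v) =
          frame_endo (kframe N) (cov_word (gramian N (kframe N)) i j ws) w (\<Phi> w v)"
        using curv[OF ij] wZ(1) unfolding intertwines_on_def curvature_deriv_def Let_def cov_word_def by blast
      then show "cov_word (gramian M (kframe M)) i j ws w ** A w = A w ** cov_word (gramian N (kframe N)) i j ws w"
        using intertwines_iff_matrix[OF M.frame_at_kframe[OF wZ(2)] N.frame_at_kframe[OF wZ(2)], of "\<Phi> w" A]
          \<Phi>_add[OF wZ(1)] \<Phi>_scale[OF wZ(1)] A(2)[OF wZ(1)] by blast
    qed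
  qed
qed

end
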